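(* Let $E\to M$ be a Courant algebroid, $\tau:M'\to M$ a smooth map, and $E'=\tau^*E$ a CA-pullback of $E$. If $(V_+\subset E,\operatorname{div},F)$ is a solution of the generalized type II SUGRA equations, then $(\tau^*V_+\subset E',\tau^*\operatorname{div},\tau^*F)$ is also a solution of the generalized type II SUGRA equations.
   Context: A Courant algebroid (CA) is a vector bundle $E\to M$ with a non-degenerate symmetric fibrewise bilinear form $\langle\,,\,\rangle$, a bundle map $\rho:E\to TM$ (the anchor) and an $\mathbb R$-bilinear bracket $[\,,\,]:\Gamma(E)\times\Gamma(E)\to\Gamma(E)$ such that for $u,v,w\in\Gamma(E)$, $f\in C^\infty(M)$: $[u,[v,w]]=[[u,v],w]+[v,[u,w]]$; $[u,fv]=f[u,v]+(u\cdot f)v$; $u\cdot\langle v,w\rangle=\langle[u,v],w\rangle+\langle v,[u,w]\rangle$; $[u,v]+[v,u]=d_E\langle u,v\rangle$. Here $u\cdot f:=\rho(u)f$ and $d_Ef\in\Gamma(E)$ is defined by $\langle u,d_Ef\rangle=u\cdot f$. A generalized pseudometric is a subbundle $V_+\subset E$ on which $\langle\,,\,\rangle$ is non-degenerate; $V_-:=V_+^\perp$; subscripts $\pm$ denote orthogonal projections to $V_\pm$. A divergence on $E$ is an $\mathbb R$-linear map $\operatorname{div}:\Gamma(E)\to C^\infty(M)$ with $\operatorname{div}(fa)=f\operatorname{div}a+a\cdot f$. $\mathrm{GRic}_{V_+,\operatorname{div}}(a_+,b_-):=\operatorname{div}[b_-,a_+]_+-b_-\cdot\operatorname{div}a_+-\operatorname{Tr}_{V_+}[[\,\cdot\,,b_-]_-,a_+]_+$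 for $a_+\in\Gamma(V_+),b_-\in\Gamma(V_-)$. In a local frame $e_\alpha$ of $E$, the union of frames $e_a$ of $V_+$ and $e_{\bar a}$ of $V_-$, with $\langle e_\alpha,e_\beta\rangle$ constant, and with $c_{\alpha\beta\gamma}:=\langle e_\alpha,[e_\beta,e_\gamma]\rangle$ (indices raised with $\langle\,,\,\rangle$), $\mathcal R_{V_+,\operatorname{div}}:=(\operatorname{div}e^a)(\operatorname{div}e_a)+2e^a\cdot(\operatorname{div}e_a)-\frac16c_{abc}c^{abc}-\frac12c_{ab\bar c}c^{ab\bar c}$ (independent of the frame). CA-pullback: $\tau^*E\to M'$ is a CA-pullback of $E$ if it carries a CA structure $(\langle\,,\,\rangle',[\,,\,]',\rho')$ with $\langle\tau^*u,\tau^*v\rangle'=\tau^*\langle u,v\rangle$, $[\tau^*u,\tau^*v]'=\tau^*[u,v]$, $\tau_*(\rho'(\tau^*u))=\rho(u)$ for $u,v\in\Gamma(E)$. $\tau^*\operatorname{div}$ is the divergence with $(\tau^*\operatorname{div})(\tau^*u)=\tau^*(\operatorname{div}u)$. Spinors: $\mathrm{Cl}(V)$ is generated by $V$ with relations $uv+vu=\langle u,v\rangle$. For $V$ of even dimension and symmetric signature (in general complexify), with a Lagrangian splitting $V=L_1\oplus L_2$, the spinor module is $S_V=\bigwedge L_1\otimes(\bigwedge^{\mathrm{top}}L_1)^{-1/2}$, $L_1$ acting by exterior multiplication and $L_2\cong L_1^*$ by contraction. With $\vartheta a=i^{|a|}a$ on homogeneous $a\in\bigwedge L_1$, there is a natural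 pairing $(\,,\,):S_V\otimes S_V\to\mathbb C$, $(a\otimes\lambda,b\otimes\lambda):=\langle(\vartheta a\wedge b)^{\mathrm{top}},\lambda^2\rangle$. It is assumed that $E$ admits a spin structure; $S_E$ is the associated ($\mathbb Z_2$-graded) bundle of $\mathrm{Cl}(E)$-modules, with the fibrewise pairing $(\,,\,)$; for a pullback, $S_{\tau^*E}=\tau^*S_E$. The generating Dirac operator $D_{\operatorname{div}}$ on $\Gamma(S_E)$ is, in a local trivialization by a frame $e_\alpha$ with constant $\langle e_\alpha,e_\beta\rangle$, $$D_{\operatorname{div}}=e^\alpha\bigl(\rho(e_\alpha)+\tfrac12\operatorname{div}e_\alpha\bigr)-\tfrac16e^\alpha e^\beta e^\gamma c_{\alpha\beta\gamma}.$$ If $V_+$ is oriented of rank $n$ with local oriented orthonormal basis $e_1,\dots,e_n$ ($\langle e_a,e_b\rangle=\pm\delta_{ab}$), $R_{V_+}:=2^{n/2}e_1\cdots e_n\in\mathrm{Cl}(E)$. Standing assumptions: $V_+$ is oriented, $\langle\,,\,\rangle|_{V_+}$ is Lorentzian, and $\operatorname{rank}V_+\equiv2$ mod $4$. The generalized type II SUGRA equations for $(V_+\subset E,\operatorname{div},F)$, where $F\in\Gamma(S_E)$ is even (then $\nu=1$) or odd (then $\nu=i$), are $$R_{V_+}F=F,\quad D_{\operatorname{div}}F=0,\quad\mathcal R_{V_+,\operatorname{div}}=0,\quad\mathrm{GRic}_{V_+,\operatorname{div}}(u_+,v_-)=\tfrac{i}{8\nu}(u_+F,v_-F)\ \ \forall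 u_+\in V_+,\,v_-\in V_-.$$ *)

theory Defs
  imports "HOL-Analysis.Analysis" "HOL-Combinatorics.Combinatorics"
begin

section \<open>Smooth manifolds\<close>

text \<open>\<open>Ck_on\<close> and \<open>smooth_on\<close> are meant for open subsets of finite-dimensional spaces, where
  existence and continuity of all iterated directional derivatives is the usual notion.\<close>

primrec Ck_on :: "nat \<Rightarrow> 'a::real_normed_vector set \<Rightarrow> ('a \<Rightarrow> 'b::real_normed_vector) \<Rightarrow> bool" where
  "Ck_on 0 S f \<longleftrightarrow> continuous_on S f"
| "Ck_on (Suc k) S f \<longleftrightarrow> (\<forall>x\<in>S. f differentiable (at x)) \<and>
     (\<forall>v. Ck_on k S (\<lambda>x. frechet_derivative f (at x) v))"

definition smooth_on :: "'a::real_normed_vector set \<Rightarrow> ('a \<Rightarrow> 'b::real_normed_vector) \<Rightarrow> bool" where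
  "smooth_on S f \<longleftrightarrow> (\<forall>k. Ck_on k S f)"

text \<open>A manifold is a whole type \<open>'m\<close> with an atlas of pairs (domain, coordinate map).  The model
  space \<open>'b\<close> is of sort \<open>{real_inner, heine_borel}\<close>: such spaces are exactly the finite-dimensional
  Euclidean spaces including the zero space (unlike \<open>euclidean_space\<close>), so that a point is
  a manifold.\<close>

type_synonym ('m, 'b) atlas = "('m set \<times> ('m \<Rightarrow> 'b)) set"

definition manifold ::
  "('m::{t2_space, second_countable_topology}, 'b::{real_inner, heine_borel}) atlas \<Rightarrow> bool" where
  "manifold A \<longleftrightarrow>
     (\<forall>(U, \<phi>)\<in>A. open U \<and> open (\<phi> ` U) \<and> homeomorphism U (\<phi> ` U) \<phi> (inv_into U \<phi>)) \<and>
     (\<Union>(U, \<phi>)\<in>A. U) = UNIV \<and>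
     (\<forall>(U, \<phi>)\<in>A. \<forall>(V, \<psi>)\<in>A. smooth_on (\<phi> ` (U \<inter> V)) (\<psi> \<circ> inv_into U \<phi>))"

definition smooth_fun_on ::
  "('m, 'b::real_normed_vector) atlas \<Rightarrow> 'm set \<Rightarrow> ('m \<Rightarrow> 'k::real_normed_vector) \<Rightarrow> bool" where
  "smooth_fun_on A W f \<longleftrightarrow> (\<forall>(U, \<phi>)\<in>A. smooth_on (\<phi> ` (U \<inter> W)) (f \<circ> inv_into U \<phi>))"

definition C_inf :: "('m, 'b::real_normed_vector) atlas \<Rightarrow> ('m \<Rightarrow> real) set" where
  "C_inf A = {f. smooth_fun_on A UNIV f}"

definition smooth_near ::
  "('m::topological_space, 'b::real_normed_vector) atlas \<Rightarrow> 'm \<Rightarrow> ('m \<Rightarrow> real) \<Rightarrow> bool" where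
  "smooth_near A x f \<longleftrightarrow> (\<exists>W. open W \<and> x \<in> W \<and> smooth_fun_on A W f)"

definition smooth_map ::
  "('m'::topological_space, 'b'::real_normed_vector) atlas \<Rightarrow>
   ('m::topological_space, 'b::real_normed_vector) atlas \<Rightarrow> ('m' \<Rightarrow> 'm) \<Rightarrow> bool" where
  "smooth_map A' A \<tau> \<longleftrightarrow> continuous_on UNIV \<tau> \<and>
     (\<forall>(U', \<phi>')\<in>A'. \<forall>(U, \<phi>)\<in>A.
        smooth_on (\<phi>' ` (U' \<inter> \<tau> -` U)) (\<phi> \<circ> \<tau> \<circ> inv_into U' \<phi>'))"

text \<open>Tangent vectors at \<open>x\<close> are the derivations of germs of smooth functions; the values on
  functions that are not smooth near \<open>x\<close> are irrelevant.\<close>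

definition tangent_vector ::
  "('m::topological_space, 'b::real_normed_vector) atlas \<Rightarrow> 'm \<Rightarrow> (('m \<Rightarrow> real) \<Rightarrow> real) \<Rightarrow> bool" where
  "tangent_vector A x X \<longleftrightarrow>
     (\<forall>f g. smooth_near A x f \<and> smooth_near A x g \<longrightarrow>
        X (\<lambda>y. f y + g y) = X f + X g \<and>
        X (\<lambda>y. f y * g y) = f x * X g + g x * X f \<and>
        ((\<forall>\<^sub>F y in nhds x. f y = g y) \<longrightarrow> X f = X g)) \<and>
     (\<forall>c f. smooth_near A x f \<longrightarrow> X (\<lambda>y. c * f y) = c * X f)"

definition push_tangent ::
  "('m' \<Rightarrow> 'm) \<Rightarrow> (('m' \<Rightarrow> real) \<Rightarrow> real) \<Rightarrow> ('m \<Rightarrow> real) \<Rightarrow> real" where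
  "push_tangent \<tau> X f = X (f \<circ> \<tau>)"

definition complex_deriv :: "(('m \<Rightarrow> real) \<Rightarrow> real) \<Rightarrow> ('m \<Rightarrow> complex) \<Rightarrow> complex" where
  "complex_deriv X f = Complex (X (\<lambda>y. Re (f y))) (X (\<lambda>y. Im (f y)))"

section \<open>Vector bundles\<close>

text \<open>Real and complex bundles are treated together by an explicit scalar multiplication \<open>sc\<close>.\<close>

definition basis_of ::
  "('k::field \<Rightarrow> 'v::ab_group_add \<Rightarrow> 'v) \<Rightarrow> 'i set \<Rightarrow> ('i \<Rightarrow> 'v) \<Rightarrow> 'v set \<Rightarrow> bool" where
  "basis_of sc I e V \<longleftrightarrow> V = range (\<lambda>c. \<Sum>i\<in>I. sc (c i) (e i)) \<and>
     (\<forall>c. (\<Sum>i\<in>I. sc (c i) (e i)) = 0 \<longrightarrow> (\<forall>i\<in>I. c i = 0))"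

definition coords ::
  "('k::field \<Rightarrow> 'v::ab_group_add \<Rightarrow> 'v) \<Rightarrow> 'i set \<Rightarrow> ('i \<Rightarrow> 'v) \<Rightarrow> 'v \<Rightarrow> 'i \<Rightarrow> 'k" where
  "coords sc I e v = (THE c. (\<forall>i. i \<notin> I \<longrightarrow> c i = 0) \<and> v = (\<Sum>i\<in>I. sc (c i) (e i)))"

text \<open>The fibres are subspaces of one ambient vector space without any smooth dependence on the
  base point, which is no restriction; the smooth structure is given by a covering family
  \<open>vb_frames\<close> of local frames indexed by \<open>vb_index\<close>.\<close>

record ('m, 'v, 'i) vbundle =
  fibre :: "'m \<Rightarrow> 'v set"
  vb_index :: "'i set"
  vb_frames :: "('m set \<times> ('i \<Rightarrow> 'm \<Rightarrow> 'v)) set"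

definition vector_bundle ::
  "('m::topological_space, 'b::real_normed_vector) atlas \<Rightarrow>
   ('k::real_normed_field \<Rightarrow> 'v::ab_group_add \<Rightarrow> 'v) \<Rightarrow> ('m, 'v, 'i) vbundle \<Rightarrow> bool" where
  "vector_bundle A sc B \<longleftrightarrow> vector_space sc \<and> finite (vb_index B) \<and>
     (\<forall>(W, e)\<in>vb_frames B. open W \<and>
        (\<forall>y\<in>W. basis_of sc (vb_index B) (\<lambda>i. e i y) (fibre B y))) \<and>
     (\<Union>(W, e)\<in>vb_frames B. W) = UNIV \<and>
     (\<forall>(W, e)\<in>vb_frames B. \<forall>(W', e')\<in>vb_frames B. \<forall>i\<in>vb_index B. \<forall>j\<in>vb_index B.
        smooth_fun_on A (W \<inter> W') (\<lambda>y. coords sc (vb_index B) (\<lambda>k. e k y) (e' i y) j))"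

definition local_section ::
  "('m, 'b::real_normed_vector) atlas \<Rightarrow> ('k::real_normed_field \<Rightarrow> 'v::ab_group_add \<Rightarrow> 'v) \<Rightarrow>
   ('m, 'v, 'i) vbundle \<Rightarrow> 'm set \<Rightarrow> ('m \<Rightarrow> 'v) \<Rightarrow> bool" where
  "local_section A sc B W s \<longleftrightarrow> (\<forall>y\<in>W. s y \<in> fibre B y) \<and>
     (\<forall>(W', e)\<in>vb_frames B. \<forall>i\<in>vb_index B.
        smooth_fun_on A (W \<inter> W') (\<lambda>y. coords sc (vb_index B) (\<lambda>k. e k y) (s y) i))"

definition sections ::
  "('m, 'b::real_normed_vector) atlas \<Rightarrow> ('k::real_normed_field \<Rightarrow> 'v::ab_group_add \<Rightarrow> 'v) \<Rightarrow>
   ('m, 'v, 'i) vbundle \<Rightarrow> ('m \<Rightarrow> 'v) set" where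
  "sections A sc B = {s. local_section A sc B UNIV s}"

definition pullback_bundle :: "('m' \<Rightarrow> 'm) \<Rightarrow> ('m, 'v, 'i) vbundle \<Rightarrow> ('m', 'v, 'i) vbundle" where
  "pullback_bundle \<tau> B = \<lparr>fibre = fibre B \<circ> \<tau>, vb_index = vb_index B,
     vb_frames = (\<lambda>(W, e). (\<tau> -` W, \<lambda>i. e i \<circ> \<tau>)) ` vb_frames B\<rparr>"

section \<open>Courant algebroids\<close>

record ('m, 'v) courant =
  cbundle :: "('m, 'v, nat) vbundle"
  ip :: "'m \<Rightarrow> 'v \<Rightarrow> 'v \<Rightarrow> real"
  anchor :: "'m \<Rightarrow> 'v \<Rightarrow> ('m \<Rightarrow> real) \<Rightarrow> real"
  bracket :: "('m \<Rightarrow> 'v) \<Rightarrow> ('m \<Rightarrow> 'v) \<Rightarrow> 'm \<Rightarrow> 'v"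

abbreviation fib :: "('m, 'v) courant \<Rightarrow> 'm \<Rightarrow> 'v set" where
  "fib E \<equiv> fibre (cbundle E)"

abbreviation Gam ::
  "('m, 'b::real_normed_vector) atlas \<Rightarrow> ('m, 'v::real_vector) courant \<Rightarrow> ('m \<Rightarrow> 'v) set" where
  "Gam A E \<equiv> sections A (scaleR :: real \<Rightarrow> 'v \<Rightarrow> 'v) (cbundle E)"

definition crank :: "('m, 'v) courant \<Rightarrow> nat" where
  "crank E = card (vb_index (cbundle E))"

definition act :: "('m, 'v) courant \<Rightarrow> ('m \<Rightarrow> 'v) \<Rightarrow> ('m \<Rightarrow> real) \<Rightarrow> 'm \<Rightarrow> real" where
  "act E u f = (\<lambda>x. anchor E x (u x) f)"

definition d_E :: "('m, 'v) courant \<Rightarrow> ('m \<Rightarrow> real) \<Rightarrow> 'm \<Rightarrow> 'v" where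
  "d_E E f = (\<lambda>x. THE w. w \<in> fib E x \<and> (\<forall>u\<in>fib E x. ip E x u w = anchor E x u f))"

definition fibre_metric ::
  "('m::topological_space, 'b::real_normed_vector) atlas \<Rightarrow> ('m, 'v::real_vector) courant \<Rightarrow> bool" where
  "fibre_metric A E \<longleftrightarrow>
     (\<forall>x. \<forall>u\<in>fib E x. \<forall>v\<in>fib E x. \<forall>w\<in>fib E x. \<forall>c.
        ip E x u v = ip E x v u \<and> ip E x (u + v) w = ip E x u w + ip E x v w \<and>
        ip E x (c *\<^sub>R u) v = c * ip E x u v) \<and>
     (\<forall>x. \<forall>u\<in>fib E x. (\<forall>v\<in>fib E x. ip E x u v = 0) \<longrightarrow> u = 0) \<and>
     (\<forall>u\<in>Gam A E. \<forall>v\<in>Gam A E. (\<lambda>x. ip E x (u x) (v x)) \<in> C_inf A)"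

definition anchor_map ::
  "('m::topological_space, 'b::real_normed_vector) atlas \<Rightarrow> ('m, 'v::real_vector) courant \<Rightarrow> bool" where
  "anchor_map A E \<longleftrightarrow>
     (\<forall>x. \<forall>u\<in>fib E x. tangent_vector A x (anchor E x u)) \<and>
     (\<forall>x. \<forall>u\<in>fib E x. \<forall>v\<in>fib E x. \<forall>c f. smooth_near A x f \<longrightarrow>
        anchor E x (u + v) f = anchor E x u f + anchor E x v f \<and>
        anchor E x (c *\<^sub>R u) f = c * anchor E x u f) \<and>
     (\<forall>u\<in>Gam A E. \<forall>f\<in>C_inf A. act E u f \<in> C_inf A)"

definition courant_algebroid ::
  "('m::topological_space, 'b::real_normed_vector) atlas \<Rightarrow> ('m, 'v::real_vector) courant \<Rightarrow> bool" where
  "courant_algebroid A E \<longleftrightarrow>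
     vector_bundle A (scaleR :: real \<Rightarrow> 'v \<Rightarrow> 'v) (cbundle E) \<and>
     vb_index (cbundle E) = {..<crank E} \<and>
     fibre_metric A E \<and> anchor_map A E \<and>
     (\<forall>u\<in>Gam A E. \<forall>v\<in>Gam A E. bracket E u v \<in> Gam A E) \<and>
     (\<forall>u\<in>Gam A E. \<forall>v\<in>Gam A E. \<forall>w\<in>Gam A E. \<forall>c d.
        bracket E (\<lambda>x. c *\<^sub>R u x + d *\<^sub>R v x) w = (\<lambda>x. c *\<^sub>R bracket E u w x + d *\<^sub>R bracket E v w x) \<and>
        bracket E w (\<lambda>x. c *\<^sub>R u x + d *\<^sub>R v x) = (\<lambda>x. c *\<^sub>R bracket E w u x + d *\<^sub>R bracket E w v x)) \<and>
     (\<forall>u\<in>Gam A E. \<forall>v\<in>Gam A E. \<forall>w\<in>Gam A E.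
        bracket E u (bracket E v w) =
          (\<lambda>x. bracket E (bracket E u v) w x + bracket E v (bracket E u w) x)) \<and>
     (\<forall>u\<in>Gam A E. \<forall>v\<in>Gam A E. \<forall>f\<in>C_inf A.
        bracket E u (\<lambda>x. f x *\<^sub>R v x) = (\<lambda>x. f x *\<^sub>R bracket E u v x + act E u f x *\<^sub>R v x)) \<and>
     (\<forall>u\<in>Gam A E. \<forall>v\<in>Gam A E. \<forall>w\<in>Gam A E.
        act E u (\<lambda>x. ip E x (v x) (w x)) =
          (\<lambda>x. ip E x (bracket E u v x) (w x) + ip E x (v x) (bracket E u w x))) \<and>
     (\<forall>u\<in>Gam A E. \<forall>v\<in>Gam A E.
        (\<lambda>x. bracket E u v x + bracket E v u x) = d_E E (\<lambda>x. ip E x (u x) (v x)))"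

definition CA_pullback ::
  "('m'::topological_space, 'b'::real_normed_vector) atlas \<Rightarrow>
   ('m::topological_space, 'b::real_normed_vector) atlas \<Rightarrow> ('m' \<Rightarrow> 'm) \<Rightarrow>
   ('m, 'v::real_vector) courant \<Rightarrow> ('m', 'v) courant \<Rightarrow> bool" where
  "CA_pullback A' A \<tau> E E' \<longleftrightarrow>
     cbundle E' = pullback_bundle \<tau> (cbundle E) \<and> courant_algebroid A' E' \<and>
     (\<forall>u\<in>Gam A E. \<forall>v\<in>Gam A E. \<forall>x. ip E' x ((u \<circ> \<tau>) x) ((v \<circ> \<tau>) x) = ip E (\<tau> x) (u (\<tau> x)) (v (\<tau> x))) \<and>
     (\<forall>u\<in>Gam A E. \<forall>v\<in>Gam A E. bracket E' (u \<circ> \<tau>) (v \<circ> \<tau>) = bracket E u v \<circ> \<tau>) \<and>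
     (\<forall>u\<in>Gam A E. \<forall>x f. smooth_near A (\<tau> x) f \<longrightarrow>
        push_tangent \<tau> (anchor E' x ((u \<circ> \<tau>) x)) f = anchor E (\<tau> x) (u (\<tau> x)) f)"

definition divergence ::
  "('m::topological_space, 'b::real_normed_vector) atlas \<Rightarrow> ('m, 'v::real_vector) courant \<Rightarrow>
   (('m \<Rightarrow> 'v) \<Rightarrow> 'm \<Rightarrow> real) \<Rightarrow> bool" where
  "divergence A E dv \<longleftrightarrow>
     (\<forall>u\<in>Gam A E. dv u \<in> C_inf A) \<and>
     (\<forall>u\<in>Gam A E. \<forall>v\<in>Gam A E. \<forall>c d.
        dv (\<lambda>x. c *\<^sub>R u x + d *\<^sub>R v x) = (\<lambda>x. c * dv u x + d * dv v x)) \<and>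
     (\<forall>u\<in>Gam A E. \<forall>f\<in>C_inf A. dv (\<lambda>x. f x *\<^sub>R u x) = (\<lambda>x. f x * dv u x + act E u f x))"

text \<open>\<open>dv'\<close> is \<open>\<tau>\<^sup>*div\<close>; these conditions determine its values on all sections of \<open>E'\<close>.\<close>

definition pullback_divergence ::
  "('m'::topological_space, 'b'::real_normed_vector) atlas \<Rightarrow>
   ('m::topological_space, 'b::real_normed_vector) atlas \<Rightarrow> ('m' \<Rightarrow> 'm) \<Rightarrow>
   ('m, 'v::real_vector) courant \<Rightarrow> ('m', 'v) courant \<Rightarrow>
   (('m \<Rightarrow> 'v) \<Rightarrow> 'm \<Rightarrow> real) \<Rightarrow> (('m' \<Rightarrow> 'v) \<Rightarrow> 'm' \<Rightarrow> real) \<Rightarrow> bool" where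
  "pullback_divergence A' A \<tau> E E' dv dv' \<longleftrightarrow>
     divergence A' E' dv' \<and> (\<forall>u\<in>Gam A E. dv' (u \<circ> \<tau>) = dv u \<circ> \<tau>)"

section \<open>Generalized pseudometrics and curvatures\<close>

definition perp :: "('m, 'v) courant \<Rightarrow> ('m \<Rightarrow> 'v set) \<Rightarrow> 'm \<Rightarrow> 'v set" where
  "perp E V x = {w \<in> fib E x. \<forall>v\<in>V x. ip E x w v = 0}"

definition gen_pseudometric ::
  "('m::topological_space, 'b::real_normed_vector) atlas \<Rightarrow> ('m, 'v::real_vector) courant \<Rightarrow>
   nat \<Rightarrow> ('m \<Rightarrow> 'v set) \<Rightarrow> bool" where
  "gen_pseudometric A E n V \<longleftrightarrow>
     (\<forall>x. V x \<subseteq> fib E x) \<and>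
     (\<forall>x. \<exists>W e. open W \<and> x \<in> W \<and>
        (\<forall>i<n. local_section A (scaleR :: real \<Rightarrow> 'v \<Rightarrow> 'v) (cbundle E) W (e i)) \<and>
        (\<forall>y\<in>W. basis_of scaleR {..<n} (\<lambda>i. e i y) (V y))) \<and>
     (\<forall>x. \<forall>u\<in>V x. (\<forall>v\<in>V x. ip E x u v = 0) \<longrightarrow> u = 0)"

text \<open>Projection of a section to \<open>V\<close> along \<open>V\<^sup>\<bottom>\<close>.  The projection to \<open>V\<^sup>\<bottom>\<close> is \<open>proj E (perp E V)\<close>,
  as \<open>perp E (perp E V) = V\<close> for a generalized pseudometric.\<close>

definition proj :: "('m, 'v::real_vector) courant \<Rightarrow> ('m \<Rightarrow> 'v set) \<Rightarrow> ('m \<Rightarrow> 'v) \<Rightarrow> 'm \<Rightarrow> 'v" where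
  "proj E V s = (\<lambda>x. THE w. w \<in> V x \<and> s x - w \<in> perp E V x)"

definition sub_sections ::
  "('m, 'b::real_normed_vector) atlas \<Rightarrow> ('m, 'v::real_vector) courant \<Rightarrow> ('m \<Rightarrow> 'v set) \<Rightarrow>
   ('m \<Rightarrow> 'v) set" where
  "sub_sections A E V = {s \<in> Gam A E. \<forall>x. s x \<in> V x}"

definition trace_on :: "'v::real_vector set \<Rightarrow> ('v \<Rightarrow> 'v) \<Rightarrow> real" where
  "trace_on W T = (let B = (SOME B. independent B \<and> span B = W) in \<Sum>b\<in>B. representation B (T b) b)"

text \<open>The endomorphism of the fibre \<open>V x\<close> induced by a \<open>C\<^sup>\<infinity>\<close>-linear map \<open>\<Phi>\<close> on sections of \<open>V\<close>.\<close>

definition induced_endo ::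
  "('m, 'b::real_normed_vector) atlas \<Rightarrow> ('m, 'v::real_vector) courant \<Rightarrow> ('m \<Rightarrow> 'v set) \<Rightarrow>
   (('m \<Rightarrow> 'v) \<Rightarrow> 'm \<Rightarrow> 'v) \<Rightarrow> 'm \<Rightarrow> 'v \<Rightarrow> 'v" where
  "induced_endo A E V \<Phi> x v = \<Phi> (SOME s. s \<in> sub_sections A E V \<and> s x = v) x"

definition GRic ::
  "('m, 'b::real_normed_vector) atlas \<Rightarrow> ('m, 'v::real_vector) courant \<Rightarrow> ('m \<Rightarrow> 'v set) \<Rightarrow>
   (('m \<Rightarrow> 'v) \<Rightarrow> 'm \<Rightarrow> real) \<Rightarrow> ('m \<Rightarrow> 'v) \<Rightarrow> ('m \<Rightarrow> 'v) \<Rightarrow> 'm \<Rightarrow> real" where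
  "GRic A E V dv a b = (\<lambda>x.
     dv (proj E V (bracket E b a)) x - act E b (dv a) x
     - trace_on (V x) (induced_endo A E V
         (\<lambda>s. proj E V (bracket E (proj E (perp E V) (bracket E s b)) a)) x))"

text \<open>Local frames around \<open>x\<close> are represented by families of global sections that form a frame near
  \<open>x\<close> (every frame agrees near \<open>x\<close> with such a family), so that \<open>bracket\<close> and divergences
  apply to them directly.\<close>

definition const_frame ::
  "('m::topological_space, 'b::real_normed_vector) atlas \<Rightarrow> ('m, 'v::real_vector) courant \<Rightarrow>
   'm \<Rightarrow> (nat \<Rightarrow> 'm \<Rightarrow> 'v) \<Rightarrow> bool" where
  "const_frame A E x e \<longleftrightarrow> (\<forall>\<alpha><crank E. e \<alpha> \<in> Gam A E) \<and>
     (\<forall>\<^sub>F y in nhds x. basis_of scaleR {..<crank E} (\<lambda>\<alpha>. e \<alpha> y) (fib E y) \<and>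
        (\<forall>\<alpha><crank E. \<forall>\<beta><crank E. ip E y (e \<alpha> y) (e \<beta> y) = ip E x (e \<alpha> x) (e \<beta> x)))"

text \<open>The indices \<open>a < n\<close> are those of \<open>V\<close>, the indices \<open>n \<le> a < crank E\<close> those of \<open>V\<^sup>\<bottom>\<close>.\<close>

definition adapted_frame ::
  "('m::topological_space, 'b::real_normed_vector) atlas \<Rightarrow> ('m, 'v::real_vector) courant \<Rightarrow>
   nat \<Rightarrow> ('m \<Rightarrow> 'v set) \<Rightarrow> 'm \<Rightarrow> (nat \<Rightarrow> 'm \<Rightarrow> 'v) \<Rightarrow> bool" where
  "adapted_frame A E n V x e \<longleftrightarrow> const_frame A E x e \<and>
     (\<forall>\<^sub>F y in nhds x. basis_of scaleR {..<n} (\<lambda>a. e a y) (V y) \<and>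
        basis_of scaleR {n..<crank E} (\<lambda>a. e a y) (perp E V y))"

definition inv_gram :: "('m, 'v) courant \<Rightarrow> 'm \<Rightarrow> (nat \<Rightarrow> 'm \<Rightarrow> 'v) \<Rightarrow> nat \<Rightarrow> nat \<Rightarrow> real" where
  "inv_gram E x e = (THE h. (\<forall>\<alpha> \<beta>. \<alpha> \<ge> crank E \<or> \<beta> \<ge> crank E \<longrightarrow> h \<alpha> \<beta> = 0) \<and>
     (\<forall>\<alpha><crank E. \<forall>\<beta><crank E.
        (\<Sum>\<gamma><crank E. h \<alpha> \<gamma> * ip E x (e \<gamma> x) (e \<beta> x)) = (if \<alpha> = \<beta> then 1 else 0)))"

definition raised :: "('m, 'v::real_vector) courant \<Rightarrow> 'm \<Rightarrow> (nat \<Rightarrow> 'm \<Rightarrow> 'v) \<Rightarrow> nat \<Rightarrow> 'm \<Rightarrow> 'v" where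
  "raised E x e \<alpha> = (\<lambda>y. \<Sum>\<beta><crank E. inv_gram E x e \<alpha> \<beta> *\<^sub>R e \<beta> y)"

definition struct_coeff ::
  "('m, 'v) courant \<Rightarrow> 'm \<Rightarrow> (nat \<Rightarrow> 'm \<Rightarrow> 'v) \<Rightarrow> nat \<Rightarrow> nat \<Rightarrow> nat \<Rightarrow> real" where
  "struct_coeff E x e \<alpha> \<beta> \<gamma> = ip E x (e \<alpha> x) (bracket E (e \<beta>) (e \<gamma>) x)"

definition gscal_in_frame ::
  "('m, 'v::real_vector) courant \<Rightarrow> nat \<Rightarrow> (('m \<Rightarrow> 'v) \<Rightarrow> 'm \<Rightarrow> real) \<Rightarrow>
   (nat \<Rightarrow> 'm \<Rightarrow> 'v) \<Rightarrow> 'm \<Rightarrow> real" where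
  "gscal_in_frame E n dv e x =
     (\<Sum>a<n. dv (raised E x e a) x * dv (e a) x)
     + 2 * (\<Sum>a<n. act E (raised E x e a) (dv (e a)) x)
     - 1 / 6 * (\<Sum>a<n. \<Sum>b<n. \<Sum>c<n.
         struct_coeff E x e a b c * struct_coeff E x (raised E x e) a b c)
     - 1 / 2 * (\<Sum>a<n. \<Sum>b<n. \<Sum>c\<in>{n..<crank E}.
         struct_coeff E x e a b c * struct_coeff E x (raised E x e) a b c)"

text \<open>The choice is immaterial, the expression being independent of the adapted frame.\<close>

definition gscal ::
  "('m::topological_space, 'b::real_normed_vector) atlas \<Rightarrow> ('m, 'v::real_vector) courant \<Rightarrow>
   nat \<Rightarrow> ('m \<Rightarrow> 'v set) \<Rightarrow> (('m \<Rightarrow> 'v) \<Rightarrow> 'm \<Rightarrow> real) \<Rightarrow> 'm \<Rightarrow> real" where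
  "gscal A E n V dv x = gscal_in_frame E n dv (SOME e. adapted_frame A E n V x e) x"

text \<open>An orientation of \<open>V\<close> is given by the set of its oriented bases at each point.\<close>

definition orientation ::
  "('m::topological_space, 'b::real_normed_vector) atlas \<Rightarrow> ('m, 'v::real_vector) courant \<Rightarrow>
   nat \<Rightarrow> ('m \<Rightarrow> 'v set) \<Rightarrow> ('m \<Rightarrow> (nat \<Rightarrow> 'v) \<Rightarrow> bool) \<Rightarrow> bool" where
  "orientation A E n V ori \<longleftrightarrow>
     (\<forall>x b. ori x b \<longrightarrow> basis_of scaleR {..<n} b (V x)) \<and>
     (\<forall>x b b' M. ori x b \<and> basis_of scaleR {..<n} b' (V x) \<and>
        (\<forall>i<n. b' i = (\<Sum>j<n. M i j *\<^sub>R b j)) \<longrightarrow>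
        (ori x b' \<longleftrightarrow>
          (\<Sum>p | p permutes {..<n}. of_int (sign p) * (\<Prod>i<n. M i (p i))) > (0::real))) \<and>
     (\<forall>x. \<exists>W e. open W \<and> x \<in> W \<and>
        (\<forall>i<n. local_section A (scaleR :: real \<Rightarrow> 'v \<Rightarrow> 'v) (cbundle E) W (e i)) \<and>
        (\<forall>y\<in>W. ori y (\<lambda>i. e i y)))"

text \<open>Both sign conventions are admitted: \<open>\<sigma> = 1\<close> is signature \<open>(n - 1, 1)\<close>,
  \<open>\<sigma> = -1\<close> is signature \<open>(1, n - 1)\<close>.\<close>

definition lorentzian :: "('m, 'v::real_vector) courant \<Rightarrow> nat \<Rightarrow> ('m \<Rightarrow> 'v set) \<Rightarrow> bool" where
  "lorentzian E n V \<longleftrightarrow> (\<exists>\<sigma>\<in>{1, -1}. \<forall>x. \<exists>b. basis_of scaleR {..<n} b (V x) \<and>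
     (\<forall>i<n. \<forall>j<n. ip E x (b i) (b j) = (if i \<noteq> j then 0 else if i = 0 then - \<sigma> else \<sigma>)))"

section \<open>Spinors\<close>

text \<open>The model spinor module \<open>\<And>L\<^sub>1\<close> for \<open>L\<^sub>1 = \<complex>\<^sup>m\<close>: \<open>s I\<close> is the coefficient of the basis monomial
  \<open>l\<^bsub>i\<^sub>1\<^esub> \<and> \<dots> \<and> l\<^bsub>i\<^sub>k\<^esub>\<close>, where \<open>I = {i\<^sub>1 < \<dots> < i\<^sub>k}\<close>.  The half-density factor is trivialized by
  the square root of \<open>(l\<^sub>0 \<and> \<dots> \<and> l\<^bsub>m-1\<^esub>)\<^sup>-\<^sup>1\<close>.\<close>

type_synonym form = "nat set \<Rightarrow> complex"

definition wedge :: "form \<Rightarrow> form \<Rightarrow> form" where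
  "wedge s t K = (\<Sum>I\<in>Pow K. (-1) ^ card {(i, j). i \<in> I \<and> j \<in> K - I \<and> j < i} * s I * t (K - I))"

definition one_form :: "nat \<Rightarrow> (nat \<Rightarrow> complex) \<Rightarrow> form" where
  "one_form m a I = (\<Sum>i<m. if I = {i} then a i else 0)"

definition contract :: "nat \<Rightarrow> (nat \<Rightarrow> complex) \<Rightarrow> form \<Rightarrow> form" where
  "contract m b s K = (\<Sum>i\<in>{..<m} - K. (-1) ^ card {j \<in> K. j < i} * b i * s (insert i K))"

definition theta :: "form \<Rightarrow> form" where
  "theta s I = \<i> ^ card I * s I"

definition model_pairing :: "nat \<Rightarrow> form \<Rightarrow> form \<Rightarrow> complex" where
  "model_pairing m s t = wedge (theta s) t {..<m}"

record ('m, 'v, 'w) spinors =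
  sbundle :: "('m, 'w, nat set) vbundle"
  smult :: "complex \<Rightarrow> 'w \<Rightarrow> 'w"
  cl :: "'m \<Rightarrow> 'v \<Rightarrow> 'w \<Rightarrow> 'w"
  spair :: "'m \<Rightarrow> 'w \<Rightarrow> 'w \<Rightarrow> complex"
  spin_even :: "'m \<Rightarrow> 'w set"
  spin_odd :: "'m \<Rightarrow> 'w set"

abbreviation sGam ::
  "('m, 'b::real_normed_vector) atlas \<Rightarrow> ('m, 'v, 'w::ab_group_add) spinors \<Rightarrow> ('m \<Rightarrow> 'w) set" where
  "sGam A S \<equiv> sections A (smult S) (sbundle S)"

definition triv ::
  "('m, 'v, 'w::ab_group_add) spinors \<Rightarrow> nat \<Rightarrow> (nat set \<Rightarrow> 'm \<Rightarrow> 'w) \<Rightarrow> 'm \<Rightarrow> form \<Rightarrow> 'w" where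
  "triv S m \<psi> y s = (\<Sum>I\<in>Pow {..<m}. smult S (s I) (\<psi> I y))"

text \<open>A local trivialization of the pair \<open>(E, S)\<close> around \<open>x\<close>: a frame \<open>e\<close> of \<open>E\<close> with constant inner
  products and a frame \<open>\<psi>\<close> of \<open>S\<close> identifying the fibres of \<open>S\<close> with the model module, with its
  pairing and grading, such that \<open>e \<alpha>\<close> acts as the constant vector \<open>(p \<alpha>, q \<alpha>) \<in> L\<^sub>1 \<oplus> L\<^sub>2\<close>.
  The coefficients \<open>p, q\<close> are complex, so that every signature is covered.\<close>

definition spin_frame ::
  "('m::topological_space, 'b::real_normed_vector) atlas \<Rightarrow> ('m, 'v::real_vector) courant \<Rightarrow>
   ('m, 'v, 'w::ab_group_add) spinors \<Rightarrow> 'm \<Rightarrow> (nat \<Rightarrow> 'm \<Rightarrow> 'v) \<Rightarrow> (nat set \<Rightarrow> 'm \<Rightarrow> 'w) \<Rightarrow> bool" where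
  "spin_frame A E S x e \<psi> \<longleftrightarrow> (let m = crank E div 2 in
     const_frame A E x e \<and> (\<forall>I\<in>Pow {..<m}. \<psi> I \<in> sGam A S) \<and>
     (\<exists>p q. \<forall>\<^sub>F y in nhds x.
        basis_of (smult S) (Pow {..<m}) (\<lambda>I. \<psi> I y) (fibre (sbundle S) y) \<and>
        (\<forall>\<alpha><crank E. \<forall>s. cl S y (e \<alpha> y) (triv S m \<psi> y s) =
           triv S m \<psi> y (\<lambda>K. wedge (one_form m (p \<alpha>)) s K + contract m (q \<alpha>) s K)) \<and>
        (\<forall>s t. spair S y (triv S m \<psi> y s) (triv S m \<psi> y t) = model_pairing m s t) \<and>
        spin_even S y = triv S m \<psi> y ` {s. \<forall>I. odd (card I) \<longrightarrow> s I = 0} \<and>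
        spin_odd S y = triv S m \<psi> y ` {s. \<forall>I. even (card I) \<longrightarrow> s I = 0}))"

text \<open>The transition maps between two spin frames are locally lifts of maps into the special
  orthogonal group that preserve pairing and grading.  Such lifts are unique up to sign, so the spin
  frames constitute a spin structure, of which \<open>S\<close> is the associated bundle.\<close>

definition spinor_bundle ::
  "('m::topological_space, 'b::real_normed_vector) atlas \<Rightarrow> ('m, 'v::real_vector) courant \<Rightarrow>
   ('m, 'v, 'w::ab_group_add) spinors \<Rightarrow> bool" where
  "spinor_bundle A E S \<longleftrightarrow>
     even (crank E) \<and> vector_bundle A (smult S) (sbundle S) \<and>
     vb_index (sbundle S) = Pow {..<crank E div 2} \<and>
     (\<forall>x. \<forall>u\<in>fib E x. \<forall>v\<in>fib E x. \<forall>\<phi>\<in>fibre (sbundle S) x. \<forall>\<xi>\<in>fibre (sbundle S) x. \<forall>(c::real) z.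
        cl S x u \<phi> \<in> fibre (sbundle S) x \<and>
        cl S x (u + v) \<phi> = cl S x u \<phi> + cl S x v \<phi> \<and>
        cl S x (c *\<^sub>R u) \<phi> = smult S (of_real c) (cl S x u \<phi>) \<and>
        cl S x u (\<phi> + \<xi>) = cl S x u \<phi> + cl S x u \<xi> \<and>
        cl S x u (smult S z \<phi>) = smult S z (cl S x u \<phi>) \<and>
        cl S x u (cl S x v \<phi>) + cl S x v (cl S x u \<phi>) = smult S (of_real (ip E x u v)) \<phi>) \<and>
     (\<forall>x. \<exists>e \<psi>. spin_frame A E S x e \<psi>)"

definition pullback_spinors :: "('m' \<Rightarrow> 'm) \<Rightarrow> ('m, 'v, 'w) spinors \<Rightarrow> ('m', 'v, 'w) spinors" where
  "pullback_spinors \<tau> S = \<lparr>sbundle = pullback_bundle \<tau> (sbundle S), smult = smult S,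
     cl = cl S \<circ> \<tau>, spair = spair S \<circ> \<tau>, spin_even = spin_even S \<circ> \<tau>, spin_odd = spin_odd S \<circ> \<tau>\<rparr>"

text \<open>\<open>D\<^bsub>div\<^esub> F\<close> in the trivialization \<open>(e, \<psi>)\<close>; \<open>\<rho>(e \<alpha>)\<close> differentiates the components of \<open>F\<close>
  with respect to \<open>\<psi>\<close>.\<close>

definition dirac_in_frame ::
  "('m, 'v::real_vector) courant \<Rightarrow> ('m, 'v, 'w::ab_group_add) spinors \<Rightarrow>
   (('m \<Rightarrow> 'v) \<Rightarrow> 'm \<Rightarrow> real) \<Rightarrow> (nat \<Rightarrow> 'm \<Rightarrow> 'v) \<Rightarrow> (nat set \<Rightarrow> 'm \<Rightarrow> 'w) \<Rightarrow> ('m \<Rightarrow> 'w) \<Rightarrow> 'm \<Rightarrow> 'w" where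
  "dirac_in_frame E S dv e \<psi> F x = (let P = Pow {..<crank E div 2}; e' = raised E x e in
     (\<Sum>\<alpha><crank E. cl S x (e' \<alpha> x)
        ((\<Sum>I\<in>P. smult S (complex_deriv (anchor E x (e \<alpha> x))
             (\<lambda>y. coords (smult S) P (\<lambda>J. \<psi> J y) (F y) I)) (\<psi> I x))
         + smult S (of_real (dv (e \<alpha>) x / 2)) (F x)))
     - (\<Sum>\<alpha><crank E. \<Sum>\<beta><crank E. \<Sum>\<gamma><crank E.
          smult S (of_real (struct_coeff E x e \<alpha> \<beta> \<gamma> / 6))
            (cl S x (e' \<alpha> x) (cl S x (e' \<beta> x) (cl S x (e' \<gamma> x) (F x))))))"

text \<open>Again the choice of the trivialization is immaterial.\<close>

definition dirac ::
  "('m::topological_space, 'b::real_normed_vector) atlas \<Rightarrow> ('m, 'v::real_vector) courant \<Rightarrow>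
   ('m, 'v, 'w::ab_group_add) spinors \<Rightarrow> (('m \<Rightarrow> 'v) \<Rightarrow> 'm \<Rightarrow> real) \<Rightarrow> ('m \<Rightarrow> 'w) \<Rightarrow> 'm \<Rightarrow> 'w" where
  "dirac A E S dv F x =
     (case SOME f. spin_frame A E S x (fst f) (snd f) of (e, \<psi>) \<Rightarrow> dirac_in_frame E S dv e \<psi> F x)"

text \<open>The action of \<open>R\<^bsub>V\<^esub> = 2\<^bsup>n/2\<^esup> b\<^sub>1 \<cdots> b\<^sub>n\<close> for an oriented orthonormal basis \<open>b\<close> of \<open>V x\<close>, any two
  of which give the same element of the Clifford algebra.\<close>

definition R_op ::
  "('m, 'v) courant \<Rightarrow> ('m, 'v, 'w::ab_group_add) spinors \<Rightarrow> nat \<Rightarrow>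
   ('m \<Rightarrow> (nat \<Rightarrow> 'v) \<Rightarrow> bool) \<Rightarrow> ('m \<Rightarrow> 'w) \<Rightarrow> 'm \<Rightarrow> 'w" where
  "R_op E S n ori F x =
     (let b = (SOME b. ori x b \<and> (\<forall>i<n. \<forall>j<n. if i = j then \<bar>ip E x (b i) (b j)\<bar> = 1
                                               else ip E x (b i) (b j) = 0))
      in smult S (of_real (2 powr (real n / 2))) (foldr (\<lambda>i. cl S x (b i)) [0..<n] (F x)))"

section \<open>Generalized type II supergravity equations\<close>

definition sugra_setting ::
  "('m::topological_space, 'b::real_normed_vector) atlas \<Rightarrow> ('m, 'v::real_vector) courant \<Rightarrow>
   ('m, 'v, 'w::ab_group_add) spinors \<Rightarrow> nat \<Rightarrow> ('m \<Rightarrow> 'v set) \<Rightarrow> ('m \<Rightarrow> (nat \<Rightarrow> 'v) \<Rightarrow> bool) \<Rightarrow>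
   (('m \<Rightarrow> 'v) \<Rightarrow> 'm \<Rightarrow> real) \<Rightarrow> ('m \<Rightarrow> 'w) \<Rightarrow> bool" where
  "sugra_setting A E S n V ori dv F \<longleftrightarrow>
     spinor_bundle A E S \<and> gen_pseudometric A E n V \<and> orientation A E n V ori \<and>
     lorentzian E n V \<and> n mod 4 = 2 \<and> divergence A E dv \<and> F \<in> sGam A S"

definition sugra_equations ::
  "('m::topological_space, 'b::real_normed_vector) atlas \<Rightarrow> ('m, 'v::real_vector) courant \<Rightarrow>
   ('m, 'v, 'w::ab_group_add) spinors \<Rightarrow> nat \<Rightarrow> ('m \<Rightarrow> 'v set) \<Rightarrow> ('m \<Rightarrow> (nat \<Rightarrow> 'v) \<Rightarrow> bool) \<Rightarrow>
   (('m \<Rightarrow> 'v) \<Rightarrow> 'm \<Rightarrow> real) \<Rightarrow> ('m \<Rightarrow> 'w) \<Rightarrow> complex \<Rightarrow> bool" where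
  "sugra_equations A E S n V ori dv F \<nu> \<longleftrightarrow>
     (\<forall>x. R_op E S n ori F x = F x) \<and>
     (\<forall>x. dirac A E S dv F x = 0) \<and>
     (\<forall>x. gscal A E n V dv x = 0) \<and>
     (\<forall>u\<in>sub_sections A E V. \<forall>v\<in>sub_sections A E (perp E V). \<forall>x.
        of_real (GRic A E V dv u v x) =
          \<i> / (8 * \<nu>) * spair S x (cl S x (u x) (F x)) (cl S x (v x) (F x)))"

definition sugra_solution ::
  "('m::topological_space, 'b::real_normed_vector) atlas \<Rightarrow> ('m, 'v::real_vector) courant \<Rightarrow>
   ('m, 'v, 'w::ab_group_add) spinors \<Rightarrow> nat \<Rightarrow> ('m \<Rightarrow> 'v set) \<Rightarrow> ('m \<Rightarrow> (nat \<Rightarrow> 'v) \<Rightarrow> bool) \<Rightarrow>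
   (('m \<Rightarrow> 'v) \<Rightarrow> 'm \<Rightarrow> real) \<Rightarrow> ('m \<Rightarrow> 'w) \<Rightarrow> bool" where
  "sugra_solution A E S n V ori dv F \<longleftrightarrow> sugra_setting A E S n V ori dv F \<and>
     ((\<forall>x. F x \<in> spin_even S x) \<and> sugra_equations A E S n V ori dv F 1 \<or>
      (\<forall>x. F x \<in> spin_odd S x) \<and> sugra_equations A E S n V ori dv F \<i>)"

end

theory Submission
  imports Defs
begin

text \<open>Every term of the equations is a local expression in sections of \<open>E\<close> and \<open>S\<close>, the bracket, the
  anchor, the metric and the divergence, and each of these operations is intertwined with its
  counterpart on \<open>E'\<close> by \<open>u \<mapsto> u \<circ> \<tau>\<close>; the anchor because it only ever differentiates functions pulled back
  from \<open>M\<close>, on which \<open>\<rho>'(u \<circ> \<tau>)\<close> acts as \<open>\<rho>(u)\<close>.  So if a curvature or the Dirac operator at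
  \<open>x \<in> M'\<close> is computed with frames and sections that are pulled back from \<open>M\<close>, it is the corresponding
  quantity at \<open>\<tau> x\<close>, which solves the equations there.

  The substance of the proof is that such frames and sections may be used.  A general section of \<open>E'\<close>
  is not a pullback, and \<open>gscal\<close> and \<open>dirac\<close> on \<open>M'\<close> refer to unspecified frames.
  What is needed, at a single point \<open>x\<close> of an arbitrary Courant algebroid, is the following.

  \<^item> The generalized Ricci tensor is tensorial (\<open>GRic_pointwise\<close>), so that its arguments at \<open>x\<close> can be
    replaced by pullbacks with the same values.

  \<^item> The generalized scalar curvature is the same in all adapted frames
    (\<open>gscal_in_frame_independent\<close>).

  \<^item> The Dirac operator is the same in all spin frames (\<open>dirac_in_frame_independent\<close>).

  For the last two, a frame is first changed with constant coefficients, which alters no contraction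
  (\<open>contraction\<close>, \<open>triple_contraction\<close>), until two given frames are orthonormal and agree at \<open>x\<close>.  Then
  they differ through the antisymmetric derivatives \<open>\<theta>\<^sub>i\<^sub>j\<^sub>k = e\<^sub>i \<cdot> \<langle>e'\<^sub>j, e\<^sub>k\<rangle>\<close> and, for the scalar curvature,
  through second derivatives.  Structure functions change by the cyclic sum of \<open>\<theta>\<close> and divergences by its
  trace.  In the scalar curvature, differentiating \<open>\<langle>e'\<^sub>a, e'\<^sub>b\<rangle>\<close> twice, the identity
  \<open>\<rho>([u, v]) = [\<rho>(u), \<rho>(v)]\<close> and the nullity \<open>\<Sum> \<rho>(e\<^sup>i) \<otimes> \<rho>(e\<^sub>i) = 0\<close> make all changes cancel
  (\<open>on_scal_eq\<close>).  For the Dirac operator the frames of \<open>S\<close> change as well, and only through an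
  infinitesimal spin transformation: the difference of the two flat derivatives and
  \<open>\<Sum> \<theta>\<^sub>i\<^sub>j\<^sub>l e\<^sup>j e\<^sup>l / 2\<close> have the same commutators with Clifford multiplication, and both are skew for the
  spinor pairing.  By irreducibility of the model module they are equal (\<open>N_eq_N0\<close>),
  and the cubic term absorbs the change (\<open>cubic_clifford_identity\<close>).\<close>

section \<open>Calculus of smooth functions on open sets\<close>

lemmas at_point = eventually_nhds_x_imp_x

lemma Ck_on_cong:
  assumes "open S" "\<And>x. x \<in> S ==> f x = g x" "Ck_on k S f"
  shows "Ck_on k S g"
  using assms(2,3)
proof (induction k arbitrary: f g)
  case 0
  then show ?case using continuous_on_cong[of S S f g] by simp
next
  case (Suc k)
  have ev: "\<forall>\<^sub>F y in nhds x. f y = g y" if "x \<in> S" for x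
    using Suc.prems(1) assms(1) that eventually_nhds by blast
  have hd: "(f has_derivative D) (at x) \<longleftrightarrow> (g has_derivative D) (at x)" if "x \<in> S" for x D
    using that Suc.prems(1) assms(1) by (metis has_derivative_transform_within_open)
  then have fd: "frechet_derivative f (at x) = frechet_derivative g (at x)" if "x \<in> S" for x
    using that unfolding frechet_derivative_def by presburger
  show ?case
    using Suc.prems(2) hd fd Suc.IH[of "\<lambda>x. frechet_derivative f (at x) v" "\<lambda>x. frechet_derivative g (at x) v" for v]
    by (auto simp: differentiable_def)
qed

lemma Ck_on_SucI:
  assumes "open S" "\<And>x. x \<in> S ==> (f has_derivative f' x) (at x)"
    and "\<And>v. Ck_on k S (\<lambda>x. f' x v)"
  shows "Ck_on (Suc k) S f"
proof -
  have "frechet_derivative f (at x) = f' x" if "x \<in> S" for x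
    using frechet_derivative_at[OF assms(2)[OF that]] by simp
  moreover have "f differentiable (at x)" if "x \<in> S" for x
    using assms(2)[OF that] differentiable_def by blast
  ultimately show ?thesis
    using Ck_on_cong[OF assms(1) _ assms(3)] by simp
qed

lemma Ck_on_SucD:
  assumes "Ck_on (Suc k) S f"
  obtains f' where "\<And>x. x \<in> S ==> (f has_derivative f' x) (at x)" "\<And>v. Ck_on k S (\<lambda>x. f' x v)"
  using assms frechet_derivative_works by (metis Ck_on.simps(2))

lemma Ck_on_lower: "Ck_on (Suc k) S f ==> Ck_on k S f"
proof (induction k arbitrary: f)
  case 0
  then show ?case
    by (auto intro!: continuous_at_imp_continuous_on differentiable_imp_continuous_within)
next
  case (Suc k)
  then show ?case by (metis Ck_on.simps(2))
qed

lemma Ck_on_subset: "Ck_on k S f ==> T \<subseteq> S ==> Ck_on k T f"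
  by (induction k arbitrary: f) (auto intro: continuous_on_subset)

lemma Ck_on_local:
  assumes "\<And>x. x \<in> S ==> \<exists>T. open T \<and> x \<in> T \<and> Ck_on k T f"
  shows "Ck_on k S f"
  using assms
proof (induction k arbitrary: f)
  case 0
  then have "isCont f x" if "x \<in> S" for x
    using that continuous_on_eq_continuous_at by (metis Ck_on.simps(1))
  then show ?case by (simp add: continuous_at_imp_continuous_on)
next
  case (Suc k)
  then show ?case by (metis Ck_on.simps(2))
qed

lemma Ck_on_const: "open S ==> Ck_on k S (\<lambda>x. c)"
proof (induction k arbitrary: c)
  case 0
  then show ?case by simp
next
  case (Suc k)
  show ?case
    by (rule Ck_on_SucI[OF Suc.prems, of _ "\<lambda>x v. 0"]) (auto simp: Suc)
qed

lemma Ck_on_add: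
  "open S ==> Ck_on k S f ==> Ck_on k S g ==> Ck_on k S (\<lambda>x. f x + g x)"
proof (induction k arbitrary: f g)
  case 0
  then show ?case by (auto intro: continuous_intros)
next
  case (Suc k)
  obtain f' where f': "\<And>x. x \<in> S ==> (f has_derivative f' x) (at x)" "\<And>v. Ck_on k S (\<lambda>x. f' x v)"
    using Ck_on_SucD[OF Suc.prems(2)] by metis
  obtain g' where g': "\<And>x. x \<in> S ==> (g has_derivative g' x) (at x)" "\<And>v. Ck_on k S (\<lambda>x. g' x v)"
    using Ck_on_SucD[OF Suc.prems(3)] by metis
  show ?case
    by (rule Ck_on_SucI[OF Suc.prems(1), of _ "\<lambda>x v. f' x v + g' x v"])
      (auto intro: has_derivative_add f' g' Suc)
qed

lemma Ck_on_sum: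
  "open S ==> (\<And>i. i \<in> I ==> Ck_on k S (f i)) ==> Ck_on k S (\<lambda>x. \<Sum>i\<in>I. f i x)"
  by (induction I rule: infinite_finite_induct) (auto intro: Ck_on_add Ck_on_const)

lemma Ck_on_bilinear:
  assumes "bounded_bilinear B" "open S"
  shows "Ck_on k S f ==> Ck_on k S g ==> Ck_on k S (\<lambda>x. B (f x) (g x))"
proof (induction k arbitrary: f g)
  case 0
  then show ?case by (auto intro: bounded_bilinear.continuous_on[OF assms(1)])
next
  case (Suc k)
  obtain f' where f': "\<And>x. x \<in> S ==> (f has_derivative f' x) (at x)" "\<And>v. Ck_on k S (\<lambda>x. f' x v)"
    using Ck_on_SucD[OF Suc.prems(1)] by metis
  obtain g' where g': "\<And>x. x \<in> S ==> (g has_derivative g' x) (at x)" "\<And>v. Ck_on k S (\<lambda>x. g' x v)"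
    using Ck_on_SucD[OF Suc.prems(2)] by metis
  show ?case
    by (rule Ck_on_SucI[OF assms(2), of _ "\<lambda>x v. B (f x) (g' x v) + B (f' x v) (g x)"])
      (auto intro!: bounded_bilinear.FDERIV[OF assms(1)] Ck_on_add f' g' Suc.IH assms
        Ck_on_lower[OF Suc.prems(1)] Ck_on_lower[OF Suc.prems(2)])
qed

lemma Ck_on_mult:
  fixes f g :: "'a::real_normed_vector => 'k::real_normed_algebra"
  shows "open S ==> Ck_on k S f ==> Ck_on k S g ==> Ck_on k S (\<lambda>x. f x * g x)"
  by (rule Ck_on_bilinear[OF bounded_bilinear_mult])

lemma Ck_on_linear:
  assumes "bounded_linear L" "open S"
  shows "Ck_on k S f ==> Ck_on k S (\<lambda>x. L (f x))"
proof (induction k arbitrary: f)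
  case 0
  then show ?case by (auto intro: bounded_linear.continuous_on[OF assms(1)])
next
  case (Suc k)
  obtain f' where f': "\<And>x. x \<in> S ==> (f has_derivative f' x) (at x)" "\<And>v. Ck_on k S (\<lambda>x. f' x v)"
    using Ck_on_SucD[OF Suc.prems(1)] by metis
  show ?case
    by (rule Ck_on_SucI[OF assms(2), of _ "\<lambda>x v. L (f' x v)"])
      (auto intro!: bounded_linear.has_derivative[OF assms(1)] f' Suc.IH)
qed

lemma Ck_on_id: "open S ==> Ck_on k S (\<lambda>x. x)"
proof (cases k)
  case (Suc l)
  assume "open S"
  then show ?thesis unfolding Suc
    by (intro Ck_on_SucI[of _ _ "\<lambda>x v. v"]) (auto intro: Ck_on_const)
qed simp

lemma Ck_on_inverse:
  fixes f :: "'a::real_normed_vector => 'k::real_normed_field"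
  assumes "open S" "\<And>x. x \<in> S ==> f x \<noteq> 0"
  shows "Ck_on k S f ==> Ck_on k S (\<lambda>x. inverse (f x))"
proof (induction k)
  case 0
  then show ?case using assms by (auto intro!: continuous_intros)
next
  case (Suc k)
  obtain f' where f': "\<And>x. x \<in> S ==> (f has_derivative f' x) (at x)" "\<And>v. Ck_on k S (\<lambda>x. f' x v)"
    using Ck_on_SucD[OF Suc.prems(1)] by metis
  have IH: "Ck_on k S (\<lambda>x. inverse (f x))"
    using Suc Ck_on_lower by blast
  have "Ck_on k S (\<lambda>x. - 1 * (inverse (f x) * f' x v * inverse (f x)))" for v
    by (intro Ck_on_mult Ck_on_const assms IH f')
  then show ?case
    by (intro Ck_on_SucI[OF assms(1), of _ "\<lambda>x v. - (inverse (f x) * f' x v * inverse (f x))"])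
      (auto intro!: Deriv.has_derivative_inverse f' assms)
qed

lemma Ck_on_sqrt:
  fixes f :: "'a::real_normed_vector => real"
  assumes "open S" "\<And>x. x \<in> S ==> f x > 0"
  shows "Ck_on k S f ==> Ck_on k S (\<lambda>x. sqrt (f x))"
proof (induction k)
  case 0
  then show ?case by (auto intro!: continuous_intros)
next
  case (Suc k)
  obtain f' where f': "\<And>x. x \<in> S ==> (f has_derivative f' x) (at x)" "\<And>v. Ck_on k S (\<lambda>x. f' x v)"
    using Ck_on_SucD[OF Suc.prems(1)] by metis
  have IH: "Ck_on k S (\<lambda>x. sqrt (f x))"
    using Suc Ck_on_lower by blast
  have "Ck_on k S (\<lambda>x. f' x v * (1 / 2 * inverse (sqrt (f x))))" for v
    by (intro Ck_on_mult Ck_on_const Ck_on_inverse assms IH f') (use assms in force)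
  moreover have "((\<lambda>x. sqrt (f x)) has_derivative (\<lambda>v. f' x v * (1 / 2 * inverse (sqrt (f x))))) (at x)"
    if "x \<in> S" for x
    using has_derivative_real_sqrt[OF assms(2)[OF that] f'(1)[OF that]]
    by (simp add: field_simps)
  ultimately show ?case
    by (intro Ck_on_SucI[OF assms(1)])
qed

text \<open>The functions \<open>t\<^sup>-\<^sup>j e\<^sup>-\<^sup>1\<^sup>/\<^sup>t\<close>, extended by \<open>0\<close> to \<open>t \<le> 0\<close>, are a family closed under differentiation
  up to linear combinations; so all of them are smooth on the whole line.\<close>

definition flat_fun :: "nat => real => real" where
  "flat_fun j t = (if t \<le> 0 then 0 else inverse t ^ j * exp (- inverse t))"

lemma flat_fun_tendsto_0: "(flat_fun j \<longlongrightarrow> 0) (at_right 0)"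
proof -
  have "((\<lambda>u::real. u ^ j / exp u) \<longlongrightarrow> 0) at_top"
    by (rule tendsto_power_div_exp_0)
  then have "((\<lambda>t::real. inverse t ^ j / exp (inverse t)) \<longlongrightarrow> 0) (at_right 0)"
    using filterlim_compose[OF _ filterlim_inverse_at_top_right] by blast
  then show ?thesis
    by (rule Lim_transform_eventually)
      (auto simp: flat_fun_def exp_minus divide_inverse eventually_at_right_field intro!: exI[of _ 1])
qed

lemma flat_fun_has_derivative:
  "(flat_fun j has_real_derivative (- real j * flat_fun (Suc j) t + flat_fun (Suc (Suc j)) t)) (at t)"
proof -
  consider "t < 0" | "t > 0" | "t = 0" by linarith
  then show ?thesis
  proof cases
    case 1
    have "((\<lambda>t. 0) has_real_derivative 0) (at t)" by simp
    then have "(flat_fun j has_real_derivative 0) (at t)"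
      by (rule has_field_derivative_transform_within_open[of _ _ _ "{..<0}"])
        (use 1 in \<open>auto simp: flat_fun_def\<close>)
    then show ?thesis using 1 by (simp add: flat_fun_def)
  next
    case 2
    have "((\<lambda>t. inverse t ^ j * exp (- inverse t)) has_real_derivative
       (real j * (- (inverse t ^ 2)) * inverse t ^ (j - 1) * exp (- inverse t)
         + inverse t ^ 2 * exp (- inverse t) * inverse t ^ j)) (at t)"
      using 2 by (auto intro!: derivative_eq_intros simp: power2_eq_square)
    moreover have "real j * (- (inverse t ^ 2)) * inverse t ^ (j - 1) * exp (- inverse t)
         + inverse t ^ 2 * exp (- inverse t) * inverse t ^ j
       = - real j * flat_fun (Suc j) t + flat_fun (Suc (Suc j)) t"
      using 2 by (cases j) (auto simp: flat_fun_def power2_eq_square algebra_simps)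
    ultimately have "((\<lambda>t. inverse t ^ j * exp (- inverse t)) has_real_derivative
        - real j * flat_fun (Suc j) t + flat_fun (Suc (Suc j)) t) (at t)"
      by simp
    then show ?thesis
      by (rule has_field_derivative_transform_within_open[of _ _ _ "{0<..}"])
        (use 2 in \<open>auto simp: flat_fun_def\<close>)
  next
    case 3
    have "((\<lambda>y. (flat_fun j y - flat_fun j 0) / (y - 0)) \<longlongrightarrow> 0) (at 0)"
    proof (rule filterlim_split_at)
      have "((\<lambda>y::real. 0::real) \<longlongrightarrow> 0) (at_left 0)" by simp
      then show "((\<lambda>y. (flat_fun j y - flat_fun j 0) / (y - 0)) \<longlongrightarrow> 0) (at_left 0)"
        by (rule Lim_transform_eventually)
          (auto simp: flat_fun_def eventually_at_left_field intro!: exI[of _ "-1"])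
      show "((\<lambda>y. (flat_fun j y - flat_fun j 0) / (y - 0)) \<longlongrightarrow> 0) (at_right 0)"
        by (rule Lim_transform_eventually[OF flat_fun_tendsto_0[of "Suc j"]])
          (auto simp: flat_fun_def field_simps eventually_at_right_field intro!: exI[of _ 1])
    qed
    then show ?thesis
      unfolding 3 by (simp add: has_field_derivative_iff flat_fun_def)
  qed
qed

lemma Ck_on_flat_fun:
  fixes f :: "'a::real_normed_vector => real"
  assumes "open S"
  shows "Ck_on k S f ==> Ck_on k S (\<lambda>x. flat_fun j (f x))"
proof (induction k arbitrary: j)
  case 0
  have "continuous_on UNIV (flat_fun j)"
    using flat_fun_has_derivative by (meson DERIV_isCont continuous_at_imp_continuous_on)
  then show ?case using 0 continuous_on_compose2 by (metis Ck_on.simps(1) subset_UNIV)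
next
  case (Suc k)
  obtain f' where f': "\<And>x. x \<in> S ==> (f has_derivative f' x) (at x)" "\<And>v. Ck_on k S (\<lambda>x. f' x v)"
    using Ck_on_SucD[OF Suc.prems(1)] by metis
  have IH: "Ck_on k S (\<lambda>x. flat_fun j (f x))" for j
    using Suc Ck_on_lower by blast
  have "Ck_on k S (\<lambda>x. f' x v * (- real j * flat_fun (Suc j) (f x) + flat_fun (Suc (Suc j)) (f x)))" for v
    by (intro Ck_on_mult Ck_on_add Ck_on_const IH f' assms)
  moreover have "((\<lambda>x. flat_fun j (f x)) has_derivative
      (\<lambda>v. f' x v * (- real j * flat_fun (Suc j) (f x) + flat_fun (Suc (Suc j)) (f x)))) (at x)"
    if "x \<in> S" for x
    using DERIV_compose_FDERIV[OF flat_fun_has_derivative f'(1)[OF that]] .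
  ultimately show ?case
    by (intro Ck_on_SucI[OF assms])
qed

text \<open>A Heine-Borel inner product space has a finite orthonormal basis: finitely many balls of
  radius \<open>1/2\<close> cover the unit ball, no two orthonormal vectors share one of them, and an orthonormal
  set of maximal size spans.\<close>

lemma finite_orthonormal_basis_exists:
  obtains B :: "'b::{real_inner, heine_borel} set"
  where "finite B" "\<And>v. v = (\<Sum>b\<in>B. (v \<bullet> b) *\<^sub>R b)"
proof -
  define ON where "ON B \<longleftrightarrow> finite B \<and> (\<forall>a\<in>B. \<forall>b\<in>B. a \<bullet> b = (if a = b then 1 else 0))" for B :: "'b set"
  have "compact (cball (0::'b) 1)" by (simp add: compact_eq_bounded_closed)
  then obtain C where C: "finite C" "cball (0::'b) 1 \<subseteq> (\<Union>c\<in>C. ball c (1/2))"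
    using compact_eq_totally_bounded[of "cball (0::'b) 1"] by (metis half_gt_zero zero_less_one)
  have bound: "card B \<le> card C" if B: "ON B" for B
  proof -
    have nrm: "norm b = 1" if "b \<in> B" for b
      using B that by (simp add: ON_def norm_eq_1)
    then have "\<forall>b\<in>B. \<exists>c. c \<in> C \<and> b \<in> ball c (1/2)"
      using C(2) by (metis (no_types, lifting) UN_E dist_0_norm mem_cball order_refl subsetD)
    then obtain g where g: "\<And>b. b \<in> B ==> g b \<in> C \<and> b \<in> ball (g b) (1/2)"
      by metis
    have "inj_on g B"
    proof (rule inj_onI, rule ccontr)
      fix a b assume ab: "a \<in> B" "b \<in> B" "g a = g b" "a \<noteq> b"
      have "dist (g a) a < 1/2" "dist (g a) b < 1/2" using g[OF ab(1)] g[OF ab(2)] ab(3) by auto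
      then have "norm (a - b) < 1"
        using dist_triangle_half_r[of "g a" a 1 b] by (simp add: dist_norm)
      then have "norm (a - b) ^ 2 < 1" by (simp add: abs_square_less_1)
      moreover have "norm (a - b) ^ 2 = 2"
        using B ab unfolding power2_norm_eq_inner ON_def by (simp add: inner_diff inner_commute)
      ultimately show False by simp
    qed
    then show ?thesis using card_inj_on_le[OF _ _ C(1)] g by blast
  qed
  obtain B where B: "ON B" "\<And>B'. ON B' ==> card B' \<le> card B"
  proof -
    have "ON {}" by (simp add: ON_def)
    then show ?thesis
      using ex_has_greatest_nat[of ON "{}" card "Suc (card C)"] bound that
      by (metis le_imp_less_Suc)
  qed
  have fin: "finite B" using B(1) by (simp add: ON_def)
  have "v = (\<Sum>b\<in>B. (v \<bullet> b) *\<^sub>R b)" for v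
  proof (rule ccontr)
    define w where "w = v - (\<Sum>b\<in>B. (v \<bullet> b) *\<^sub>R b)"
    assume "\<not> ?thesis"
    then have w: "w \<noteq> 0" by (simp add: w_def)
    have wb: "w \<bullet> b = 0" if "b \<in> B" for b
    proof -
      have "(\<Sum>a\<in>B. (v \<bullet> a) * (a \<bullet> b)) = (\<Sum>a\<in>B. if a = b then v \<bullet> b else 0)"
        using B(1) that by (intro sum.cong) (auto simp: ON_def)
      then show ?thesis using fin that by (simp add: w_def inner_diff_left inner_sum_left)
    qed
    define u where "u = (1 / norm w) *\<^sub>R w"
    have u: "u \<bullet> u = 1" "\<And>b. b \<in> B ==> u \<bullet> b = 0"
      using w wb by (auto simp: u_def dot_square_norm power2_eq_square)
    then have "u \<notin> B" by force
    moreover have "ON (insert u B)"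
      using B(1) u by (auto simp: ON_def inner_commute)
    ultimately show False using B(2)[of "insert u B"] fin by simp
  qed
  then show ?thesis using that fin by blast
qed

text \<open>The induction over the order of differentiability needs the chain rule in the form
  \<open>D(f \<circ> g)(x) v = (\<Sum>b. \<langle>Dg(x) v, b\<rangle> Df(g x) b)\<close>, because \<open>Ck_on\<close> speaks of the derivatives in fixed
  directions; this is where the model space has to be finite-dimensional.\<close>

lemma Ck_on_compose:
  fixes f :: "'b::{real_inner, heine_borel} => 'c::real_normed_vector"
    and g :: "'a::real_normed_vector => 'b"
  assumes "open S" "open T" "\<And>x. x \<in> S ==> g x \<in> T"
  shows "Ck_on k S g ==> Ck_on k T f ==> Ck_on k S (\<lambda>x. f (g x))"
proof (induction k arbitrary: f)
  case 0
  then show ?case using assms by (auto intro: continuous_on_compose2)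
next
  case (Suc k)
  obtain f' where f': "\<And>x. x \<in> T ==> (f has_derivative f' x) (at x)" "\<And>v. Ck_on k T (\<lambda>x. f' x v)"
    using Ck_on_SucD[OF Suc.prems(2)] by metis
  obtain g' where g': "\<And>x. x \<in> S ==> (g has_derivative g' x) (at x)" "\<And>v. Ck_on k S (\<lambda>x. g' x v)"
    using Ck_on_SucD[OF Suc.prems(1)] by metis
  obtain B :: "'b set" where B: "finite B" "\<And>v. v = (\<Sum>b\<in>B. (v \<bullet> b) *\<^sub>R b)"
    using finite_orthonormal_basis_exists by blast
  define h where "h x v = (\<Sum>b\<in>B. (g' x v \<bullet> b) *\<^sub>R f' (g x) b)" for x v
  have "((\<lambda>x. f (g x)) has_derivative h x) (at x)" if "x \<in> S" for x
  proof -
    have lin: "bounded_linear (f' (g x))"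
      using f'(1) assms(3) that has_derivative_bounded_linear by blast
    have "(\<lambda>v. f' (g x) (g' x v)) = h x"
    proof (rule ext)
      fix v
      have "f' (g x) (g' x v) = f' (g x) (\<Sum>b\<in>B. (g' x v \<bullet> b) *\<^sub>R b)"
        using B(2)[of "g' x v"] by simp
      also have "... = h x v"
        using lin by (simp add: h_def linear_sum linear_scale bounded_linear.linear)
      finally show "f' (g x) (g' x v) = h x v" .
    qed
    moreover have "((\<lambda>x. f (g x)) has_derivative (\<lambda>v. f' (g x) (g' x v))) (at x)"
      using has_derivative_compose[OF g'(1)[OF that] f'(1)[OF assms(3)[OF that]]] .
    ultimately show ?thesis by simp
  qed
  moreover have "Ck_on k S (\<lambda>x. h x v)" for v
    unfolding h_def
    by (intro Ck_on_sum Ck_on_bilinear[OF bounded_bilinear_scaleR]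
        Ck_on_linear[OF bounded_linear_inner_left] assms(1) g' Suc.IH f' Ck_on_lower[OF Suc.prems(1)])
  ultimately show ?case
    by (rule Ck_on_SucI[OF assms(1)])
qed

lemma smooth_bump_exists:
  fixes c :: "'b::real_inner"
  assumes "r > 0"
  obtains \<eta> :: "'b => real"
  where "smooth_on UNIV \<eta>" "\<And>y. dist c y < r / 2 ==> \<eta> y = 1" "\<And>y. dist c y \<ge> r ==> \<eta> y = 0"
proof -
  define q where "q y = (y - c) \<bullet> (y - c)" for y
  have q: "q y = dist c y ^ 2" for y
    by (simp add: q_def dist_norm power2_norm_eq_inner norm_minus_commute[of c y])
  have dq: "Ck_on k UNIV q" for k
  proof -
    have "Ck_on k UNIV (\<lambda>y. y + - c)" by (intro Ck_on_add Ck_on_id Ck_on_const) auto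
    then show ?thesis
      using Ck_on_bilinear[OF bounded_bilinear_inner open_UNIV] unfolding q_def by fastforce
  qed
  define den where "den y = flat_fun 0 (r\<^sup>2 + - 1 * q y) + flat_fun 0 (q y + - (r\<^sup>2 / 4))" for y
  have pos: "flat_fun 0 t > 0" if "t > 0" for t using that by (simp add: flat_fun_def)
  have nn: "flat_fun 0 t \<ge> 0" for t by (simp add: flat_fun_def)
  have den: "den y > 0" for y
  proof (cases "q y < r\<^sup>2")
    case True
    then show ?thesis using pos[of "r\<^sup>2 + - 1 * q y"] nn[of "q y + - (r\<^sup>2 / 4)"] by (simp add: den_def)
  next
    case False
    moreover have "r\<^sup>2 > 0" using assms by simp
    ultimately have "q y + - (r\<^sup>2 / 4) > 0" by linarith
    then show ?thesis using pos nn[of "r\<^sup>2 + - 1 * q y"] by (simp add: den_def add_nonneg_pos)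
  qed
  define \<eta> where "\<eta> y = flat_fun 0 (r\<^sup>2 + - 1 * q y) * inverse (den y)" for y
  have "Ck_on k UNIV den" for k
    unfolding den_def by (intro Ck_on_add Ck_on_flat_fun Ck_on_mult dq Ck_on_const) auto
  then have "smooth_on UNIV \<eta>"
    unfolding smooth_on_def \<eta>_def
    by (intro allI Ck_on_mult Ck_on_inverse Ck_on_flat_fun Ck_on_add dq Ck_on_const)
      (use den in \<open>auto simp: less_imp_neq[symmetric]\<close>)
  moreover have "\<eta> y = 1" if "dist c y < r / 2" for y
  proof -
    have "q y < (r / 2)\<^sup>2" unfolding q using that by (intro power_strict_mono) auto
    then have "flat_fun 0 (q y + - (r\<^sup>2 / 4)) = 0" by (simp add: flat_fun_def power_divide)
    then show ?thesis using den[of y] by (simp add: \<eta>_def den_def)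
  qed
  moreover have "\<eta> y = 0" if "dist c y \<ge> r" for y
    using power_mono[OF that, of 2] assms by (simp add: \<eta>_def flat_fun_def q)
  ultimately show ?thesis using that by blast
qed

section \<open>Smooth functions on manifolds\<close>

locale smooth_manifold =
  fixes A :: "('m::{t2_space, second_countable_topology}, 'b::{real_inner, heine_borel}) atlas"
  assumes manifold: "manifold A"
begin

lemma chart_homeomorphism:
  "(U, \<phi>) \<in> A ==> open U \<and> open (\<phi> ` U) \<and> homeomorphism U (\<phi> ` U) \<phi> (inv_into U \<phi>)"
  using manifold unfolding manifold_def by fast

lemma chart_inj: "(U, \<phi>) \<in> A ==> inj_on \<phi> U"
  using chart_homeomorphism homeomorphism_def inj_on_def by (smt (verit) homeomorphism_apply1)

lemma chart_exists: obtains U \<phi> where "(U, \<phi>) \<in> A" "x \<in> U"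
  using manifold unfolding manifold_def by blast

lemma chart_transition:
  assumes "(U, \<phi>) \<in> A" "(V, \<psi>) \<in> A"
  shows "smooth_on (\<phi> ` (U \<inter> V)) (\<psi> \<circ> inv_into U \<phi>)"
proof -
  have "\<forall>c\<in>A. \<forall>d\<in>A. smooth_on (snd c ` (fst c \<inter> fst d)) (snd d \<circ> inv_into (fst c) (snd c))"
    using manifold by (simp add: manifold_def case_prod_beta')
  from bspec[OF bspec[OF this assms(1)] assms(2)] show ?thesis by simp
qed

lemma chart_image_open:
  assumes "(U, \<phi>) \<in> A" "open W"
  shows "open (\<phi> ` (U \<inter> W))"
proof -
  have "openin (top_of_set U) (U \<inter> W)" using assms(2) by (simp add: openin_open_Int)
  then have "openin (top_of_set (\<phi> ` U)) (\<phi> ` (U \<inter> W))"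
    using chart_homeomorphism[OF assms(1)] homeomorphism_imp_open_map by blast
  then show ?thesis using chart_homeomorphism[OF assms(1)] openin_open_eq by blast
qed

lemma smooth_fun_onI:
  assumes "\<And>U \<phi> k. (U, \<phi>) \<in> A ==> Ck_on k (\<phi> ` (U \<inter> W)) (\<lambda>z. f (inv_into U \<phi> z))"
  shows "smooth_fun_on A W f"
  unfolding smooth_fun_on_def smooth_on_def o_def
  by (intro ballI, clarify, rule assms)

lemma smooth_fun_onD:
  "smooth_fun_on A W f ==> (U, \<phi>) \<in> A ==> Ck_on k (\<phi> ` (U \<inter> W)) (\<lambda>z. f (inv_into U \<phi> z))"
  unfolding smooth_fun_on_def smooth_on_def o_def by blast

lemma smooth_fun_on_cong:
  assumes "open W" "\<And>x. x \<in> W ==> f x = g x" "smooth_fun_on A W f"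
  shows "smooth_fun_on A W g"
proof (rule smooth_fun_onI)
  fix U \<phi> k assume U: "(U, \<phi>) \<in> A"
  show "Ck_on k (\<phi> ` (U \<inter> W)) (\<lambda>z. g (inv_into U \<phi> z))"
    by (rule Ck_on_cong[OF chart_image_open[OF U assms(1)] _ smooth_fun_onD[OF assms(3) U]])
      (use assms(2) chart_inj[OF U] in auto)
qed

lemma smooth_fun_on_subset: "smooth_fun_on A W f ==> W' \<subseteq> W ==> smooth_fun_on A W' f"
  by (rule smooth_fun_onI, rule Ck_on_subset, erule (1) smooth_fun_onD) blast

lemma smooth_fun_on_local:
  assumes "\<And>x. x \<in> W ==> \<exists>T. open T \<and> x \<in> T \<and> smooth_fun_on A T f"
  shows "smooth_fun_on A W f"
proof (rule smooth_fun_onI)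
  fix U \<phi> k assume U: "(U, \<phi>) \<in> A"
  show "Ck_on k (\<phi> ` (U \<inter> W)) (\<lambda>z. f (inv_into U \<phi> z))"
  proof (rule Ck_on_local)
    fix z assume "z \<in> \<phi> ` (U \<inter> W)"
    then obtain y where y: "y \<in> U" "y \<in> W" "z = \<phi> y" by blast
    obtain T where T: "open T" "y \<in> T" "smooth_fun_on A T f" using assms[OF y(2)] by blast
    then have "Ck_on k (\<phi> ` (U \<inter> T)) (\<lambda>z. f (inv_into U \<phi> z))"
      using U smooth_fun_onD by blast
    then show "\<exists>T. open T \<and> z \<in> T \<and> Ck_on k T (\<lambda>z. f (inv_into U \<phi> z))"
      using chart_image_open[OF U T(1)] T(2) y by blast
  qed
qed

lemma smooth_fun_on_const: "open W ==> smooth_fun_on A W (\<lambda>x. c)"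
  by (rule smooth_fun_onI, rule Ck_on_const, rule chart_image_open)

lemma smooth_fun_on_add:
  "open W ==> smooth_fun_on A W f ==> smooth_fun_on A W g ==> smooth_fun_on A W (\<lambda>x. f x + g x)"
  by (rule smooth_fun_onI, rule Ck_on_add) (blast intro: chart_image_open smooth_fun_onD)+

lemma smooth_fun_on_mult:
  fixes f g :: "'m => 'k::real_normed_algebra"
  shows "open W ==> smooth_fun_on A W f ==> smooth_fun_on A W g ==> smooth_fun_on A W (\<lambda>x. f x * g x)"
  by (rule smooth_fun_onI, rule Ck_on_mult) (blast intro: chart_image_open smooth_fun_onD)+

lemma smooth_fun_on_linear:
  assumes "bounded_linear L"
  shows "open W ==> smooth_fun_on A W f ==> smooth_fun_on A W (\<lambda>x. L (f x))"
  by (rule smooth_fun_onI, rule Ck_on_linear[OF assms]) (blast intro: chart_image_open smooth_fun_onD)+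

lemma smooth_fun_on_sum:
  "open W ==> (\<And>i. i \<in> I ==> smooth_fun_on A W (f i)) ==> smooth_fun_on A W (\<lambda>x. \<Sum>i\<in>I. f i x)"
  by (induction I rule: infinite_finite_induct) (auto intro: smooth_fun_on_add smooth_fun_on_const)

lemma smooth_fun_on_minus:
  fixes f :: "'m => 'k::real_normed_field"
  shows "open W ==> smooth_fun_on A W f ==> smooth_fun_on A W (\<lambda>x. - f x)"
  by (rule smooth_fun_on_linear[OF bounded_linear_minus[OF bounded_linear_ident]])

lemma smooth_fun_on_inverse:
  fixes f :: "'m => 'k::real_normed_field"
  assumes "open W" "\<And>x. x \<in> W ==> f x \<noteq> 0" "smooth_fun_on A W f"
  shows "smooth_fun_on A W (\<lambda>x. inverse (f x))"
  by (rule smooth_fun_onI, rule Ck_on_inverse)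
    (use assms chart_inj in \<open>auto intro: chart_image_open smooth_fun_onD\<close>)

lemma smooth_fun_on_sqrt:
  fixes f :: "'m => real"
  assumes "open W" "\<And>x. x \<in> W ==> f x > 0" "smooth_fun_on A W f"
  shows "smooth_fun_on A W (\<lambda>x. sqrt (f x))"
  by (rule smooth_fun_onI, rule Ck_on_sqrt)
    (use assms chart_inj in \<open>auto intro: chart_image_open smooth_fun_onD\<close>)

lemma smooth_fun_continuous:
  assumes "smooth_fun_on A UNIV f"
  shows "continuous_on UNIV f"
proof -
  have "isCont f x" for x
  proof -
    obtain U \<phi> where U: "(U, \<phi>) \<in> A" "x \<in> U" using chart_exists .
    have "Ck_on 0 (\<phi> ` U) (f \<circ> inv_into U \<phi>)"
      using smooth_fun_onD[OF assms U(1), of 0] by (simp add: o_def)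
    then have "continuous_on (\<phi> ` U) (f \<circ> inv_into U \<phi>)" by simp
    then have "continuous_on U ((f \<circ> inv_into U \<phi>) \<circ> \<phi>)"
      using chart_homeomorphism[OF U(1)] by (meson continuous_on_compose homeomorphism_cont1)
    then have "continuous_on U f"
      using chart_inj[OF U(1)] by (simp cong: continuous_on_cong)
    then show ?thesis
      using chart_homeomorphism[OF U(1)] U(2) continuous_on_eq_continuous_at by blast
  qed
  then show ?thesis by (simp add: continuous_at_imp_continuous_on)
qed

text \<open>A bump function of the model space, transported by a chart and extended by \<open>0\<close>, is smooth
  because its support is compact and hence closed in the Hausdorff space \<open>M\<close>.\<close>

lemma bump_function:
  assumes "open W" "x \<in> W"
  obtains \<eta> :: "'m => real" and K
  where "smooth_fun_on A UNIV \<eta>" "\<forall>\<^sub>F y in nhds x. \<eta> y = 1" "closed K" "K \<subseteq> W"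
    "\<And>y. y \<notin> K ==> \<eta> y = 0"
proof -
  obtain U \<phi> where U: "(U, \<phi>) \<in> A" "x \<in> U" using chart_exists .
  have hom: "homeomorphism U (\<phi> ` U) \<phi> (inv_into U \<phi>)" "open U" using chart_homeomorphism[OF U(1)] by auto
  obtain r where r: "r > 0" "cball (\<phi> x) r \<subseteq> \<phi> ` (U \<inter> W)"
    using open_contains_cball chart_image_open[OF U(1) assms(1)] U(2) assms(2) by blast
  obtain \<eta>0 :: "'b => real" where \<eta>0: "smooth_on UNIV \<eta>0"
    "\<And>y. dist (\<phi> x) y < r / 2 ==> \<eta>0 y = 1" "\<And>y. dist (\<phi> x) y \<ge> r ==> \<eta>0 y = 0"
    using smooth_bump_exists[OF r(1)] by metis
  define \<eta> where "\<eta> y = (if y \<in> U then \<eta>0 (\<phi> y) else 0)" for y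
  define K where "K = inv_into U \<phi> ` cball (\<phi> x) r"
  have KW: "K \<subseteq> U \<inter> W"
    using r(2) chart_inj[OF U(1)] by (force simp: K_def subset_iff image_iff)
  have "continuous_on (cball (\<phi> x) r) (inv_into U \<phi>)"
    using r(2) hom(1) by (meson continuous_on_subset homeomorphism_cont2 image_mono inf_le1 order_trans)
  then have "compact K"
    unfolding K_def by (intro compact_continuous_image) (auto simp: compact_eq_bounded_closed)
  then have clK: "closed K" by (rule compact_imp_closed)
  have off: "\<eta> y = 0" if "y \<notin> K" for y
  proof (cases "y \<in> U")
    case True
    have "\<not> dist (\<phi> x) (\<phi> y) < r"
    proof
      assume "dist (\<phi> x) (\<phi> y) < r"
      then have "inv_into U \<phi> (\<phi> y) \<in> K" by (auto simp: K_def)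
      then show False using True that chart_inj[OF U(1)] by simp
    qed
    then show ?thesis using True \<eta>0(3) by (simp add: \<eta>_def)
  qed (simp add: \<eta>_def)
  have "open (U \<inter> \<phi> -` ball (\<phi> x) (r / 2))"
    using hom by (meson continuous_open_preimage homeomorphism_cont1 open_ball)
  then have one: "\<forall>\<^sub>F y in nhds x. \<eta> y = 1"
    unfolding eventually_nhds using U(2) r(1) \<eta>0(2)
    by (intro exI[of _ "U \<inter> \<phi> -` ball (\<phi> x) (r / 2)"]) (auto simp: \<eta>_def)
  \<comment> \<open>Smoothness is local, and \<open>U\<close> and the complement of the closed set \<open>K\<close> cover \<open>M\<close>.\<close>
  have onU: "smooth_fun_on A U \<eta>"
  proof (rule smooth_fun_onI)
    fix V \<psi> k assume V: "(V, \<psi>) \<in> A"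
    have "Ck_on k (\<psi> ` (V \<inter> U)) (\<phi> \<circ> inv_into V \<psi>)" "Ck_on k UNIV \<eta>0"
      using chart_transition[OF V U(1)] \<eta>0(1) by (simp_all add: smooth_on_def)
    then have "Ck_on k (\<psi> ` (V \<inter> U)) (\<lambda>z. \<eta>0 ((\<phi> \<circ> inv_into V \<psi>) z))"
      by (rule Ck_on_compose[OF chart_image_open[OF V hom(2)] open_UNIV UNIV_I])
    moreover have "\<eta>0 ((\<phi> \<circ> inv_into V \<psi>) z) = \<eta> (inv_into V \<psi> z)" if "z \<in> \<psi> ` (V \<inter> U)" for z
      using that chart_inj[OF V] by (auto simp: \<eta>_def)
    ultimately show "Ck_on k (\<psi> ` (V \<inter> U)) (\<lambda>z. \<eta> (inv_into V \<psi> z))"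
      by (rule Ck_on_cong[OF chart_image_open[OF V hom(2)], rotated])
  qed
  have offK: "smooth_fun_on A (- K) \<eta>"
    by (rule smooth_fun_on_cong[of _ "\<lambda>_. 0"]) (use clK off in \<open>auto intro: smooth_fun_on_const\<close>)
  have "smooth_fun_on A UNIV \<eta>"
  proof (rule smooth_fun_on_local)
    fix y
    show "\<exists>T. open T \<and> y \<in> T \<and> smooth_fun_on A T \<eta>"
      using onU offK hom(2) clK KW by (cases "y \<in> U") (auto simp: open_Compl intro: exI[of _ "- K"])
  qed
  then show ?thesis using that one clK KW off by blast
qed

lemma smooth_fun_on_bump:
  fixes f :: "'m => 'k::real_normed_field"
  assumes "open W" "smooth_fun_on A W f" "smooth_fun_on A UNIV \<eta>" "closed K" "K \<subseteq> W"
    and "\<And>y. y \<notin> K ==> \<eta> y = 0"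
  shows "smooth_fun_on A UNIV (\<lambda>y. of_real (\<eta> y) * f y)"
proof (rule smooth_fun_on_local)
  fix y
  have "smooth_fun_on A W (\<lambda>y. of_real (\<eta> y) * f y)"
    by (intro smooth_fun_on_mult smooth_fun_on_linear[OF bounded_linear_of_real] assms
        smooth_fun_on_subset[OF assms(3)]) auto
  moreover have "smooth_fun_on A (- K) (\<lambda>y. of_real (\<eta> y) * f y)"
    by (rule smooth_fun_on_cong[of _ "\<lambda>_. 0"]) (use assms in \<open>auto intro: smooth_fun_on_const\<close>)
  ultimately show "\<exists>T. open T \<and> y \<in> T \<and> smooth_fun_on A T (\<lambda>y. of_real (\<eta> y) * f y)"
    using assms(1,4,5) open_Compl[OF assms(4)] by (metis ComplI subsetD)
qed

lemma smooth_germ_extends: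
  fixes f :: "'m => 'k::real_normed_field"
  assumes "open W" "x \<in> W" "smooth_fun_on A W f"
  obtains g where "smooth_fun_on A UNIV g" "\<forall>\<^sub>F y in nhds x. g y = f y"
proof -
  obtain \<eta> :: "'m => real" and K where \<eta>: "smooth_fun_on A UNIV \<eta>" "\<forall>\<^sub>F y in nhds x. \<eta> y = 1" "closed K" "K \<subseteq> W"
    "\<And>y. y \<notin> K ==> \<eta> y = 0" using bump_function[OF assms(1,2)] by metis
  have "\<forall>\<^sub>F y in nhds x. of_real (\<eta> y) * f y = f y"
    using \<eta>(2) by eventually_elim simp
  then show ?thesis using that smooth_fun_on_bump[OF assms(1,3) \<eta>(1,3,4,5)] by blast
qed

lemma smooth_germ_inverse:
  fixes f :: "'m => 'k::real_normed_field"
  assumes "smooth_fun_on A UNIV f" "f x \<noteq> 0"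
  obtains g where "smooth_fun_on A UNIV g" "\<forall>\<^sub>F y in nhds x. g y * f y = 1"
proof -
  define W where "W = f -` (- {0})"
  have W: "open W" "x \<in> W"
    using open_vimage[OF _ smooth_fun_continuous[OF assms(1)], of "- {0}"] assms(2)
    by (auto simp: W_def open_Compl)
  have "smooth_fun_on A W (\<lambda>y. inverse (f y))"
    by (rule smooth_fun_on_inverse[OF W(1)]) (auto simp: W_def intro: smooth_fun_on_subset[OF assms(1)])
  then obtain g where g: "smooth_fun_on A UNIV g" "\<forall>\<^sub>F y in nhds x. g y = inverse (f y)"
    using smooth_germ_extends[OF W] by blast
  have "\<forall>\<^sub>F y in nhds x. y \<in> W" using W by (rule eventually_nhds_in_open)
  then have "\<forall>\<^sub>F y in nhds x. g y * f y = 1"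
    using g(2) by eventually_elim (auto simp: W_def)
  then show ?thesis using that g by blast
qed

text \<open>The germ of \<open>g\<close> is \<open>1 / sqrt \<bar>f\<bar>\<close>, the factor that normalizes a vector with square \<open>f\<close>.\<close>

lemma smooth_germ_normalize:
  fixes f :: "'m => real"
  assumes "smooth_fun_on A UNIV f" "f x \<noteq> 0"
  obtains g where "smooth_fun_on A UNIV g" "\<forall>\<^sub>F y in nhds x. g y * g y * f y = sgn (f x)"
proof -
  define \<sigma> where "\<sigma> = sgn (f x)"
  define W where "W = {y. \<sigma> * f y > 0}"
  have "continuous_on UNIV (\<lambda>y. \<sigma> * f y)"
    by (intro continuous_intros smooth_fun_continuous[OF assms(1)])
  then have W: "open W" "x \<in> W"
    using assms(2) unfolding W_def \<sigma>_def
    by (auto simp: open_Collect_less sgn_mult_self_eq sgn_if)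
  have "smooth_fun_on A W (\<lambda>y. inverse (sqrt (\<sigma> * f y)))"
    by (intro smooth_fun_on_inverse smooth_fun_on_sqrt smooth_fun_on_mult smooth_fun_on_const W
        smooth_fun_on_subset[OF assms(1)]) (auto simp: W_def)
  then obtain g where g: "smooth_fun_on A UNIV g" "\<forall>\<^sub>F y in nhds x. g y = inverse (sqrt (\<sigma> * f y))"
    using smooth_germ_extends[OF W] by blast
  have "\<forall>\<^sub>F y in nhds x. y \<in> W" using W by (rule eventually_nhds_in_open)
  then have "\<forall>\<^sub>F y in nhds x. g y * g y * f y = sgn (f x)"
    using g(2)
  proof eventually_elim
    case (elim y)
    then have p: "\<sigma> * f y > 0" by (simp add: W_def)
    have "\<sigma> = 1 \<or> \<sigma> = -1" using assms(2) by (auto simp: \<sigma>_def sgn_if)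
    moreover have "g y * g y = inverse (\<sigma> * f y)"
      using elim(2) p by (metis inverse_mult_distrib less_imp_le real_sqrt_mult_self abs_of_nonneg)
    ultimately show ?case using p unfolding \<sigma>_def[symmetric] by (auto simp: field_simps)
  qed
  then show ?thesis using that g by blast
qed

lemma C_inf_iff: "f \<in> C_inf A \<longleftrightarrow> smooth_fun_on A UNIV f"
  by (simp add: C_inf_def)

lemma smooth_nearI: "smooth_fun_on A UNIV f ==> smooth_near A x f"
  unfolding smooth_near_def by blast

lemma smooth_near_cong:
  assumes "smooth_near A x f" "\<forall>\<^sub>F y in nhds x. f y = g y"
  shows "smooth_near A x g"
proof -
  obtain W where W: "open W" "x \<in> W" "smooth_fun_on A W f" using assms(1) smooth_near_def by blast
  obtain T where T: "open T" "x \<in> T" "\<And>y. y \<in> T ==> f y = g y"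
    using assms(2) unfolding eventually_nhds by blast
  have "smooth_fun_on A (W \<inter> T) g"
    by (rule smooth_fun_on_cong[of _ f]) (use W T smooth_fun_on_subset[OF W(3)] in auto)
  then show ?thesis using W T unfolding smooth_near_def by blast
qed

end

lemma smooth_fun_on_pullback:
  fixes A :: "('m::{t2_space, second_countable_topology}, 'b::{real_inner, heine_borel}) atlas"
    and A' :: "('m'::{t2_space, second_countable_topology}, 'b'::{real_inner, heine_borel}) atlas"
  assumes "manifold A" "manifold A'" "smooth_map A' A \<tau>" "open W" "smooth_fun_on A W f"
  shows "smooth_fun_on A' (\<tau> -` W) (f \<circ> \<tau>)"
proof -
  interpret M: smooth_manifold A by unfold_locales (rule assms)
  interpret M': smooth_manifold A' by unfold_locales (rule assms)
  have cont: "open (\<tau> -` T)" if "open T" for T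
    using assms(3) that open_vimage by (auto simp: smooth_map_def)
  show ?thesis
  proof (rule M'.smooth_fun_onI)
  fix U' \<phi>' k assume U': "(U', \<phi>') \<in> A'"
  show "Ck_on k (\<phi>' ` (U' \<inter> \<tau> -` W)) (\<lambda>z. (f \<circ> \<tau>) (inv_into U' \<phi>' z))"
  proof (rule Ck_on_local)
    fix z assume "z \<in> \<phi>' ` (U' \<inter> \<tau> -` W)"
    then obtain y where y: "y \<in> U'" "\<tau> y \<in> W" "z = \<phi>' y" by blast
    obtain U \<phi> where U: "(U, \<phi>) \<in> A" "\<tau> y \<in> U" using M.chart_exists .
    have oU: "open U" using M.chart_homeomorphism[OF U(1)] by blast
    define T where "T = \<phi>' ` (U' \<inter> \<tau> -` (U \<inter> W))"
    have T: "open T" "z \<in> T"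
      unfolding T_def using M'.chart_image_open[OF U' cont[OF open_Int[OF oU assms(4)]]] y U(2) by auto
    have "smooth_on (\<phi>' ` (U' \<inter> \<tau> -` U)) (\<phi> \<circ> \<tau> \<circ> inv_into U' \<phi>')"
      using assms(3) U U' unfolding smooth_map_def by blast
    then have s1: "Ck_on k T (\<phi> \<circ> \<tau> \<circ> inv_into U' \<phi>')"
      unfolding smooth_on_def T_def by (force intro: Ck_on_subset)
    have s2: "Ck_on k (\<phi> ` (U \<inter> W)) (f \<circ> inv_into U \<phi>)"
      using M.smooth_fun_onD[OF assms(5) U(1)] by (simp add: o_def)
    have "Ck_on k T (\<lambda>z. (f \<circ> inv_into U \<phi>) ((\<phi> \<circ> \<tau> \<circ> inv_into U' \<phi>') z))"
      by (rule Ck_on_compose[OF T(1) M.chart_image_open[OF U(1) assms(4)] _ s1 s2])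
        (use M'.chart_inj[OF U'] in \<open>auto simp: T_def\<close>)
    moreover have "(f \<circ> inv_into U \<phi>) ((\<phi> \<circ> \<tau> \<circ> inv_into U' \<phi>') z) = (f \<circ> \<tau>) (inv_into U' \<phi>' z)"
      if "z \<in> T" for z
      using that M'.chart_inj[OF U'] M.chart_inj[OF U(1)] by (auto simp: T_def)
    ultimately have "Ck_on k T (\<lambda>z. (f \<circ> \<tau>) (inv_into U' \<phi>' z))"
      by (rule Ck_on_cong[OF T(1), rotated])
    then show "\<exists>T. open T \<and> z \<in> T \<and> Ck_on k T (\<lambda>z. (f \<circ> \<tau>) (inv_into U' \<phi>' z))"
      using T by blast
  qed
  qed
qed

section \<open>Inverting matrices of germs\<close>

text \<open>Gaussian elimination over a local ring of germs: a function is invertible as soon as its value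
  at \<open>x\<close> is nonzero, so pivots can be chosen at \<open>x\<close>.  For smooth germs this makes coordinates with
  respect to an arbitrary smooth frame smooth; for the trivial filter at a point it is the linear
  algebra fact that as many independent vectors as the dimension form a basis.\<close>

lemma germ_matrix_left_inverse:
  fixes R :: "('y => 'k::field) set" and Fl :: "'y filter" and a :: "'i => 'j => 'y => 'k"
  assumes R_const: "\<And>c. (\<lambda>_. c) \<in> R"
    and R_add: "\<And>f g. f \<in> R ==> g \<in> R ==> (\<lambda>y. f y + g y) \<in> R"
    and R_mult: "\<And>f g. f \<in> R ==> g \<in> R ==> (\<lambda>y. f y * g y) \<in> R"
    and R_inv: "\<And>f. f \<in> R ==> f x \<noteq> 0 ==> \<exists>g\<in>R. \<forall>\<^sub>F y in Fl. g y * f y = 1"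
    and at: "\<And>P. eventually P Fl ==> P x"
  shows "finite I ==> finite K ==> card I = card K ==> (\<And>i k. i \<in> I ==> k \<in> K ==> a i k \<in> R) ==>
    (\<And>c. (\<And>k. k \<in> K ==> (\<Sum>i\<in>I. c i * a i k x) = 0) ==> \<forall>i\<in>I. c i = 0) ==>
    \<exists>b. (\<forall>k\<in>K. \<forall>i\<in>I. b k i \<in> R) \<and>
      (\<forall>k\<in>K. \<forall>k'\<in>K. \<forall>\<^sub>F y in Fl. (\<Sum>i\<in>I. b k i y * a i k' y) = (if k = k' then 1 else 0))"
proof (induction I arbitrary: K a rule: finite_induct)
  case empty
  then show ?case by auto
next
  case (insert i0 I)
  have R_sum: "(\<lambda>y. \<Sum>j\<in>J. f j y) \<in> R" if "\<And>j. j \<in> J ==> f j \<in> R" for J :: "'l set" and f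
    using that by (induction J rule: infinite_finite_induct) (auto intro: R_const R_add)
  have R_minus: "(\<lambda>y. - f y) \<in> R" if "f \<in> R" for f
    using R_mult[OF R_const[of "-1"] that] by simp
  have R_diff: "(\<lambda>y. f y - g y) \<in> R" if "f \<in> R" "g \<in> R" for f g
    using R_add[OF that(1) R_minus[OF that(2)]] by simp
  have "\<exists>k\<in>K. a i0 k x \<noteq> 0"
  proof (rule ccontr)
    assume "\<not> ?thesis"
    then have "(\<Sum>i\<in>insert i0 I. (if i = i0 then 1 else 0) * a i k x) = 0" if "k \<in> K" for k
      using that insert.hyps by (simp add: sum.neutral)
    then show False using insert.prems(4)[of "\<lambda>i. if i = i0 then 1 else 0"] by force
  qed
  then obtain k0 where k0: "k0 \<in> K" "a i0 k0 x \<noteq> 0" by blast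
  obtain g where g: "g \<in> R" "\<forall>\<^sub>F y in Fl. g y * a i0 k0 y = 1"
    using R_inv[OF insert.prems(3)[of i0 k0]] k0 by auto
  have gx: "g x * a i0 k0 x = 1" using at[OF g(2)] .
  define K' where "K' = K - {k0}"
  define a' where "a' i k y = a i k y - a i k0 y * g y * a i0 k y" for i k y
  have K': "finite K'" "card I = card K'" "K = insert k0 K'" "k0 \<notin> K'"
    using insert.prems(1,2) insert.hyps k0(1) by (auto simp: K'_def)
  have a'R: "a' i k \<in> R" if "i \<in> I" "k \<in> K'" for i k
    unfolding a'_def using that K' insert.prems(3) g(1) by (intro R_diff R_mult) auto
  have ind: "\<forall>i\<in>I. c i = 0" if c: "\<And>k. k \<in> K' ==> (\<Sum>i\<in>I. c i * a' i k x) = 0" for c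
  proof -
    define c' where "c' i = (if i = i0 then - (\<Sum>i\<in>I. c i * a i k0 x) * g x else c i)" for i
    have eq: "(\<Sum>i\<in>insert i0 I. c' i * a i k x)
        = (\<Sum>i\<in>I. c i * a i k x) - (\<Sum>i\<in>I. c i * a i k0 x) * (g x * a i0 k x)" for k
    proof -
      have "(\<Sum>i\<in>I. c' i * a i k x) = (\<Sum>i\<in>I. c i * a i k x)"
        using insert.hyps by (intro sum.cong) (auto simp: c'_def)
      then show ?thesis using insert.hyps by (simp add: c'_def)
    qed
    have "(\<Sum>i\<in>insert i0 I. c' i * a i k x) = 0" if "k \<in> K" for k
    proof (cases "k = k0")
      case True
      then show ?thesis unfolding eq by (simp add: gx)
    next
      case False
      then have "(\<Sum>i\<in>I. c i * a' i k x) = 0" using c K' that by blast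
      then show ?thesis unfolding eq
        by (simp add: a'_def algebra_simps sum_subtractf sum_distrib_left)
    qed
    then have "\<forall>i\<in>insert i0 I. c' i = 0" using insert.prems(4) by blast
    then show ?thesis using insert.hyps by (auto simp: c'_def split: if_splits)
  qed
  have "\<exists>b. (\<forall>k\<in>K'. \<forall>i\<in>I. b k i \<in> R) \<and>
      (\<forall>k\<in>K'. \<forall>k'\<in>K'. \<forall>\<^sub>F y in Fl. (\<Sum>i\<in>I. b k i y * a' i k' y) = (if k = k' then 1 else 0))"
    using insert.IH[OF K'(1,2) a'R ind] .
  then obtain b where b: "\<And>k i. k \<in> K' ==> i \<in> I ==> b k i \<in> R"
    and bK: "\<And>k k'. k \<in> K' ==> k' \<in> K' ==> \<forall>\<^sub>F y in Fl. (\<Sum>i\<in>I. b k i y * a' i k' y) = (if k = k' then 1 else 0)"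
    by blast
  define b1 where "b1 k i y = (if i = i0 then - (\<Sum>i\<in>I. b k i y * a i k0 y) * g y else b k i y)" for k i y
  define b2 where "b2 k i y = (if k = k0 then g y * ((if i = i0 then 1 else 0) - (\<Sum>k\<in>K'. a i0 k y * b1 k i y))
      else b1 k i y)" for k i y
  have b1': "b1 k i = (if i = i0 then (\<lambda>y. - (\<Sum>i\<in>I. b k i y * a i k0 y) * g y) else b k i)" for k i
    by (auto simp: b1_def fun_eq_iff)
  have b2': "b2 k i = (if k = k0 then (\<lambda>y. g y * ((if i = i0 then 1 else 0) - (\<Sum>k\<in>K'. a i0 k y * b1 k i y)))
      else b1 k i)" for k i
    by (auto simp: b2_def fun_eq_iff)
  have b1R: "b1 k i \<in> R" if "k \<in> K'" "i \<in> insert i0 I" for k i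
    using that insert.prems(3) k0 K' g(1)
    unfolding b1' by (auto intro!: R_mult R_minus R_sum b simp del: mult_minus_left)
  have b2R: "b2 k i \<in> R" if "k \<in> K" "i \<in> insert i0 I" for k i
  proof (cases "k = k0")
    case True
    have "(\<lambda>y. g y * ((if i = i0 then 1 else 0) - (\<Sum>k\<in>K'. a i0 k y * b1 k i y))) \<in> R"
      using that b1R insert.prems(3) K' by (intro R_mult R_diff R_sum R_const g(1)) auto
    then show ?thesis by (simp add: b2' True)
  next
    case False
    then show ?thesis using that b1R K' by (auto simp: b2')
  qed
  have sum_b1: "(\<Sum>i\<in>insert i0 I. b1 k i y * a i k' y)
      = (\<Sum>i\<in>I. b k i y * a i k' y) - (\<Sum>i\<in>I. b k i y * a i k0 y) * (g y * a i0 k' y)" for k k' y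
  proof -
    have "(\<Sum>i\<in>I. b1 k i y * a i k' y) = (\<Sum>i\<in>I. b k i y * a i k' y)"
      using insert.hyps by (intro sum.cong) (auto simp: b1_def)
    then show ?thesis using insert.hyps by (simp add: b1_def)
  qed
  have ev1: "\<forall>\<^sub>F y in Fl. (\<Sum>i\<in>insert i0 I. b1 k i y * a i k' y) = (if k = k' then 1 else 0)"
    if "k \<in> K'" "k' \<in> K" for k k'
  proof (cases "k' = k0")
    case True
    show ?thesis using g(2)
      by eventually_elim (use True that K' in \<open>auto simp: sum_b1\<close>)
  next
    case False
    then have "k' \<in> K'" using that K' by blast
    have *: "(\<Sum>i\<in>I. b k i y * a i k' y) - (\<Sum>i\<in>I. b k i y * a i k0 y) * (g y * a i0 k' y)
        = (\<Sum>i\<in>I. b k i y * a' i k' y)" for y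
      by (simp add: a'_def algebra_simps sum_subtractf sum_distrib_left)
    show ?thesis using bK[OF that(1) \<open>k' \<in> K'\<close>] unfolding sum_b1 * .
  qed
  have ev2: "\<forall>\<^sub>F y in Fl. (\<Sum>i\<in>insert i0 I. b2 k0 i y * a i k' y) = (if k0 = k' then 1 else 0)"
    if "k' \<in> K" for k'
  proof -
    have exp: "(\<Sum>i\<in>insert i0 I. b2 k0 i y * a i k' y)
        = g y * (a i0 k' y - (\<Sum>k\<in>K'. a i0 k y * (\<Sum>i\<in>insert i0 I. b1 k i y * a i k' y)))" for y
    proof -
      have "(\<Sum>i\<in>insert i0 I. b2 k0 i y * a i k' y)
          = g y * (\<Sum>i\<in>insert i0 I. ((if i = i0 then 1 else 0) - (\<Sum>k\<in>K'. a i0 k y * b1 k i y)) * a i k' y)"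
        unfolding sum_distrib_left by (intro sum.cong) (auto simp: b2_def)
      also have "(\<Sum>i\<in>insert i0 I. ((if i = i0 then 1 else 0) - (\<Sum>k\<in>K'. a i0 k y * b1 k i y)) * a i k' y)
          = (\<Sum>i\<in>insert i0 I. (if i = i0 then 1 else 0) * a i k' y)
            - (\<Sum>i\<in>insert i0 I. (\<Sum>k\<in>K'. a i0 k y * b1 k i y) * a i k' y)"
        by (simp only: left_diff_distrib sum_subtractf)
      also have "(\<Sum>i\<in>insert i0 I. (if i = i0 then 1 else 0) * a i k' y) = a i0 k' y"
        using insert.hyps by (simp add: sum.neutral)
      also have "(\<Sum>i\<in>insert i0 I. (\<Sum>k\<in>K'. a i0 k y * b1 k i y) * a i k' y)
          = (\<Sum>k\<in>K'. a i0 k y * (\<Sum>i\<in>insert i0 I. b1 k i y * a i k' y))"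
        unfolding sum_distrib_left sum_distrib_right by (subst sum.swap) (simp only: mult.assoc)
      finally show ?thesis .
    qed
    have "\<forall>\<^sub>F y in Fl. \<forall>k\<in>K'. (\<Sum>i\<in>insert i0 I. b1 k i y * a i k' y) = (if k = k' then 1 else 0)"
      using K'(1) ev1 that by (simp add: eventually_ball_finite)
    with g(2) show ?thesis
    proof eventually_elim
      case (elim y)
      have "(\<Sum>k\<in>K'. a i0 k y * (\<Sum>i\<in>insert i0 I. b1 k i y * a i k' y))
          = (\<Sum>k\<in>K'. if k = k' then a i0 k y else 0)"
        using elim(2) by (intro sum.cong) auto
      then show ?case
        unfolding exp using elim(1) K' that by (auto simp: sum.delta)
    qed
  qed
  have "\<forall>\<^sub>F y in Fl. (\<Sum>i\<in>insert i0 I. b2 k i y * a i k' y) = (if k = k' then 1 else 0)"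
    if "k \<in> K" "k' \<in> K" for k k'
    using ev1[of k k'] ev2[of k'] that K' by (cases "k = k0") (auto simp: b2_def)
  then show ?case using b2R by blast
qed

section \<open>Sections of vector bundles\<close>

context vector_space
begin

lemma basis_of_sum: "basis_of scale I e V ==> (\<Sum>i\<in>I. scale (c i) (e i)) \<in> V"
  unfolding basis_of_def by blast

lemma basis_of_unique:
  assumes "basis_of scale I e V" "(\<Sum>i\<in>I. scale (c i) (e i)) = (\<Sum>i\<in>I. scale (d i) (e i))" "i \<in> I"
  shows "c i = d i"
proof -
  have "(\<Sum>i\<in>I. scale (c i - d i) (e i)) = 0"
    using assms(2) by (simp add: scale_left_diff_distrib sum_subtractf)
  then show ?thesis using assms(1,3) unfolding basis_of_def by fastforce
qed

lemma coords_eq: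
  assumes "basis_of scale I e V" "v = (\<Sum>i\<in>I. scale (c i) (e i))" "i \<in> I"
  shows "coords scale I e v i = c i"
proof -
  let ?P = "\<lambda>c'. (\<forall>i. i \<notin> I \<longrightarrow> c' i = 0) \<and> v = (\<Sum>i\<in>I. scale (c' i) (e i))"
  have "?P (\<lambda>i. if i \<in> I then c i else 0)" using assms(2) by (simp cong: sum.cong)
  moreover have "c' = (\<lambda>i. if i \<in> I then c i else 0)" if "?P c'" for c'
  proof
    fix j show "c' j = (if j \<in> I then c j else 0)"
      using that basis_of_unique[OF assms(1), of c' c j] assms(2) by (cases "j \<in> I") auto
  qed
  ultimately have "(THE c'. ?P c') = (\<lambda>i. if i \<in> I then c i else 0)" by (rule the_equality)
  then show ?thesis using assms(3) by (simp add: coords_def)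
qed

lemma coords_sum:
  assumes "basis_of scale I e V" "v \<in> V"
  shows "(\<Sum>i\<in>I. scale (coords scale I e v i) (e i)) = v"
proof -
  obtain c where "v = (\<Sum>i\<in>I. scale (c i) (e i))" using assms unfolding basis_of_def by blast
  then show ?thesis using coords_eq[OF assms(1)] by (auto intro!: sum.cong)
qed

lemma basis_of_add: "basis_of scale I e V ==> v \<in> V ==> w \<in> V ==> v + w \<in> V"
proof -
  assume a: "basis_of scale I e V" "v \<in> V" "w \<in> V"
  have "(\<Sum>i\<in>I. scale (coords scale I e v i + coords scale I e w i) (e i)) = v + w"
    using coords_sum[OF a(1)] a by (simp add: scale_left_distrib sum.distrib)
  then show ?thesis using basis_of_sum[OF a(1)] by metis
qed

lemma basis_of_scale: "basis_of scale I e V ==> v \<in> V ==> scale c v \<in> V"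
proof -
  assume a: "basis_of scale I e V" "v \<in> V"
  have "(\<Sum>i\<in>I. scale (c * coords scale I e v i) (e i)) = scale c v"
    using coords_sum[OF a] by (simp flip: scale_scale scale_sum_right)
  then show ?thesis using basis_of_sum[OF a(1)] by metis
qed

lemma basis_of_zero: "basis_of scale I e V ==> 0 \<in> V"
  using basis_of_sum[of I e V "\<lambda>_. 0"] by simp

lemma basis_of_in: "basis_of scale I e V ==> finite I ==> i \<in> I ==> e i \<in> V"
proof -
  assume a: "basis_of scale I e V" "finite I" "i \<in> I"
  have "(\<Sum>j\<in>I. scale (if j = i then 1 else 0) (e j)) = (\<Sum>j\<in>I. if j = i then e j else 0)"
    by (intro sum.cong) auto
  then show ?thesis using a basis_of_sum[OF a(1), of "\<lambda>j. if j = i then 1 else 0"] by simp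
qed

lemma coords_add:
  assumes "basis_of scale I e V" "v \<in> V" "w \<in> V" "i \<in> I"
  shows "coords scale I e (v + w) i = coords scale I e v i + coords scale I e w i"
  using coords_sum[OF assms(1,2)] coords_sum[OF assms(1,3)]
  by (intro coords_eq[OF assms(1) _ assms(4)]) (simp add: scale_left_distrib sum.distrib)

lemma coords_scale:
  assumes "basis_of scale I e V" "v \<in> V" "i \<in> I"
  shows "coords scale I e (scale c v) i = c * coords scale I e v i"
  using coords_sum[OF assms(1,2)]
  by (intro coords_eq[OF assms(1) _ assms(3)]) (simp flip: scale_scale scale_sum_right)

end

locale smooth_bundle = smooth_manifold A
  for A :: "('m::{t2_space, second_countable_topology}, 'b::{real_inner, heine_borel}) atlas" +
  fixes sc :: "'k::real_normed_field => 'v::ab_group_add => 'v" and B :: "('m, 'v, 'i) vbundle"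
  assumes vector_bundle: "vector_bundle A sc B"
begin

sublocale vs: vector_space sc
  using vector_bundle by (simp add: vector_bundle_def)

lemma finite_index: "finite (vb_index B)"
  using vector_bundle by (simp add: vector_bundle_def)

lemma frame_open: "(W, e) \<in> vb_frames B ==> open W"
  using vector_bundle by (auto simp: vector_bundle_def)

lemma frame_basis:
  "(W, e) \<in> vb_frames B ==> y \<in> W ==> basis_of sc (vb_index B) (\<lambda>i. e i y) (fibre B y)"
  using vector_bundle by (auto simp: vector_bundle_def)

lemma frame_exists: obtains W e where "(W, e) \<in> vb_frames B" "x \<in> W"
proof -
  have "(\<Union>(W, e)\<in>vb_frames B. W) = UNIV"
    using vector_bundle by (simp add: vector_bundle_def)
  then show ?thesis using that by blast
qed

lemma fibre_basis: obtains e where "basis_of sc (vb_index B) e (fibre B x)"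
  using frame_exists frame_basis by metis

lemma fibre_add: "v \<in> fibre B x ==> w \<in> fibre B x ==> v + w \<in> fibre B x"
  using fibre_basis vs.basis_of_add by metis

lemma fibre_scale: "v \<in> fibre B x ==> sc c v \<in> fibre B x"
  using fibre_basis vs.basis_of_scale by metis

lemma fibre_zero: "0 \<in> fibre B x"
  using fibre_basis vs.basis_of_zero by metis

lemma fibre_sum: "(\<And>j. j \<in> J ==> f j \<in> fibre B x) ==> (\<Sum>j\<in>J. f j) \<in> fibre B x"
  by (induction J rule: infinite_finite_induct) (auto intro: fibre_zero fibre_add)

lemma fibre_minus: "v \<in> fibre B x ==> - v \<in> fibre B x"
  using fibre_scale[of v x "-1"] by simp

lemma fibre_diff: "v \<in> fibre B x ==> w \<in> fibre B x ==> v - w \<in> fibre B x"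
  using fibre_add[OF _ fibre_minus, of v x w] by simp

lemma local_sectionI:
  assumes "\<And>y. y \<in> W ==> s y \<in> fibre B y"
    and "\<And>W' e i. (W', e) \<in> vb_frames B ==> i \<in> vb_index B ==>
      smooth_fun_on A (W \<inter> W') (\<lambda>y. coords sc (vb_index B) (\<lambda>k. e k y) (s y) i)"
  shows "local_section A sc B W s"
  using assms(1) unfolding local_section_def by (auto intro: assms(2))

lemma local_sectionD:
  assumes "local_section A sc B W s"
  shows "y \<in> W ==> s y \<in> fibre B y"
    and "(W', e) \<in> vb_frames B ==> i \<in> vb_index B ==>
      smooth_fun_on A (W \<inter> W') (\<lambda>y. coords sc (vb_index B) (\<lambda>k. e k y) (s y) i)"
  using assms unfolding local_section_def by auto

lemma local_section_cong:
  assumes "open W" "\<And>y. y \<in> W ==> s y = t y" "local_section A sc B W s"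
  shows "local_section A sc B W t"
proof (rule local_sectionI)
  show "t y \<in> fibre B y" if "y \<in> W" for y
    using local_sectionD(1)[OF assms(3) that] assms(2)[OF that] by simp
  fix W' e i assume a: "(W', e) \<in> vb_frames B" "i \<in> vb_index B"
  show "smooth_fun_on A (W \<inter> W') (\<lambda>y. coords sc (vb_index B) (\<lambda>k. e k y) (t y) i)"
    by (rule smooth_fun_on_cong[OF _ _ local_sectionD(2)[OF assms(3) a]])
      (use assms(1,2) frame_open[OF a(1)] in auto)
qed

lemma local_section_subset:
  assumes "local_section A sc B W s" "W' \<subseteq> W"
  shows "local_section A sc B W' s"
proof (rule local_sectionI)
  fix V e i assume a: "(V, e) \<in> vb_frames B" "i \<in> vb_index B"
  show "smooth_fun_on A (W' \<inter> V) (\<lambda>y. coords sc (vb_index B) (\<lambda>k. e k y) (s y) i)"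
    by (rule smooth_fun_on_subset[OF local_sectionD(2)[OF assms(1) a]]) (use assms(2) in blast)
qed (use assms local_sectionD(1)[OF assms(1)] in auto)

lemma local_section_local:
  assumes "\<And>x. x \<in> W ==> \<exists>T. open T \<and> x \<in> T \<and> local_section A sc B T s"
  shows "local_section A sc B W s"
proof (rule local_sectionI)
  show "s y \<in> fibre B y" if "y \<in> W" for y
    using assms[OF that] local_sectionD(1) by blast
  fix W' e i assume a: "(W', e) \<in> vb_frames B" "i \<in> vb_index B"
  show "smooth_fun_on A (W \<inter> W') (\<lambda>y. coords sc (vb_index B) (\<lambda>k. e k y) (s y) i)"
  proof (rule smooth_fun_on_local)
    fix x assume x: "x \<in> W \<inter> W'"
    obtain T where "open T" "x \<in> T" "local_section A sc B T s" using assms x by blast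
    then show "\<exists>T. open T \<and> x \<in> T \<and> smooth_fun_on A T (\<lambda>y. coords sc (vb_index B) (\<lambda>k. e k y) (s y) i)"
      using local_sectionD(2)[of T s, OF _ a] frame_open[OF a(1)] x by (intro exI[of _ "T \<inter> W'"]) auto
  qed
qed

lemma local_section_add:
  assumes "open W" "local_section A sc B W s" "local_section A sc B W t"
  shows "local_section A sc B W (\<lambda>y. s y + t y)"
proof (rule local_sectionI)
  show "s y + t y \<in> fibre B y" if "y \<in> W" for y
    using local_sectionD(1)[OF assms(2) that] local_sectionD(1)[OF assms(3) that] fibre_add by blast
  fix W' e i assume a: "(W', e) \<in> vb_frames B" "i \<in> vb_index B"
  have o: "open (W \<inter> W')" using assms(1) frame_open[OF a(1)] by blast
  show "smooth_fun_on A (W \<inter> W') (\<lambda>y. coords sc (vb_index B) (\<lambda>k. e k y) (s y + t y) i)"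
    by (rule smooth_fun_on_cong[OF o _ smooth_fun_on_add[OF o local_sectionD(2)[OF assms(2) a] local_sectionD(2)[OF assms(3) a]]])
      (use vs.coords_add[OF frame_basis[OF a(1)]] a(2) local_sectionD(1)[OF assms(2)] local_sectionD(1)[OF assms(3)] in auto)
qed

lemma local_section_scale:
  assumes "open W" "smooth_fun_on A W f" "local_section A sc B W s"
  shows "local_section A sc B W (\<lambda>y. sc (f y) (s y))"
proof (rule local_sectionI)
  show "sc (f y) (s y) \<in> fibre B y" if "y \<in> W" for y
    using local_sectionD(1)[OF assms(3) that] fibre_scale by blast
  fix W' e i assume a: "(W', e) \<in> vb_frames B" "i \<in> vb_index B"
  have o: "open (W \<inter> W')" using assms(1) frame_open[OF a(1)] by blast
  have f: "smooth_fun_on A (W \<inter> W') f" using smooth_fun_on_subset[OF assms(2)] by blast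
  show "smooth_fun_on A (W \<inter> W') (\<lambda>y. coords sc (vb_index B) (\<lambda>k. e k y) (sc (f y) (s y)) i)"
    by (rule smooth_fun_on_cong[OF o _ smooth_fun_on_mult[OF o f local_sectionD(2)[OF assms(3) a]]])
      (use vs.coords_scale[OF frame_basis[OF a(1)]] a(2) local_sectionD(1)[OF assms(3)] in auto)
qed

lemma local_section_frame:
  assumes "(W, e) \<in> vb_frames B" "i \<in> vb_index B"
  shows "local_section A sc B W (e i)"
proof (rule local_sectionI)
  show "e i y \<in> fibre B y" if "y \<in> W" for y
    using vs.basis_of_in[OF frame_basis[OF assms(1) that] finite_index assms(2)] .
  fix W' e' j assume a: "(W', e') \<in> vb_frames B" "j \<in> vb_index B"
  have "\<forall>c\<in>vb_frames B. \<forall>d\<in>vb_frames B. \<forall>i\<in>vb_index B. \<forall>j\<in>vb_index B.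
      smooth_fun_on A (fst c \<inter> fst d) (\<lambda>y. coords sc (vb_index B) (\<lambda>k. snd c k y) (snd d i y) j)"
    using vector_bundle by (simp add: vector_bundle_def case_prod_beta')
  from bspec[OF bspec[OF bspec[OF bspec[OF this a(1)] assms(1)] assms(2)] a(2)]
  show "smooth_fun_on A (W \<inter> W') (\<lambda>y. coords sc (vb_index B) (\<lambda>k. e' k y) (e i y) j)"
    by (simp add: Int_commute)
qed

abbreviation "\<Gamma> \<equiv> sections A sc B"

lemma sections_iff: "s \<in> \<Gamma> \<longleftrightarrow> local_section A sc B UNIV s"
  by (simp add: sections_def)

lemma sections_fibre: "s \<in> \<Gamma> ==> s y \<in> fibre B y"
  using local_sectionD(1) sections_iff by blast

lemma sections_local:
  assumes "\<And>x. \<exists>t\<in>\<Gamma>. \<forall>\<^sub>F y in nhds x. s y = t y"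
  shows "s \<in> \<Gamma>"
  unfolding sections_iff
proof (rule local_section_local)
  fix x
  obtain t where t: "t \<in> \<Gamma>" "\<forall>\<^sub>F y in nhds x. s y = t y" using assms by blast
  obtain T where T: "open T" "x \<in> T" "\<And>y. y \<in> T ==> s y = t y"
    using t(2) unfolding eventually_nhds by blast
  have "local_section A sc B T s"
    by (rule local_section_cong[OF T(1) _ local_section_subset[OF t(1)[unfolded sections_iff]]])
      (use T(3) in auto)
  then show "\<exists>T. open T \<and> x \<in> T \<and> local_section A sc B T s" using T by blast
qed

lemma sections_add: "s \<in> \<Gamma> ==> t \<in> \<Gamma> ==> (\<lambda>y. s y + t y) \<in> \<Gamma>"
  by (simp add: sections_iff local_section_add)

lemma sections_scale: "smooth_fun_on A UNIV f ==> s \<in> \<Gamma> ==> (\<lambda>y. sc (f y) (s y)) \<in> \<Gamma>"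
  by (simp add: sections_iff local_section_scale)

lemma sections_const_scale: "s \<in> \<Gamma> ==> (\<lambda>y. sc c (s y)) \<in> \<Gamma>"
  by (intro sections_scale smooth_fun_on_const) auto

lemma sections_extend:
  assumes "open W" "x \<in> W" "local_section A sc B W s"
  obtains \<eta> where "(\<lambda>y. sc (of_real (\<eta> y)) (s y)) \<in> \<Gamma>" "\<forall>\<^sub>F y in nhds x. \<eta> y = 1"
    "\<And>y. y \<notin> W ==> \<eta> y = 0"
proof -
  obtain \<eta> :: "'m => real" and K where \<eta>: "smooth_fun_on A UNIV \<eta>" "\<forall>\<^sub>F y in nhds x. \<eta> y = 1"
    "closed K" "K \<subseteq> W" "\<And>y. y \<notin> K ==> \<eta> y = 0" using bump_function[OF assms(1,2)] by metis
  have r: "smooth_fun_on A UNIV (\<lambda>y. of_real (\<eta> y) :: 'k)"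
    by (intro smooth_fun_on_linear[OF bounded_linear_of_real] \<eta>) auto
  have onW: "local_section A sc B W (\<lambda>y. sc (of_real (\<eta> y)) (s y))"
    by (rule local_section_scale[OF assms(1) smooth_fun_on_subset[OF r] assms(3)]) simp
  have zero: "local_section A sc B (- K) (\<lambda>y. 0)"
  proof (rule local_sectionI)
    fix W' e i assume a: "(W', e) \<in> vb_frames B" "i \<in> vb_index B"
    have o: "open (- K \<inter> W')" using frame_open[OF a(1)] \<eta>(3) by blast
    show "smooth_fun_on A (- K \<inter> W') (\<lambda>y. coords sc (vb_index B) (\<lambda>k. e k y) 0 i)"
      by (rule smooth_fun_on_cong[OF o _ smooth_fun_on_const[OF o, of 0]])
        (use vs.coords_eq[OF frame_basis[OF a(1)], of _ 0 "\<lambda>_. 0" i] a(2) in auto)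
  qed (rule fibre_zero)
  have offK: "local_section A sc B (- K) (\<lambda>y. sc (of_real (\<eta> y)) (s y))"
    by (rule local_section_cong[OF _ _ zero]) (use \<eta>(3,5) in auto)
  have "(\<lambda>y. sc (of_real (\<eta> y)) (s y)) \<in> \<Gamma>"
    unfolding sections_iff
  proof (rule local_section_local)
    fix y
    show "\<exists>T. open T \<and> y \<in> T \<and> local_section A sc B T (\<lambda>y. sc (of_real (\<eta> y)) (s y))"
      using onW offK assms(1) \<eta>(3,4) open_Compl by (metis ComplI subsetD)
  qed
  then show ?thesis using that \<eta>(2,4,5) by blast
qed

lemma sections_extend_germ:
  assumes "open W" "x \<in> W" "local_section A sc B W s"
  obtains t where "t \<in> \<Gamma>" "\<forall>\<^sub>F y in nhds x. t y = s y"
proof -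
  obtain \<eta> where \<eta>: "(\<lambda>y. sc (of_real (\<eta> y)) (s y)) \<in> \<Gamma>" "\<forall>\<^sub>F y in nhds x. \<eta> y = 1"
    using sections_extend[OF assms] by metis
  have "\<forall>\<^sub>F y in nhds x. sc (of_real (\<eta> y)) (s y) = s y" using \<eta>(2) by eventually_elim simp
  then show ?thesis using that \<eta>(1) by blast
qed

lemma sections_zero: "(\<lambda>_. 0) \<in> \<Gamma>"
proof (rule sections_local)
  fix x
  obtain W e where W: "(W, e) \<in> vb_frames B" "x \<in> W" using frame_exists .
  show "\<exists>t\<in>\<Gamma>. \<forall>\<^sub>F y in nhds x. 0 = t y"
  proof (cases "vb_index B = {}")
    case True
    then have "local_section A sc B UNIV (\<lambda>_. 0)"
      by (intro local_sectionI fibre_zero) auto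
    then show ?thesis unfolding sections_iff by (intro bexI[of _ "\<lambda>_. 0"]) (auto simp: sections_iff)
  next
    case False
    then obtain i where i: "i \<in> vb_index B" by blast
    obtain t where t: "t \<in> \<Gamma>"
      using sections_extend_germ[OF frame_open[OF W(1)] W(2) local_section_frame[OF W(1) i]] by blast
    have "(\<lambda>y. sc 0 (t y)) \<in> \<Gamma>" by (rule sections_const_scale[OF t])
    then show ?thesis by (intro bexI[of _ "\<lambda>y. sc 0 (t y)"]) auto
  qed
qed

lemma sections_sum: "(\<And>j. j \<in> J ==> s j \<in> \<Gamma>) ==> (\<lambda>y. \<Sum>j\<in>J. s j y) \<in> \<Gamma>"
  by (induction J rule: infinite_finite_induct) (auto intro: sections_zero sections_add)

lemma sections_minus: "s \<in> \<Gamma> ==> (\<lambda>y. - s y) \<in> \<Gamma>"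
  using sections_const_scale[of s "-1"] by simp

lemma sections_diff: "s \<in> \<Gamma> ==> t \<in> \<Gamma> ==> (\<lambda>y. s y - t y) \<in> \<Gamma>"
  using sections_add[OF _ sections_minus, of s t] by simp

lemma frame_germs:
  obtains W e f where "(W, e) \<in> vb_frames B" "x \<in> W" "\<And>i. i \<in> vb_index B ==> f i \<in> \<Gamma>"
    "\<And>i. i \<in> vb_index B ==> \<forall>\<^sub>F y in nhds x. f i y = e i y"
proof -
  obtain W e where W: "(W, e) \<in> vb_frames B" "x \<in> W" using frame_exists .
  have "\<exists>t. t \<in> \<Gamma> \<and> (\<forall>\<^sub>F y in nhds x. t y = e i y)" if "i \<in> vb_index B" for i
    using sections_extend_germ[OF frame_open[OF W(1)] W(2) local_section_frame[OF W(1) that]] by blast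
  then obtain f where "\<And>i. i \<in> vb_index B ==> f i \<in> \<Gamma> \<and> (\<forall>\<^sub>F y in nhds x. f i y = e i y)" by metis
  then show ?thesis using that W by blast
qed

lemma section_through:
  assumes "v \<in> fibre B x"
  obtains s where "s \<in> \<Gamma>" "s x = v"
proof -
  obtain W e f where f: "(W, e) \<in> vb_frames B" "x \<in> W" "\<And>i. i \<in> vb_index B ==> f i \<in> \<Gamma>"
    "\<And>i. i \<in> vb_index B ==> \<forall>\<^sub>F y in nhds x. f i y = e i y" using frame_germs[of x] by blast
  have fx: "f i x = e i x" if "i \<in> vb_index B" for i
    using at_point[OF f(4)[OF that]] .
  define c where "c = coords sc (vb_index B) (\<lambda>i. e i x) v"
  have "(\<Sum>i\<in>vb_index B. sc (c i) (f i x)) = v"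
    using vs.coords_sum[OF frame_basis[OF f(1,2)] assms] by (simp add: c_def fx cong: sum.cong)
  moreover have "(\<lambda>y. \<Sum>i\<in>vb_index B. sc (c i) (f i y)) \<in> \<Gamma>"
    by (intro sections_sum sections_const_scale f)
  ultimately show ?thesis using that[of "\<lambda>y. \<Sum>i\<in>vb_index B. sc (c i) (f i y)"] by simp
qed

text \<open>The matrix of an arbitrary smooth frame with respect to one of the frames that define the bundle
  has a smooth inverse near the point; hence coordinates with respect to it are smooth.\<close>

lemma frame_expansion:
  assumes I: "finite I" "card I = card (vb_index B)" and \<psi>: "\<And>i. i \<in> I ==> \<psi> i \<in> \<Gamma>"
    and ind: "\<And>c. (\<Sum>i\<in>I. sc (c i) (\<psi> i x)) = 0 ==> \<forall>i\<in>I. c i = 0" and s: "s \<in> \<Gamma>"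
  obtains c where "\<And>i. i \<in> I ==> smooth_fun_on A UNIV (c i)"
    "\<forall>\<^sub>F y in nhds x. s y = (\<Sum>i\<in>I. sc (c i y) (\<psi> i y))"
proof -
  obtain W e where W: "(W, e) \<in> vb_frames B" "x \<in> W" using frame_exists .
  have oW: "open W" by (rule frame_open[OF W(1)])
  let ?K = "vb_index B"
  let ?co = "\<lambda>t y k. coords sc ?K (\<lambda>k. e k y) (t y) k"
  have co: "\<exists>a. smooth_fun_on A UNIV a \<and> (\<forall>\<^sub>F y in nhds x. a y = ?co t y k)"
    if "t \<in> \<Gamma>" "k \<in> ?K" for t k
  proof -
    have "smooth_fun_on A (UNIV \<inter> W) (\<lambda>y. ?co t y k)"
      using that(1) unfolding sections_iff by (rule local_sectionD(2)[OF _ W(1) that(2)])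
    then have "smooth_fun_on A W (\<lambda>y. ?co t y k)" by simp
    from smooth_germ_extends[OF oW W(2) this] show ?thesis by blast
  qed
  define a where "a i k = (SOME a. smooth_fun_on A UNIV a \<and> (\<forall>\<^sub>F y in nhds x. a y = ?co (\<psi> i) y k))" for i k
  have a: "smooth_fun_on A UNIV (a i k)"
    and aW: "\<forall>\<^sub>F y in nhds x. a i k y = ?co (\<psi> i) y k" if "i \<in> I" "k \<in> ?K" for i k
    using someI_ex[OF co[OF \<psi>[OF that(1)] that(2)]] by (simp_all add: a_def)
  obtain d where d: "\<And>k. k \<in> ?K ==> smooth_fun_on A UNIV (d k)"
    and dW: "\<And>k. k \<in> ?K ==> \<forall>\<^sub>F y in nhds x. d k y = ?co s y k"
    using co[OF s] by metis
  have exp: "(\<Sum>k\<in>?K. sc (?co t y k) (e k y)) = t y" if "y \<in> W" "t \<in> \<Gamma>" for t y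
    by (rule vs.coords_sum[OF frame_basis[OF W(1) that(1)] sections_fibre[OF that(2)]])
  have ax: "a i k x = ?co (\<psi> i) x k" if "i \<in> I" "k \<in> ?K" for i k
    using at_point[OF aW[OF that]] .
  have indx: "\<forall>i\<in>I. c i = 0" if c: "\<And>k. k \<in> ?K ==> (\<Sum>i\<in>I. c i * a i k x) = 0" for c
  proof (rule ind)
    have "(\<Sum>i\<in>I. sc (c i) (\<psi> i x)) = (\<Sum>i\<in>I. \<Sum>k\<in>?K. sc (c i * a i k x) (e k x))"
    proof (rule sum.cong, rule refl)
      fix i assume i: "i \<in> I"
      have "sc (c i) (\<psi> i x) = sc (c i) (\<Sum>k\<in>?K. sc (a i k x) (e k x))"
        using exp[OF W(2) \<psi>[OF i]] ax[OF i] by simp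
      then show "sc (c i) (\<psi> i x) = (\<Sum>k\<in>?K. sc (c i * a i k x) (e k x))"
        by (simp add: vs.scale_sum_right)
    qed
    also have "... = (\<Sum>k\<in>?K. sc (\<Sum>i\<in>I. c i * a i k x) (e k x))"
      by (subst sum.swap) (simp add: vs.scale_sum_left)
    also have "... = 0" using c by simp
    finally show "(\<Sum>i\<in>I. sc (c i) (\<psi> i x)) = 0" .
  qed
  let ?R = "{f. smooth_fun_on A UNIV f} :: ('m => 'k) set"
  have "\<exists>b. (\<forall>k\<in>?K. \<forall>i\<in>I. b k i \<in> ?R) \<and> (\<forall>k\<in>?K. \<forall>k'\<in>?K. \<forall>\<^sub>F y in nhds x.
      (\<Sum>i\<in>I. b k i y * a i k' y) = (if k = k' then 1 else 0))"
  proof (rule germ_matrix_left_inverse[of ?R x "nhds x"])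
    show "\<exists>g\<in>?R. \<forall>\<^sub>F y in nhds x. g y * f y = 1" if "f \<in> ?R" "f x \<noteq> 0" for f
      using smooth_germ_inverse[of f x] that by blast
  qed (use I finite_index a indx in \<open>auto intro: smooth_fun_on_const smooth_fun_on_add smooth_fun_on_mult
      dest: at_point\<close>)
  then obtain b where b: "\<And>k i. k \<in> ?K ==> i \<in> I ==> smooth_fun_on A UNIV (b k i)"
    and bW: "\<And>k k'. k \<in> ?K ==> k' \<in> ?K ==> \<forall>\<^sub>F y in nhds x.
      (\<Sum>i\<in>I. b k i y * a i k' y) = (if k = k' then 1 else 0)"
    by blast
  define c where "c i y = (\<Sum>k\<in>?K. d k y * b k i y)" for i y
  have "\<forall>\<^sub>F y in nhds x. y \<in> W \<and> (\<forall>k\<in>?K. d k y = ?co s y k) \<and> (\<forall>i\<in>I. \<forall>k\<in>?K. a i k y = ?co (\<psi> i) y k)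
      \<and> (\<forall>k\<in>?K. \<forall>k'\<in>?K. (\<Sum>i\<in>I. b k i y * a i k' y) = (if k = k' then 1 else 0))"
    using aW dW bW finite_index I(1) eventually_nhds_in_open[OF oW W(2)]
    by (intro eventually_conj eventually_ball_finite ballI) auto
  then have "\<forall>\<^sub>F y in nhds x. s y = (\<Sum>i\<in>I. sc (c i y) (\<psi> i y))"
  proof eventually_elim
    case (elim y)
    then have y: "y \<in> W" by blast
    have "(\<Sum>i\<in>I. sc (c i y) (\<psi> i y)) = (\<Sum>i\<in>I. sc (c i y) (\<Sum>k'\<in>?K. sc (a i k' y) (e k' y)))"
      using exp[OF y \<psi>] elim by (intro sum.cong) (auto cong: sum.cong)
    also have "... = (\<Sum>k'\<in>?K. sc (\<Sum>i\<in>I. c i y * a i k' y) (e k' y))"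
      unfolding vs.scale_sum_right vs.scale_sum_left by (subst sum.swap) simp
    also have "... = (\<Sum>k'\<in>?K. sc (d k' y) (e k' y))"
    proof (rule sum.cong, rule refl)
      fix k' assume k': "k' \<in> ?K"
      have "(\<Sum>i\<in>I. c i y * a i k' y) = (\<Sum>k\<in>?K. d k y * (\<Sum>i\<in>I. b k i y * a i k' y))"
        unfolding c_def sum_distrib_right sum_distrib_left by (subst sum.swap) (simp add: mult.assoc)
      also have "... = (\<Sum>k\<in>?K. if k = k' then d k y else 0)"
        using elim k' by (intro sum.cong) auto
      also have "... = d k' y" using k' finite_index by simp
      finally show "sc (\<Sum>i\<in>I. c i y * a i k' y) (e k' y) = sc (d k' y) (e k' y)" by simp
    qed
    also have "... = s y" using exp[OF y s] elim by (simp cong: sum.cong)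
    finally show ?case by simp
  qed
  moreover have "smooth_fun_on A UNIV (c i)" if "i \<in> I" for i
    unfolding c_def[abs_def] using that by (intro smooth_fun_on_sum smooth_fun_on_mult b d) auto
  ultimately show ?thesis using that by blast
qed

lemma independent_basis_of:
  assumes I: "finite I" "card I = card (vb_index B)" and b: "\<And>i. i \<in> I ==> b i \<in> fibre B x"
    and ind: "\<And>c. (\<Sum>i\<in>I. sc (c i) (b i)) = 0 ==> \<forall>i\<in>I. c i = 0"
  shows "basis_of sc I b (fibre B x)"
proof -
  have "\<exists>s. s \<in> \<Gamma> \<and> s x = b i" if "i \<in> I" for i using section_through[OF b[OF that]] by blast
  then obtain \<psi> where \<psi>: "\<And>i. i \<in> I ==> \<psi> i \<in> \<Gamma>" "\<And>i. i \<in> I ==> \<psi> i x = b i" by metis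
  have ind': "\<forall>i\<in>I. c i = 0" if "(\<Sum>i\<in>I. sc (c i) (\<psi> i x)) = 0" for c
    using that \<psi>(2) by (intro ind) (simp cong: sum.cong)
  have "v \<in> range (\<lambda>c. \<Sum>i\<in>I. sc (c i) (b i))" if v: "v \<in> fibre B x" for v
  proof -
    obtain s where s: "s \<in> \<Gamma>" "s x = v" using section_through[OF v] .
    obtain c where "\<forall>\<^sub>F y in nhds x. s y = (\<Sum>i\<in>I. sc (c i y) (\<psi> i y))"
      using frame_expansion[where \<psi> = \<psi> and x = x, OF I \<psi>(1) ind' s(1)] by blast
    from at_point[OF this] have "v = (\<Sum>i\<in>I. sc (c i x) (b i))"
      using s(2) \<psi>(2) by (simp cong: sum.cong)
    then show ?thesis by (intro image_eqI[of _ _ "\<lambda>i. c i x"]) auto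
  qed
  moreover have "(\<Sum>i\<in>I. sc (c i) (b i)) \<in> fibre B x" for c
    by (intro fibre_sum fibre_scale b)
  ultimately show ?thesis
    unfolding basis_of_def using ind by (intro conjI set_eqI iffI allI impI) auto
qed

lemma frame_coords_smooth:
  assumes I: "finite I" "card I = card (vb_index B)" and \<psi>: "\<And>i. i \<in> I ==> \<psi> i \<in> \<Gamma>"
    and basis: "\<forall>\<^sub>F y in nhds x. basis_of sc I (\<lambda>i. \<psi> i y) (fibre B y)" and s: "s \<in> \<Gamma>" and "i \<in> I"
  obtains c where "smooth_fun_on A UNIV c" "\<forall>\<^sub>F y in nhds x. coords sc I (\<lambda>i. \<psi> i y) (s y) i = c y"
proof -
  have ind: "\<forall>i\<in>I. c i = 0" if "(\<Sum>i\<in>I. sc (c i) (\<psi> i x)) = 0" for c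
    using at_point[OF basis] that unfolding basis_of_def by blast
  obtain c where c: "\<And>i. i \<in> I ==> smooth_fun_on A UNIV (c i)"
    "\<forall>\<^sub>F y in nhds x. s y = (\<Sum>i\<in>I. sc (c i y) (\<psi> i y))"
    using frame_expansion[where \<psi> = \<psi> and x = x, OF I \<psi> ind s] by blast
  have "\<forall>\<^sub>F y in nhds x. coords sc I (\<lambda>i. \<psi> i y) (s y) i = c i y"
    using basis c(2) by eventually_elim (rule vs.coords_eq, use assms(6) in auto)
  then show ?thesis using that c(1) assms(6) by blast
qed

end

subsection \<open>Pullbacks\<close>

locale smooth_mapping =
  M: smooth_manifold A + M': smooth_manifold A'
  for A :: "('m::{t2_space, second_countable_topology}, 'b::{real_inner, heine_borel}) atlas"
    and A' :: "('m'::{t2_space, second_countable_topology}, 'b'::{real_inner, heine_borel}) atlas" +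
  fixes \<tau> :: "'m' => 'm"
  assumes smooth_map: "smooth_map A' A \<tau>"
begin

lemma open_vimage_map: "open W ==> open (\<tau> -` W)"
  using smooth_map open_vimage by (auto simp: smooth_map_def)

lemma eventually_pullback: "\<forall>\<^sub>F y in nhds (\<tau> x). P y ==> \<forall>\<^sub>F y in nhds x. P (\<tau> y)"
  unfolding eventually_nhds using open_vimage_map by (metis vimage_eq)

lemma smooth_fun_pullback: "open W ==> smooth_fun_on A W f ==> smooth_fun_on A' (\<tau> -` W) (f \<circ> \<tau>)"
  by (rule smooth_fun_on_pullback[OF M.manifold M'.manifold smooth_map])

lemma local_section_pullback:
  assumes "vector_bundle A sc B" "open W" "local_section A sc B W s"
  shows "local_section A' sc (pullback_bundle \<tau> B) (\<tau> -` W) (s \<circ> \<tau>)"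
proof -
  interpret B: smooth_bundle A sc B by unfold_locales (rule assms(1))
  have *: "smooth_fun_on A' (\<tau> -` W \<inter> \<tau> -` W') (\<lambda>y. coords sc (vb_index B) (\<lambda>k. e k (\<tau> y)) (s (\<tau> y)) i)"
    if a: "(W', e) \<in> vb_frames B" "i \<in> vb_index B" for W' e i
    using smooth_fun_pullback[OF _ B.local_sectionD(2)[OF assms(3) a]] assms(2) B.frame_open[OF a(1)]
    by (simp add: o_def open_Int)
  show ?thesis
    unfolding local_section_def pullback_bundle_def
    by (auto simp: B.local_sectionD(1)[OF assms(3)] intro!: *)
qed

lemma sections_pullback:
  "vector_bundle A sc B ==> s \<in> sections A sc B ==> s \<circ> \<tau> \<in> sections A' sc (pullback_bundle \<tau> B)"
  using local_section_pullback[of sc B UNIV s] by (simp add: sections_def)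

lemma vector_bundle_pullback:
  assumes "vector_bundle A sc B"
  shows "vector_bundle A' sc (pullback_bundle \<tau> B)"
proof -
  interpret B: smooth_bundle A sc B by unfold_locales (rule assms(1))
  have *: "smooth_fun_on A' (\<tau> -` W \<inter> \<tau> -` W') (\<lambda>y. coords sc (vb_index B) (\<lambda>k. e k (\<tau> y)) (e' i (\<tau> y)) j)"
    if a: "(W, e) \<in> vb_frames B" "(W', e') \<in> vb_frames B" "i \<in> vb_index B" "j \<in> vb_index B" for W W' e e' i j
    using smooth_fun_pullback[OF _ B.local_sectionD(2)[OF B.local_section_frame[OF a(2,3)] a(1,4)]]
      B.frame_open[OF a(1)] B.frame_open[OF a(2)]
    by (simp add: o_def open_Int Int_commute)
  have "(\<Union>(W, e)\<in>vb_frames (pullback_bundle \<tau> B). W) = UNIV"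
  proof -
    have "x \<in> (\<Union>(W, e)\<in>vb_frames (pullback_bundle \<tau> B). W)" for x
    proof -
      obtain W e where "(W, e) \<in> vb_frames B" "\<tau> x \<in> W" using B.frame_exists .
      then show ?thesis by (force simp: pullback_bundle_def)
    qed
    then show ?thesis by blast
  qed
  then show ?thesis
    unfolding vector_bundle_def
    using B.finite_index B.vs.vector_space_axioms B.frame_basis B.frame_open
    by (auto simp: pullback_bundle_def open_vimage_map intro!: *)
qed

end

section \<open>Courant algebroids and orthonormal frames\<close>

lemma independent_family:
  fixes e :: "'i => 'v::real_vector"
  assumes "finite I" "\<And>c. (\<Sum>i\<in>I. c i *\<^sub>R e i) = 0 ==> \<forall>i\<in>I. c i = 0"
  shows "inj_on e I" "independent (e ` I)"
proof -
  show inj: "inj_on e I"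
  proof (rule inj_onI, rule ccontr)
    fix i j assume ij: "i \<in> I" "j \<in> I" "e i = e j" "i \<noteq> j"
    have "(\<Sum>k\<in>I. ((if k = i then 1 else 0) - (if k = j then 1 else 0)) *\<^sub>R e k)
        = (\<Sum>k\<in>I. if k = i then e k else 0) - (\<Sum>k\<in>I. if k = j then e k else 0)"
      unfolding sum_subtractf[symmetric] by (intro sum.cong) (auto simp: scaleR_left_diff_distrib)
    also have "... = 0" using ij assms(1) by simp
    finally show False using assms(2)[of "\<lambda>k. (if k = i then 1 else 0) - (if k = j then 1 else 0)"] ij by force
  qed
  show "independent (e ` I)"
    unfolding independent_explicit_finite_subsets
  proof (intro allI impI ballI)
    fix S u v assume S: "S \<subseteq> e ` I" "finite S" "(\<Sum>v\<in>S. u v *\<^sub>R v) = 0" "v \<in> S"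
    define c where "c i = (if e i \<in> S then u (e i) else 0)" for i
    have "(\<Sum>i\<in>I. c i *\<^sub>R e i) = (\<Sum>v\<in>e ` I. (if v \<in> S then u v else 0) *\<^sub>R v)"
      unfolding sum.reindex[OF inj] by (simp add: c_def)
    also have "... = (\<Sum>v\<in>S. u v *\<^sub>R v)"
      using S(1) assms(1) by (intro sum.mono_neutral_cong_right) auto
    finally have "\<forall>i\<in>I. c i = 0" using assms(2)[of c] S(3) by simp
    moreover obtain i where "i \<in> I" "v = e i" using S(1,4) by blast
    ultimately show "u v = 0" using S(4) by (force simp: c_def)
  qed
qed

lemma basis_of_real:
  fixes e :: "'i => 'v::real_vector"
  assumes "finite I" "basis_of scaleR I e V"
  shows "inj_on e I" "independent (e ` I)" "span (e ` I) = V"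
proof -
  show inj: "inj_on e I" and "independent (e ` I)"
    using independent_family[OF assms(1)] assms(2) unfolding basis_of_def by blast+
  have "span (e ` I) = range (\<lambda>u. \<Sum>v\<in>e ` I. u v *\<^sub>R v)"
    by (simp add: span_finite assms(1))
  also have "... = range (\<lambda>c. \<Sum>i\<in>I. c i *\<^sub>R e i)"
  proof (intro equalityI subsetI; clarify)
    show "(\<Sum>v\<in>e ` I. u v *\<^sub>R v) \<in> range (\<lambda>c. \<Sum>i\<in>I. c i *\<^sub>R e i)" for u
      unfolding sum.reindex[OF inj] by (auto intro!: image_eqI[of _ _ "\<lambda>i. u (e i)"])
    show "(\<Sum>i\<in>I. c i *\<^sub>R e i) \<in> range (\<lambda>u. \<Sum>v\<in>e ` I. u v *\<^sub>R v)" for c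
      unfolding sum.reindex[OF inj]
      by (rule image_eqI[of _ _ "\<lambda>v. c (inv_into I e v)"]) (simp_all add: inj inv_into_f_f)
  qed
  finally show "span (e ` I) = V" using assms(2) by (simp add: basis_of_def)
qed

lemma basis_of_card_le:
  fixes e :: "'i => 'v::real_vector" and b :: "'j => 'v"
  assumes "finite I" "basis_of scaleR I e V" "finite J" "V \<subseteq> span (b ` J)"
  shows "card I \<le> card J"
proof -
  have "e ` I \<subseteq> span (b ` J)"
    using basis_of_real(3)[OF assms(1,2)] assms(4) span_superset[of "e ` I"] by simp
  then have "card (e ` I) \<le> card (b ` J)"
    using independent_span_bound[OF _ basis_of_real(2)[OF assms(1,2)], of "b ` J"] assms(3) by simp
  then show ?thesis
    using card_image[OF basis_of_real(1)[OF assms(1,2)]] card_image_le[OF assms(3), of b] by simp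
qed

lemma basis_of_independent:
  fixes e :: "'i => 'v::real_vector" and b :: "'i => 'v"
  assumes "finite I" "basis_of scaleR I e V" "\<And>i. i \<in> I ==> b i \<in> V"
    and "\<And>c. (\<Sum>i\<in>I. c i *\<^sub>R b i) = 0 ==> \<forall>i\<in>I. c i = 0"
  shows "basis_of scaleR I b V"
proof -
  have inj: "inj_on b I" and ind: "independent (b ` I)"
    using independent_family[OF assms(1,4)] by blast+
  have sub: "span (b ` I) \<subseteq> V"
    unfolding basis_of_real(3)[OF assms(1,2), symmetric]
    using assms(3) basis_of_real(3)[OF assms(1,2)] by (intro span_minimal subspace_span) auto
  have "V \<subseteq> span (b ` I)"
  proof (rule subsetI, rule ccontr)
    fix v assume v: "v \<in> V" "v \<notin> span (b ` I)"
    then have "independent (insert v (b ` I))" by (simp add: ind independent_insertI)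
    moreover have "insert v (b ` I) \<subseteq> span (e ` I)"
      using v assms(3) basis_of_real(3)[OF assms(1,2)] by auto
    ultimately have "card (insert v (b ` I)) \<le> card (e ` I)"
      using independent_span_bound[of "e ` I"] assms(1) by blast
    moreover have "v \<notin> b ` I" using v(2) span_base by metis
    ultimately show False
      using assms(1) card_image[OF inj] card_image[OF basis_of_real(1)[OF assms(1,2)]] by simp
  qed
  then have V: "V = span (b ` I)" using sub by blast
  have "range (\<lambda>c. \<Sum>i\<in>I. c i *\<^sub>R b i) = span (b ` I)"
    using basis_of_real(3)[OF assms(1), of b] assms(4) unfolding basis_of_def by blast
  then show ?thesis unfolding basis_of_def V using assms(4) by blast
qed

locale courant_alg = smooth_manifold A
  for A :: "('m::{t2_space, second_countable_topology}, 'b::{real_inner, heine_borel}) atlas" +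
  fixes E :: "('m, 'v::real_vector) courant"
  assumes courant: "courant_algebroid A E"
begin

abbreviation "r \<equiv> crank E"

lemma index: "vb_index (cbundle E) = {..<r}"
  using courant by (simp add: courant_algebroid_def)

sublocale vb: smooth_bundle A "scaleR :: real => 'v => 'v" "cbundle E"
  by unfold_locales (use courant in \<open>simp add: courant_algebroid_def\<close>)

lemma C_inf_const: "(\<lambda>_. c) \<in> C_inf A"
  and C_inf_add: "f \<in> C_inf A ==> g \<in> C_inf A ==> (\<lambda>y. f y + g y) \<in> C_inf A"
  and C_inf_mult: "f \<in> C_inf A ==> g \<in> C_inf A ==> (\<lambda>y. f y * g y) \<in> C_inf A"
  and C_inf_minus: "f \<in> C_inf A ==> (\<lambda>y. - f y) \<in> C_inf A"
  and C_inf_sum: "(\<And>i. i \<in> I ==> h i \<in> C_inf A) ==> (\<lambda>y. \<Sum>i\<in>I. h i y) \<in> C_inf A"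
  by (simp_all add: C_inf_iff smooth_fun_on_const smooth_fun_on_add smooth_fun_on_mult 
      smooth_fun_on_minus smooth_fun_on_sum)

lemmas sec_fib = vb.sections_fibre and sec_add = vb.sections_add and sec_zero = vb.sections_zero
  and sec_const_scale = vb.sections_const_scale and sec_sum = vb.sections_sum
  and sec_diff = vb.sections_diff

lemma sec_scale: "f \<in> C_inf A ==> s \<in> Gam A E ==> (\<lambda>y. f y *\<^sub>R s y) \<in> Gam A E"
  by (simp add: C_inf_iff vb.sections_scale)

lemmas fib_add = vb.fibre_add and fib_scale = vb.fibre_scale and fib_zero = vb.fibre_zero
  and fib_sum = vb.fibre_sum and fib_minus = vb.fibre_minus and fib_diff = vb.fibre_diff

subsection \<open>The metric\<close>

lemma metric: "fibre_metric A E"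
  using courant by (simp add: courant_algebroid_def)

lemma ip_sym: "u \<in> fib E x ==> v \<in> fib E x ==> ip E x u v = ip E x v u"
  and ip_add_left: "u \<in> fib E x ==> v \<in> fib E x ==> w \<in> fib E x ==>
    ip E x (u + v) w = ip E x u w + ip E x v w"
  and ip_scale_left: "u \<in> fib E x ==> v \<in> fib E x ==> ip E x (c *\<^sub>R u) v = c * ip E x u v"
  and ip_nondeg: "u \<in> fib E x ==> (\<And>v. v \<in> fib E x ==> ip E x u v = 0) ==> u = 0"
  and ip_C_inf: "s \<in> Gam A E ==> t \<in> Gam A E ==> (\<lambda>x. ip E x (s x) (t x)) \<in> C_inf A"
  using metric unfolding fibre_metric_def by blast+

lemma ip_add_right: "u \<in> fib E x ==> v \<in> fib E x ==> w \<in> fib E x ==>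
    ip E x u (v + w) = ip E x u v + ip E x u w"
  by (metis fib_add ip_add_left ip_sym)

lemma ip_scale_right: "u \<in> fib E x ==> v \<in> fib E x ==> ip E x u (c *\<^sub>R v) = c * ip E x u v"
  by (metis fib_scale ip_scale_left ip_sym)

lemma ip_zero_left: "u \<in> fib E x ==> ip E x 0 u = 0"
  using ip_scale_left[of u x u 0] by simp

lemma ip_zero_right: "u \<in> fib E x ==> ip E x u 0 = 0"
  using ip_scale_right[of u x u 0] by simp

lemma ip_minus_left: "u \<in> fib E x ==> v \<in> fib E x ==> ip E x (- u) v = - ip E x u v"
  using ip_scale_left[of u x v "-1"] by simp

lemma ip_diff_left: "u \<in> fib E x ==> v \<in> fib E x ==> w \<in> fib E x ==>
    ip E x (u - v) w = ip E x u w - ip E x v w"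
  using ip_add_left[OF _ fib_minus, of u x v w] ip_minus_left[of v x w] by simp

lemma ip_diff_right: "u \<in> fib E x ==> v \<in> fib E x ==> w \<in> fib E x ==>
    ip E x u (v - w) = ip E x u v - ip E x u w"
  by (metis fib_diff ip_diff_left ip_sym)

lemma ip_sum_left: "(\<And>i. i \<in> I ==> u i \<in> fib E x) ==> w \<in> fib E x ==>
    ip E x (\<Sum>i\<in>I. u i) w = (\<Sum>i\<in>I. ip E x (u i) w)"
  by (induction I rule: infinite_finite_induct) (auto simp: ip_zero_left ip_add_left fib_sum)

lemma ip_sum_right: "(\<And>i. i \<in> I ==> u i \<in> fib E x) ==> w \<in> fib E x ==>
    ip E x w (\<Sum>i\<in>I. u i) = (\<Sum>i\<in>I. ip E x w (u i))"
  by (induction I rule: infinite_finite_induct) (auto simp: ip_zero_right ip_add_right fib_sum)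

subsection \<open>Orthonormal families\<close>

definition orthonormal :: "nat => 'm => (nat => real) => (nat => 'v) => bool" where
  "orthonormal k x \<mu> b \<longleftrightarrow> (\<forall>i<k. b i \<in> fib E x \<and> (\<mu> i = 1 \<or> \<mu> i = -1)) \<and>
    (\<forall>i<k. \<forall>j<k. ip E x (b i) (b j) = (if i = j then \<mu> i else 0))"

lemma orthonormal_fib: "orthonormal k x \<mu> b ==> i < k ==> b i \<in> fib E x"
  and orthonormal_sign: "orthonormal k x \<mu> b ==> i < k ==> \<mu> i * \<mu> i = 1"
  and orthonormal_ip: "orthonormal k x \<mu> b ==> i < k ==> j < k ==>
    ip E x (b i) (b j) = (if i = j then \<mu> i else 0)"
  by (auto simp: orthonormal_def)

lemma orthonormal_ip_sum:
  assumes "orthonormal k x \<mu> b" "j < k" "I \<subseteq> {..<k}"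
  shows "ip E x (\<Sum>i\<in>I. c i *\<^sub>R b i) (b j) = (if j \<in> I then \<mu> j * c j else 0)"
proof -
  have I: "i < k" if "i \<in> I" for i using assms(3) that by blast
  have fin: "finite I" using assms(3) finite_subset by blast
  have "ip E x (\<Sum>i\<in>I. c i *\<^sub>R b i) (b j) = (\<Sum>i\<in>I. c i * ip E x (b i) (b j))"
    using orthonormal_fib[OF assms(1)] assms(2) I
    by (subst ip_sum_left) (auto intro!: fib_scale sum.cong ip_scale_left)
  also have "... = (\<Sum>i\<in>I. if i = j then \<mu> j * c j else 0)"
    using orthonormal_ip[OF assms(1)] assms(2) I by (intro sum.cong) auto
  finally show ?thesis using fin by simp
qed

lemma orthonormal_independent:
  assumes "orthonormal k x \<mu> b" "I \<subseteq> {..<k}" "(\<Sum>i\<in>I. c i *\<^sub>R b i) = 0"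
  shows "\<forall>i\<in>I. c i = 0"
proof
  fix j assume j: "j \<in> I"
  then have jk: "j < k" using assms(2) by blast
  have "\<mu> j * c j = 0"
    using orthonormal_ip_sum[OF assms(1) jk assms(2), of c] assms(3) j
      ip_zero_left[OF orthonormal_fib[OF assms(1) jk]] by simp
  then show "c j = 0" using orthonormal_sign[OF assms(1) jk] by auto
qed

lemma orthonormal_basis:
  assumes "orthonormal r x \<mu> b"
  shows "basis_of scaleR {..<r} b (fib E x)"
  by (rule vb.independent_basis_of)
    (use orthonormal_fib[OF assms] orthonormal_independent[OF assms] index in auto)

lemma orthonormal_expand:
  assumes "orthonormal r x \<mu> b" "v \<in> fib E x"
  shows "v = (\<Sum>i<r. (\<mu> i * ip E x v (b i)) *\<^sub>R b i)"
proof -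
  obtain c where c: "v = (\<Sum>i<r. c i *\<^sub>R b i)"
    using orthonormal_basis[OF assms(1)] assms(2) unfolding basis_of_def by blast
  have "\<mu> i * ip E x v (b i) = c i" if "i < r" for i
    using orthonormal_ip_sum[OF assms(1) that, of "{..<r}" c] orthonormal_sign[OF assms(1) that] that
    by (simp add: c flip: mult.assoc)
  then show ?thesis using c by simp
qed

lemma orthonormal_parseval:
  assumes "orthonormal r x \<mu> b" "v \<in> fib E x" "w \<in> fib E x"
  shows "ip E x v w = (\<Sum>i<r. \<mu> i * ip E x v (b i) * ip E x w (b i))"
proof -
  have "ip E x v w = ip E x (\<Sum>i<r. (\<mu> i * ip E x v (b i)) *\<^sub>R b i) w"
    using orthonormal_expand[OF assms(1,2)] by simp
  also have "... = (\<Sum>i<r. \<mu> i * ip E x v (b i) * ip E x w (b i))"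
    using orthonormal_fib[OF assms(1)] assms(3)
    by (subst ip_sum_left) (auto intro!: fib_scale sum.cong simp: ip_scale_left ip_sym)
  finally show ?thesis .
qed

lemma orthogonal_part:
  assumes "orthonormal k x \<mu> b" "w \<in> fib E x" "j < k"
  shows "ip E x (w - (\<Sum>i<k. (\<mu> i * ip E x w (b i)) *\<^sub>R b i)) (b j) = 0"
proof -
  have "(\<Sum>i<k. (\<mu> i * ip E x w (b i)) *\<^sub>R b i) \<in> fib E x"
    using orthonormal_fib[OF assms(1)] by (auto intro!: fib_sum fib_scale)
  then show ?thesis
    using orthonormal_ip_sum[OF assms(1,3), of "{..<k}"] orthonormal_sign[OF assms(1,3)]
      orthonormal_fib[OF assms(1,3)] assms(2,3)
    by (simp add: ip_diff_left flip: mult.assoc)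
qed

subsection \<open>Generalized pseudometrics\<close>

lemma pseudometric_fib: "gen_pseudometric A E N U ==> v \<in> U x ==> v \<in> fib E x"
  by (auto simp: gen_pseudometric_def)

lemma pseudometric_nondeg:
  "gen_pseudometric A E N U ==> u \<in> U x ==> (\<And>v. v \<in> U x ==> ip E x u v = 0) ==> u = 0"
  by (simp add: gen_pseudometric_def)

lemma pseudometric_frame:
  assumes "gen_pseudometric A E N U"
  obtains W e where "open W" "x \<in> W"
    "\<And>i. i < N ==> local_section A (scaleR :: real => 'v => 'v) (cbundle E) W (e i)"
    "\<And>y. y \<in> W ==> basis_of scaleR {..<N} (\<lambda>i. e i y) (U y)"
proof -
  have "\<exists>W e. open W \<and> x \<in> W \<and>
      (\<forall>i<N. local_section A (scaleR :: real => 'v => 'v) (cbundle E) W (e i)) \<and>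
      (\<forall>y\<in>W. basis_of scaleR {..<N} (\<lambda>i. e i y) (U y))"
    using assms by (simp add: gen_pseudometric_def)
  then obtain W e where "open W" "x \<in> W"
      "\<forall>i<N. local_section A (scaleR :: real => 'v => 'v) (cbundle E) W (e i)"
      "\<forall>y\<in>W. basis_of scaleR {..<N} (\<lambda>i. e i y) (U y)" by (elim exE conjE)
  then show ?thesis by (intro that[of W e]) auto
qed

lemma pseudometric_basis:
  assumes "gen_pseudometric A E N U"
  obtains e where "basis_of scaleR {..<N} e (U x)"
proof (rule pseudometric_frame[OF assms, of x])
  fix W e assume "x \<in> W" "\<And>y. y \<in> W ==> basis_of scaleR {..<N} (\<lambda>i. e i y) (U y)"
  then show thesis by (intro that)
qed

lemma pseudometric_add: "gen_pseudometric A E N U ==> u \<in> U x ==> v \<in> U x ==> u + v \<in> U x"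
  using pseudometric_basis[of N U x] real_vector.basis_of_add by metis

lemma pseudometric_scale: "gen_pseudometric A E N U ==> u \<in> U x ==> c *\<^sub>R u \<in> U x"
  using pseudometric_basis[of N U x] real_vector.basis_of_scale by metis

lemma pseudometric_zero: "gen_pseudometric A E N U ==> 0 \<in> U x"
  using pseudometric_basis[of N U x] real_vector.basis_of_zero by metis

lemma pseudometric_sum:
  "gen_pseudometric A E N U ==> (\<And>i. i \<in> I ==> f i \<in> U x) ==> (\<Sum>i\<in>I. f i) \<in> U x"
  by (induction I rule: infinite_finite_induct) (auto intro: pseudometric_zero pseudometric_add)

lemma pseudometric_diff: "gen_pseudometric A E N U ==> u \<in> U x ==> v \<in> U x ==> u - v \<in> U x"
  using pseudometric_add[of N U u x "- 1 *\<^sub>R v"] pseudometric_scale[of N U v x "-1"] by simp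

lemma pseudometric_rank_le: "gen_pseudometric A E N U ==> N \<le> r"
proof -
  assume U: "gen_pseudometric A E N U"
  obtain e where e: "basis_of scaleR {..<N} e (U undefined)" using pseudometric_basis[OF U] .
  obtain f where f: "basis_of scaleR {..<r} f (fib E undefined)"
    using vb.fibre_basis[of undefined] index by metis
  have "U undefined \<subseteq> span (f ` {..<r})"
    using pseudometric_fib[OF U] basis_of_real(3)[OF _ f] by auto
  then show "N \<le> r" using basis_of_card_le[OF _ e, of "{..<r}" f] by simp
qed

lemma pseudometric_total: "gen_pseudometric A E r (fib E)"
  unfolding gen_pseudometric_def
proof (intro conjI allI ballI impI)
  fix x
  obtain W e where W: "(W, e) \<in> vb_frames (cbundle E)" "x \<in> W" using vb.frame_exists .
  show "\<exists>W e. open W \<and> x \<in> W \<and>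
      (\<forall>i<r. local_section A (scaleR :: real => 'v => 'v) (cbundle E) W (e i)) \<and>
      (\<forall>y\<in>W. basis_of scaleR {..<r} (\<lambda>i. e i y) (fib E y))"
    using vb.frame_open[OF W(1)] W vb.local_section_frame[OF W(1)] vb.frame_basis[OF W(1)] index
    by (intro exI[of _ W] exI[of _ e]) auto
qed (use ip_nondeg in auto)

lemma sub_section_through:
  assumes U: "gen_pseudometric A E N U" and v: "v \<in> U x"
  obtains s where "s \<in> sub_sections A E U" "s x = v"
proof -
  obtain W e where W: "open W" "x \<in> W"
    and e: "\<And>i. i < N ==> local_section A (scaleR :: real => 'v => 'v) (cbundle E) W (e i)"
    and basis: "\<And>y. y \<in> W ==> basis_of scaleR {..<N} (\<lambda>i. e i y) (U y)"
    using pseudometric_frame[OF U, of x] by blast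
  obtain c where c: "v = (\<Sum>i<N. c i *\<^sub>R e i x)"
    using basis[OF W(2)] v unfolding basis_of_def by blast
  have ls: "local_section A (scaleR :: real => 'v => 'v) (cbundle E) W (\<lambda>y. \<Sum>i\<in>I. c i *\<^sub>R e i y)"
    if "I \<subseteq> {..<N}" "finite I" for I
    using that(2,1)
  proof (induction I rule: finite_induct)
    case empty
    show ?case
      using vb.local_section_subset[OF sec_zero[unfolded vb.sections_iff] subset_UNIV] by simp
  next
    case (insert i I)
    have "local_section A (scaleR :: real => 'v => 'v) (cbundle E) W (\<lambda>y. c i *\<^sub>R e i y + (\<Sum>i\<in>I. c i *\<^sub>R e i y))"
      by (intro vb.local_section_add vb.local_section_scale smooth_fun_on_const W e insert.IH)
        (use insert.prems in auto)
    then show ?case using insert.hyps by simp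
  qed
  obtain \<eta> where \<eta>: "(\<lambda>y. (of_real (\<eta> y) :: real) *\<^sub>R (\<Sum>i<N. c i *\<^sub>R e i y)) \<in> Gam A E"
    "\<forall>\<^sub>F y in nhds x. \<eta> y = 1" "\<And>y. y \<notin> W ==> \<eta> y = 0"
    using vb.sections_extend[OF W ls[of "{..<N}"]] by auto
  have "\<eta> y *\<^sub>R (\<Sum>i<N. c i *\<^sub>R e i y) \<in> U y" for y
    using \<eta>(3) pseudometric_zero[OF U] pseudometric_scale[OF U] real_vector.basis_of_sum[OF basis]
    by (cases "y \<in> W") auto
  moreover have "\<eta> x *\<^sub>R (\<Sum>i<N. c i *\<^sub>R e i x) = v"
    using at_point[OF \<eta>(2)] c by simp
  ultimately show ?thesis
    using that[of "\<lambda>y. \<eta> y *\<^sub>R (\<Sum>i<N. c i *\<^sub>R e i y)"] \<eta>(1) by (simp add: sub_sections_def)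
qed

text \<open>A nondegenerate symmetric form that vanishes on the diagonal of the orthogonal complement of an
  orthonormal family vanishes there identically by polarization; so as long as the family does not
  span, its complement contains a vector that can be normalized.\<close>

lemma orthonormal_extension_vector:
  assumes U: "gen_pseudometric A E N U" and b: "orthonormal k x \<mu> b" "\<And>i. i < k ==> b i \<in> U x" and "k < N"
  obtains v where "v \<in> U x" "\<And>i. i < k ==> ip E x v (b i) = 0" "ip E x v v \<noteq> 0"
proof (rule ccontr)
  assume neg: "\<not> thesis"
  define p where "p w = w - (\<Sum>i<k. (\<mu> i * ip E x w (b i)) *\<^sub>R b i)" for w
  have pU: "p w \<in> U x" if "w \<in> U x" for w
    unfolding p_def using that b(2)
    by (intro pseudometric_diff[OF U] pseudometric_sum[OF U] pseudometric_scale[OF U]) auto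
  have orth: "ip E x (p w) (b i) = 0" if "w \<in> U x" "i < k" for w i
    unfolding p_def using orthogonal_part[OF b(1) _ that(2)] pseudometric_fib[OF U that(1)] by blast
  have null: "ip E x v v = 0" if "v \<in> U x" "\<And>i. i < k ==> ip E x v (b i) = 0" for v
    using neg that \<open>\<And>v. v \<in> U x ==> (\<And>i. i < k ==> ip E x v (b i) = 0) ==> ip E x v v \<noteq> 0 ==> thesis\<close> by blast
  have pp: "ip E x (p v) (p w) = 0" if "v \<in> U x" "w \<in> U x" for v w
  proof -
    have f: "p v \<in> fib E x" "p w \<in> fib E x" using pU that pseudometric_fib[OF U] by blast+
    have "ip E x (p v + p w) (p v + p w) = 0"
      using orth[OF that(1)] orth[OF that(2)] pU that f orthonormal_fib[OF b(1)]
      by (intro null pseudometric_add[OF U]) (auto simp: ip_add_left)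
    then show ?thesis
      using null[OF pU[OF that(1)] orth[OF that(1)]] null[OF pU[OF that(2)] orth[OF that(2)]] f
      by (simp add: ip_add_left ip_add_right fib_add ip_sym)
  qed
  have "p w = 0" if w: "w \<in> U x" for w
  proof (rule pseudometric_nondeg[OF U pU[OF w]])
    fix v assume v: "v \<in> U x"
    have fw: "p w \<in> fib E x" using pU[OF w] pseudometric_fib[OF U] by blast
    have s: "(\<Sum>i<k. (\<mu> i * ip E x v (b i)) *\<^sub>R b i) \<in> fib E x"
      using orthonormal_fib[OF b(1)] by (auto intro!: fib_sum fib_scale)
    have "ip E x (p w) (\<Sum>i<k. (\<mu> i * ip E x v (b i)) *\<^sub>R b i) = 0"
      using orth[OF w] orthonormal_fib[OF b(1)] fw
      by (subst ip_sum_right) (auto intro!: fib_scale sum.neutral simp: ip_scale_right)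
    moreover have "v = p v + (\<Sum>i<k. (\<mu> i * ip E x v (b i)) *\<^sub>R b i)" by (simp add: p_def)
    moreover have "ip E x (p w) (p v + (\<Sum>i<k. (\<mu> i * ip E x v (b i)) *\<^sub>R b i))
        = ip E x (p w) (p v) + ip E x (p w) (\<Sum>i<k. (\<mu> i * ip E x v (b i)) *\<^sub>R b i)"
      using fw pU[OF v] pseudometric_fib[OF U] s by (intro ip_add_right) auto
    ultimately show "ip E x (p w) v = 0" using pp[OF w v] by simp
  qed
  then have "w \<in> span (b ` {..<k})" if "w \<in> U x" for w
    using that unfolding p_def by (metis (no_types, lifting) eq_iff_diff_eq_0 imageI span_base span_scale span_sum)
  moreover obtain e where "basis_of scaleR {..<N} e (U x)" using pseudometric_basis[OF U] .
  ultimately have "N \<le> k" using basis_of_card_le[of "{..<N}" e "U x" "{..<k}" b] by auto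
  then show False using \<open>k < N\<close> by simp
qed

text \<open>One step of the Gram-Schmidt process near a point.\<close>

lemma orthonormal_extension:
  assumes U: "gen_pseudometric A E N U" and e: "\<And>i. i < k ==> e i \<in> Gam A E"
    and on: "\<forall>\<^sub>F y in nhds x. orthonormal k y \<mu> (\<lambda>i. e i y) \<and> (\<forall>i<k. e i y \<in> U y)" and "k < N"
  obtains s \<sigma> where "s \<in> Gam A E" "\<forall>\<^sub>F y in nhds x. orthonormal (Suc k) y (\<mu>(k := \<sigma>)) (\<lambda>i. (e(k := s)) i y)
    \<and> (\<forall>i<Suc k. (e(k := s)) i y \<in> U y)"
proof -
  have onx: "orthonormal k x \<mu> (\<lambda>i. e i x)" "\<And>i. i < k ==> e i x \<in> U x"
    using at_point[OF on] by auto
  obtain v where v: "v \<in> U x" "\<And>i. i < k ==> ip E x v (e i x) = 0" "ip E x v v \<noteq> 0"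
    using orthonormal_extension_vector[OF U onx \<open>k < N\<close>] by blast
  obtain s0 where s0: "s0 \<in> sub_sections A E U" "s0 x = v" using sub_section_through[OF U v(1)] .
  then have s0': "s0 \<in> Gam A E" "\<And>y. s0 y \<in> U y" by (auto simp: sub_sections_def)
  define s1 where "s1 y = s0 y - (\<Sum>i<k. (\<mu> i * ip E y (s0 y) (e i y)) *\<^sub>R e i y)" for y
  have s1: "s1 \<in> Gam A E"
    unfolding s1_def[abs_def]
    by (intro sec_diff sec_sum sec_scale C_inf_mult C_inf_const ip_C_inf s0') (use e in auto)
  have "s1 x = v" using v(2) by (simp add: s1_def s0(2))
  then have "ip E x (s1 x) (s1 x) \<noteq> 0" using v(3) by simp
  then obtain g where g: "smooth_fun_on A UNIV g"
    "\<forall>\<^sub>F y in nhds x. g y * g y * ip E y (s1 y) (s1 y) = sgn (ip E x (s1 x) (s1 x))"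
    using smooth_germ_normalize[of "\<lambda>y. ip E y (s1 y) (s1 y)" x] ip_C_inf[OF s1 s1] C_inf_iff by blast
  define \<sigma> where "\<sigma> = sgn (ip E x (s1 x) (s1 x))"
  have \<sigma>: "\<sigma> = 1 \<or> \<sigma> = -1" using \<open>ip E x (s1 x) (s1 x) \<noteq> 0\<close> by (auto simp: \<sigma>_def sgn_if)
  define s where "s y = g y *\<^sub>R s1 y" for y
  have s: "s \<in> Gam A E" unfolding s_def[abs_def] using g(1) s1 by (intro sec_scale) (auto simp: C_inf_iff)
  have "\<forall>\<^sub>F y in nhds x. orthonormal (Suc k) y (\<mu>(k := \<sigma>)) (\<lambda>i. (e(k := s)) i y)
    \<and> (\<forall>i<Suc k. (e(k := s)) i y \<in> U y)"
    using on g(2)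
  proof eventually_elim
    case (elim y)
    then have on: "orthonormal k y \<mu> (\<lambda>i. e i y)" and eU: "\<And>i. i < k ==> e i y \<in> U y" by auto
    have f: "s1 y \<in> fib E y" "s y \<in> fib E y" using sec_fib s1 s by blast+
    have orth: "ip E y (s y) (e i y) = 0" if "i < k" for i
      using orthogonal_part[OF on sec_fib[OF s0'(1)] that] f(1) orthonormal_fib[OF on that]
      by (simp add: s_def ip_scale_left flip: s1_def)
    have orth': "ip E y (e i y) (s y) = 0" if "i < k" for i
      using orth[OF that] f(2) orthonormal_fib[OF on that] by (simp add: ip_sym)
    have "ip E y (s y) (s y) = \<sigma>"
      using elim(2) f by (simp add: s_def ip_scale_left ip_scale_right \<sigma>_def fib_scale)
    then have "orthonormal (Suc k) y (\<mu>(k := \<sigma>)) (\<lambda>i. (e(k := s)) i y)"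
      using on orth orth' f(2) \<sigma> unfolding orthonormal_def by (auto simp: less_Suc_eq)
    moreover have "s1 y \<in> U y"
      unfolding s1_def using eU s0'(2)
      by (intro pseudometric_diff[OF U] pseudometric_sum[OF U] pseudometric_scale[OF U]) auto
    then have "s y \<in> U y" using pseudometric_scale[OF U] by (simp add: s_def)
    ultimately show ?case using eU by (auto simp: less_Suc_eq)
  qed
  then show ?thesis using that s by blast
qed

lemma orthonormal_frame_in:
  assumes U: "gen_pseudometric A E N U"
  shows "m \<le> N ==> \<exists>e \<mu>. (\<forall>i<m. e i \<in> Gam A E) \<and>
    (\<forall>\<^sub>F y in nhds x. orthonormal m y \<mu> (\<lambda>i. e i y) \<and> (\<forall>i<m. e i y \<in> U y))"
proof (induction m)
  case 0
  show ?case by (simp add: orthonormal_def)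
next
  case (Suc m)
  then obtain e \<mu> where e: "\<And>i. i < m ==> e i \<in> Gam A E"
    and on: "\<forall>\<^sub>F y in nhds x. orthonormal m y \<mu> (\<lambda>i. e i y) \<and> (\<forall>i<m. e i y \<in> U y)" by auto
  obtain s \<sigma> where s: "s \<in> Gam A E" "\<forall>\<^sub>F y in nhds x. orthonormal (Suc m) y (\<mu>(m := \<sigma>)) (\<lambda>i. (e(m := s)) i y)
    \<and> (\<forall>i<Suc m. (e(m := s)) i y \<in> U y)"
    using orthonormal_extension[OF U e on] Suc.prems by auto
  moreover have "\<forall>i<Suc m. (e(m := s)) i \<in> Gam A E" using s(1) e by (simp add: less_Suc_eq)
  ultimately show ?case by blast
qed

definition adapted_on :: "nat => ('m => 'v set) => 'm => (nat => real) => (nat => 'm => 'v) => bool" where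
  "adapted_on n V x \<mu> e \<longleftrightarrow> (\<forall>i<r. e i \<in> Gam A E) \<and>
    (\<forall>\<^sub>F y in nhds x. orthonormal r y \<mu> (\<lambda>i. e i y) \<and> (\<forall>i<n. e i y \<in> V y))"

text \<open>The Gram-Schmidt process runs in \<open>V\<close> first and then in \<open>E\<close>.\<close>

lemma adapted_on_exists:
  assumes V: "gen_pseudometric A E n V"
  obtains \<mu> e where "adapted_on n V x \<mu> e"
proof -
  have "\<exists>e \<mu>. (\<forall>i<m. e i \<in> Gam A E) \<and>
      (\<forall>\<^sub>F y in nhds x. orthonormal m y \<mu> (\<lambda>i. e i y) \<and> (\<forall>i<n. e i y \<in> V y))" if "n \<le> m" "m \<le> r" for m
    using that
  proof (induction m rule: dec_induct)
    case base
    then show ?case using orthonormal_frame_in[OF V, of n x] by auto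
  next
    case (step m)
    then obtain e \<mu> where e: "\<And>i. i < m ==> e i \<in> Gam A E"
      and on: "\<forall>\<^sub>F y in nhds x. orthonormal m y \<mu> (\<lambda>i. e i y) \<and> (\<forall>i<n. e i y \<in> V y)" by auto
    have on': "\<forall>\<^sub>F y in nhds x. orthonormal m y \<mu> (\<lambda>i. e i y) \<and> (\<forall>i<m. e i y \<in> fib E y)"
      using on by eventually_elim (auto simp: orthonormal_def)
    obtain s \<sigma> where s: "s \<in> Gam A E" "\<forall>\<^sub>F y in nhds x. orthonormal (Suc m) y (\<mu>(m := \<sigma>)) (\<lambda>i. (e(m := s)) i y)
      \<and> (\<forall>i<Suc m. (e(m := s)) i y \<in> fib E y)"
      using orthonormal_extension[OF pseudometric_total e on'] step.prems by auto
    have "\<forall>\<^sub>F y in nhds x. orthonormal (Suc m) y (\<mu>(m := \<sigma>)) (\<lambda>i. (e(m := s)) i y) \<and> (\<forall>i<n. (e(m := s)) i y \<in> V y)"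
      using on s(2) by eventually_elim (use step.hyps in auto)
    moreover have "\<forall>i<Suc m. (e(m := s)) i \<in> Gam A E" using s(1) e by (simp add: less_Suc_eq)
    ultimately show ?case by blast
  qed
  then show ?thesis using that pseudometric_rank_le[OF V] unfolding adapted_on_def by blast
qed

lemma orthonormal_sub_basis:
  assumes V: "gen_pseudometric A E n V" and b: "orthonormal r x \<mu> b" "\<And>i. i < n ==> b i \<in> V x"
  shows "basis_of scaleR {..<n} b (V x)" "basis_of scaleR {n..<r} b (perp E V x)"
proof -
  have nr: "n \<le> r" by (rule pseudometric_rank_le[OF V])
  obtain e where e: "basis_of scaleR {..<n} e (V x)" using pseudometric_basis[OF V] .
  show 1: "basis_of scaleR {..<n} b (V x)"
    by (rule basis_of_independent[OF _ e]) (use b nr orthonormal_independent[OF b(1), of "{..<n}"] in auto)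
  have mem: "(\<Sum>i\<in>{n..<r}. c i *\<^sub>R b i) \<in> perp E V x" for c
    unfolding perp_def
  proof (intro CollectI conjI ballI)
    show f: "(\<Sum>i\<in>{n..<r}. c i *\<^sub>R b i) \<in> fib E x"
      using orthonormal_fib[OF b(1)] by (auto intro!: fib_sum fib_scale)
    fix v assume "v \<in> V x"
    then obtain d where v: "v = (\<Sum>j<n. d j *\<^sub>R b j)" using 1 unfolding basis_of_def by blast
    have "ip E x (\<Sum>i\<in>{n..<r}. c i *\<^sub>R b i) (b j) = 0" if "j < n" for j
      using orthonormal_ip_sum[OF b(1), of j "{n..<r}" c] that nr by (simp add: subset_eq)
    then show "ip E x (\<Sum>i\<in>{n..<r}. c i *\<^sub>R b i) v = 0"
      unfolding v using f orthonormal_fib[OF b(1)] nr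
      by (subst ip_sum_right) (auto intro!: fib_scale sum.neutral simp: ip_scale_right)
  qed
  have "w \<in> range (\<lambda>c. \<Sum>i\<in>{n..<r}. c i *\<^sub>R b i)" if w: "w \<in> perp E V x" for w
  proof -
    have "w = (\<Sum>i<r. (\<mu> i * ip E x w (b i)) *\<^sub>R b i)"
      using orthonormal_expand[OF b(1)] w by (simp add: perp_def)
    also have "... = (\<Sum>i\<in>{n..<r}. (\<mu> i * ip E x w (b i)) *\<^sub>R b i)"
      using w b(2) by (intro sum.mono_neutral_right) (auto simp: perp_def)
    finally show ?thesis by (intro image_eqI[where x = "\<lambda>i. \<mu> i * ip E x w (b i)"]) simp_all
  qed
  then have "perp E V x = range (\<lambda>c. \<Sum>i\<in>{n..<r}. c i *\<^sub>R b i)" using mem by blast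
  then show "basis_of scaleR {n..<r} b (perp E V x)"
    unfolding basis_of_def using orthonormal_independent[OF b(1), of "{n..<r}"]
    by (simp add: subset_eq)
qed

lemma adapted_on_orthonormal: "adapted_on n V x \<mu> e ==> orthonormal r x \<mu> (\<lambda>i. e i x)"
  unfolding adapted_on_def using at_point by blast

text \<open>Since \<open>V\<close> has rank \<open>n\<close>, the first \<open>n\<close> vectors of an orthonormal frame span it as soon as they lie
  in it, and the others span its orthogonal complement.\<close>

lemma adapted_on_frame:
  assumes V: "gen_pseudometric A E n V" and e: "adapted_on n V x \<mu> e"
  shows "adapted_frame A E n V x e"
proof -
  have ev: "\<forall>\<^sub>F y in nhds x. orthonormal r y \<mu> (\<lambda>i. e i y) \<and> (\<forall>i<n. e i y \<in> V y)"
    using e by (simp add: adapted_on_def)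
  have x: "orthonormal r x \<mu> (\<lambda>i. e i x)" by (rule adapted_on_orthonormal[OF e])
  have "\<forall>\<^sub>F y in nhds x. basis_of scaleR {..<r} (\<lambda>i. e i y) (fib E y) \<and>
      (\<forall>i<r. \<forall>j<r. ip E y (e i y) (e j y) = ip E x (e i x) (e j x))"
    using ev
  proof eventually_elim
    case (elim y)
    then have y: "orthonormal r y \<mu> (\<lambda>i. e i y)" by blast
    show ?case using orthonormal_basis[OF y] orthonormal_ip[OF y] orthonormal_ip[OF x] by simp
  qed
  moreover have "\<forall>\<^sub>F y in nhds x. basis_of scaleR {..<n} (\<lambda>i. e i y) (V y) \<and>
      basis_of scaleR {n..<r} (\<lambda>i. e i y) (perp E V y)"
    using ev by eventually_elim (auto intro: orthonormal_sub_basis[OF V])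
  ultimately show ?thesis
    using e by (simp add: adapted_frame_def const_frame_def adapted_on_def)
qed

lemma orthonormal_exists:
  obtains \<mu> b where "orthonormal r x \<mu> b"
  using adapted_on_exists[OF pseudometric_total] adapted_on_orthonormal by metis

end

section \<open>Calculus in a Courant algebroid\<close>

context courant_alg
begin

subsection \<open>The anchor\<close>

lemma anchor_map: "anchor_map A E"
  using courant by (simp add: courant_algebroid_def)

lemma anchor_tangent: "u \<in> fib E x ==> tangent_vector A x (anchor E x u)"
  using anchor_map by (simp add: anchor_map_def)

lemma anchor_fun_near:
  assumes "u \<in> fib E x" "smooth_near A x f" "smooth_near A x g"
  shows "anchor E x u (\<lambda>y. f y + g y) = anchor E x u f + anchor E x u g"
    and "anchor E x u (\<lambda>y. f y * g y) = f x * anchor E x u g + g x * anchor E x u f"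
    and "\<forall>\<^sub>F y in nhds x. f y = g y ==> anchor E x u f = anchor E x u g"
  using anchor_tangent[OF assms(1)] assms(2,3) unfolding tangent_vector_def by blast+

lemma near: "f \<in> C_inf A ==> smooth_near A x f"
  by (simp add: C_inf_iff smooth_nearI)

lemma anchor_add_fun: "u \<in> fib E x ==> f \<in> C_inf A ==> g \<in> C_inf A ==>
    anchor E x u (\<lambda>y. f y + g y) = anchor E x u f + anchor E x u g"
  and anchor_mult_fun: "u \<in> fib E x ==> f \<in> C_inf A ==> g \<in> C_inf A ==>
    anchor E x u (\<lambda>y. f y * g y) = f x * anchor E x u g + g x * anchor E x u f"
  and anchor_local: "u \<in> fib E x ==> f \<in> C_inf A ==> g \<in> C_inf A ==>
    \<forall>\<^sub>F y in nhds x. f y = g y ==> anchor E x u f = anchor E x u g"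
  by (simp_all add: anchor_fun_near near)

lemma anchor_near_cong:
  assumes "u \<in> fib E x" "f \<in> C_inf A" "\<forall>\<^sub>F y in nhds x. f y = g y"
  shows "anchor E x u f = anchor E x u g"
  using anchor_fun_near(3)[OF assms(1) near[OF assms(2)] smooth_near_cong[OF near[OF assms(2)] assms(3)] assms(3)] .

lemma anchor_const: "u \<in> fib E x ==> anchor E x u (\<lambda>_. c) = 0"
proof -
  assume u: "u \<in> fib E x"
  have "anchor E x u (\<lambda>_. c * c') = c * anchor E x u (\<lambda>_. c') + c' * anchor E x u (\<lambda>_. c)" for c c'
    using anchor_mult_fun[OF u C_inf_const C_inf_const] .
  from this[of 1 1] have "anchor E x u (\<lambda>_. 1) = 0" by simp
  moreover have "anchor E x u (\<lambda>_. c * 1) = c * anchor E x u (\<lambda>_. 1)"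
    using anchor_tangent[OF u] near[OF C_inf_const, of x 1] unfolding tangent_vector_def by blast
  ultimately show ?thesis by simp
qed

lemma anchor_scale_fun: "u \<in> fib E x ==> f \<in> C_inf A ==>
    anchor E x u (\<lambda>y. c * f y) = c * anchor E x u f"
  using anchor_mult_fun[of u x "\<lambda>_. c" f] by (simp add: C_inf_const anchor_const)

lemma anchor_minus_fun: "u \<in> fib E x ==> f \<in> C_inf A ==> anchor E x u (\<lambda>y. - f y) = - anchor E x u f"
  using anchor_scale_fun[of u x f "-1"] by simp

lemma anchor_diff_fun: "u \<in> fib E x ==> f \<in> C_inf A ==> g \<in> C_inf A ==>
    anchor E x u (\<lambda>y. f y - g y) = anchor E x u f - anchor E x u g"
  using anchor_add_fun[of u x f "\<lambda>y. - g y"] by (simp add: C_inf_minus anchor_minus_fun)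

lemma anchor_sum_fun: "u \<in> fib E x ==> (\<And>i. i \<in> I ==> h i \<in> C_inf A) ==>
    anchor E x u (\<lambda>y. \<Sum>i\<in>I. h i y) = (\<Sum>i\<in>I. anchor E x u (h i))"
  by (induction I rule: infinite_finite_induct) (auto simp: anchor_const anchor_add_fun C_inf_sum)

lemma anchor_eventually_const:
  "u \<in> fib E x ==> f \<in> C_inf A ==> \<forall>\<^sub>F y in nhds x. f y = c ==> anchor E x u f = 0"
  using anchor_local[of u x f "\<lambda>_. c"] by (simp add: C_inf_const anchor_const)

lemma anchor_near_vec:
  assumes "u \<in> fib E x" "v \<in> fib E x" "smooth_near A x f"
  shows "anchor E x (u + v) f = anchor E x u f + anchor E x v f"
    and "anchor E x (c *\<^sub>R u) f = c * anchor E x u f"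
  using anchor_map assms unfolding anchor_map_def by blast+

lemma anchor_add_vec: "u \<in> fib E x ==> v \<in> fib E x ==> f \<in> C_inf A ==>
    anchor E x (u + v) f = anchor E x u f + anchor E x v f"
  and anchor_scale_vec: "u \<in> fib E x ==> f \<in> C_inf A ==> anchor E x (c *\<^sub>R u) f = c * anchor E x u f"
  by (simp_all add: anchor_near_vec near)

lemma anchor_zero_vec: "f \<in> C_inf A ==> anchor E x 0 f = 0"
  using anchor_scale_vec[OF fib_zero, of f x 0] by simp

lemma anchor_sum_vec: "(\<And>i. i \<in> I ==> u i \<in> fib E x) ==> f \<in> C_inf A ==>
    anchor E x (\<Sum>i\<in>I. u i) f = (\<Sum>i\<in>I. anchor E x (u i) f)"
  by (induction I rule: infinite_finite_induct) (auto simp: anchor_zero_vec anchor_add_vec fib_sum)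

lemma act_C_inf: "u \<in> Gam A E ==> f \<in> C_inf A ==> act E u f \<in> C_inf A"
  using anchor_map unfolding anchor_map_def by blast

lemma act_apply: "act E u f x = anchor E x (u x) f"
  by (simp add: act_def)

subsection \<open>The bracket\<close>

lemma bracket_sec: "u \<in> Gam A E ==> v \<in> Gam A E ==> bracket E u v \<in> Gam A E"
  and bracket_linear_left: "u \<in> Gam A E ==> v \<in> Gam A E ==> w \<in> Gam A E ==>
    bracket E (\<lambda>x. c *\<^sub>R u x + d *\<^sub>R v x) w = (\<lambda>x. c *\<^sub>R bracket E u w x + d *\<^sub>R bracket E v w x)"
  and bracket_linear_right: "u \<in> Gam A E ==> v \<in> Gam A E ==> w \<in> Gam A E ==>
    bracket E w (\<lambda>x. c *\<^sub>R u x + d *\<^sub>R v x) = (\<lambda>x. c *\<^sub>R bracket E w u x + d *\<^sub>R bracket E w v x)"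
  and jacobi: "u \<in> Gam A E ==> v \<in> Gam A E ==> w \<in> Gam A E ==>
    bracket E u (bracket E v w) = (\<lambda>x. bracket E (bracket E u v) w x + bracket E v (bracket E u w) x)"
  and leibniz: "u \<in> Gam A E ==> v \<in> Gam A E ==> f \<in> C_inf A ==>
    bracket E u (\<lambda>x. f x *\<^sub>R v x) = (\<lambda>x. f x *\<^sub>R bracket E u v x + act E u f x *\<^sub>R v x)"
  and compat: "u \<in> Gam A E ==> v \<in> Gam A E ==> w \<in> Gam A E ==>
    act E u (\<lambda>x. ip E x (v x) (w x)) =
      (\<lambda>x. ip E x (bracket E u v x) (w x) + ip E x (v x) (bracket E u w x))"
  and bracket_sym: "u \<in> Gam A E ==> v \<in> Gam A E ==>
    (\<lambda>x. bracket E u v x + bracket E v u x) = d_E E (\<lambda>x. ip E x (u x) (v x))"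
  using courant unfolding courant_algebroid_def by blast+

lemma bracket_fib: "u \<in> Gam A E ==> v \<in> Gam A E ==> bracket E u v x \<in> fib E x"
  using bracket_sec sec_fib by blast

lemma bracket_add_left: "u \<in> Gam A E ==> v \<in> Gam A E ==> w \<in> Gam A E ==>
    bracket E (\<lambda>x. u x + v x) w x = bracket E u w x + bracket E v w x"
  and bracket_scale_left: "u \<in> Gam A E ==> w \<in> Gam A E ==>
    bracket E (\<lambda>x. c *\<^sub>R u x) w x = c *\<^sub>R bracket E u w x"
  and bracket_add_right: "u \<in> Gam A E ==> v \<in> Gam A E ==> w \<in> Gam A E ==>
    bracket E w (\<lambda>x. u x + v x) x = bracket E w u x + bracket E w v x"
  and bracket_scale_right: "u \<in> Gam A E ==> w \<in> Gam A E ==>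
    bracket E w (\<lambda>x. c *\<^sub>R u x) x = c *\<^sub>R bracket E w u x"
  using bracket_linear_left[of u v w 1 1] bracket_linear_left[of u u w c 0]
    bracket_linear_right[of u v w 1 1] bracket_linear_right[of u u w c 0] by simp_all

lemma bracket_zero: "u \<in> Gam A E ==> bracket E u (\<lambda>_. 0) x = 0" "u \<in> Gam A E ==> bracket E (\<lambda>_. 0) u x = 0"
  using bracket_scale_right[of u u 0 x] bracket_scale_left[of u u 0 x] by simp_all

lemma bracket_diff_left: "u \<in> Gam A E ==> v \<in> Gam A E ==> w \<in> Gam A E ==>
    bracket E (\<lambda>x. u x - v x) w x = bracket E u w x - bracket E v w x"
  and bracket_diff_right: "u \<in> Gam A E ==> v \<in> Gam A E ==> w \<in> Gam A E ==>
    bracket E w (\<lambda>x. u x - v x) x = bracket E w u x - bracket E w v x"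
  using bracket_linear_left[of u v w 1 "-1"] bracket_linear_right[of u v w 1 "-1"] by simp_all

lemma bracket_sum_left: "(\<And>i. i \<in> I ==> u i \<in> Gam A E) ==> w \<in> Gam A E ==>
    bracket E (\<lambda>y. \<Sum>i\<in>I. c i *\<^sub>R u i y) w x = (\<Sum>i\<in>I. c i *\<^sub>R bracket E (u i) w x)"
  by (induction I rule: infinite_finite_induct)
    (auto simp: bracket_zero bracket_add_left bracket_scale_left sec_const_scale sec_sum)

lemma bracket_sum_right: "(\<And>i. i \<in> I ==> u i \<in> Gam A E) ==> w \<in> Gam A E ==>
    bracket E w (\<lambda>y. \<Sum>i\<in>I. c i *\<^sub>R u i y) x = (\<Sum>i\<in>I. c i *\<^sub>R bracket E w (u i) x)"
  by (induction I rule: infinite_finite_induct)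
    (auto simp: bracket_zero bracket_add_right bracket_scale_right sec_const_scale sec_sum)

subsection \<open>The differential\<close>

lemma d_E_properties:
  assumes f: "f \<in> C_inf A"
  shows "d_E E f x \<in> fib E x \<and> (\<forall>u\<in>fib E x. ip E x u (d_E E f x) = anchor E x u f)"
proof -
  obtain \<mu> b where b: "orthonormal r x \<mu> b" using orthonormal_exists .
  define w where "w = (\<Sum>i<r. (\<mu> i * anchor E x (b i) f) *\<^sub>R b i)"
  have w: "w \<in> fib E x"
    unfolding w_def using orthonormal_fib[OF b] by (auto intro!: fib_sum fib_scale)
  have ipw: "ip E x u w = anchor E x u f" if u: "u \<in> fib E x" for u
  proof -
    have "ip E x u w = (\<Sum>i<r. \<mu> i * anchor E x (b i) f * ip E x u (b i))"
      unfolding w_def using orthonormal_fib[OF b] u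
      by (subst ip_sum_right) (auto intro!: fib_scale sum.cong simp: ip_scale_right)
    also have "... = anchor E x (\<Sum>i<r. (\<mu> i * ip E x u (b i)) *\<^sub>R b i) f"
      using orthonormal_fib[OF b] f
      by (subst anchor_sum_vec) (auto intro!: fib_scale sum.cong simp: anchor_scale_vec)
    finally show ?thesis using orthonormal_expand[OF b u] by simp
  qed
  have unique: "w' = w" if w': "w' \<in> fib E x" "\<forall>u\<in>fib E x. ip E x u w' = anchor E x u f" for w'
  proof -
    have "w' - w = 0"
    proof (rule ip_nondeg[OF fib_diff[OF w'(1) w]])
      fix v assume v: "v \<in> fib E x"
      have "ip E x v (w' - w) = 0" using w' w v ipw by (simp add: ip_diff_right)
      then show "ip E x (w' - w) v = 0" using ip_sym[OF v fib_diff[OF w'(1) w]] by simp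
    qed
    then show ?thesis by simp
  qed
  have "d_E E f x = w"
    unfolding d_E_def by (rule the_equality) (simp add: w ipw, blast intro: unique)
  then show ?thesis using w ipw by simp
qed

lemma d_E_fib: "f \<in> C_inf A ==> d_E E f x \<in> fib E x"
  and d_E_ip: "f \<in> C_inf A ==> u \<in> fib E x ==> ip E x u (d_E E f x) = anchor E x u f"
  using d_E_properties by blast+

lemma fib_eqI:
  assumes "u \<in> fib E x" "v \<in> fib E x" "\<And>w. w \<in> fib E x ==> ip E x w u = ip E x w v"
  shows "u = v"
proof -
  have "u - v = 0"
    using assms by (intro ip_nondeg[OF fib_diff[OF assms(1,2)]])
      (simp add: ip_diff_left ip_sym[of _ x])
  then show ?thesis by simp
qed

lemma d_E_local:
  "f \<in> C_inf A ==> g \<in> C_inf A ==> \<forall>\<^sub>F y in nhds x. f y = g y ==> d_E E f x = d_E E g x"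
  by (rule fib_eqI[where x = x]) (simp_all add: d_E_fib d_E_ip anchor_local[of _ x f g])

lemma ip_bracket_sym:
  assumes "u \<in> Gam A E" "v \<in> Gam A E" "w \<in> fib E x"
  shows "ip E x w (bracket E u v x) = - ip E x w (bracket E v u x) + anchor E x w (\<lambda>y. ip E y (u y) (v y))"
proof -
  have "bracket E u v x + bracket E v u x = d_E E (\<lambda>y. ip E y (u y) (v y)) x"
    using fun_cong[OF bracket_sym[OF assms(1,2)]] .
  then have "ip E x w (bracket E u v x + bracket E v u x) = anchor E x w (\<lambda>y. ip E y (u y) (v y))"
    using d_E_ip[OF ip_C_inf[OF assms(1,2)] assms(3)] by simp
  then show ?thesis using bracket_fib assms by (simp add: ip_add_right)
qed

subsection \<open>Brackets with a section that vanishes at a point\<close>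

text \<open>If \<open>d\<close> vanishes at \<open>x\<close>, the brackets with \<open>d\<close> at \<open>x\<close> are first derivatives of inner products of
  \<open>d\<close> with sections, because the other term of the compatibility with the metric contains \<open>d x\<close>.\<close>

lemma ip_bracket_right_zero:
  assumes "u \<in> Gam A E" "d \<in> Gam A E" "w \<in> Gam A E" "d x = 0"
  shows "ip E x (w x) (bracket E u d x) = anchor E x (u x) (\<lambda>y. ip E y (d y) (w y))"
  using fun_cong[OF compat[OF assms(1-3)], of x] assms bracket_fib
  by (simp add: act_apply ip_zero_left ip_sym[of _ x "w x"] sec_fib)

lemma ip_bracket_left_zero:
  assumes "v \<in> Gam A E" "d \<in> Gam A E" "w \<in> Gam A E" "d x = 0"
  shows "ip E x (w x) (bracket E d v x)
    = - anchor E x (v x) (\<lambda>y. ip E y (d y) (w y)) + anchor E x (w x) (\<lambda>y. ip E y (d y) (v y))"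
  using ip_bracket_sym[OF assms(2,1) sec_fib[OF assms(3)]] ip_bracket_right_zero[OF assms] by simp

subsection \<open>Consequences of the Jacobi identity\<close>

text \<open>Expanding the Jacobi identity for \<open>u, v, f w\<close> leaves only the derivatives of \<open>f\<close> times \<open>w\<close>,
  which is chosen with \<open>w x \<noteq> 0\<close>; this is where the rank has to be positive.\<close>

lemma anchor_bracket:
  assumes "0 < r" "u \<in> Gam A E" "v \<in> Gam A E" "f \<in> C_inf A"
  shows "act E (bracket E u v) f x = act E u (act E v f) x - act E v (act E u f) x"
proof -
  obtain \<mu> b where b: "orthonormal r x \<mu> b" using orthonormal_exists .
  obtain w where w: "w \<in> Gam A E" "w x = b 0"
    using vb.section_through[OF orthonormal_fib[OF b assms(1)]] .
  have "b 0 \<noteq> 0"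
    using orthonormal_ip[OF b assms(1,1)] orthonormal_sign[OF b assms(1)]
      ip_zero_left[OF orthonormal_fib[OF b assms(1)]] by auto
  note s = assms(2,3) w(1) and f = assms(4)
  have expand: "bracket E a (bracket E c (\<lambda>y. f y *\<^sub>R w y)) x
      = f x *\<^sub>R bracket E a (bracket E c w) x + act E a f x *\<^sub>R bracket E c w x
        + act E c f x *\<^sub>R bracket E a w x + act E a (act E c f) x *\<^sub>R w x"
    if "a \<in> Gam A E" "c \<in> Gam A E" for a c
  proof -
    have "bracket E c (\<lambda>y. f y *\<^sub>R w y) = (\<lambda>y. f y *\<^sub>R bracket E c w y + act E c f y *\<^sub>R w y)"
      by (rule leibniz[OF that(2) w(1) f])
    then show ?thesis
      using that s f by (simp add: bracket_add_right leibniz sec_scale bracket_sec act_C_inf)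
  qed
  have "act E u (act E v f) x *\<^sub>R w x = act E (bracket E u v) f x *\<^sub>R w x + act E v (act E u f) x *\<^sub>R w x"
    using fun_cong[OF jacobi[OF s(1,2) sec_scale[OF f s(3)]], of x] fun_cong[OF jacobi[OF s], of x]
      fun_cong[OF leibniz[OF bracket_sec[OF s(1,2)] s(3) f], of x] expand[OF s(1,2)] expand[OF s(2,1)]
    by (simp add: algebra_simps)
  then have "(act E u (act E v f) x - act E (bracket E u v) f x - act E v (act E u f) x) *\<^sub>R w x = 0"
    by (simp add: algebra_simps)
  then show ?thesis using \<open>b 0 \<noteq> 0\<close> w(2) by simp
qed

text \<open>Locally every function is an inner product \<open>\<langle>u, v\<rangle>\<close>, and \<open>d\<^sub>E \<langle>u, v\<rangle> = [u, v] + [v, u]\<close> acts by zero.\<close>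

lemma anchor_d_E:
  assumes "0 < r" "f \<in> C_inf A" "g \<in> C_inf A"
  shows "anchor E x (d_E E f x) g = 0"
proof -
  obtain \<mu> e where e: "adapted_on r (fib E) x \<mu> e" using adapted_on_exists[OF pseudometric_total] .
  define v where "v y = (\<mu> 0 * f y) *\<^sub>R e 0 y" for y
  have e0: "e 0 \<in> Gam A E" using e assms(1) by (simp add: adapted_on_def)
  have v: "v \<in> Gam A E" unfolding v_def by (intro sec_scale C_inf_mult C_inf_const assms e0)
  have ev: "\<forall>\<^sub>F y in nhds x. orthonormal r y \<mu> (\<lambda>i. e i y)"
    using e by (auto simp: adapted_on_def elim: eventually_mono)
  have "\<forall>\<^sub>F y in nhds x. ip E y (e 0 y) (v y) = f y"
    using ev
  proof eventually_elim
    case (elim y)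
    have "ip E y (e 0 y) (v y) = (\<mu> 0 * f y) * \<mu> 0"
      using orthonormal_ip[OF elim assms(1,1)] sec_fib[OF e0] by (simp add: v_def ip_scale_right)
    then show ?case using orthonormal_sign[OF elim assms(1)] by (simp add: algebra_simps)
  qed
  then have "d_E E f x = bracket E (e 0) v x + bracket E v (e 0) x"
    using d_E_local[OF ip_C_inf[OF e0 v] assms(2)] fun_cong[OF bracket_sym[OF e0 v]] by simp
  then show ?thesis
    using anchor_bracket[OF assms(1) e0 v assms(3), of x] anchor_bracket[OF assms(1) v e0 assms(3), of x]
      bracket_fib e0 v assms(3)
    by (simp add: anchor_add_vec act_apply)
qed

text \<open>The left-hand side is \<open>\<rho>(d\<^sub>E f) g\<close>, expanded in the basis.\<close>

lemma anchor_null: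
  assumes "0 < r" "f \<in> C_inf A" "g \<in> C_inf A" "orthonormal r x \<mu> b"
  shows "(\<Sum>i<r. \<mu> i * (anchor E x (b i) f * anchor E x (b i) g)) = 0"
proof -
  have "d_E E f x = (\<Sum>i<r. (\<mu> i * anchor E x (b i) f) *\<^sub>R b i)"
    using orthonormal_expand[OF assms(4) d_E_fib[OF assms(2)]] d_E_ip[OF assms(2)]
      orthonormal_fib[OF assms(4)] d_E_fib[OF assms(2)]
    by (simp add: ip_sym[of "d_E E f x" x])
  moreover have "anchor E x (\<Sum>i<r. (\<mu> i * anchor E x (b i) f) *\<^sub>R b i) g
      = (\<Sum>i<r. \<mu> i * (anchor E x (b i) f * anchor E x (b i) g))"
    using orthonormal_fib[OF assms(4)] assms(3)
    by (subst anchor_sum_vec) (auto intro!: fib_scale sum.cong simp: anchor_scale_vec)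
  ultimately show ?thesis using anchor_d_E[OF assms(1-3), of x] by simp
qed

end

subsection \<open>Divergences\<close>

locale courant_div = courant_alg A E
  for A :: "('m::{t2_space, second_countable_topology}, 'b::{real_inner, heine_borel}) atlas"
    and E :: "('m, 'v::real_vector) courant" +
  fixes dv :: "('m => 'v) => 'm => real"
  assumes divergence: "divergence A E dv"
begin

lemma dv_C_inf: "u \<in> Gam A E ==> dv u \<in> C_inf A"
  and dv_linear: "u \<in> Gam A E ==> v \<in> Gam A E ==>
    dv (\<lambda>x. c *\<^sub>R u x + d *\<^sub>R v x) = (\<lambda>x. c * dv u x + d * dv v x)"
  and dv_leibniz: "u \<in> Gam A E ==> f \<in> C_inf A ==>
    dv (\<lambda>x. f x *\<^sub>R u x) = (\<lambda>x. f x * dv u x + act E u f x)"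
  using divergence unfolding divergence_def by blast+

lemma dv_add: "u \<in> Gam A E ==> v \<in> Gam A E ==> dv (\<lambda>x. u x + v x) x = dv u x + dv v x"
  and dv_diff: "u \<in> Gam A E ==> v \<in> Gam A E ==> dv (\<lambda>x. u x - v x) x = dv u x - dv v x"
  and dv_scale: "u \<in> Gam A E ==> dv (\<lambda>x. c *\<^sub>R u x) x = c * dv u x"
  using dv_linear[of u v 1 1] dv_linear[of u v 1 "-1"] dv_linear[of u u c 0] by simp_all

lemma dv_zero: "dv (\<lambda>_. 0) x = 0"
  using dv_scale[OF sec_zero, of 0 x] by simp

lemma dv_sum: "(\<And>i. i \<in> I ==> u i \<in> Gam A E) ==> dv (\<lambda>y. \<Sum>i\<in>I. u i y) x = (\<Sum>i\<in>I. dv (u i) x)"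
  by (induction I rule: infinite_finite_induct) (auto simp: dv_zero dv_add sec_sum)

lemma dv_local:
  assumes "u \<in> Gam A E" "v \<in> Gam A E" "\<forall>\<^sub>F y in nhds x. u y = v y"
  shows "dv u x = dv v x"
proof -
  obtain W where W: "open W" "x \<in> W" "\<And>y. y \<in> W ==> u y = v y"
    using assms(3) unfolding eventually_nhds by blast
  obtain \<eta> :: "'m => real" and K where \<eta>: "smooth_fun_on A UNIV \<eta>" "\<forall>\<^sub>F y in nhds x. \<eta> y = 1"
    "K \<subseteq> W" "\<And>y. y \<notin> K ==> \<eta> y = 0" using bump_function[OF W(1,2)] by metis
  have d: "(\<lambda>y. u y - v y) \<in> Gam A E" by (intro sec_diff assms)
  have "\<eta> y *\<^sub>R (u y - v y) = 0" for y using W(3) \<eta>(3,4) by (cases "y \<in> K") auto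
  then have "(\<lambda>y. \<eta> y *\<^sub>R (u y - v y)) = (\<lambda>_. 0)" by blast
  then have "\<eta> x * dv (\<lambda>y. u y - v y) x + act E (\<lambda>y. u y - v y) \<eta> x = 0"
    using fun_cong[OF dv_leibniz[OF d, of \<eta>], of x] \<eta>(1) dv_zero by (simp add: C_inf_iff)
  moreover have "act E (\<lambda>y. u y - v y) \<eta> x = 0"
    using at_point[OF assms(3)] \<eta>(1) by (simp add: act_apply anchor_zero_vec C_inf_iff)
  ultimately show ?thesis
    using at_point[OF \<eta>(2)] dv_diff[OF assms(1,2), of x] by simp
qed

end

section \<open>Orthogonal projections and the generalized Ricci tensor\<close>

context courant_alg
begin

lemma sub_sections_sec: "s \<in> sub_sections A E U ==> s \<in> Gam A E"
  and sub_sections_in: "s \<in> sub_sections A E U ==> s x \<in> U x"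
  by (auto simp: sub_sections_def)

lemma sub_sections_add:
  "gen_pseudometric A E N U ==> s \<in> sub_sections A E U ==> t \<in> sub_sections A E U ==>
    (\<lambda>y. s y + t y) \<in> sub_sections A E U"
  by (auto simp: sub_sections_def intro: sec_add pseudometric_add)

lemma sub_sections_scale:
  "gen_pseudometric A E N U ==> f \<in> C_inf A ==> s \<in> sub_sections A E U ==>
    (\<lambda>y. f y *\<^sub>R s y) \<in> sub_sections A E U"
  by (auto simp: sub_sections_def intro: sec_scale pseudometric_scale)

lemma sub_sections_sum:
  "gen_pseudometric A E N U ==> (\<And>i. i \<in> I ==> s i \<in> sub_sections A E U) ==>
    (\<lambda>y. \<Sum>i\<in>I. s i y) \<in> sub_sections A E U"
  by (auto simp: sub_sections_def intro: sec_sum pseudometric_sum)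

text \<open>The tensor property: a \<open>C\<^sup>\<infinity>\<close>-linear map has at \<open>x\<close> a value that depends only on the value of its
  argument at \<open>x\<close>, because a section vanishing at \<open>x\<close> is near \<open>x\<close> a combination of frame sections
  whose coefficients vanish at \<open>x\<close>.\<close>

lemma tensorial_pointwise:
  fixes \<Phi> :: "('m => 'v) => 'c::real_vector"
  assumes U: "gen_pseudometric A E N U"
    and add: "\<And>s t. s \<in> sub_sections A E U ==> t \<in> sub_sections A E U ==> \<Phi> (\<lambda>y. s y + t y) = \<Phi> s + \<Phi> t"
    and hom: "\<And>f s. f \<in> C_inf A ==> s \<in> sub_sections A E U ==> \<Phi> (\<lambda>y. f y *\<^sub>R s y) = f x *\<^sub>R \<Phi> s"
    and s: "s \<in> sub_sections A E U" and t: "t \<in> sub_sections A E U" and "s x = t x"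
  shows "\<Phi> s = \<Phi> t"
proof -
  note sU = sub_sections_add[OF U] sub_sections_scale[OF U]
  define d where "d y = s y + (-1) *\<^sub>R t y" for y
  have d: "d \<in> sub_sections A E U"
    unfolding d_def[abs_def] by (intro sU s t C_inf_const)
  have dx: "d x = 0" using \<open>s x = t x\<close> by (simp add: d_def)
  have "\<exists>e \<mu>. (\<forall>i<N. e i \<in> Gam A E) \<and>
      (\<forall>\<^sub>F y in nhds x. orthonormal N y \<mu> (\<lambda>i. e i y) \<and> (\<forall>i<N. e i y \<in> U y))"
    by (rule orthonormal_frame_in[OF U order_refl])
  then obtain e \<mu> where e: "\<And>i. i < N ==> e i \<in> Gam A E"
    and "\<forall>\<^sub>F y in nhds x. orthonormal N y \<mu> (\<lambda>i. e i y) \<and> (\<forall>i<N. e i y \<in> U y)" by blast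
  then obtain W where W: "open W" "x \<in> W" "\<And>y. y \<in> W ==> orthonormal N y \<mu> (\<lambda>i. e i y)"
    "\<And>y i. y \<in> W ==> i < N ==> e i y \<in> U y" unfolding eventually_nhds by blast
  obtain \<eta> :: "'m => real" and K where \<eta>: "smooth_fun_on A UNIV \<eta>" "\<forall>\<^sub>F y in nhds x. \<eta> y = 1"
    "K \<subseteq> W" "\<And>y. y \<notin> K ==> \<eta> y = 0" using bump_function[OF W(1,2)] by metis
  have \<eta>C: "\<eta> \<in> C_inf A" using \<eta>(1) by (simp add: C_inf_iff)
  have \<eta>x: "\<eta> x = 1" by (rule at_point[OF \<eta>(2)])
  define f where "f i y = \<eta> y * (\<mu> i * ip E y (d y) (e i y))" for i y
  define g where "g i y = \<eta> y *\<^sub>R e i y" for i y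
  have g: "g i \<in> sub_sections A E U" if "i < N" for i
  proof -
    have "g i y \<in> U y" for y
      using W(4)[OF _ that] \<eta>(3,4) pseudometric_scale[OF U] pseudometric_zero[OF U]
      by (cases "y \<in> K") (auto simp: g_def)
    then show ?thesis using sec_scale[OF \<eta>C e[OF that]] by (auto simp: sub_sections_def g_def[abs_def])
  qed
  have f: "f i \<in> C_inf A" if "i < N" for i
    unfolding f_def[abs_def] by (intro C_inf_mult C_inf_const ip_C_inf \<eta>C sub_sections_sec[OF d] e that)
  have exp: "(\<eta> y * \<eta> y) *\<^sub>R d y = (\<Sum>i<N. f i y *\<^sub>R g i y)" for y
  proof (cases "y \<in> K")
    case True
    then have y: "y \<in> W" using \<eta>(3) by blast
    obtain b where b: "basis_of scaleR {..<N} b (U y)" using pseudometric_basis[OF U] .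
    have "basis_of scaleR {..<N} (\<lambda>i. e i y) (U y)"
      by (rule basis_of_independent[OF _ b])
        (use W(4)[OF y] orthonormal_independent[OF W(3)[OF y], of "{..<N}"] in auto)
    then obtain c where c: "d y = (\<Sum>i<N. c i *\<^sub>R e i y)"
      using sub_sections_in[OF d, of y] unfolding basis_of_def by blast
    have "\<mu> i * ip E y (d y) (e i y) = c i" if "i < N" for i
      using orthonormal_ip_sum[OF W(3)[OF y] that, of "{..<N}" c] orthonormal_sign[OF W(3)[OF y] that] that
      by (simp add: c flip: mult.assoc)
    then have "(\<Sum>i<N. f i y *\<^sub>R g i y) = (\<eta> y * \<eta> y) *\<^sub>R (\<Sum>i<N. c i *\<^sub>R e i y)"
      by (simp add: f_def g_def scaleR_sum_right mult_ac)
    then show ?thesis using c by simp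
  next
    case False
    then show ?thesis using \<eta>(4) by (simp add: f_def)
  qed
  have zero: "\<Phi> (\<lambda>_. 0) = 0"
    using hom[OF C_inf_const[of 0] s] by simp
  have "\<Phi> (\<lambda>y. \<Sum>i\<in>I. f i y *\<^sub>R g i y) = (\<Sum>i\<in>I. f i x *\<^sub>R \<Phi> (g i))" if "I \<subseteq> {..<N}" "finite I" for I
    using that(2,1)
  proof (induction I rule: finite_induct)
    case (insert i I)
    have "(\<lambda>y. \<Sum>i\<in>I. f i y *\<^sub>R g i y) \<in> sub_sections A E U"
      using insert.prems by (intro sub_sections_sum[OF U] sU f g) auto
    then show ?case using insert f g by (simp add: add sU hom)
  qed (simp add: zero)
  from this[of "{..<N}"] have "\<Phi> (\<lambda>y. \<Sum>i<N. f i y *\<^sub>R g i y) = 0"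
    using e sec_fib by (simp add: f_def dx ip_zero_left)
  moreover have "\<Phi> (\<lambda>y. (\<eta> y * \<eta> y) *\<^sub>R d y) = \<Phi> d"
    using hom[OF C_inf_mult[OF \<eta>C \<eta>C] d] by (simp add: \<eta>x)
  ultimately have "\<Phi> d = 0" by (simp add: exp)
  moreover have "\<Phi> d = \<Phi> s - \<Phi> t"
    unfolding d_def[abs_def] using add[OF s sU(2)[OF C_inf_const[of "-1"] t]] hom[OF C_inf_const[of "-1"] t] by simp
  ultimately show ?thesis by simp
qed

end

locale pseudometric = courant_div A E dv
  for A :: "('m::{t2_space, second_countable_topology}, 'b::{real_inner, heine_borel}) atlas"
    and E :: "('m, 'v::real_vector) courant" and dv :: "('m => 'v) => 'm => real" +
  fixes n :: nat and V :: "'m => 'v set"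
  assumes V: "gen_pseudometric A E n V"
begin

abbreviation "Vp \<equiv> perp E V"
abbreviation "GamP \<equiv> sub_sections A E V"
abbreviation "GamM \<equiv> sub_sections A E Vp"

lemma V_fib: "v \<in> V x ==> v \<in> fib E x"
  by (rule pseudometric_fib[OF V])

lemma perp_fib: "v \<in> Vp x ==> v \<in> fib E x"
  and perp_ip: "v \<in> Vp x ==> w \<in> V x ==> ip E x v w = 0"
  by (auto simp: perp_def)

lemma onb_exists:
  obtains \<mu> b where "orthonormal r x \<mu> b" "\<And>i. i < n ==> b i \<in> V x"
proof -
  obtain \<mu> e where "adapted_on n V x \<mu> e" using adapted_on_exists[OF V] .
  then have "\<forall>\<^sub>F y in nhds x. orthonormal r y \<mu> (\<lambda>i. e i y) \<and> (\<forall>i<n. e i y \<in> V y)"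
    by (simp add: adapted_on_def)
  from at_point[OF this] show ?thesis using that[of \<mu> "\<lambda>i. e i x"] by blast
qed

lemma perp_pseudometric: "gen_pseudometric A E (r - n) Vp"
  unfolding gen_pseudometric_def
proof (intro conjI allI ballI impI)
  fix x
  show "Vp x \<subseteq> fib E x" using perp_fib by blast
  obtain \<mu> e where e: "adapted_on n V x \<mu> e" using adapted_on_exists[OF V] .
  have nr: "n \<le> r" by (rule pseudometric_rank_le[OF V])
  have "\<forall>\<^sub>F y in nhds x. orthonormal r y \<mu> (\<lambda>i. e i y) \<and> (\<forall>i<n. e i y \<in> V y)"
    using e by (simp add: adapted_on_def)
  then obtain W where W: "open W" "x \<in> W" "\<And>y. y \<in> W ==> orthonormal r y \<mu> (\<lambda>i. e i y)"
    "\<And>y i. y \<in> W ==> i < n ==> e i y \<in> V y" unfolding eventually_nhds by blast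
  have "basis_of scaleR {..<r - n} (\<lambda>i. e (n + i) y) (Vp y)" if "y \<in> W" for y
  proof -
    have *: "(\<Sum>i<r - n. c i *\<^sub>R e (n + i) y) = (\<Sum>j\<in>{n..<r}. c (j - n) *\<^sub>R e j y)" for c
      by (rule sum.reindex_bij_witness[of _ "\<lambda>j. j - n" "\<lambda>i. n + i"]) (use nr in auto)
    have b: "basis_of scaleR {n..<r} (\<lambda>i. e i y) (Vp y)"
      using orthonormal_sub_basis(2)[OF V W(3)[OF that]] W(4)[OF that] by blast
    have **: "(\<Sum>j\<in>{n..<r}. c j *\<^sub>R e j y) = (\<Sum>i<r - n. c (n + i) *\<^sub>R e (n + i) y)" for c
      by (rule sum.reindex_bij_witness[of _ "\<lambda>i. n + i" "\<lambda>j. j - n"]) (use nr in auto)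
    have "range (\<lambda>c. \<Sum>i<r - n. c i *\<^sub>R e (n + i) y) = range (\<lambda>c. \<Sum>j\<in>{n..<r}. c j *\<^sub>R e j y)"
    proof (intro equalityI subsetI; clarify)
      show "(\<Sum>i<r - n. c i *\<^sub>R e (n + i) y) \<in> range (\<lambda>c. \<Sum>j\<in>{n..<r}. c j *\<^sub>R e j y)" for c
        by (rule image_eqI[of _ _ "\<lambda>j. c (j - n)"]) (simp_all add: *)
      show "(\<Sum>j\<in>{n..<r}. c j *\<^sub>R e j y) \<in> range (\<lambda>c. \<Sum>i<r - n. c i *\<^sub>R e (n + i) y)" for c
        by (rule image_eqI[of _ _ "\<lambda>i. c (n + i)"]) (simp_all add: **)
    qed
    moreover have "\<forall>i\<in>{..<r - n}. c i = 0" if c: "(\<Sum>i<r - n. c i *\<^sub>R e (n + i) y) = 0" for c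
    proof
      fix i assume i: "i \<in> {..<r - n}"
      have "(\<Sum>j\<in>{n..<r}. c (j - n) *\<^sub>R e j y) = 0" using c * by simp
      with b[unfolded basis_of_def, THEN conjunct2, rule_format, of "\<lambda>j. c (j - n)" "n + i"] i
      show "c i = 0" by auto
    qed
    ultimately show ?thesis using b unfolding basis_of_def by simp
  qed
  moreover have "local_section A (scaleR :: real => 'v => 'v) (cbundle E) W (e (n + i))" if "i < r - n" for i
    using e that vb.local_section_subset[of UNIV "e (n + i)" W] by (simp add: adapted_on_def sections_def)
  ultimately show "\<exists>W e. open W \<and> x \<in> W \<and>
      (\<forall>i<r - n. local_section A (scaleR :: real => 'v => 'v) (cbundle E) W (e i)) \<and>
      (\<forall>y\<in>W. basis_of scaleR {..<r - n} (\<lambda>i. e i y) (Vp y))"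
    using W(1,2) by (intro exI[of _ W] exI[of _ "\<lambda>i. e (n + i)"]) simp
next
  fix x u assume u: "u \<in> Vp x" "\<forall>v\<in>Vp x. ip E x u v = 0"
  obtain \<mu> b where b: "orthonormal r x \<mu> b" "\<And>i. i < n ==> b i \<in> V x" using onb_exists[of x] by blast
  have "ip E x u (b i) = 0" if "i < r" for i
  proof (cases "i < n")
    case True
    then show ?thesis using perp_ip[OF u(1)] b(2) by blast
  next
    case False
    then have "b i \<in> Vp x"
      using real_vector.basis_of_in[OF orthonormal_sub_basis(2)[OF V b], of i] that by simp
    then show ?thesis using u(2) by blast
  qed
  then show "u = 0" using orthonormal_expand[OF b(1) perp_fib[OF u(1)]] by simp
qed

subsection \<open>Projections\<close>

lemma proj_eqI:
  assumes "w \<in> V x" "s x - w \<in> Vp x"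
  shows "proj E V s x = w"
  unfolding proj_def
proof (rule the_equality)
  fix w' assume w': "w' \<in> V x \<and> s x - w' \<in> Vp x"
  have "w' - w = 0"
  proof (rule pseudometric_nondeg[OF V pseudometric_diff[OF V]])
    fix v assume v: "v \<in> V x"
    have "(s x - w) - (s x - w') = w' - w" by simp
    moreover have "ip E x ((s x - w) - (s x - w')) v = 0"
      using perp_ip[OF assms(2) v] perp_ip[of "s x - w'" x v] w' v
        ip_diff_left[OF perp_fib[OF assms(2)] perp_fib[of "s x - w'" x] V_fib[OF v]] by auto
    ultimately show "ip E x (w' - w) v = 0" by simp
  qed (use w' assms in auto)
  then show "w' = w" by simp
qed (use assms in auto)

lemma proj_onb:
  assumes "orthonormal r x \<mu> b" "\<And>i. i < n ==> b i \<in> V x" "s x \<in> fib E x"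
  shows "proj E V s x = (\<Sum>i<n. (\<mu> i * ip E x (s x) (b i)) *\<^sub>R b i)"
    and "s x - (\<Sum>i<n. (\<mu> i * ip E x (s x) (b i)) *\<^sub>R b i) \<in> Vp x"
proof -
  have nr: "n \<le> r" by (rule pseudometric_rank_le[OF V])
  have split: "{..<r} = {..<n} \<union> {n..<r}" "{..<n} \<inter> {n..<r} = {}" using nr by auto
  have "s x - (\<Sum>i<n. (\<mu> i * ip E x (s x) (b i)) *\<^sub>R b i) = (\<Sum>i\<in>{n..<r}. (\<mu> i * ip E x (s x) (b i)) *\<^sub>R b i)"
    by (subst orthonormal_expand[OF assms(1,3)]) (simp add: split(1) sum.union_disjoint[OF _ _ split(2)])
  also have "... \<in> Vp x"
    by (rule real_vector.basis_of_sum[OF orthonormal_sub_basis(2)[OF V assms(1,2)]])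
  finally show *: "s x - (\<Sum>i<n. (\<mu> i * ip E x (s x) (b i)) *\<^sub>R b i) \<in> Vp x" .
  show "proj E V s x = (\<Sum>i<n. (\<mu> i * ip E x (s x) (b i)) *\<^sub>R b i)"
    by (rule proj_eqI[where s = s and x = x, OF _ *]) (auto intro!: pseudometric_sum[OF V] pseudometric_scale[OF V] assms(2))
qed

lemma proj_in: "s x \<in> fib E x ==> proj E V s x \<in> V x"
  and proj_compl: "s x \<in> fib E x ==> s x - proj E V s x \<in> Vp x"
proof -
  assume s: "s x \<in> fib E x"
  obtain \<mu> b where b: "orthonormal r x \<mu> b" "\<And>i. i < n ==> b i \<in> V x" using onb_exists[of x] by blast
  show "proj E V s x \<in> V x" "s x - proj E V s x \<in> Vp x"
    using proj_onb[of x \<mu> b s, OF b s] by (auto intro!: pseudometric_sum[OF V] pseudometric_scale[OF V] b(2))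
qed

lemma perp_add: "u \<in> Vp x ==> v \<in> Vp x ==> u + v \<in> Vp x"
  and perp_scale: "u \<in> Vp x ==> c *\<^sub>R u \<in> Vp x"
  and perp_zero: "0 \<in> Vp x"
  using pseudometric_add[OF perp_pseudometric] pseudometric_scale[OF perp_pseudometric]
    pseudometric_zero[OF perp_pseudometric] by blast+

lemma proj_add:
  "s x \<in> fib E x ==> t x \<in> fib E x ==> proj E V (\<lambda>y. s y + t y) x = proj E V s x + proj E V t x"
  by (rule proj_eqI)
    (use perp_add[OF proj_compl proj_compl, of s x t] in
      \<open>auto intro: pseudometric_add[OF V] proj_in simp: algebra_simps\<close>)

lemma proj_scale: "s x \<in> fib E x ==> proj E V (\<lambda>y. f y *\<^sub>R s y) x = f x *\<^sub>R proj E V s x"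
  by (rule proj_eqI)
    (use perp_scale[OF proj_compl, of s x "f x"] in
      \<open>auto intro: pseudometric_scale[OF V] proj_in simp: algebra_simps\<close>)

lemma proj_id: "s x \<in> V x ==> proj E V s x = s x"
  by (rule proj_eqI) (auto intro: perp_zero)

lemma proj_perp_zero: "s x \<in> Vp x ==> proj E V s x = 0"
  by (rule proj_eqI) (auto intro: pseudometric_zero[OF V])

lemma proj_cong: "s x = t x ==> proj E V s x = proj E V t x"
  by (simp add: proj_def)

text \<open>The complement of \<open>V\<^sup>\<bottom>\<close> that enters \<open>proj E Vp\<close> is \<open>(V\<^sup>\<bottom>)\<^sup>\<bottom> = V\<close>.\<close>

lemma proj_perp:
  assumes "s x \<in> fib E x"
  shows "proj E Vp s x = s x - proj E V s x"
  unfolding proj_def[of E Vp]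
proof (rule the_equality)
  have "s x - (s x - proj E V s x) \<in> perp E Vp x"
    using proj_in[of s x, OF assms] V_fib perp_fib perp_ip ip_sym by (auto simp: perp_def[of E Vp])
  then show "s x - proj E V s x \<in> Vp x \<and> s x - (s x - proj E V s x) \<in> perp E Vp x"
    using proj_compl[of s x, OF assms] by blast
  fix w assume w: "w \<in> Vp x \<and> s x - w \<in> perp E Vp x"
  have f: "proj E V s x \<in> fib E x" "w \<in> fib E x" using proj_in[of s x, OF assms] V_fib w perp_fib by blast+
  define u where "u = (s x - proj E V s x) - w"
  have u: "u \<in> Vp x"
    unfolding u_def using proj_compl[of s x, OF assms] w perp_add perp_scale[of w x "-1"] by fastforce
  have "u = 0"
  proof (rule pseudometric_nondeg[OF perp_pseudometric u])
    fix v assume v: "v \<in> Vp x"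
    have "u = (s x - w) - proj E V s x" by (simp add: u_def)
    moreover have "ip E x (s x - w) v = 0" using w v by (simp add: perp_def[of E Vp])
    moreover have "ip E x (proj E V s x) v = 0"
      using perp_ip[OF v proj_in[of s x, OF assms]] ip_sym[OF f(1) perp_fib[OF v]] by simp
    ultimately show "ip E x u v = 0"
      using f perp_fib[OF v] assms by (simp add: ip_diff_left fib_diff)
  qed
  then show "w = s x - proj E V s x" by (simp add: u_def)
qed

lemma proj_perp_in: "s x \<in> fib E x ==> proj E Vp s x \<in> Vp x"
  using proj_perp[of s x] proj_compl[of s x] by simp

lemma proj_sec: "s \<in> Gam A E ==> proj E V s \<in> GamP"
proof -
  assume s: "s \<in> Gam A E"
  have "proj E V s \<in> Gam A E"
  proof (rule vb.sections_local)
    fix x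
    obtain \<mu> e where e: "adapted_on n V x \<mu> e" using adapted_on_exists[OF V] .
    have nr: "n \<le> r" by (rule pseudometric_rank_le[OF V])
    have eG: "e i \<in> Gam A E" if "i < r" for i using e that by (simp add: adapted_on_def)
    have "(\<lambda>y. \<Sum>i<n. (\<mu> i * ip E y (s y) (e i y)) *\<^sub>R e i y) \<in> Gam A E"
      by (intro sec_sum sec_scale C_inf_mult C_inf_const ip_C_inf s eG) (use nr in auto)
    moreover have "\<forall>\<^sub>F y in nhds x. proj E V s y = (\<Sum>i<n. (\<mu> i * ip E y (s y) (e i y)) *\<^sub>R e i y)"
    proof -
      have "\<forall>\<^sub>F y in nhds x. orthonormal r y \<mu> (\<lambda>i. e i y) \<and> (\<forall>i<n. e i y \<in> V y)"
        using e by (simp add: adapted_on_def)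
      then show ?thesis
      proof eventually_elim
        case (elim y)
        then show ?case using proj_onb(1)[of y \<mu> "\<lambda>i. e i y" s] sec_fib[OF s] by blast
      qed
    qed
    ultimately show "\<exists>t\<in>Gam A E. \<forall>\<^sub>F y in nhds x. proj E V s y = t y"
      by (intro bexI[of _ "\<lambda>y. \<Sum>i<n. (\<mu> i * ip E y (s y) (e i y)) *\<^sub>R e i y"])
  qed
  then show ?thesis using proj_in sec_fib[OF s] by (auto simp: sub_sections_def)
qed

lemma proj_perp_sec: "s \<in> Gam A E ==> proj E Vp s \<in> GamM"
proof -
  assume s: "s \<in> Gam A E"
  have "proj E Vp s = (\<lambda>y. s y - proj E V s y)" using proj_perp sec_fib[OF s] by blast
  then have "proj E Vp s \<in> Gam A E" using sec_diff[OF s sub_sections_sec[OF proj_sec[OF s]]] by simp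
  then show ?thesis using proj_perp_in sec_fib[OF s] by (auto simp: sub_sections_def)
qed

lemma proj_perp_add:
  "s x \<in> fib E x ==> t x \<in> fib E x ==> proj E Vp (\<lambda>y. s y + t y) x = proj E Vp s x + proj E Vp t x"
  using proj_perp[of s x] proj_perp[of t x] proj_perp[of "\<lambda>y. s y + t y" x] fib_add proj_add[of s x t] by simp

lemma proj_perp_scale: "s x \<in> fib E x ==> proj E Vp (\<lambda>y. f y *\<^sub>R s y) x = f x *\<^sub>R proj E Vp s x"
  using proj_perp[of s x] proj_perp[of "\<lambda>y. f y *\<^sub>R s y" x] fib_scale proj_scale[of s x f]
  by (simp add: scaleR_diff_right)

lemma proj_perp_id: "s x \<in> Vp x ==> proj E Vp s x = s x"
  using proj_perp[of s x] perp_fib proj_perp_zero[of s x] by simp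

lemma proj_perp_V_zero: "s x \<in> V x ==> proj E Vp s x = 0"
  using proj_perp[of s x] V_fib proj_id[of s x] by simp

end

context pseudometric
begin

subsection \<open>Tensoriality of the generalized Ricci tensor\<close>

lemma bracket_perp_sym:
  assumes "s \<in> GamP" "b \<in> GamM"
  shows "bracket E s b x = - bracket E b s x"
proof -
  note sb = sub_sections_sec[OF assms(1)] sub_sections_sec[OF assms(2)]
  have "(\<lambda>x. ip E x (s x) (b x)) = (\<lambda>_. 0)"
  proof
    fix x
    show "ip E x (s x) (b x) = 0"
      using perp_ip[OF sub_sections_in[OF assms(2)] sub_sections_in[OF assms(1)]] ip_sym sb sec_fib
      by metis
  qed
  moreover have "d_E E (\<lambda>_. 0) x = 0"
    by (rule fib_eqI[where x = x])
      (simp_all add: d_E_fib d_E_ip C_inf_const fib_zero anchor_const ip_zero_right)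
  ultimately have "bracket E s b x + bracket E b s x = 0"
    using fun_cong[OF bracket_sym[OF sb], of x] by simp
  then show ?thesis by (simp add: add_eq_0_iff2)
qed

lemmas subP_scale = sub_sections_scale[OF V] and subM_scale = sub_sections_scale[OF perp_pseudometric]

lemma GamP_sec: "a \<in> GamP ==> a \<in> Gam A E" and GamM_sec: "b \<in> GamM ==> b \<in> Gam A E"
  by (auto simp: sub_sections_def)

lemma GamP_in: "a \<in> GamP ==> a x \<in> V x" and GamM_in: "b \<in> GamM ==> b x \<in> Vp x"
  by (auto simp: sub_sections_def)

lemma proj_bracket_scale_right:
  assumes "a \<in> GamP" "b \<in> GamM" "f \<in> C_inf A"
  shows "proj E V (bracket E b (\<lambda>y. f y *\<^sub>R a y)) = (\<lambda>x. f x *\<^sub>R proj E V (bracket E b a) x + act E b f x *\<^sub>R a x)"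
proof
  fix x
  note s = GamP_sec[OF assms(1)] GamM_sec[OF assms(2)]
  have "proj E V (\<lambda>x. f x *\<^sub>R bracket E b a x + act E b f x *\<^sub>R a x) x
      = f x *\<^sub>R proj E V (bracket E b a) x + act E b f x *\<^sub>R a x"
    using s bracket_fib sec_fib proj_scale[of "bracket E b a" x f] proj_scale[of a x "act E b f"]
      proj_id[of a x, OF GamP_in[OF assms(1)]] by (simp add: proj_add fib_scale)
  then show "proj E V (bracket E b (\<lambda>y. f y *\<^sub>R a y)) x
      = f x *\<^sub>R proj E V (bracket E b a) x + act E b f x *\<^sub>R a x"
    using leibniz[OF s(2,1) assms(3)] by simp
qed

lemma proj_bracket_scale_left:
  assumes "a \<in> GamP" "b \<in> GamM" "f \<in> C_inf A"
  shows "proj E V (bracket E (\<lambda>y. f y *\<^sub>R b y) a) = (\<lambda>x. f x *\<^sub>R proj E V (bracket E b a) x)"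
proof
  fix x
  note s = GamP_sec[OF assms(1)] GamM_sec[OF assms(2)]
  have fb: "(\<lambda>y. f y *\<^sub>R b y) \<in> GamM" by (rule subM_scale[OF assms(3,2)])
  have "bracket E (\<lambda>y. f y *\<^sub>R b y) a x = f x *\<^sub>R bracket E b a x + (- act E a f x) *\<^sub>R b x"
    using bracket_perp_sym[OF assms(1) fb, of x] bracket_perp_sym[OF assms(1,2), of x]
      fun_cong[OF leibniz[OF s assms(3)], of x] by (simp add: algebra_simps)
  then have "proj E V (bracket E (\<lambda>y. f y *\<^sub>R b y) a) x
      = proj E V (\<lambda>x. f x *\<^sub>R bracket E b a x + (- act E a f x) *\<^sub>R b x) x" by (rule proj_cong)
  also have "... = f x *\<^sub>R proj E V (bracket E b a) x"
    using s bracket_fib sec_fib proj_scale[of "bracket E b a" x f] proj_scale[of b x "\<lambda>x. - act E a f x"]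
      proj_perp_zero[of b x, OF GamM_in[OF assms(2)]]
      proj_add[of "\<lambda>x. f x *\<^sub>R bracket E b a x" x "\<lambda>x. (- act E a f x) *\<^sub>R b x"]
      fib_scale fib_minus by simp
  finally show "proj E V (bracket E (\<lambda>y. f y *\<^sub>R b y) a) x = f x *\<^sub>R proj E V (bracket E b a) x" .
qed

lemma proj_bracket_add_left:
  assumes "a \<in> Gam A E" "b \<in> Gam A E" "b' \<in> Gam A E"
  shows "proj E V (bracket E (\<lambda>y. b y + b' y) a) = (\<lambda>x. proj E V (bracket E b a) x + proj E V (bracket E b' a) x)"
proof
  fix x
  have "proj E V (bracket E (\<lambda>y. b y + b' y) a) x = proj E V (\<lambda>y. bracket E b a y + bracket E b' a y) x"
    using assms by (intro proj_cong) (simp add: bracket_add_left)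
  then show "proj E V (bracket E (\<lambda>y. b y + b' y) a) x
      = proj E V (bracket E b a) x + proj E V (bracket E b' a) x"
    using assms bracket_fib proj_add by simp
qed

lemma proj_bracket_add_right:
  assumes "a \<in> Gam A E" "b \<in> Gam A E" "a' \<in> Gam A E"
  shows "proj E V (bracket E b (\<lambda>y. a y + a' y)) = (\<lambda>x. proj E V (bracket E b a) x + proj E V (bracket E b a') x)"
proof
  fix x
  have "proj E V (bracket E b (\<lambda>y. a y + a' y)) x = proj E V (\<lambda>y. bracket E b a y + bracket E b a' y) x"
    using assms by (intro proj_cong) (simp add: bracket_add_right)
  then show "proj E V (bracket E b (\<lambda>y. a y + a' y)) x
      = proj E V (bracket E b a) x + proj E V (bracket E b a') x"
    using assms bracket_fib proj_add by simp
qed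

text \<open>The map \<open>s \<mapsto> [s, b]\<^sub>-\<close> and the endomorphism \<open>s \<mapsto> [[s, b]\<^sub>-, a]\<^sub>+\<close> whose trace enters the Ricci tensor.\<close>

definition mixed :: "('m => 'v) => ('m => 'v) => 'm => 'v" where
  "mixed b s = proj E Vp (bracket E s b)"

definition ric_endo :: "('m => 'v) => ('m => 'v) => ('m => 'v) => 'm => 'v" where
  "ric_endo a b s = proj E V (bracket E (mixed b s) a)"

lemma mixed_sec: "s \<in> GamP ==> b \<in> GamM ==> mixed b s \<in> GamM"
  unfolding mixed_def by (intro proj_perp_sec bracket_sec GamP_sec GamM_sec)

lemma mixed_add_right:
  assumes "s \<in> GamP" "t \<in> GamP" "b \<in> GamM"
  shows "mixed b (\<lambda>y. s y + t y) = (\<lambda>x. mixed b s x + mixed b t x)"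
proof
  fix x
  note g = GamP_sec[OF assms(1)] GamP_sec[OF assms(2)] GamM_sec[OF assms(3)]
  have "bracket E (\<lambda>y. s y + t y) b = (\<lambda>y. bracket E s b y + bracket E t b y)"
    using g by (intro ext bracket_add_left)
  then show "mixed b (\<lambda>y. s y + t y) x = mixed b s x + mixed b t x"
    unfolding mixed_def using g bracket_fib proj_perp_add by simp
qed

lemma mixed_add_left:
  assumes "s \<in> GamP" "b \<in> GamM" "b' \<in> GamM"
  shows "mixed (\<lambda>y. b y + b' y) s = (\<lambda>x. mixed b s x + mixed b' s x)"
proof
  fix x
  note g = GamP_sec[OF assms(1)] GamM_sec[OF assms(2)] GamM_sec[OF assms(3)]
  have "bracket E s (\<lambda>y. b y + b' y) = (\<lambda>y. bracket E s b y + bracket E s b' y)"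
    using g by (intro ext bracket_add_right)
  then show "mixed (\<lambda>y. b y + b' y) s x = mixed b s x + mixed b' s x"
    unfolding mixed_def using g bracket_fib proj_perp_add by simp
qed

lemma mixed_scale_right:
  assumes "s \<in> GamP" "b \<in> GamM" "f \<in> C_inf A"
  shows "mixed b (\<lambda>y. f y *\<^sub>R s y) = (\<lambda>x. f x *\<^sub>R mixed b s x)"
proof
  fix x
  note g = GamP_sec[OF assms(1)] GamM_sec[OF assms(2)]
  have fs: "(\<lambda>y. f y *\<^sub>R s y) \<in> GamP" by (rule subP_scale[OF assms(3,1)])
  have "bracket E (\<lambda>y. f y *\<^sub>R s y) b = (\<lambda>y. f y *\<^sub>R bracket E s b y + (- act E b f y) *\<^sub>R s y)"
  proof
    fix y
    show "bracket E (\<lambda>y. f y *\<^sub>R s y) b y = f y *\<^sub>R bracket E s b y + (- act E b f y) *\<^sub>R s y"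
      using bracket_perp_sym[OF fs assms(2), of y] bracket_perp_sym[OF assms(1,2), of y]
        fun_cong[OF leibniz[OF g(2,1) assms(3)], of y] by (simp add: algebra_simps)
  qed
  then show "mixed b (\<lambda>y. f y *\<^sub>R s y) x = f x *\<^sub>R mixed b s x"
    unfolding mixed_def
    using proj_perp_add[of "\<lambda>y. f y *\<^sub>R bracket E s b y" x "\<lambda>y. (- act E b f y) *\<^sub>R s y"]
      proj_perp_scale[of "bracket E s b" x f] proj_perp_scale[of s x "\<lambda>y. - act E b f y"]
      proj_perp_V_zero[of s x, OF GamP_in[OF assms(1)]] bracket_fib[OF g] sec_fib[OF g(1)] fib_scale fib_minus
    by simp
qed

lemma mixed_scale_left:
  assumes "s \<in> GamP" "b \<in> GamM" "f \<in> C_inf A"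
  shows "mixed (\<lambda>y. f y *\<^sub>R b y) s = (\<lambda>x. f x *\<^sub>R mixed b s x + act E s f x *\<^sub>R b x)"
proof
  fix x
  note g = GamP_sec[OF assms(1)] GamM_sec[OF assms(2)]
  show "mixed (\<lambda>y. f y *\<^sub>R b y) s x = f x *\<^sub>R mixed b s x + act E s f x *\<^sub>R b x"
    unfolding mixed_def leibniz[OF g assms(3)]
    using proj_perp_add[of "\<lambda>y. f y *\<^sub>R bracket E s b y" x "\<lambda>y. act E s f y *\<^sub>R b y"]
      proj_perp_scale[of "bracket E s b" x f] proj_perp_scale[of b x "act E s f"]
      proj_perp_id[of b x, OF GamM_in[OF assms(2)]] bracket_fib[OF g] sec_fib[OF g(2)] fib_scale
    by simp
qed

lemma ric_endo_sec: "a \<in> GamP ==> b \<in> GamM ==> s \<in> GamP ==> ric_endo a b s \<in> GamP"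
  unfolding ric_endo_def by (intro proj_sec bracket_sec GamP_sec GamM_sec mixed_sec)

lemma ric_endo_pointwise:
  assumes a: "a \<in> GamP" and b: "b \<in> GamM" and "s \<in> GamP" "t \<in> GamP" "s x = t x"
  shows "ric_endo a b s x = ric_endo a b t x"
proof (rule tensorial_pointwise[OF V _ _ assms(3-5)])
  fix s t f assume s: "s \<in> GamP" and t: "t \<in> GamP"
  show "ric_endo a b (\<lambda>y. s y + t y) x = ric_endo a b s x + ric_endo a b t x"
    unfolding ric_endo_def mixed_add_right[OF s t b]
    using proj_bracket_add_left[OF GamP_sec[OF a] GamM_sec[OF mixed_sec[OF s b]] GamM_sec[OF mixed_sec[OF t b]]]
    by simp
next
  fix f s assume f: "f \<in> C_inf A" and s: "s \<in> GamP"
  show "ric_endo a b (\<lambda>y. f y *\<^sub>R s y) x = f x *\<^sub>R ric_endo a b s x"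
    unfolding ric_endo_def mixed_scale_right[OF s b f]
    using proj_bracket_scale_left[OF a mixed_sec[OF s b] f] by simp
qed

definition fibre_base :: "'m => 'v set" where
  "fibre_base x = (SOME B. independent B \<and> span B = V x)"

definition lift :: "'m => 'v => 'm => 'v" where
  "lift x v = (SOME s. s \<in> GamP \<and> s x = v)"

lemma fibre_base: "independent (fibre_base x)" "span (fibre_base x) = V x" "finite (fibre_base x)"
proof -
  obtain e where e: "basis_of scaleR {..<n} e (V x)" using pseudometric_basis[OF V] .
  have "\<exists>B. independent B \<and> span B = V x" using basis_of_real(2,3)[OF _ e] by blast
  then have B: "independent (fibre_base x) \<and> span (fibre_base x) = V x"
    unfolding fibre_base_def by (rule someI_ex)
  then show "independent (fibre_base x)" "span (fibre_base x) = V x" by auto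
  have "fibre_base x \<subseteq> span (e ` {..<n})"
    using B basis_of_real(3)[OF _ e] span_superset[of "fibre_base x"] by simp
  then show "finite (fibre_base x)" using independent_span_bound[of "e ` {..<n}"] B by blast
qed

lemma fibre_base_in: "v \<in> fibre_base x ==> v \<in> V x"
  using fibre_base(2) span_base by metis

lemma lift: "v \<in> V x ==> lift x v \<in> GamP \<and> lift x v x = v"
proof -
  assume "v \<in> V x"
  then obtain s where "s \<in> GamP" "s x = v" by (rule sub_section_through[OF V])
  then show ?thesis unfolding lift_def by (intro someI[where P = "\<lambda>s. s \<in> GamP \<and> s x = v" and x = s]) simp
qed

lemma GRic_eq:
  "GRic A E V dv a b x = dv (proj E V (bracket E b a)) x - act E b (dv a) x
    - (\<Sum>v\<in>fibre_base x. representation (fibre_base x) (ric_endo a b (lift x v) x) v)"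
  unfolding GRic_def trace_on_def induced_endo_def Let_def lift_def fibre_base_def ric_endo_def mixed_def ..

text \<open>Rank one endomorphisms \<open>s \<mapsto> L(s) a\<close> arise where the Leibniz rule differentiates a function.\<close>

lemma trace_rank_one:
  fixes L :: "('m => 'v) => real"
  assumes add: "\<And>s t. s \<in> GamP ==> t \<in> GamP ==> L (\<lambda>y. s y + t y) = L s + L t"
    and hom: "\<And>f s. f \<in> C_inf A ==> s \<in> GamP ==> L (\<lambda>y. f y *\<^sub>R s y) = f x * L s"
    and a: "a \<in> GamP"
  shows "(\<Sum>v\<in>fibre_base x. representation (fibre_base x) (a x) v * L (lift x v)) = L a"
proof -
  let ?c = "representation (fibre_base x) (a x)"
  have lifts: "lift x v \<in> GamP" "lift x v x = v" if "v \<in> fibre_base x" for v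
    using lift[OF fibre_base_in[OF that]] by auto
  have zero: "L (\<lambda>_. 0) = 0" using hom[OF C_inf_const[of 0] a] by simp
  have mem: "(\<lambda>y. \<Sum>v\<in>I. ?c v *\<^sub>R lift x v y) \<in> GamP" if "I \<subseteq> fibre_base x" for I
    using that by (intro sub_sections_sum[OF V] subP_scale C_inf_const lifts) auto
  have "L (\<lambda>y. \<Sum>v\<in>I. ?c v *\<^sub>R lift x v y) = (\<Sum>v\<in>I. ?c v * L (lift x v))"
    if "I \<subseteq> fibre_base x" "finite I" for I
    using that(2,1)
  proof (induction I rule: finite_induct)
    case (insert v I)
    then have v: "lift x v \<in> GamP" using lifts by blast
    have "L (\<lambda>y. ?c v *\<^sub>R lift x v y + (\<Sum>v\<in>I. ?c v *\<^sub>R lift x v y))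
        = L (\<lambda>y. ?c v *\<^sub>R lift x v y) + L (\<lambda>y. \<Sum>v\<in>I. ?c v *\<^sub>R lift x v y)"
      using insert.prems by (intro add subP_scale C_inf_const v mem) auto
    then show ?case using insert hom[OF C_inf_const v] by simp
  qed (simp add: zero)
  from this[OF order_refl fibre_base(3)]
  have "(\<Sum>v\<in>fibre_base x. ?c v * L (lift x v)) = L (\<lambda>y. \<Sum>v\<in>fibre_base x. ?c v *\<^sub>R lift x v y)"
    by simp
  also have "... = L a"
  proof (rule tensorial_pointwise[OF V add _ mem[OF order_refl] a])
    show "L (\<lambda>y. f y *\<^sub>R s y) = f x *\<^sub>R L s" if "f \<in> C_inf A" "s \<in> GamP" for f s
      using hom[OF that] by simp
    have "(\<Sum>v\<in>fibre_base x. ?c v *\<^sub>R lift x v x) = (\<Sum>v\<in>fibre_base x. ?c v *\<^sub>R v)"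
      using lifts by (intro sum.cong) auto
    also have "... = a x"
      using sum_representation_eq[OF fibre_base(1) _ fibre_base(3) order_refl, of "a x" x]
        GamP_in[OF a] fibre_base(2) by simp
    finally show "(\<Sum>v\<in>fibre_base x. ?c v *\<^sub>R lift x v x) = a x" .
  qed
  finally show ?thesis .
qed

lemma rep_add: "u \<in> V x ==> w \<in> V x ==> representation (fibre_base x) (u + w) v
    = representation (fibre_base x) u v + representation (fibre_base x) w v"
  using representation_add[OF fibre_base(1), of w x u] fibre_base(2) by simp

lemma rep_scale: "u \<in> V x ==> representation (fibre_base x) (c *\<^sub>R u) v = c * representation (fibre_base x) u v"
  using representation_scale[OF fibre_base(1), of u x c] fibre_base(2) by simp

lemma GRic_add_left:
  assumes a: "a \<in> GamP" "a' \<in> GamP" and b: "b \<in> GamM"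
  shows "GRic A E V dv (\<lambda>y. a y + a' y) b x = GRic A E V dv a b x + GRic A E V dv a' b x"
proof -
  note g = GamP_sec[OF a(1)] GamP_sec[OF a(2)] GamM_sec[OF b]
  have "dv (\<lambda>y. a y + a' y) = (\<lambda>y. dv a y + dv a' y)" using dv_add g by blast
  then have 2: "act E b (dv (\<lambda>y. a y + a' y)) x = act E b (dv a) x + act E b (dv a') x"
    using g by (simp add: act_apply anchor_add_fun sec_fib dv_C_inf)
  have 1: "dv (proj E V (bracket E b (\<lambda>y. a y + a' y))) x
      = dv (proj E V (bracket E b a)) x + dv (proj E V (bracket E b a')) x"
    unfolding proj_bracket_add_right[OF g(1,3,2)]
    by (intro dv_add GamP_sec proj_sec bracket_sec g)
  have "ric_endo (\<lambda>y. a y + a' y) b s x = ric_endo a b s x + ric_endo a' b s x" if s: "s \<in> GamP" for s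
    unfolding ric_endo_def
    using proj_bracket_add_right[OF g(1) GamM_sec[OF mixed_sec[OF s b]] g(2)] by simp
  then have "representation (fibre_base x) (ric_endo (\<lambda>y. a y + a' y) b (lift x v) x) v
      = representation (fibre_base x) (ric_endo a b (lift x v) x) v
        + representation (fibre_base x) (ric_endo a' b (lift x v) x) v" if "v \<in> fibre_base x" for v
    using lift[OF fibre_base_in[OF that]] rep_add GamP_in ric_endo_sec a b by simp
  then show ?thesis unfolding GRic_eq using 1 2 by (simp add: sum.distrib)
qed

lemma GRic_add_right:
  assumes a: "a \<in> GamP" and b: "b \<in> GamM" "b' \<in> GamM"
  shows "GRic A E V dv a (\<lambda>y. b y + b' y) x = GRic A E V dv a b x + GRic A E V dv a b' x"
proof -
  note g = GamP_sec[OF a] GamM_sec[OF b(1)] GamM_sec[OF b(2)]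
  have 2: "act E (\<lambda>y. b y + b' y) (dv a) x = act E b (dv a) x + act E b' (dv a) x"
    using g by (simp add: act_apply anchor_add_vec sec_fib dv_C_inf)
  have 1: "dv (proj E V (bracket E (\<lambda>y. b y + b' y) a)) x
      = dv (proj E V (bracket E b a)) x + dv (proj E V (bracket E b' a)) x"
    unfolding proj_bracket_add_left[OF g]
    by (intro dv_add GamP_sec proj_sec bracket_sec g)
  have "ric_endo a (\<lambda>y. b y + b' y) s x = ric_endo a b s x + ric_endo a b' s x" if s: "s \<in> GamP" for s
    unfolding ric_endo_def mixed_add_left[OF s b]
    using proj_bracket_add_left[OF g(1) GamM_sec[OF mixed_sec[OF s b(1)]] GamM_sec[OF mixed_sec[OF s b(2)]]] by simp
  then have "representation (fibre_base x) (ric_endo a (\<lambda>y. b y + b' y) (lift x v) x) v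
      = representation (fibre_base x) (ric_endo a b (lift x v) x) v
        + representation (fibre_base x) (ric_endo a b' (lift x v) x) v" if "v \<in> fibre_base x" for v
    using lift[OF fibre_base_in[OF that]] rep_add GamP_in ric_endo_sec a b by simp
  then show ?thesis unfolding GRic_eq using 1 2 by (simp add: sum.distrib)
qed

text \<open>The second derivatives of \<open>f\<close> combine to \<open>[a, b] \<cdot> f\<close>; the trace contributes \<open>[a, b]\<^sub>- \<cdot> f\<close>, the first
  term \<open>[b, a]\<^sub>+ \<cdot> f\<close>, and everything cancels because \<open>[b, a] = - [a, b]\<close>.\<close>

lemma GRic_scale_left:
  assumes "0 < r" and a: "a \<in> GamP" and b: "b \<in> GamM" and f: "f \<in> C_inf A"
  shows "GRic A E V dv (\<lambda>y. f y *\<^sub>R a y) b x = f x * GRic A E V dv a b x"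
proof -
  note g = GamP_sec[OF a] GamM_sec[OF b]
  let ?p = "proj E V (bracket E b a)"
  have p: "?p \<in> GamP" by (intro proj_sec bracket_sec g)
  have bf: "act E b f \<in> C_inf A" and af: "act E a f \<in> C_inf A" by (intro act_C_inf g f)+
  have 1: "dv (proj E V (bracket E b (\<lambda>y. f y *\<^sub>R a y))) x
      = f x * dv ?p x + act E ?p f x + act E b f x * dv a x + act E a (act E b f) x"
    unfolding proj_bracket_scale_right[OF a b f]
    using dv_add[OF sec_scale[OF f GamP_sec[OF p]] sec_scale[OF bf g(1)], of x]
      fun_cong[OF dv_leibniz[OF GamP_sec[OF p] f], of x] fun_cong[OF dv_leibniz[OF g(1) bf], of x] by simp
  have 2: "act E b (dv (\<lambda>y. f y *\<^sub>R a y)) x = f x * act E b (dv a) x + act E b f x * dv a x + act E b (act E a f) x"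
    unfolding dv_leibniz[OF g(1) f]
    using g f af by (simp add: act_apply[where u = b] anchor_add_fun anchor_mult_fun sec_fib dv_C_inf C_inf_mult)
  have re: "ric_endo (\<lambda>y. f y *\<^sub>R a y) b s x = f x *\<^sub>R ric_endo a b s x + act E (mixed b s) f x *\<^sub>R a x"
    if "s \<in> GamP" for s
    unfolding ric_endo_def using proj_bracket_scale_right[OF a mixed_sec[OF that b] f] by simp
  have "(\<Sum>v\<in>fibre_base x. representation (fibre_base x) (ric_endo (\<lambda>y. f y *\<^sub>R a y) b (lift x v) x) v)
      = (\<Sum>v\<in>fibre_base x. f x * representation (fibre_base x) (ric_endo a b (lift x v) x) v
          + representation (fibre_base x) (a x) v * act E (mixed b (lift x v)) f x)"
  proof (rule sum.cong, rule refl)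
    fix v assume v: "v \<in> fibre_base x"
    have s: "lift x v \<in> GamP" using lift[OF fibre_base_in[OF v]] by blast
    show "representation (fibre_base x) (ric_endo (\<lambda>y. f y *\<^sub>R a y) b (lift x v) x) v
        = f x * representation (fibre_base x) (ric_endo a b (lift x v) x) v
          + representation (fibre_base x) (a x) v * act E (mixed b (lift x v)) f x"
      unfolding re[OF s]
      using GamP_in[OF ric_endo_sec[OF a b s], of x] GamP_in[OF a, of x] pseudometric_scale[OF V]
      by (simp add: rep_add rep_scale)
  qed
  also have "... = f x * (\<Sum>v\<in>fibre_base x. representation (fibre_base x) (ric_endo a b (lift x v) x) v)
      + act E (mixed b a) f x"
    unfolding sum.distrib sum_distrib_left[symmetric]
  proof (subst trace_rank_one[where L = "\<lambda>s. act E (mixed b s) f x" and a = a, OF _ _ a])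
    fix s t assume st: "s \<in> GamP" "t \<in> GamP"
    show "act E (mixed b (\<lambda>y. s y + t y)) f x = act E (mixed b s) f x + act E (mixed b t) f x"
      unfolding mixed_add_right[OF st b]
      using sec_fib[OF GamM_sec[OF mixed_sec[OF st(1) b]]] sec_fib[OF GamM_sec[OF mixed_sec[OF st(2) b]]] f
      by (simp add: act_apply anchor_add_vec)
  next
    fix h s assume hs: "h \<in> C_inf A" "s \<in> GamP"
    show "act E (mixed b (\<lambda>y. h y *\<^sub>R s y)) f x = h x * act E (mixed b s) f x"
      unfolding mixed_scale_right[OF hs(2) b hs(1)]
      using sec_fib[OF GamM_sec[OF mixed_sec[OF hs(2) b]]] f
      by (simp add: act_apply anchor_scale_vec)
  qed simp
  finally have 3: "(\<Sum>v\<in>fibre_base x. representation (fibre_base x) (ric_endo (\<lambda>y. f y *\<^sub>R a y) b (lift x v) x) v)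
      = f x * (\<Sum>v\<in>fibre_base x. representation (fibre_base x) (ric_endo a b (lift x v) x) v)
        + act E (mixed b a) f x" .
  have "act E ?p f x + act E a (act E b f) x - act E b (act E a f) x - act E (mixed b a) f x = 0"
  proof -
    have ab: "bracket E a b x \<in> fib E x" "bracket E b a x \<in> fib E x" using bracket_fib g by blast+
    have pf: "?p x \<in> fib E x" using sec_fib[OF GamP_sec[OF p]] .
    have "proj E V (bracket E a b) x = proj E V (\<lambda>x. (-1) *\<^sub>R bracket E b a x) x"
      using bracket_perp_sym[OF a b] by (intro proj_cong) simp
    then have "proj E V (bracket E a b) x = - ?p x" using proj_scale[of "bracket E b a" x "\<lambda>_. -1"] ab by simp
    then have "mixed b a x = bracket E a b x + ?p x"
      unfolding mixed_def using proj_perp[of "bracket E a b" x] ab by simp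
    then show ?thesis
      using anchor_bracket[OF assms(1) g f, of x] ab pf f by (simp add: act_apply anchor_add_vec)
  qed
  then show ?thesis unfolding GRic_eq 1 2 3 by (simp add: algebra_simps)
qed

text \<open>Scaling \<open>b\<close> by \<open>f\<close> differentiates \<open>f\<close> in two terms: the divergence contributes \<open>[b, a]\<^sub>+ \<cdot> f\<close>, and the trace
  that of \<open>s \<mapsto> (s \<cdot> f) [b, a]\<^sub>+\<close>, which is the same.\<close>

lemma GRic_scale_right:
  assumes a: "a \<in> GamP" and b: "b \<in> GamM" and f: "f \<in> C_inf A"
  shows "GRic A E V dv a (\<lambda>y. f y *\<^sub>R b y) x = f x * GRic A E V dv a b x"
proof -
  note g = GamP_sec[OF a] GamM_sec[OF b]
  let ?p = "proj E V (bracket E b a)"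
  have p: "?p \<in> GamP" by (intro proj_sec bracket_sec g)
  have 1: "dv (proj E V (bracket E (\<lambda>y. f y *\<^sub>R b y) a)) x = f x * dv ?p x + act E ?p f x"
    unfolding proj_bracket_scale_left[OF a b f] using dv_leibniz[OF GamP_sec[OF p] f] by simp
  have 2: "act E (\<lambda>y. f y *\<^sub>R b y) (dv a) x = f x * act E b (dv a) x"
    using g by (simp add: act_apply anchor_scale_vec sec_fib dv_C_inf)
  have re: "ric_endo a (\<lambda>y. f y *\<^sub>R b y) s x = f x *\<^sub>R ric_endo a b s x + act E s f x *\<^sub>R ?p x"
    if s: "s \<in> GamP" for s
  proof -
    have sf: "act E s f \<in> C_inf A" by (intro act_C_inf GamP_sec s f)
    have m: "mixed b s \<in> GamM" by (rule mixed_sec[OF s b])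
    show ?thesis
      unfolding ric_endo_def mixed_scale_left[OF s b f]
      using fun_cong[OF proj_bracket_add_left[OF g(1) sec_scale[OF f GamM_sec[OF m]] sec_scale[OF sf g(2)]], of x]
        fun_cong[OF proj_bracket_scale_left[OF a m f], of x] fun_cong[OF proj_bracket_scale_left[OF a b sf], of x]
      by simp
  qed
  have "(\<Sum>v\<in>fibre_base x. representation (fibre_base x) (ric_endo a (\<lambda>y. f y *\<^sub>R b y) (lift x v) x) v)
      = (\<Sum>v\<in>fibre_base x. f x * representation (fibre_base x) (ric_endo a b (lift x v) x) v
          + representation (fibre_base x) (?p x) v * act E (lift x v) f x)"
  proof (rule sum.cong, rule refl)
    fix v assume v: "v \<in> fibre_base x"
    have s: "lift x v \<in> GamP" using lift[OF fibre_base_in[OF v]] by blast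
    show "representation (fibre_base x) (ric_endo a (\<lambda>y. f y *\<^sub>R b y) (lift x v) x) v
        = f x * representation (fibre_base x) (ric_endo a b (lift x v) x) v
          + representation (fibre_base x) (?p x) v * act E (lift x v) f x"
      unfolding re[OF s]
      using GamP_in[OF ric_endo_sec[OF a b s], of x] GamP_in[OF p, of x] pseudometric_scale[OF V]
      by (simp add: rep_add rep_scale)
  qed
  also have "... = f x * (\<Sum>v\<in>fibre_base x. representation (fibre_base x) (ric_endo a b (lift x v) x) v)
      + act E ?p f x"
    unfolding sum.distrib sum_distrib_left[symmetric]
    by (subst trace_rank_one[where L = "\<lambda>s. act E s f x" and a = ?p, OF _ _ p])
      (use f in \<open>simp_all add: act_apply anchor_add_vec anchor_scale_vec sec_fib GamP_sec\<close>)
  finally show ?thesis unfolding GRic_eq 1 2 by (simp add: algebra_simps)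
qed

theorem GRic_pointwise:
  assumes "0 < r" "a \<in> GamP" "a' \<in> GamP" "a x = a' x" "b \<in> GamM" "b' \<in> GamM" "b x = b' x"
  shows "GRic A E V dv a b x = GRic A E V dv a' b' x"
proof -
  have "GRic A E V dv a b x = GRic A E V dv a' b x"
    using GRic_add_left GRic_scale_left[OF assms(1)] assms(5)
    by (intro tensorial_pointwise[where \<Phi> = "\<lambda>a. GRic A E V dv a b x", OF V _ _ assms(2-4)]) auto
  also have "... = GRic A E V dv a' b' x"
    using GRic_add_right GRic_scale_right assms(3)
    by (intro tensorial_pointwise[where \<Phi> = "\<lambda>b. GRic A E V dv a' b x", OF perp_pseudometric _ _ assms(5-7)]) auto
  finally show ?thesis .
qed

end

section \<open>Change of frame\<close>

context courant_alg
begin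

lemma ip_comb_left:
  assumes "\<And>i. i \<in> I ==> u i \<in> fib E x" "w \<in> fib E x"
  shows "ip E x (\<Sum>i\<in>I. c i *\<^sub>R u i) w = (\<Sum>i\<in>I. c i * ip E x (u i) w)"
proof -
  have "ip E x (\<Sum>i\<in>I. c i *\<^sub>R u i) w = (\<Sum>i\<in>I. ip E x (c i *\<^sub>R u i) w)"
    by (rule ip_sum_left) (auto intro: fib_scale assms)
  then show ?thesis using assms by (simp add: ip_scale_left)
qed

lemma ip_comb_right:
  assumes "\<And>i. i \<in> I ==> u i \<in> fib E x" "w \<in> fib E x"
  shows "ip E x w (\<Sum>i\<in>I. c i *\<^sub>R u i) = (\<Sum>i\<in>I. c i * ip E x w (u i))"
proof -
  have "ip E x w (\<Sum>i\<in>I. c i *\<^sub>R u i) = (\<Sum>i\<in>I. ip E x w (c i *\<^sub>R u i))"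
    by (rule ip_sum_right) (auto intro: fib_scale assms)
  then show ?thesis using assms by (simp add: ip_scale_right)
qed

lemma anchor_comb:
  assumes "\<And>i. i \<in> I ==> u i \<in> fib E x" "f \<in> C_inf A"
  shows "anchor E x (\<Sum>i\<in>I. c i *\<^sub>R u i) f = (\<Sum>i\<in>I. c i * anchor E x (u i) f)"
proof -
  have "anchor E x (\<Sum>i\<in>I. c i *\<^sub>R u i) f = (\<Sum>i\<in>I. anchor E x (c i *\<^sub>R u i) f)"
    by (rule anchor_sum_vec) (auto intro: fib_scale assms)
  then show ?thesis using assms by (simp add: anchor_scale_vec)
qed

end

subsection \<open>Constant changes of frame\<close>

text \<open>A frame \<open>e\<close> near \<open>x\<close> is replaced by the frame \<open>on\<close> of those combinations of \<open>e\<close> with constant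
  coefficients whose values at \<open>x\<close> are a given orthonormal basis \<open>b\<close>.  Expressions in which
  \<open>e\<close> is contracted with the dual frame \<open>raised E x e\<close> do not change.\<close>

locale basis_change = courant_alg A E
  for A :: "('m::{t2_space, second_countable_topology}, 'b::{real_inner, heine_borel}) atlas"
    and E :: "('m, 'v::real_vector) courant" +
  fixes x :: 'm and e :: "nat => 'm => 'v" and \<mu> :: "nat => real" and b :: "nat => 'v" and k :: "nat => nat => real"
  assumes e_sec: "\<And>i. i < r ==> e i \<in> Gam A E"
    and basis: "basis_of scaleR {..<r} (\<lambda>i. e i x) (fib E x)"
    and b: "orthonormal r x \<mu> b"
    and k: "\<And>i. i < r ==> b i = (\<Sum>j<r. k i j *\<^sub>R e j x)"
begin

definition comb :: "(nat => real) => 'm => 'v" where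
  "comb c = (\<lambda>y. \<Sum>i<r. c i *\<^sub>R e i y)"

definition on :: "nat => 'm => 'v" where
  "on i = comb (k i)"

lemma on_at: "i < r ==> on i x = b i"
  using k by (simp add: on_def comb_def)

lemma comb_sec: "comb c \<in> Gam A E"
  unfolding comb_def by (intro sec_sum sec_const_scale e_sec) auto

lemma on_sec: "on i \<in> Gam A E"
  by (simp add: on_def comb_sec)

lemma e_fib: "i < r ==> e i y \<in> fib E y"
  using e_sec sec_fib by blast

lemma dual_coefficients:
  assumes "i < r" "j < r"
  shows "(\<Sum>g<r. \<mu> g * ip E x (b g) (e j x) * k g i) = (if i = j then 1 else 0)"
proof -
  have "e j x = (\<Sum>g<r. (\<mu> g * ip E x (e j x) (b g)) *\<^sub>R b g)"
    by (rule orthonormal_expand[OF b e_fib[OF assms(2)]])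
  also have "... = (\<Sum>g<r. (\<mu> g * ip E x (e j x) (b g)) *\<^sub>R (\<Sum>i<r. k g i *\<^sub>R e i x))"
    using k by simp
  also have "... = (\<Sum>i<r. (\<Sum>g<r. \<mu> g * ip E x (b g) (e j x) * k g i) *\<^sub>R e i x)"
    unfolding scaleR_sum_right scaleR_sum_left
    by (subst sum.swap) (auto intro!: sum.cong simp: ip_sym[OF e_fib[OF assms(2)] orthonormal_fib[OF b]])
  finally have "(\<Sum>i<r. (\<Sum>g<r. \<mu> g * ip E x (b g) (e j x) * k g i) *\<^sub>R e i x) = e j x" by simp
  also have "e j x = (\<Sum>i<r. (if i = j then 1 else 0) *\<^sub>R e i x)"
    using assms(2) by (simp add: if_distrib[of "\<lambda>c. c *\<^sub>R _"] cong: if_cong)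
  finally show ?thesis
    by (rule real_vector.basis_of_unique[OF basis]) (use assms(1) in simp)
qed

lemma inv_gram_eq:
  assumes "i < r" "j < r"
  shows "inv_gram E x e i j = (\<Sum>g<r. \<mu> g * k g i * k g j)"
proof -
  define h where "h i j = (if i < r \<and> j < r then \<Sum>g<r. \<mu> g * k g i * k g j else 0)" for i j
  let ?P = "\<lambda>h. (\<forall>i j. i \<ge> r \<or> j \<ge> r \<longrightarrow> h i j = 0) \<and>
     (\<forall>i<r. \<forall>j<r. (\<Sum>g<r. h i g * ip E x (e g x) (e j x)) = (if i = j then 1 else 0))"
  have ipb: "ip E x (b g) (e j x) = (\<Sum>l<r. k g l * ip E x (e l x) (e j x))" if "g < r" "j < r" for g j
    unfolding k[OF that(1)] by (rule ip_comb_left) (use e_fib that in auto)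
  have "(\<Sum>l<r. h i l * ip E x (e l x) (e j x)) = (if i = j then 1 else 0)" if "i < r" "j < r" for i j
  proof -
    have "(\<Sum>l<r. h i l * ip E x (e l x) (e j x))
        = (\<Sum>l<r. \<Sum>g<r. \<mu> g * k g i * (k g l * ip E x (e l x) (e j x)))"
      using that(1) by (intro sum.cong) (auto simp: h_def sum_distrib_right mult.assoc)
    also have "... = (\<Sum>g<r. \<mu> g * ip E x (b g) (e j x) * k g i)"
      by (subst sum.swap) (auto intro!: sum.cong simp: ipb that sum_distrib_left mult_ac)
    finally show ?thesis using dual_coefficients[OF that] by simp
  qed
  then have Ph: "?P h" by (auto simp: h_def)
  have "h' = h" if h': "?P h'" for h'
  proof (intro ext)
    fix i j
    show "h' i j = h i j"
    proof (cases "i < r \<and> j < r")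
      case True
      define w where "w = (\<Sum>g<r. (h' i g - h i g) *\<^sub>R e g x)"
      have wf: "w \<in> fib E x" unfolding w_def by (intro fib_sum fib_scale e_fib) auto
      have we: "ip E x w (e l x) = 0" if "l < r" for l
      proof -
        have "ip E x w (e l x) = (\<Sum>g<r. (h' i g - h i g) * ip E x (e g x) (e l x))"
          unfolding w_def by (rule ip_comb_left) (use e_fib that in auto)
        also have "... = 0" using h' Ph True that by (simp add: left_diff_distrib sum_subtractf)
        finally show ?thesis .
      qed
      have "w = 0"
      proof (rule ip_nondeg[OF wf])
        fix v assume "v \<in> fib E x"
        then obtain c where "v = (\<Sum>l<r. c l *\<^sub>R e l x)" using basis unfolding basis_of_def by blast
        moreover have "ip E x w (\<Sum>l<r. c l *\<^sub>R e l x) = (\<Sum>l<r. c l * ip E x w (e l x))"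
          by (rule ip_comb_right) (use e_fib wf in auto)
        ultimately show "ip E x w v = 0" using we by simp
      qed
      then have "h' i j - h i j = 0"
        using basis[unfolded basis_of_def, THEN conjunct2, rule_format, of "\<lambda>g. h' i g - h i g" j] True
        unfolding w_def by simp
      then show ?thesis by simp
    next
      case False
      then show ?thesis using h' by (auto simp: h_def)
    qed
  qed
  with Ph have "(THE h. ?P h) = h" by (rule the_equality)
  then show ?thesis using assms by (simp add: inv_gram_def h_def)
qed

lemma raised_comb: "raised E x e i = comb (inv_gram E x e i)"
  by (simp add: raised_def comb_def)

lemma raised_sec: "raised E x e i \<in> Gam A E"
  by (simp add: raised_comb comb_sec)

lemma e_comb: "i < r ==> e i = comb (\<lambda>j. if j = i then 1 else 0)"
  by (auto simp: comb_def if_distrib[of "\<lambda>c. c *\<^sub>R _"] cong: if_cong)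

definition frame_linear :: "(real => 'c => 'c) => (('m => 'v) => 'c::ab_group_add) => bool" where
  "frame_linear sc L \<longleftrightarrow> (\<forall>c. L (comb c) = (\<Sum>i<r. sc (c i) (L (e i))))"

text \<open>The dual frame has the coefficients of the inverse Gram matrix, \<open>\<Sum>\<^sub>g \<mu>\<^sub>g k\<^sub>g\<^sub>i k\<^sub>g\<^sub>j\<close>, so summing over \<open>i\<close> and
  expanding both arguments turns the contraction into a sum over \<open>g\<close>.  Partial contractions, over the
  indices of \<open>V\<close> or of \<open>V\<^sup>\<bottom>\<close>, survive when the change of frame is block diagonal.\<close>

lemma contraction:
  fixes sc :: "real => 'c => 'c::ab_group_add"
  assumes sc: "vector_space sc" and N: "N \<subseteq> {..<r}"
    and block: "\<And>i j. i < r ==> j < r ==> (i \<in> N) \<noteq> (j \<in> N) ==> k i j = 0"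
    and left: "\<And>c. frame_linear sc (\<lambda>u. B u (comb c))"
    and right: "\<And>c. frame_linear sc (\<lambda>v. B (comb c) v)"
  shows "(\<Sum>i\<in>N. B (raised E x e i) (e i)) = (\<Sum>g\<in>N. sc (\<mu> g) (B (on g) (on g)))"
proof -
  interpret S: vector_space sc by (rule sc)
  have fin: "finite N" using N finite_subset by blast
  have Bee: "B (comb c) (e i) = (\<Sum>j<r. sc (c j) (B (e j) (e i)))" if "i < r" for c i
    using left[of "\<lambda>j. if j = i then 1 else 0"] that unfolding frame_linear_def e_comb[OF that, symmetric] by blast
  have Bon: "B (on g) (on g) = (\<Sum>i<r. \<Sum>j<r. sc (k g i * k g j) (B (e j) (e i)))" for g
    using right[of "k g"] unfolding frame_linear_def on_def by (simp add: Bee S.scale_sum_right)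
  have "(\<Sum>i\<in>N. B (raised E x e i) (e i))
      = (\<Sum>i\<in>N. \<Sum>j<r. \<Sum>g<r. sc (\<mu> g * k g i * k g j) (B (e j) (e i)))"
    using N by (intro sum.cong) (auto simp: raised_comb Bee inv_gram_eq S.scale_sum_left subset_eq)
  also have "... = (\<Sum>i\<in>N. \<Sum>g<r. \<Sum>j<r. sc (\<mu> g * k g i * k g j) (B (e j) (e i)))"
    by (intro sum.cong refl sum.swap)
  also have "... = (\<Sum>g<r. \<Sum>i\<in>N. \<Sum>j<r. sc (\<mu> g * k g i * k g j) (B (e j) (e i)))"
    by (rule sum.swap)
  also have "... = (\<Sum>g\<in>N. \<Sum>i\<in>N. \<Sum>j<r. sc (\<mu> g * k g i * k g j) (B (e j) (e i)))"
    using N block by (intro sum.mono_neutral_right) (auto simp: subset_eq)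
  also have "... = (\<Sum>g\<in>N. \<Sum>i<r. \<Sum>j<r. sc (\<mu> g * k g i * k g j) (B (e j) (e i)))"
    using N block by (intro sum.cong refl sum.mono_neutral_left) (auto simp: subset_eq)
  also have "... = (\<Sum>g\<in>N. sc (\<mu> g) (B (on g) (on g)))"
    by (simp add: Bon S.scale_sum_right mult.assoc)
  finally show ?thesis .
qed

text \<open>A contraction over three index pairs is carried out one pair at a time.\<close>

lemma triple_contraction:
  fixes sc :: "real => 'c => 'c::ab_group_add"
  assumes sc: "vector_space sc" and N: "N \<subseteq> {..<r}" and M: "M \<subseteq> {..<r}"
    and blN: "\<And>i j. i < r ==> j < r ==> (i \<in> N) \<noteq> (j \<in> N) ==> k i j = 0"
    and blM: "\<And>i j. i < r ==> j < r ==> (i \<in> M) \<noteq> (j \<in> M) ==> k i j = 0"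
    and lin: "\<And>u v w u' v' w'. {u, v, w, u', v', w'} \<subseteq> Gam A E ==>
      frame_linear sc (\<lambda>z. Q z v w u' v' w') \<and> frame_linear sc (\<lambda>z. Q u z w u' v' w') \<and>
      frame_linear sc (\<lambda>z. Q u v z u' v' w') \<and> frame_linear sc (\<lambda>z. Q u v w z v' w') \<and>
      frame_linear sc (\<lambda>z. Q u v w u' z w') \<and> frame_linear sc (\<lambda>z. Q u v w u' v' z)"
  shows "(\<Sum>a\<in>N. \<Sum>b\<in>N. \<Sum>c\<in>M. Q (e a) (e b) (e c) (raised E x e a) (raised E x e b) (raised E x e c))
    = (\<Sum>a\<in>N. \<Sum>b\<in>N. \<Sum>c\<in>M. sc (\<mu> a * \<mu> b * \<mu> c) (Q (on a) (on b) (on c) (on a) (on b) (on c)))"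
proof -
  interpret S: vector_space sc by (rule sc)
  let ?e' = "raised E x e"
  note mem = raised_sec on_sec comb_sec
  have Nr: "e i \<in> Gam A E" if "i \<in> N" for i using that N e_sec by blast
  have c1: "(\<Sum>c\<in>M. Q u v (e c) u' v' (?e' c)) = (\<Sum>c\<in>M. sc (\<mu> c) (Q u v (on c) u' v' (on c)))"
    if "{u, v, u', v'} \<subseteq> Gam A E" for u v u' v'
    by (rule contraction[OF sc M blM, where B = "\<lambda>z y. Q u v y u' v' z"]) (use lin that mem in auto)
  have c2: "(\<Sum>b\<in>N. Q u (e b) w u' (?e' b) w') = (\<Sum>b\<in>N. sc (\<mu> b) (Q u (on b) w u' (on b) w'))"
    if "{u, w, u', w'} \<subseteq> Gam A E" for u w u' w'
    by (rule contraction[OF sc N blN, where B = "\<lambda>z y. Q u y w u' z w'"]) (use lin that mem in auto)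
  have c3: "(\<Sum>a\<in>N. Q (e a) v w (?e' a) v' w') = (\<Sum>a\<in>N. sc (\<mu> a) (Q (on a) v w (on a) v' w'))"
    if "{v, w, v', w'} \<subseteq> Gam A E" for v w v' w'
    by (rule contraction[OF sc N blN, where B = "\<lambda>z y. Q y v w z v' w'"]) (use lin that mem in auto)
  have "(\<Sum>a\<in>N. \<Sum>b\<in>N. \<Sum>c\<in>M. Q (e a) (e b) (e c) (?e' a) (?e' b) (?e' c))
      = (\<Sum>a\<in>N. \<Sum>b\<in>N. \<Sum>c\<in>M. sc (\<mu> c) (Q (e a) (e b) (on c) (?e' a) (?e' b) (on c)))"
    by (rule sum.cong[OF refl], rule sum.cong[OF refl], rule c1) (use Nr mem in auto)
  also have "... = (\<Sum>a\<in>N. \<Sum>c\<in>M. \<Sum>b\<in>N. sc (\<mu> c) (Q (e a) (e b) (on c) (?e' a) (?e' b) (on c)))"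
    by (intro sum.cong refl sum.swap)
  also have "... = (\<Sum>a\<in>N. \<Sum>c\<in>M. sc (\<mu> c) (\<Sum>b\<in>N. sc (\<mu> b) (Q (e a) (on b) (on c) (?e' a) (on b) (on c))))"
    unfolding S.scale_sum_right[symmetric] by (intro sum.cong refl) (use Nr mem c2 in simp)
  also have "... = (\<Sum>c\<in>M. \<Sum>b\<in>N. \<Sum>a\<in>N. sc (\<mu> c) (sc (\<mu> b) (Q (e a) (on b) (on c) (?e' a) (on b) (on c))))"
    unfolding S.scale_sum_right by (rule trans[OF sum.swap]) (intro sum.cong refl sum.swap)
  also have "... = (\<Sum>c\<in>M. \<Sum>b\<in>N. sc (\<mu> c) (sc (\<mu> b) (\<Sum>a\<in>N. sc (\<mu> a) (Q (on a) (on b) (on c) (on a) (on b) (on c)))))"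
    unfolding S.scale_sum_right[symmetric] by (intro sum.cong refl) (use mem c3 in simp)
  also have "... = (\<Sum>c\<in>M. \<Sum>b\<in>N. \<Sum>a\<in>N. sc (\<mu> a * \<mu> b * \<mu> c) (Q (on a) (on b) (on c) (on a) (on b) (on c)))"
    unfolding S.scale_sum_right by (simp add: mult_ac)
  also have "... = (\<Sum>b\<in>N. \<Sum>a\<in>N. \<Sum>c\<in>M. sc (\<mu> a * \<mu> b * \<mu> c) (Q (on a) (on b) (on c) (on a) (on b) (on c)))"
    by (rule trans[OF sum.swap]) (intro sum.cong refl sum.swap)
  also have "... = (\<Sum>a\<in>N. \<Sum>b\<in>N. \<Sum>c\<in>M. sc (\<mu> a * \<mu> b * \<mu> c) (Q (on a) (on b) (on c) (on a) (on b) (on c)))"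
    by (rule sum.swap)
  finally show ?thesis .
qed

lemma frame_linear_ip: "w \<in> fib E x ==> frame_linear (*) (\<lambda>u. ip E x (u x) w)"
  unfolding frame_linear_def comb_def by (intro allI ip_comb_left) (auto intro: e_fib)

lemma frame_linear_struct:
  shows "v \<in> Gam A E ==> w \<in> Gam A E ==> frame_linear (*) (\<lambda>u. ip E x (u x) (bracket E v w x))"
    and "u \<in> Gam A E ==> w \<in> Gam A E ==> frame_linear (*) (\<lambda>v. ip E x (u x) (bracket E v w x))"
    and "u \<in> Gam A E ==> v \<in> Gam A E ==> frame_linear (*) (\<lambda>w. ip E x (u x) (bracket E v w x))"
proof -
  show "v \<in> Gam A E ==> w \<in> Gam A E ==> frame_linear (*) (\<lambda>u. ip E x (u x) (bracket E v w x))"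
    by (intro frame_linear_ip bracket_fib)
  show "u \<in> Gam A E ==> w \<in> Gam A E ==> frame_linear (*) (\<lambda>v. ip E x (u x) (bracket E v w x))"
    unfolding frame_linear_def comb_def
    by (subst bracket_sum_left) (auto intro!: ip_comb_right intro: bracket_fib sec_fib e_sec)
  show "u \<in> Gam A E ==> v \<in> Gam A E ==> frame_linear (*) (\<lambda>w. ip E x (u x) (bracket E v w x))"
    unfolding frame_linear_def comb_def
    by (subst bracket_sum_right) (auto intro!: ip_comb_right intro: bracket_fib sec_fib e_sec)
qed

lemma on_orthonormal:
  assumes const: "\<forall>\<^sub>F y in nhds x. \<forall>i<r. \<forall>j<r. ip E y (e i y) (e j y) = ip E x (e i x) (e j x)"
  shows "\<forall>\<^sub>F y in nhds x. orthonormal r y \<mu> (\<lambda>i. on i y)"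
  using const
proof eventually_elim
  case (elim y)
  have exp: "ip E z (on i z) (on j z) = (\<Sum>l<r. \<Sum>m<r. k i l * (k j m * ip E z (e l z) (e m z)))" for i j z
  proof -
    have f: "e l z \<in> fib E z" if "l \<in> {..<r}" for l using that e_fib by simp
    have "ip E z (on i z) (on j z) = (\<Sum>l<r. k i l * ip E z (e l z) (on j z))"
      unfolding on_def[of i] comb_def by (rule ip_comb_left[OF f sec_fib[OF on_sec]])
    also have "... = (\<Sum>l<r. k i l * (\<Sum>m<r. k j m * ip E z (e l z) (e m z)))"
      unfolding on_def comb_def using f by (intro sum.cong refl arg_cong2[where f = "(*)"] ip_comb_right)
    finally show ?thesis by (simp add: sum_distrib_left)
  qed
  have "ip E y (on i y) (on j y) = ip E x (on i x) (on j x)" for i j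
    unfolding exp using elim by (intro sum.cong) auto
  then show ?case
    using b on_at sec_fib[OF on_sec] unfolding orthonormal_def by simp
qed

end

subsection \<open>Two orthonormal frames that agree at a point\<close>

text \<open>The difference of the frames enters at \<open>x\<close> through the first derivatives
  \<open>\<theta>\<^sub>i\<^sub>j\<^sub>k = e\<^sub>i \<cdot> \<langle>e'\<^sub>j, e\<^sub>k\<rangle>\<close>, which are antisymmetric in \<open>j, k\<close>.\<close>

locale frame_pair = courant_div A E dv
  for A :: "('m::{t2_space, second_countable_topology}, 'b::{real_inner, heine_borel}) atlas"
    and E :: "('m, 'v::real_vector) courant" and dv :: "('m => 'v) => 'm => real" +
  fixes x :: 'm and \<mu> :: "nat => real" and e e' :: "nat => 'm => 'v"
  assumes sec: "\<And>i. i < r ==> e i \<in> Gam A E" and sec': "\<And>i. i < r ==> e' i \<in> Gam A E"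
    and on: "\<forall>\<^sub>F y in nhds x. orthonormal r y \<mu> (\<lambda>i. e i y)"
    and on': "\<forall>\<^sub>F y in nhds x. orthonormal r y \<mu> (\<lambda>i. e' i y)"
    and agree: "\<And>i. i < r ==> e' i x = e i x"
begin

definition G :: "nat => nat => 'm => real" where
  "G i j = (\<lambda>y. ip E y (e' i y) (e j y))"

definition \<theta> :: "nat => nat => nat => real" where
  "\<theta> i j l = anchor E x (e i x) (G j l)"

lemma onx: "orthonormal r x \<mu> (\<lambda>i. e i x)"
  by (rule at_point[OF on])

lemma ef: "i < r ==> e i x \<in> fib E x"
  by (rule orthonormal_fib[OF onx])

lemma sign: "i < r ==> \<mu> i * \<mu> i = 1"
  by (rule orthonormal_sign[OF onx])

lemma G_C_inf: "i < r ==> j < r ==> G i j \<in> C_inf A"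
  unfolding G_def by (intro ip_C_inf sec sec')

lemma G_at: "i < r ==> j < r ==> G i j x = (if i = j then \<mu> i else 0)"
  unfolding G_def using orthonormal_ip[OF onx] by (simp add: agree)

lemma G_gram: "i < r ==> j < r ==>
    \<forall>\<^sub>F y in nhds x. (\<Sum>l<r. \<mu> l * (G i l y * G j l y)) = (if i = j then \<mu> i else 0)"
proof -
  assume ij: "i < r" "j < r"
  show ?thesis using on on'
  proof eventually_elim
    case (elim y)
    then show ?case
      using orthonormal_parseval[OF elim(1), of "e' i y" "e' j y"] orthonormal_ip[OF elim(2) ij]
        orthonormal_fib[OF elim(2)] ij by (simp add: G_def mult.assoc)
  qed
qed

lemma \<theta>_antisym:
  assumes "i < r" "j < r" "l < r"
  shows "\<theta> i j l = - \<theta> i l j"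
proof -
  have mem: "(\<lambda>y. \<mu> m * (G j m y * G l m y)) \<in> C_inf A" if "m < r" for m
    using that assms by (intro C_inf_mult C_inf_const G_C_inf)
  have "0 = anchor E x (e i x) (\<lambda>y. \<Sum>m<r. \<mu> m * (G j m y * G l m y))"
    using anchor_eventually_const[OF ef[OF assms(1)] C_inf_sum[OF mem] G_gram[OF assms(2,3)]] by simp
  also have "... = (\<Sum>m<r. \<mu> m * (G j m x * \<theta> i l m + G l m x * \<theta> i j m))"
  proof -
    have "anchor E x (e i x) (\<lambda>y. \<Sum>m<r. \<mu> m * (G j m y * G l m y))
        = (\<Sum>m<r. anchor E x (e i x) (\<lambda>y. \<mu> m * (G j m y * G l m y)))"
      by (rule anchor_sum_fun[OF ef[OF assms(1)]]) (use mem in auto)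
    then show ?thesis
      using assms ef by (simp add: anchor_scale_fun anchor_mult_fun C_inf_mult G_C_inf \<theta>_def)
  qed
  also have "... = (\<Sum>m<r. (if m = j then \<theta> i l j else 0) + (if m = l then \<theta> i j l else 0))"
  proof (rule sum.cong, rule refl)
    fix m assume "m \<in> {..<r}"
    then have m: "m < r" by simp
    then show "\<mu> m * (G j m x * \<theta> i l m + G l m x * \<theta> i j m)
        = (if m = j then \<theta> i l j else 0) + (if m = l then \<theta> i j l else 0)"
      using sign[OF m] assms
      by (cases "m = j"; cases "m = l") (simp_all add: G_at distrib_left flip: mult.assoc)
  qed
  also have "... = \<theta> i l j + \<theta> i j l" using assms by (simp add: sum.distrib)
  finally show ?thesis by simp
qed

text \<open>The differences \<open>d i = e' i - e i\<close> vanish at \<open>x\<close>, so their brackets are first derivatives of inner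
  products, that is, values of \<open>\<theta>\<close>.\<close>

lemma struct_change:
  assumes "i < r" "j < r" "l < r"
  shows "struct_coeff E x e' i j l = struct_coeff E x e i j l + \<theta> i j l + \<theta> j l i + \<theta> l i j"
proof -
  define d where "d i y = e' i y - e i y" for i y
  have d: "d i \<in> Gam A E" "d i x = 0" if "i < r" for i
    unfolding d_def[abs_def] using that by (auto intro: sec_diff sec sec' simp: agree)
  have const: "anchor E x (e m x) (\<lambda>y. ip E y (d i y) (e j y)) = \<theta> m i j" if "m < r" "i < r" "j < r" for m i j
  proof -
    have "(\<lambda>y. ip E y (d i y) (e j y)) = (\<lambda>y. G i j y - ip E y (e i y) (e j y))"
      unfolding d_def G_def using that sec_fib sec sec' by (intro ext ip_diff_left) auto
    moreover have "\<forall>\<^sub>F y in nhds x. ip E y (e i y) (e j y) = (if i = j then \<mu> i else 0)"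
      using on by eventually_elim (rule orthonormal_ip, use that in auto)
    ultimately show ?thesis
      using anchor_eventually_const[OF ef[OF that(1)] ip_C_inf[OF sec sec]] that ef G_C_inf
      by (simp add: anchor_diff_fun ip_C_inf sec \<theta>_def)
  qed
  have const': "anchor E x (e m x) (\<lambda>y. ip E y (d i y) (e' j y)) = - \<theta> m j i" if "m < r" "i < r" "j < r" for m i j
  proof -
    have "(\<lambda>y. ip E y (d i y) (e' j y)) = (\<lambda>y. ip E y (e' i y) (e' j y) - G j i y)"
      unfolding d_def G_def using that sec_fib sec sec' by (intro ext) (simp add: ip_diff_left ip_sym)
    moreover have "\<forall>\<^sub>F y in nhds x. ip E y (e' i y) (e' j y) = (if i = j then \<mu> i else 0)"
      using on' by eventually_elim (rule orthonormal_ip, use that in auto)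
    ultimately show ?thesis
      using anchor_eventually_const[OF ef[OF that(1)] ip_C_inf[OF sec' sec']] that ef G_C_inf
      by (simp add: anchor_diff_fun ip_C_inf sec' \<theta>_def)
  qed
  have split: "bracket E (e' j) (e' l) x = bracket E (e j) (e l) x + bracket E (e j) (d l) x + bracket E (d j) (e' l) x"
    unfolding d_def using assms by (simp add: bracket_diff_left bracket_diff_right sec sec' sec_diff)
  have "struct_coeff E x e' i j l = ip E x (e i x) (bracket E (e j) (e l) x)
      + ip E x (e i x) (bracket E (e j) (d l) x) + ip E x (e i x) (bracket E (d j) (e' l) x)"
    unfolding struct_coeff_def split using assms
    by (simp add: agree ip_add_right ef bracket_fib sec sec' d fib_add)
  also have "ip E x (e i x) (bracket E (e j) (d l) x) = \<theta> j l i"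
    using ip_bracket_right_zero[OF sec d(1) sec d(2), of j l i] const assms by simp
  also have "ip E x (e i x) (bracket E (d j) (e' l) x) = - \<theta> l j i - \<theta> i l j"
    using ip_bracket_left_zero[OF sec' d(1) sec d(2), of l j i] const const' assms by (simp add: agree)
  finally show ?thesis
    using \<theta>_antisym[OF assms(3,2,1)] \<theta>_antisym[OF assms(1,3,2)] by (simp add: struct_coeff_def)
qed

lemma struct_antisym:
  assumes "i < r" "j < r" "l < r"
  shows "struct_coeff E x e i j l = - struct_coeff E x e i l j"
    and "struct_coeff E x e i j l = - struct_coeff E x e l j i"
proof -
  have const: "anchor E x (e m x) (\<lambda>y. ip E y (e i y) (e j y)) = 0" if "m < r" "i < r" "j < r" for m i j
  proof (rule anchor_eventually_const[OF ef[OF that(1)] ip_C_inf[OF sec sec]])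
    show "\<forall>\<^sub>F y in nhds x. ip E y (e i y) (e j y) = (if i = j then \<mu> i else 0)"
      using on by eventually_elim (rule orthonormal_ip, use that in auto)
  qed (use that in auto)
  show "struct_coeff E x e i j l = - struct_coeff E x e i l j"
    unfolding struct_coeff_def
    using ip_bracket_sym[OF sec sec ef, of j l i] const[of i j l] assms by simp
  show "struct_coeff E x e i j l = - struct_coeff E x e l j i"
    unfolding struct_coeff_def
    using fun_cong[OF compat[OF sec sec sec, of j i l], of x] const[of j i l] assms
    by (simp add: act_apply ip_sym ef bracket_fib sec)
qed

lemma struct_cyclic: "i < r ==> j < r ==> l < r ==> struct_coeff E x e i j l = struct_coeff E x e j l i"
  using struct_antisym(1)[of i j l] struct_antisym(2)[of i l j] by simp

lemma frame_expand:
  assumes "i < r"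
  shows "\<forall>\<^sub>F y in nhds x. e' i y = (\<Sum>j<r. (\<mu> j * G i j y) *\<^sub>R e j y)"
  using on on'
proof eventually_elim
  case (elim y)
  show ?case
    using orthonormal_expand[OF elim(1) orthonormal_fib[OF elim(2) assms]] by (simp add: G_def)
qed

lemma dv_near:
  assumes "i < r"
  shows "\<forall>\<^sub>F y in nhds x. dv (e' i) y = (\<Sum>j<r. \<mu> j * (G i j y * dv (e j) y + act E (e j) (G i j) y))"
proof -
  have sj: "(\<lambda>y. (\<mu> j * G i j y) *\<^sub>R e j y) \<in> Gam A E" if "j < r" for j
    using that assms by (intro sec_scale C_inf_mult C_inf_const G_C_inf sec)
  have "\<forall>\<^sub>F y in nhds x. \<forall>\<^sub>F z in nhds y. e' i z = (\<Sum>j<r. (\<mu> j * G i j z) *\<^sub>R e j z)"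
    using frame_expand[OF assms] by (simp add: eventually_eventually)
  then show ?thesis
  proof eventually_elim
    case (elim y)
    have "dv (e' i) y = dv (\<lambda>z. \<Sum>j<r. (\<mu> j * G i j z) *\<^sub>R e j z) y"
      by (rule dv_local[OF sec'[OF assms] sec_sum elim]) (use sj in auto)
    also have "... = (\<Sum>j<r. dv (\<lambda>z. (\<mu> j * G i j z) *\<^sub>R e j z) y)"
      by (rule dv_sum) (use sj in auto)
    also have "... = (\<Sum>j<r. \<mu> j * (G i j y * dv (e j) y + act E (e j) (G i j) y))"
    proof (rule sum.cong, rule refl)
      fix j assume "j \<in> {..<r}"
      then have j: "j < r" by simp
      have "act E (e j) (\<lambda>z. \<mu> j * G i j z) y = \<mu> j * act E (e j) (G i j) y"
        using assms j by (simp add: act_apply anchor_scale_fun sec_fib sec G_C_inf)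
      then show "dv (\<lambda>z. (\<mu> j * G i j z) *\<^sub>R e j z) y = \<mu> j * (G i j y * dv (e j) y + act E (e j) (G i j) y)"
        using fun_cong[OF dv_leibniz[OF sec[OF j] C_inf_mult[OF C_inf_const[of "\<mu> j"] G_C_inf[OF assms j]]], of y]
        by (simp add: algebra_simps)
    qed
    finally show ?case .
  qed
qed

lemma dv_change:
  assumes "i < r"
  shows "dv (e' i) x = dv (e i) x + (\<Sum>j<r. \<mu> j * \<theta> j i j)"
proof -
  have "dv (e' i) x = (\<Sum>j<r. \<mu> j * (G i j x * dv (e j) x + act E (e j) (G i j) x))"
    by (rule at_point[OF dv_near[OF assms]])
  also have "... = (\<Sum>j<r. (if j = i then dv (e i) x else 0) + \<mu> j * \<theta> j i j)"
    using assms sign by (intro sum.cong) (auto simp: G_at act_apply \<theta>_def algebra_simps simp flip: mult.assoc)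
  also have "... = dv (e i) x + (\<Sum>j<r. \<mu> j * \<theta> j i j)" using assms by (simp add: sum.distrib)
  finally show ?thesis .
qed

lemma \<theta>_null: "0 < r ==> j < r ==> l < r ==> (\<Sum>i<r. \<mu> i * (\<theta> i j l * \<theta> i j l)) = 0"
  using anchor_null[OF _ G_C_inf G_C_inf onx, of j l j l] by (simp add: \<theta>_def)

end

section \<open>Frame independence of the generalized scalar curvature\<close>

context pseudometric
begin

text \<open>The scalar curvature in an orthonormal adapted frame, where indices are raised by signs.\<close>

definition on_scal :: "(nat => real) => (nat => 'm => 'v) => 'm => real" where
  "on_scal \<mu> e x = (\<Sum>a<n. \<mu> a * (dv (e a) x * dv (e a) x))
     + 2 * (\<Sum>a<n. \<mu> a * act E (e a) (dv (e a)) x)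
     - 1 / 6 * (\<Sum>a<n. \<Sum>b<n. \<Sum>c<n. \<mu> a * \<mu> b * \<mu> c *
         (struct_coeff E x e a b c * struct_coeff E x e a b c))
     - 1 / 2 * (\<Sum>c\<in>{n..<r}. \<Sum>a<n. \<Sum>b<n. \<mu> a * \<mu> b * \<mu> c *
         (struct_coeff E x e a b c * struct_coeff E x e a b c))"

end

locale adapted_pair = pseudometric A E dv n V + frame_pair A E dv x \<mu> e e'
  for A :: "('m::{t2_space, second_countable_topology}, 'b::{real_inner, heine_borel}) atlas"
    and E :: "('m, 'v::real_vector) courant" and dv :: "('m => 'v) => 'm => real" and n V
    and x :: 'm and \<mu> :: "nat => real" and e e' :: "nat => 'm => 'v" +
  assumes in_V: "\<forall>\<^sub>F y in nhds x. \<forall>i<n. e i y \<in> V y" and in_V': "\<forall>\<^sub>F y in nhds x. \<forall>i<n. e' i y \<in> V y"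
    and rank_pos: "0 < r"
begin

lemma n_le: "n \<le> r"
  by (rule pseudometric_rank_le[OF V])

lemma G_mixed:
  assumes "a < n" "n \<le> c" "c < r"
  shows "\<forall>\<^sub>F y in nhds x. G a c y = 0"
  using on in_V in_V'
proof eventually_elim
  case (elim y)
  have "basis_of scaleR {n..<r} (\<lambda>i. e i y) (Vp y)"
    by (rule orthonormal_sub_basis(2)[OF V elim(1)]) (use elim(2) in blast)
  then have "e c y \<in> Vp y"
    using real_vector.basis_of_in[of "{n..<r}" "\<lambda>i. e i y" "Vp y" c] assms by simp
  moreover have "e' a y \<in> V y" using elim(3) assms by blast
  ultimately show ?case using perp_ip perp_fib V_fib ip_sym by (metis G_def)
qed

lemma \<theta>_mixed: "i < r ==> a < n ==> n \<le> c ==> c < r ==> \<theta> i a c = 0"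
  unfolding \<theta>_def using anchor_eventually_const[OF ef G_C_inf G_mixed] n_le by simp

lemma act_G_near:
  assumes "j < r" "a < n" "n \<le> c" "c < r"
  shows "\<forall>\<^sub>F y in nhds x. act E (e j) (G a c) y = 0"
proof -
  have "\<forall>\<^sub>F y in nhds x. \<forall>\<^sub>F z in nhds y. G a c z = 0"
    using G_mixed[OF assms(2-4)] by (simp add: eventually_eventually)
  then show ?thesis
  proof eventually_elim
    case (elim y)
    show ?case
      unfolding act_apply using n_le assms
      by (intro anchor_eventually_const[OF _ _ elim] sec_fib sec G_C_inf) auto
  qed
qed

lemma sum_split: "(\<And>c. n \<le> c ==> c < r ==> f c = 0) ==> (\<Sum>c<r. f c) = (\<Sum>c<n. f c)" for f :: "nat => real"
  using n_le by (intro sum.mono_neutral_right) auto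

definition t :: "nat => real" where
  "t a = (\<Sum>b<n. \<mu> b * \<theta> b a b)"

lemma t_eq: "a < n ==> (\<Sum>b<n. \<mu> b * \<theta> b b a) = - t a"
  unfolding t_def sum_negf[symmetric] using n_le by (intro sum.cong) (auto simp: \<theta>_antisym[of _ _ a])

text \<open>Second derivatives of the transition functions enter through the terms \<open>e\<^sup>a \<cdot> div e\<^sub>a\<close>.\<close>

definition K :: "nat => nat => nat => nat => real" where
  "K a b i j = act E (e a) (act E (e b) (G i j)) x"

lemma dv_term:
  assumes a: "a < n"
  shows "act E (e' a) (dv (e' a)) x = act E (e a) (dv (e a)) x
    + (\<Sum>b<n. \<mu> b * (dv (e b) x * \<theta> a a b + K a b a b))"
proof -
  have ar: "a < r" using a n_le by simp
  have C: "G a b \<in> C_inf A" "dv (e b) \<in> C_inf A" "act E (e b) (G a b) \<in> C_inf A" if "b < r" for b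
    using that ar by (auto intro: G_C_inf dv_C_inf act_C_inf sec)
  have mem: "(\<lambda>y. \<mu> b * (G a b y * dv (e b) y + act E (e b) (G a b) y)) \<in> C_inf A" if "b < r" for b
    using that by (intro C_inf_mult C_inf_const C_inf_add C)
  have "act E (e' a) (dv (e' a)) x = anchor E x (e a x) (dv (e' a))"
    using agree[OF ar] by (simp add: act_apply)
  also have "... = anchor E x (e a x) (\<lambda>y. \<Sum>b<r. \<mu> b * (G a b y * dv (e b) y + act E (e b) (G a b) y))"
    by (rule anchor_near_cong[OF ef[OF ar] dv_C_inf[OF sec'[OF ar]] dv_near[OF ar]])
  also have "... = (\<Sum>b<r. anchor E x (e a x) (\<lambda>y. \<mu> b * (G a b y * dv (e b) y + act E (e b) (G a b) y)))"
    by (rule anchor_sum_fun[OF ef[OF ar]]) (use mem in auto)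
  also have "... = (\<Sum>b<r. \<mu> b * (G a b x * anchor E x (e a x) (dv (e b)) + dv (e b) x * \<theta> a a b + K a b a b))"
    using ef[OF ar] C
    by (intro sum.cong refl)
      (simp add: anchor_scale_fun anchor_add_fun anchor_mult_fun C_inf_add C_inf_mult \<theta>_def K_def act_apply[where u = "e a"])
  also have "... = (\<Sum>b<n. \<mu> b * (G a b x * anchor E x (e a x) (dv (e b)) + dv (e b) x * \<theta> a a b + K a b a b))"
  proof (rule sum_split)
    fix b assume b: "n \<le> b" "b < r"
    have "K a b a b = 0"
      unfolding K_def act_apply[where u = "e a"]
      by (rule anchor_eventually_const[OF ef[OF ar] C(3)[OF b(2)] act_G_near[OF b(2) a b]])
    then show "\<mu> b * (G a b x * anchor E x (e a x) (dv (e b)) + dv (e b) x * \<theta> a a b + K a b a b) = 0"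
      using at_point[OF G_mixed[OF a b]] \<theta>_mixed[OF ar a b] by simp
  qed
  also have "... = (\<Sum>b<n. (if b = a then act E (e a) (dv (e a)) x else 0)
      + \<mu> b * (dv (e b) x * \<theta> a a b + K a b a b))"
  proof (rule sum.cong, rule refl)
    fix b assume "b \<in> {..<n}"
    then have b: "b < r" using n_le by simp
    show "\<mu> b * (G a b x * anchor E x (e a x) (dv (e b)) + dv (e b) x * \<theta> a a b + K a b a b)
        = (if b = a then act E (e a) (dv (e a)) x else 0) + \<mu> b * (dv (e b) x * \<theta> a a b + K a b a b)"
      using sign[OF b] by (cases "b = a") (simp_all add: G_at ar b act_apply distrib_left add.assoc flip: mult.assoc)
  qed
  also have "... = act E (e a) (dv (e a)) x + (\<Sum>b<n. \<mu> b * (dv (e b) x * \<theta> a a b + K a b a b))"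
    using a by (simp add: sum.distrib)
  finally show ?thesis .
qed

text \<open>The constant \<open>\<langle>e'\<^sub>a, e'\<^sub>b\<rangle> = \<Sum>\<^sub>c \<mu>\<^sub>c \<langle>e'\<^sub>a, e\<^sub>c\<rangle> \<langle>e'\<^sub>b, e\<^sub>c\<rangle>\<close> is differentiated along \<open>e\<^sub>b\<close> and then along \<open>e\<^sub>a\<close>.\<close>

lemma second_derivative:
  assumes a: "a < n" and b: "b < n"
  shows "K a b b a + K a b a b + (\<Sum>c<n. \<mu> c * (\<theta> b b c * \<theta> a a c)) + (\<Sum>c<n. \<mu> c * (\<theta> b a c * \<theta> a b c)) = 0"
proof -
  have ar: "a < r" and br: "b < r" using a b n_le by simp_all
  have C: "G i c \<in> C_inf A" "act E (e b) (G i c) \<in> C_inf A" if "i < r" "c < r" for i c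
    using that br by (auto intro: G_C_inf act_C_inf sec)
  have memF: "(\<lambda>y. \<mu> c * (G a c y * G b c y)) \<in> C_inf A" if "c < r" for c
    using that ar br by (intro C_inf_mult C_inf_const C)
  let ?F = "\<lambda>y. \<Sum>c<r. \<mu> c * (G a c y * G b c y)"
  have F: "?F \<in> C_inf A" by (rule C_inf_sum) (use memF in auto)
  have "\<forall>\<^sub>F y in nhds x. \<forall>\<^sub>F z in nhds y. ?F z = (if a = b then \<mu> a else 0)"
    using G_gram[OF ar br] by (simp add: eventually_eventually)
  then have ev: "\<forall>\<^sub>F y in nhds x. act E (e b) ?F y = 0"
  proof eventually_elim
    case (elim y)
    show ?case unfolding act_apply by (rule anchor_eventually_const[OF sec_fib[OF sec[OF br]] F elim])
  qed
  have dF: "act E (e b) ?F = (\<lambda>y. \<Sum>c<r. \<mu> c * (G a c y * act E (e b) (G b c) y + G b c y * act E (e b) (G a c) y))"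
  proof
    fix y
    have yb: "e b y \<in> fib E y" using sec_fib[OF sec[OF br]] .
    have "act E (e b) ?F y = (\<Sum>c<r. anchor E y (e b y) (\<lambda>y. \<mu> c * (G a c y * G b c y)))"
      unfolding act_apply by (rule anchor_sum_fun[OF yb]) (use memF in auto)
    also have "... = (\<Sum>c<r. \<mu> c * (G a c y * act E (e b) (G b c) y + G b c y * act E (e b) (G a c) y))"
      using yb C ar br by (intro sum.cong refl) (simp add: anchor_scale_fun anchor_mult_fun C_inf_mult act_apply)
    finally show "act E (e b) ?F y = (\<Sum>c<r. \<mu> c * (G a c y * act E (e b) (G b c) y + G b c y * act E (e b) (G a c) y))" .
  qed
  have mem: "(\<lambda>y. \<mu> c * (G a c y * act E (e b) (G b c) y + G b c y * act E (e b) (G a c) y)) \<in> C_inf A" if "c < r" for c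
    using that ar br by (intro C_inf_mult C_inf_const C_inf_add C)
  have "0 = anchor E x (e a x) (act E (e b) ?F)"
    using anchor_eventually_const[OF ef[OF ar] act_C_inf[OF sec[OF br] F] ev] by simp
  also have "... = (\<Sum>c<r. anchor E x (e a x)
      (\<lambda>y. \<mu> c * (G a c y * act E (e b) (G b c) y + G b c y * act E (e b) (G a c) y)))"
    unfolding dF by (rule anchor_sum_fun[OF ef[OF ar]]) (use mem in auto)
  also have "... = (\<Sum>c<r. \<mu> c * (G a c x * K a b b c + \<theta> b b c * \<theta> a a c + (G b c x * K a b a c + \<theta> b a c * \<theta> a b c)))"
    using ef[OF ar] C ar br
    by (intro sum.cong refl)
      (simp add: anchor_scale_fun anchor_add_fun anchor_mult_fun C_inf_add C_inf_mult \<theta>_def K_def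
        act_apply[where x = x])
  also have "... = (\<Sum>c<n. \<mu> c * (G a c x * K a b b c + \<theta> b b c * \<theta> a a c + (G b c x * K a b a c + \<theta> b a c * \<theta> a b c)))"
    by (rule sum_split)
      (use \<theta>_mixed[OF ar a] \<theta>_mixed[OF ar b] at_point[OF G_mixed[OF a]]
        at_point[OF G_mixed[OF b]] in simp)
  also have "... = (\<Sum>c<n. (if c = a then K a b b a else 0) + (if c = b then K a b a b else 0)
      + (\<mu> c * (\<theta> b b c * \<theta> a a c) + \<mu> c * (\<theta> b a c * \<theta> a b c)))"
  proof (rule sum.cong, rule refl)
    fix c assume "c \<in> {..<n}"
    then have c: "c < r" using n_le by simp
    have 1: "\<mu> c * (G a c x * K a b b c) = (if c = a then K a b b a else 0)"
      using sign[OF c] by (cases "c = a") (simp_all add: G_at ar c flip: mult.assoc)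
    have 2: "\<mu> c * (G b c x * K a b a c) = (if c = b then K a b a b else 0)"
      using sign[OF c] by (cases "c = b") (simp_all add: G_at br c flip: mult.assoc)
    show "\<mu> c * (G a c x * K a b b c + \<theta> b b c * \<theta> a a c + (G b c x * K a b a c + \<theta> b a c * \<theta> a b c))
        = (if c = a then K a b b a else 0) + (if c = b then K a b a b else 0)
          + (\<mu> c * (\<theta> b b c * \<theta> a a c) + \<mu> c * (\<theta> b a c * \<theta> a b c))"
      unfolding 1[symmetric] 2[symmetric] by (simp add: distrib_left)
  qed
  also have "... = K a b b a + K a b a b + (\<Sum>c<n. \<mu> c * (\<theta> b b c * \<theta> a a c)) + (\<Sum>c<n. \<mu> c * (\<theta> b a c * \<theta> a b c))"
    using a b by (simp add: sum.distrib)
  finally show ?thesis by simp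
qed

text \<open>The commutator of two derivatives is the derivative along the bracket, whose components are
  structure functions.\<close>

lemma K_commutator:
  assumes "a < r" "b < r" "i < r" "j < r"
  shows "K a b i j - K b a i j = (\<Sum>l<r. \<mu> l * (struct_coeff E x e l a b * \<theta> l i j))"
proof -
  have f: "bracket E (e a) (e b) x \<in> fib E x" using bracket_fib sec assms by blast
  have "K a b i j - K b a i j = anchor E x (bracket E (e a) (e b) x) (G i j)"
    unfolding K_def using anchor_bracket[OF rank_pos sec[OF assms(1)] sec[OF assms(2)] G_C_inf[OF assms(3,4)], of x]
    by (simp add: act_apply[where u = "bracket E (e a) (e b)"])
  also have "bracket E (e a) (e b) x = (\<Sum>l<r. (\<mu> l * ip E x (bracket E (e a) (e b) x) (e l x)) *\<^sub>R e l x)"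
    by (rule orthonormal_expand[OF onx f])
  also have "anchor E x ... (G i j) = (\<Sum>l<r. \<mu> l * ip E x (bracket E (e a) (e b) x) (e l x) * \<theta> l i j)"
    unfolding \<theta>_def by (rule anchor_comb) (use ef G_C_inf assms in auto)
  also have "... = (\<Sum>l<r. \<mu> l * (struct_coeff E x e l a b * \<theta> l i j))"
    using f by (intro sum.cong refl) (simp add: struct_coeff_def ip_sym[OF f ef] mult.assoc)
  finally show ?thesis .
qed

definition S3 :: "(nat => nat => nat => real) => real" where
  "S3 F = (\<Sum>a<n. \<Sum>b<n. \<Sum>c<n. \<mu> a * \<mu> b * \<mu> c * F a b c)"

lemma S3_cong: "(\<And>a b c. a < n ==> b < n ==> c < n ==> F a b c = H a b c) ==> S3 F = S3 H"
  unfolding S3_def by (intro sum.cong) auto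

lemma S3_add: "S3 (\<lambda>a b c. F a b c + H a b c) = S3 F + S3 H"
  by (simp add: S3_def distrib_left sum.distrib)

lemma S3_scale: "S3 (\<lambda>a b c. k * F a b c) = k * S3 F"
  by (simp add: S3_def sum_distrib_left mult_ac)

lemma S3_rotate: "S3 (\<lambda>a b c. F b c a) = S3 F"
proof -
  have "S3 (\<lambda>a b c. F b c a) = (\<Sum>b<n. \<Sum>a<n. \<Sum>c<n. \<mu> a * \<mu> b * \<mu> c * F b c a)"
    unfolding S3_def by (rule sum.swap)
  also have "... = (\<Sum>b<n. \<Sum>c<n. \<Sum>a<n. \<mu> a * \<mu> b * \<mu> c * F b c a)"
    by (intro sum.cong refl sum.swap)
  finally show ?thesis unfolding S3_def by (simp add: mult_ac)
qed

abbreviation "s \<equiv> struct_coeff E x e"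
abbreviation "s' \<equiv> struct_coeff E x e'"

text \<open>The changes of the divergence terms and of the cubic terms are expressed by these three
  quantities.  \<open>X\<close> and \<open>Q\<close> carry a free index \<open>l\<close> because the cubic terms sum it over \<open>V\<close> and \<open>V\<^sup>\<bottom>\<close> with
  different weights, while \<open>K_commutator\<close> produces a sum over all of \<open>E\<close>.\<close>

definition X :: "nat => real" where
  "X l = (\<Sum>a<n. \<Sum>b<n. \<mu> a * \<mu> b * (s l a b * \<theta> l a b))"

definition Q :: "nat => real" where
  "Q l = (\<Sum>a<n. \<Sum>b<n. \<mu> a * \<mu> b * (\<theta> l a b * \<theta> l a b))"

definition W :: real where
  "W = S3 (\<lambda>a b c. \<theta> a b c * \<theta> b a c)"

text \<open>The commutator and \<open>second_derivative\<close> express the sum \<open>Y\<close> of the second derivatives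
  by \<open>X\<close>, \<open>W\<close> and squares of traces of \<open>\<theta>\<close>; the squares cancel those of the changed divergences.\<close>

lemma divergence_terms:
  "(\<Sum>a<n. \<mu> a * (dv (e' a) x * dv (e' a) x)) + 2 * (\<Sum>a<n. \<mu> a * act E (e' a) (dv (e' a)) x)
   = (\<Sum>a<n. \<mu> a * (dv (e a) x * dv (e a) x)) + 2 * (\<Sum>a<n. \<mu> a * act E (e a) (dv (e a)) x)
     + (\<Sum>l<r. \<mu> l * X l) - W"
proof -
  define p where "p a = dv (e a) x" for a
  define Y where "Y = (\<Sum>a<n. \<Sum>b<n. \<mu> a * \<mu> b * K a b a b)"
  define T where "T = (\<Sum>a<n. \<mu> a * (t a * t a))"
  have dv': "dv (e' a) x = p a + t a" if "a < n" for a
  proof -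
    have "(\<Sum>j<r. \<mu> j * \<theta> j a j) = t a"
      unfolding t_def using \<theta>_mixed that by (intro sum_split) auto
    then show ?thesis using dv_change[of a] that n_le by (simp add: p_def)
  qed
  have 1: "(\<Sum>a<n. \<mu> a * (dv (e' a) x * dv (e' a) x))
      = (\<Sum>a<n. \<mu> a * (p a * p a)) + 2 * (\<Sum>a<n. \<mu> a * (p a * t a)) + T"
    unfolding T_def sum_distrib_left sum.distrib[symmetric]
    by (intro sum.cong) (auto simp: dv' algebra_simps)
  have "(\<Sum>a<n. \<mu> a * act E (e' a) (dv (e' a)) x)
      = (\<Sum>a<n. \<mu> a * act E (e a) (dv (e a)) x + ((\<Sum>b<n. \<mu> b * p b * (\<mu> a * \<theta> a a b)) + (\<Sum>b<n. \<mu> a * \<mu> b * K a b a b)))"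
    by (intro sum.cong refl) (simp add: dv_term p_def distrib_left sum.distrib sum_distrib_left mult_ac)
  also have "... = (\<Sum>a<n. \<mu> a * act E (e a) (dv (e a)) x)
      + ((\<Sum>a<n. \<Sum>b<n. \<mu> b * p b * (\<mu> a * \<theta> a a b)) + Y)"
    unfolding Y_def by (simp add: sum.distrib)
  also have "(\<Sum>a<n. \<Sum>b<n. \<mu> b * p b * (\<mu> a * \<theta> a a b)) = (\<Sum>b<n. \<mu> b * p b * (\<Sum>a<n. \<mu> a * \<theta> a a b))"
    unfolding sum_distrib_left by (rule sum.swap)
  also have "... = - (\<Sum>b<n. \<mu> b * (p b * t b))"
    unfolding sum_negf[symmetric] by (intro sum.cong) (auto simp: t_eq)
  finally have 2: "(\<Sum>a<n. \<mu> a * act E (e' a) (dv (e' a)) x)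
      = (\<Sum>a<n. \<mu> a * act E (e a) (dv (e a)) x) - (\<Sum>b<n. \<mu> b * (p b * t b)) + Y" by simp
  have Z: "(\<Sum>a<n. \<Sum>b<n. \<mu> a * \<mu> b * K a b b a) = Y - (\<Sum>l<r. \<mu> l * X l)"
  proof -
    have "(\<Sum>a<n. \<Sum>b<n. \<mu> a * \<mu> b * K a b b a) = (\<Sum>a<n. \<Sum>b<n. \<mu> a * \<mu> b * K b a a b)"
      by (subst sum.swap) (simp add: mult_ac)
    also have "... = (\<Sum>a<n. \<Sum>b<n. \<mu> a * \<mu> b * K a b a b - \<mu> a * \<mu> b * (\<Sum>l<r. \<mu> l * (s l a b * \<theta> l a b)))"
    proof (intro sum.cong refl)
      fix a b assume "a \<in> {..<n}" "b \<in> {..<n}"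
      then have "a < r" "b < r" using n_le by simp_all
      from K_commutator[OF this this] have "K b a a b = K a b a b - (\<Sum>l<r. \<mu> l * (s l a b * \<theta> l a b))" by simp
      then show "\<mu> a * \<mu> b * K b a a b = \<mu> a * \<mu> b * K a b a b - \<mu> a * \<mu> b * (\<Sum>l<r. \<mu> l * (s l a b * \<theta> l a b))"
        by (simp add: right_diff_distrib)
    qed
    also have "... = Y - (\<Sum>a<n. \<Sum>b<n. \<Sum>l<r. \<mu> l * (\<mu> a * \<mu> b * (s l a b * \<theta> l a b)))"
      unfolding Y_def by (simp add: sum_subtractf sum_distrib_left mult_ac)
    also have "(\<Sum>a<n. \<Sum>b<n. \<Sum>l<r. \<mu> l * (\<mu> a * \<mu> b * (s l a b * \<theta> l a b)))
        = (\<Sum>a<n. \<Sum>l<r. \<Sum>b<n. \<mu> l * (\<mu> a * \<mu> b * (s l a b * \<theta> l a b)))"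
      by (intro sum.cong refl sum.swap)
    also have "... = (\<Sum>l<r. \<Sum>a<n. \<Sum>b<n. \<mu> l * (\<mu> a * \<mu> b * (s l a b * \<theta> l a b)))"
      by (rule sum.swap)
    also have "... = (\<Sum>l<r. \<mu> l * X l)" by (simp add: X_def sum_distrib_left)
    finally show ?thesis .
  qed
  have "0 = (\<Sum>a<n. \<Sum>b<n. \<mu> a * \<mu> b * (K a b b a + K a b a b + (\<Sum>c<n. \<mu> c * (\<theta> b b c * \<theta> a a c))
      + (\<Sum>c<n. \<mu> c * (\<theta> b a c * \<theta> a b c))))"
    using second_derivative by (simp add: sum.neutral)
  also have "... = (Y - (\<Sum>l<r. \<mu> l * X l)) + Y
      + (\<Sum>a<n. \<Sum>b<n. \<mu> a * \<mu> b * (\<Sum>c<n. \<mu> c * (\<theta> b b c * \<theta> a a c))) + W"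
    unfolding Z[symmetric] unfolding Y_def W_def S3_def
    by (simp add: distrib_left sum.distrib sum_distrib_left mult_ac)
  also have "(\<Sum>a<n. \<Sum>b<n. \<mu> a * \<mu> b * (\<Sum>c<n. \<mu> c * (\<theta> b b c * \<theta> a a c))) = T"
  proof -
    have "(\<Sum>a<n. \<Sum>b<n. \<mu> a * \<mu> b * (\<Sum>c<n. \<mu> c * (\<theta> b b c * \<theta> a a c)))
        = (\<Sum>a<n. \<Sum>c<n. \<Sum>b<n. \<mu> c * ((\<mu> a * \<theta> a a c) * (\<mu> b * \<theta> b b c)))"
      unfolding sum_distrib_left
      by (rule sum.cong[OF refl], rule trans[OF sum.swap]) (simp add: mult_ac)
    also have "... = (\<Sum>c<n. \<Sum>a<n. \<Sum>b<n. \<mu> c * ((\<mu> a * \<theta> a a c) * (\<mu> b * \<theta> b b c)))"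
      by (rule sum.swap)
    also have "... = (\<Sum>c<n. \<mu> c * ((\<Sum>a<n. \<mu> a * \<theta> a a c) * (\<Sum>b<n. \<mu> b * \<theta> b b c)))"
      by (simp only: sum_product) (simp only: sum_distrib_left)
    also have "... = T" unfolding T_def by (intro sum.cong) (auto simp: t_eq)
    finally show ?thesis .
  qed
  finally have 3: "2 * Y = (\<Sum>l<r. \<mu> l * X l) - T - W" by simp
  show ?thesis unfolding 1 2 using 3 by (simp add: p_def algebra_simps)
qed

lemma cubic_terms:
  "S3 (\<lambda>a b c. s' a b c * s' a b c) = S3 (\<lambda>a b c. s a b c * s a b c)
    + 6 * (\<Sum>l<n. \<mu> l * X l) + 3 * (\<Sum>l<n. \<mu> l * Q l) - 6 * W"
proof -
  have lt: "a < r" if "a < n" for a using that n_le by simp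
  have eq: "S3 (\<lambda>a b c. s' a b c * s' a b c)
    = S3 (\<lambda>a b c. s a b c * s a b c
        + (2 * (s a b c * \<theta> a b c) + (2 * (s b c a * \<theta> b c a) + (2 * (s c a b * \<theta> c a b)
        + (\<theta> a b c * \<theta> a b c + (\<theta> b c a * \<theta> b c a + (\<theta> c a b * \<theta> c a b
        + ((-2) * (\<theta> a b c * \<theta> b a c) + ((-2) * (\<theta> b c a * \<theta> c b a) + (-2) * (\<theta> c a b * \<theta> a c b)))))))))) "
  proof (rule S3_cong)
    fix a b c assume "a < n" "b < n" "c < n"
    note i = lt[OF this(1)] lt[OF this(2)] lt[OF this(3)]
    have 1: "s' a b c = s a b c + \<theta> a b c + \<theta> b c a + \<theta> c a b" by (rule struct_change[OF i])
    have 2: "s b c a = s a b c" "s c a b = s a b c"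
      using struct_cyclic[OF i] struct_cyclic[OF i(2,3,1)] by simp_all
    have 3: "\<theta> b a c = - \<theta> b c a" "\<theta> c b a = - \<theta> c a b" "\<theta> a c b = - \<theta> a b c"
      by (intro \<theta>_antisym i)+
    show "s' a b c * s' a b c = s a b c * s a b c
        + (2 * (s a b c * \<theta> a b c) + (2 * (s b c a * \<theta> b c a) + (2 * (s c a b * \<theta> c a b)
        + (\<theta> a b c * \<theta> a b c + (\<theta> b c a * \<theta> b c a + (\<theta> c a b * \<theta> c a b
        + ((-2) * (\<theta> a b c * \<theta> b a c) + ((-2) * (\<theta> b c a * \<theta> c b a) + (-2) * (\<theta> c a b * \<theta> a c b)))))))))"
      unfolding 1 2 3 by (simp add: algebra_simps)
  qed
  have sX: "S3 (\<lambda>a b c. s a b c * \<theta> a b c) = (\<Sum>l<n. \<mu> l * X l)"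
    unfolding S3_def X_def by (simp add: sum_distrib_left mult_ac)
  have sQ: "S3 (\<lambda>a b c. \<theta> a b c * \<theta> a b c) = (\<Sum>l<n. \<mu> l * Q l)"
    unfolding S3_def Q_def by (simp add: sum_distrib_left mult_ac)
  have rX: "S3 (\<lambda>a b c. s b c a * \<theta> b c a) = S3 (\<lambda>a b c. s a b c * \<theta> a b c)"
    "S3 (\<lambda>a b c. s c a b * \<theta> c a b) = S3 (\<lambda>a b c. s a b c * \<theta> a b c)"
    using S3_rotate[of "\<lambda>a b c. s a b c * \<theta> a b c"] S3_rotate[of "\<lambda>a b c. s b c a * \<theta> b c a"] by simp_all
  have rQ: "S3 (\<lambda>a b c. \<theta> b c a * \<theta> b c a) = S3 (\<lambda>a b c. \<theta> a b c * \<theta> a b c)"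
    "S3 (\<lambda>a b c. \<theta> c a b * \<theta> c a b) = S3 (\<lambda>a b c. \<theta> a b c * \<theta> a b c)"
    using S3_rotate[of "\<lambda>a b c. \<theta> a b c * \<theta> a b c"] S3_rotate[of "\<lambda>a b c. \<theta> b c a * \<theta> b c a"] by simp_all
  have rW: "S3 (\<lambda>a b c. \<theta> b c a * \<theta> c b a) = W" "S3 (\<lambda>a b c. \<theta> c a b * \<theta> a c b) = W"
    using S3_rotate[of "\<lambda>a b c. \<theta> a b c * \<theta> b a c"] S3_rotate[of "\<lambda>a b c. \<theta> b c a * \<theta> c b a"]
    by (simp_all add: W_def)
  show ?thesis
    unfolding eq S3_add S3_scale rX rQ rW sX sQ W_def[symmetric] by simp
qed

text \<open>When \<open>l\<close> belongs to \<open>V\<^sup>\<bottom>\<close> only one of the three terms of the cyclic sum survives, because the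
  transition functions do not mix \<open>V\<close> with \<open>V\<^sup>\<bottom>\<close>.\<close>

lemma mixed_terms:
  assumes l: "n \<le> l" "l < r"
  shows "(\<Sum>a<n. \<Sum>b<n. \<mu> a * \<mu> b * \<mu> l * (s' a b l * s' a b l))
    = (\<Sum>a<n. \<Sum>b<n. \<mu> a * \<mu> b * \<mu> l * (s a b l * s a b l)) + 2 * (\<mu> l * X l) + \<mu> l * Q l"
proof -
  have "\<mu> a * \<mu> b * \<mu> l * (s' a b l * s' a b l) = \<mu> a * \<mu> b * \<mu> l * (s a b l * s a b l)
      + 2 * (\<mu> l * (\<mu> a * \<mu> b * (s l a b * \<theta> l a b))) + \<mu> l * (\<mu> a * \<mu> b * (\<theta> l a b * \<theta> l a b))"
    if "a < n" "b < n" for a b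
  proof -
    have i: "a < r" "b < r" using that n_le by simp_all
    have "\<theta> a b l = 0" using \<theta>_mixed i that l by blast
    moreover have "\<theta> b l a = 0" using \<theta>_antisym[of b l a] \<theta>_mixed[of b a l] i that l by simp
    moreover have "s a b l = s l a b" using struct_cyclic[of l a b] i l by simp
    ultimately show ?thesis using struct_change[OF i l(2)] by (simp add: algebra_simps)
  qed
  then show ?thesis
    unfolding X_def Q_def sum_distrib_left sum.distrib[symmetric] by (intro sum.cong refl) simp
qed

text \<open>With the weights \<open>1 / 6\<close> and \<open>1 / 2\<close> the cubic terms cancel \<open>X\<close> and \<open>W\<close>, and what
  remains is a multiple of the sum of \<open>Q\<close> over all indices, which vanishes by the nullity of the anchor.\<close>

lemma on_scal_eq: "on_scal \<mu> e' x = on_scal \<mu> e x"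
proof -
  have split: "(\<Sum>l<r. f l) = (\<Sum>l<n. f l) + (\<Sum>l\<in>{n..<r}. f l)" for f :: "nat => real"
    using sum.union_disjoint[of "{..<n}" "{n..<r}" f] n_le by (simp add: ivl_disj_un ivl_disj_int)
  have mixed: "(\<Sum>l\<in>{n..<r}. \<Sum>a<n. \<Sum>b<n. \<mu> a * \<mu> b * \<mu> l * (s' a b l * s' a b l))
      = (\<Sum>l\<in>{n..<r}. \<Sum>a<n. \<Sum>b<n. \<mu> a * \<mu> b * \<mu> l * (s a b l * s a b l))
        + 2 * (\<Sum>l\<in>{n..<r}. \<mu> l * X l) + (\<Sum>l\<in>{n..<r}. \<mu> l * Q l)"
    using mixed_terms by (simp add: sum.distrib sum_distrib_left)
  have "(\<Sum>l<r. \<mu> l * Q l) = (\<Sum>a<n. \<Sum>b<n. \<mu> a * \<mu> b * (\<Sum>l<r. \<mu> l * (\<theta> l a b * \<theta> l a b)))"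
  proof -
    have "(\<Sum>l<r. \<mu> l * Q l) = (\<Sum>l<r. \<Sum>a<n. \<Sum>b<n. \<mu> l * (\<mu> a * \<mu> b * (\<theta> l a b * \<theta> l a b)))"
      by (simp add: Q_def sum_distrib_left)
    also have "... = (\<Sum>a<n. \<Sum>l<r. \<Sum>b<n. \<mu> l * (\<mu> a * \<mu> b * (\<theta> l a b * \<theta> l a b)))"
      by (rule sum.swap)
    also have "... = (\<Sum>a<n. \<Sum>b<n. \<Sum>l<r. \<mu> l * (\<mu> a * \<mu> b * (\<theta> l a b * \<theta> l a b)))"
      by (intro sum.cong refl sum.swap)
    finally show ?thesis by (simp add: sum_distrib_left mult_ac)
  qed
  also have "... = 0" using \<theta>_null[OF rank_pos] n_le by (intro sum.neutral ballI) simp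
  finally have Q0: "(\<Sum>l<n. \<mu> l * Q l) + (\<Sum>l\<in>{n..<r}. \<mu> l * Q l) = 0" unfolding split .
  show ?thesis
    unfolding on_scal_def divergence_terms mixed S3_def[symmetric] cubic_terms split[of "\<lambda>l. \<mu> l * X l"]
    using Q0 by (simp add: algebra_simps)
qed

end

context pseudometric
begin

text \<open>The coefficients are block diagonal, as contractions over the indices of \<open>V\<close> or of \<open>V\<^sup>\<bottom>\<close> require.\<close>

lemma frame_coefficients:
  assumes e: "basis_of scaleR {..<n} e (V x)" "basis_of scaleR {n..<r} e (Vp x)"
    and b: "orthonormal r x \<mu> b" "\<And>i. i < n ==> b i \<in> V x"
  obtains k where "\<And>i. i < r ==> b i = (\<Sum>j<r. k i j *\<^sub>R e j)"
    "\<And>i j. i < r ==> j < r ==> (i < n) \<noteq> (j < n) ==> k i j = 0"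
proof -
  have nr: "n \<le> r" by (rule pseudometric_rank_le[OF V])
  have "\<exists>c. b i = (\<Sum>j<r. c j *\<^sub>R e j) \<and> (\<forall>j<r. (i < n) \<noteq> (j < n) \<longrightarrow> c j = 0)" if i: "i < r" for i
  proof (cases "i < n")
    case True
    then obtain c where c: "b i = (\<Sum>j<n. c j *\<^sub>R e j)" using e(1) b(2) unfolding basis_of_def by blast
    have "(\<Sum>j<r. (if j < n then c j else 0) *\<^sub>R e j) = (\<Sum>j<n. c j *\<^sub>R e j)"
      using nr by (intro sum.mono_neutral_cong_right) auto
    then show ?thesis using True c by (intro exI[of _ "\<lambda>j. if j < n then c j else 0"]) simp
  next
    case False
    then have "b i \<in> Vp x"
      using real_vector.basis_of_in[OF orthonormal_sub_basis(2)[OF V b], of i] i by simp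
    then obtain c where c: "b i = (\<Sum>j\<in>{n..<r}. c j *\<^sub>R e j)" using e(2) unfolding basis_of_def by blast
    have "(\<Sum>j<r. (if j < n then 0 else c j) *\<^sub>R e j) = (\<Sum>j\<in>{n..<r}. c j *\<^sub>R e j)"
      by (intro sum.mono_neutral_cong_right) auto
    then show ?thesis using False c by (intro exI[of _ "\<lambda>j. if j < n then 0 else c j"]) simp
  qed
  then obtain k where k: "\<And>i. i < r ==> b i = (\<Sum>j<r. k i j *\<^sub>R e j) \<and> (\<forall>j<r. (i < n) \<noteq> (j < n) \<longrightarrow> k i j = 0)"
    by metis
  show ?thesis by (rule that[of k]) (use k in auto)
qed

text \<open>All terms are contractions over the blocks of \<open>V\<close> and \<open>V\<^sup>\<bottom>\<close>, so the frame may be replaced by the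
  orthonormal frame of its constant combinations with prescribed values at \<open>x\<close>.\<close>

lemma gscal_in_frame_orthonormal:
  assumes e: "adapted_frame A E n V x e"
    and b: "orthonormal r x \<mu> b" "\<And>i. i < n ==> b i \<in> V x"
  obtains f where "adapted_on n V x \<mu> f" "\<And>i. i < r ==> f i x = b i"
    "gscal_in_frame E n dv e x = on_scal \<mu> f x"
proof -
  have nr: "n \<le> r" by (rule pseudometric_rank_le[OF V])
  have ev: "\<forall>\<^sub>F y in nhds x. basis_of scaleR {..<r} (\<lambda>i. e i y) (fib E y) \<and>
        (\<forall>i<r. \<forall>j<r. ip E y (e i y) (e j y) = ip E x (e i x) (e j x))"
    and evV: "\<forall>\<^sub>F y in nhds x. basis_of scaleR {..<n} (\<lambda>a. e a y) (V y) \<and>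
        basis_of scaleR {n..<r} (\<lambda>a. e a y) (Vp y)"
    and sec: "\<And>i. i < r ==> e i \<in> Gam A E"
    using e by (auto simp: adapted_frame_def const_frame_def)
  note atx = at_point[OF ev] at_point[OF evV]
  obtain k where k: "\<And>i. i < r ==> b i = (\<Sum>j<r. k i j *\<^sub>R e j x)"
    and block: "\<And>i j. i < r ==> j < r ==> (i < n) \<noteq> (j < n) ==> k i j = 0"
    using frame_coefficients[OF conjunct1[OF atx(2)] conjunct2[OF atx(2)] b] by blast
  interpret C: basis_change A E x e \<mu> b k
    by unfold_locales (use sec atx b k in auto)
  have con: "\<forall>\<^sub>F y in nhds x. \<forall>i<r. \<forall>j<r. ip E y (e i y) (e j y) = ip E x (e i x) (e j x)"
    using ev by eventually_elim blast
  have onV: "\<forall>\<^sub>F y in nhds x. \<forall>i<n. C.on i y \<in> V y"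
    using evV
  proof eventually_elim
    case (elim y)
    show ?case
    proof (intro allI impI)
      fix i assume i: "i < n"
      have "C.on i y = (\<Sum>j<n. k i j *\<^sub>R e j y)"
        unfolding C.on_def C.comb_def using nr i block by (intro sum.mono_neutral_right) auto
      then show "C.on i y \<in> V y" using real_vector.basis_of_sum[OF conjunct1[OF elim]] by simp
    qed
  qed
  have 1: "adapted_on n V x \<mu> C.on"
    unfolding adapted_on_def using C.on_sec C.on_orthonormal[OF con] onV by (auto intro: eventually_conj)
  have vs: "vector_space ((*) :: real => real => real)" by unfold_locales (auto simp: algebra_simps)
  have blN: "k i j = 0" if "i < r" "j < r" "(i \<in> {..<n}) \<noteq> (j \<in> {..<n})" for i j
    using block that by simp
  have subN: "{..<n} \<subseteq> {..<r}" and subM: "{n..<r} \<subseteq> {..<r}" using nr by auto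
  let ?e' = "raised E x e"
  have conN: "(\<Sum>i<n. B (?e' i) (e i)) = (\<Sum>g<n. \<mu> g * B (C.on g) (C.on g))"
    if "\<And>c. C.frame_linear (*) (\<lambda>u. B u (C.comb c))" "\<And>c. C.frame_linear (*) (\<lambda>v. B (C.comb c) v)" for B
    by (rule C.contraction[OF vs subN blN that])
  have lin_dv: "C.frame_linear (*) (\<lambda>u. dv u x)"
    unfolding C.frame_linear_def C.comb_def by (subst dv_sum) (auto intro: sec_const_scale sec simp: dv_scale sec)
  have lin_act1: "C.frame_linear (*) (\<lambda>u. act E u f x)" if "f \<in> C_inf A" for f
    unfolding C.frame_linear_def C.comb_def act_apply using that by (intro allI anchor_comb) (auto intro: C.e_fib)
  have lin_act2: "C.frame_linear (*) (\<lambda>v. act E u (dv v) x)" if u: "u \<in> Gam A E" for u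
    unfolding C.frame_linear_def C.comb_def
  proof
    fix c
    have "dv (\<lambda>y. \<Sum>i<r. c i *\<^sub>R e i y) = (\<lambda>y. \<Sum>i<r. c i * dv (e i) y)"
      by (rule ext, subst dv_sum) (auto intro: sec_const_scale sec simp: dv_scale sec)
    moreover have "anchor E x (u x) (\<lambda>y. \<Sum>i<r. c i * dv (e i) y) = (\<Sum>i<r. anchor E x (u x) (\<lambda>y. c i * dv (e i) y))"
      by (rule anchor_sum_fun[OF sec_fib[OF u]]) (intro C_inf_mult C_inf_const dv_C_inf sec, simp)
    ultimately show "act E u (dv (\<lambda>y. \<Sum>i<r. c i *\<^sub>R e i y)) x = (\<Sum>i<r. c i * act E u (dv (e i)) x)"
      using sec_fib[OF u] by (simp add: act_apply anchor_scale_fun dv_C_inf sec)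
  qed
  have scaled: "C.frame_linear (*) (\<lambda>u. L u * z)" "C.frame_linear (*) (\<lambda>u. z * L u)"
    if "C.frame_linear (*) L" for L and z :: real
    using that by (simp_all add: C.frame_linear_def sum_distrib_left sum_distrib_right mult_ac)
  define T where "T u v w = ip E x (u x) (bracket E v w x)" for u v w
  have T: "C.frame_linear (*) (\<lambda>u. T u v w)" "C.frame_linear (*) (\<lambda>u. T v u w)" "C.frame_linear (*) (\<lambda>u. T v w u)"
    if "v \<in> Gam A E" "w \<in> Gam A E" for v w
    unfolding T_def using C.frame_linear_struct that by blast+
  have Ts: "struct_coeff E x h a b c = T (h a) (h b) (h c)" for h a b c by (simp add: struct_coeff_def T_def)
  have dvt: "(\<Sum>a<n. dv (?e' a) x * dv (e a) x) = (\<Sum>a<n. \<mu> a * (dv (C.on a) x * dv (C.on a) x))"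
    by (rule conN[of "\<lambda>u v. dv u x * dv v x"]) (auto intro: scaled lin_dv)
  have actt: "(\<Sum>a<n. act E (?e' a) (dv (e a)) x) = (\<Sum>a<n. \<mu> a * act E (C.on a) (dv (C.on a)) x)"
    by (rule conN[of "\<lambda>u v. act E u (dv v) x"]) (auto intro: lin_act1 lin_act2 dv_C_inf C.comb_sec)
  let ?Q = "\<lambda>u v w u' v' w'. T u v w * T u' v' w'"
  have cubic: "(\<Sum>a<n. \<Sum>b<n. \<Sum>c\<in>M. ?Q (e a) (e b) (e c) (?e' a) (?e' b) (?e' c))
      = (\<Sum>a<n. \<Sum>b<n. \<Sum>c\<in>M. \<mu> a * \<mu> b * \<mu> c * ?Q (C.on a) (C.on b) (C.on c) (C.on a) (C.on b) (C.on c))"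
    if "M \<subseteq> {..<r}" and bl: "\<forall>i<r. \<forall>j<r. (i \<in> M) \<noteq> (j \<in> M) \<longrightarrow> k i j = 0" for M
  proof (rule C.triple_contraction[OF vs subN that(1)])
    show "k i j = 0" if "i < r" "j < r" "(i \<in> {..<n}) \<noteq> (j \<in> {..<n})" for i j using block that by simp
    show "k i j = 0" if "i < r" "j < r" "(i \<in> M) \<noteq> (j \<in> M)" for i j using bl that by simp
  qed (intro conjI scaled T; simp)
  have swap: "(\<Sum>c\<in>{n..<r}. \<Sum>a<n. \<Sum>b<n. g a b c) = (\<Sum>a<n. \<Sum>b<n. \<Sum>c\<in>{n..<r}. g a b c)"
    for g :: "nat => nat => nat => real"
    by (rule trans[OF sum.swap]) (intro sum.cong refl sum.swap)
  have cN: "\<forall>i<r. \<forall>j<r. (i \<in> {..<n}) \<noteq> (j \<in> {..<n}) \<longrightarrow> k i j = 0"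
    and cM: "\<forall>i<r. \<forall>j<r. (i \<in> {n..<r}) \<noteq> (j \<in> {n..<r}) \<longrightarrow> k i j = 0" using block by auto
  have "gscal_in_frame E n dv e x = on_scal \<mu> C.on x"
    unfolding gscal_in_frame_def on_scal_def Ts dvt actt cubic[OF subN cN] cubic[OF subM cM] swap ..
  then show ?thesis using that 1 C.on_at by blast
qed

theorem gscal_in_frame_independent:
  assumes "0 < r" "adapted_frame A E n V x e" "adapted_frame A E n V x e'"
  shows "gscal_in_frame E n dv e x = gscal_in_frame E n dv e' x"
proof -
  obtain \<mu> b where b: "orthonormal r x \<mu> b" "\<And>i. i < n ==> b i \<in> V x" using onb_exists[of x] by blast
  obtain f where f: "adapted_on n V x \<mu> f" "\<And>i. i < r ==> f i x = b i"
    "gscal_in_frame E n dv e x = on_scal \<mu> f x" using gscal_in_frame_orthonormal[OF assms(2) b] by blast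
  obtain f' where f': "adapted_on n V x \<mu> f'" "\<And>i. i < r ==> f' i x = b i"
    "gscal_in_frame E n dv e' x = on_scal \<mu> f' x" using gscal_in_frame_orthonormal[OF assms(3) b] by blast
  interpret adapted_pair A E dv n V x \<mu> f f'
    by unfold_locales (use f f' assms(1) in \<open>auto simp: adapted_on_def elim: eventually_mono\<close>)
  show ?thesis using f(3) f'(3) on_scal_eq by simp
qed

lemma gscal_eq:
  assumes "0 < r" "adapted_frame A E n V x e"
  shows "gscal A E n V dv x = gscal_in_frame E n dv e x"
  unfolding gscal_def
  by (rule gscal_in_frame_independent[OF assms(1) someI[where P = "adapted_frame A E n V x"] assms(2)])
    (rule assms(2))

end

section \<open>The model spinor module\<close>

definition below_sign :: "nat => nat set => complex" where
  "below_sign i K = (-1) ^ card {j \<in> K. j < i}"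

definition creation :: "nat => form => form" where
  "creation i s K = (if i \<in> K then below_sign i K * s (K - {i}) else 0)"

definition annihilation :: "nat => form => form" where
  "annihilation i s K = (if i \<in> K then 0 else below_sign i K * s (insert i K))"

text \<open>The Clifford action of the vector \<open>(a, b) \<in> L\<^sub>1 \<oplus> L\<^sub>2\<close>.\<close>

definition gam :: "nat => (nat => complex) => (nat => complex) => form => form" where
  "gam m a b s = (\<lambda>K. wedge (one_form m a) s K + contract m b s K)"

definition vacuum :: form where
  "vacuum K = (if K = {} then 1 else 0)"

definition monomial :: "nat set => form" where
  "monomial J K = (if K = J then 1 else 0)"

lemma below_sign_square: "below_sign i K * below_sign i K = 1"
  by (simp add: below_sign_def flip: power_add mult_2)

lemma below_sign_remove: "below_sign i (K - {i}) = below_sign i K"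
  unfolding below_sign_def by (rule arg_cong[where f = "\<lambda>S. (-1) ^ card S"]) auto

lemma below_sign_insert: "below_sign i (insert i K) = below_sign i K"
  unfolding below_sign_def by (rule arg_cong[where f = "\<lambda>S. (-1) ^ card S"]) auto

lemma gam_eq:
  assumes K: "K \<subseteq> {..<m}"
  shows "gam m a b s K = (\<Sum>i<m. a i * creation i s K + b i * annihilation i s K)"
proof -
  have fin: "finite K" using K finite_subset by blast
  have "wedge (one_form m a) s K = (\<Sum>I\<in>(\<lambda>i. {i}) ` K. (-1) ^ card {(i, j). i \<in> I \<and> j \<in> K - I \<and> j < i} * one_form m a I * s (K - I))"
    unfolding wedge_def
  proof (rule sum.mono_neutral_right)
    show "finite (Pow K)" using fin by simp
    show "\<forall>I\<in>Pow K - (\<lambda>i. {i}) ` K. (-1) ^ card {(i, j). i \<in> I \<and> j \<in> K - I \<and> j < i} * one_form m a I * s (K - I) = 0"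
    proof
      fix I assume I: "I \<in> Pow K - (\<lambda>i. {i}) ` K"
      then have "one_form m a I = 0" unfolding one_form_def by (intro sum.neutral) auto
      then show "(-1) ^ card {(i, j). i \<in> I \<and> j \<in> K - I \<and> j < i} * one_form m a I * s (K - I) = 0" by simp
    qed
  qed auto
  also have "... = (\<Sum>i\<in>K. (-1) ^ card {(i', j). i' \<in> {i} \<and> j \<in> K - {i} \<and> j < i'} * one_form m a {i} * s (K - {i}))"
    by (subst sum.reindex) (auto simp: inj_on_def)
  also have "... = (\<Sum>i\<in>K. a i * creation i s K)"
  proof (rule sum.cong, rule refl)
    fix i assume i: "i \<in> K"
    have "{(i', j). i' \<in> {i} \<and> j \<in> K - {i} \<and> j < i'} = Pair i ` {j \<in> K. j < i}" by auto
    then have "card {(i', j). i' \<in> {i} \<and> j \<in> K - {i} \<and> j < i'} = card {j \<in> K. j < i}"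
      by (simp add: card_image inj_on_def)
    moreover have "one_form m a {i} = a i"
    proof -
      have "one_form m a {i} = (\<Sum>j<m. if j = i then a i else 0)"
        unfolding one_form_def by (intro sum.cong) auto
      then show ?thesis using i K by (simp add: subset_eq)
    qed
    ultimately show "(-1) ^ card {(i', j). i' \<in> {i} \<and> j \<in> K - {i} \<and> j < i'} * one_form m a {i} * s (K - {i})
        = a i * creation i s K"
      using i by (simp add: creation_def below_sign_def)
  qed
  also have "... = (\<Sum>i<m. a i * creation i s K)"
    using K by (intro sum.mono_neutral_left) (auto simp: creation_def)
  finally have 1: "wedge (one_form m a) s K = (\<Sum>i<m. a i * creation i s K)" .
  have "contract m b s K = (\<Sum>i\<in>{..<m} - K. b i * annihilation i s K)"
    unfolding contract_def by (intro sum.cong) (auto simp: annihilation_def below_sign_def)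
  also have "... = (\<Sum>i<m. b i * annihilation i s K)"
    by (intro sum.mono_neutral_left) (auto simp: annihilation_def)
  finally show ?thesis using 1 by (simp add: gam_def sum.distrib)
qed

lemma creation_cong:
  assumes "\<And>K. K \<subseteq> {..<m} ==> s K = t K" "K \<subseteq> {..<m}"
  shows "creation i s K = creation i t K"
proof -
  have "K - {i} \<subseteq> {..<m}" using assms(2) by blast
  then show ?thesis using assms(1) by (simp add: creation_def)
qed

lemma annihilation_cong:
  "(\<And>K. K \<subseteq> {..<m} ==> s K = t K) ==> i < m ==> K \<subseteq> {..<m} ==> annihilation i s K = annihilation i t K"
  unfolding annihilation_def by auto

lemma gam_cong:
  assumes "\<And>K. K \<subseteq> {..<m} ==> s K = t K" "K \<subseteq> {..<m}"
  shows "gam m a b s K = gam m a b t K"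
  unfolding gam_eq[OF assms(2)]
  using creation_cong[of m s t K, OF assms] annihilation_cong[of m s t _ K, OF assms(1) _ assms(2)]
  by (intro sum.cong) auto

subsection \<open>The pairing\<close>

definition shuffle_sign :: "nat set => nat set => complex" where
  "shuffle_sign I J = (-1) ^ card {(i, j). i \<in> I \<and> j \<in> J \<and> j < i}"

lemma model_pairing_eq:
  "model_pairing m s t = (\<Sum>I\<in>Pow {..<m}. shuffle_sign I ({..<m} - I) * \<i> ^ card I * s I * t ({..<m} - I))"
  unfolding model_pairing_def wedge_def theta_def shuffle_sign_def by (simp add: mult_ac)

lemma shuffle_sign_prod:
  assumes "finite I" "finite J"
  shows "shuffle_sign I J = (\<Prod>i\<in>I. below_sign i J)"
proof -
  have "{(i, j). i \<in> I \<and> j \<in> J \<and> j < i} = Sigma I (\<lambda>i. {j \<in> J. j < i})" by auto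
  then have "card {(i, j). i \<in> I \<and> j \<in> J \<and> j < i} = (\<Sum>i\<in>I. card {j \<in> J. j < i})"
    using assms by (simp add: card_SigmaI)
  then show ?thesis by (simp add: shuffle_sign_def below_sign_def power_sum)
qed

text \<open>Moving \<open>k\<close> from the second block of a shuffle to the first one.\<close>

lemma shuffle_sign_move:
  assumes "finite J" "finite J'" "k \<in> J'" "k \<notin> J"
  shows "shuffle_sign (insert k J) (J' - {k}) * below_sign k J
    = shuffle_sign J J' * (-1) ^ card J * below_sign k J'"
proof -
  have step: "below_sign i J' = below_sign i (J' - {k}) * (if k < i then -1 else 1)" for i
  proof (cases "k < i")
    case True
    have "{j \<in> J'. j < i} = insert k {j \<in> J' - {k}. j < i}" using True assms(3) by auto
    then show ?thesis using True assms(2) by (simp add: below_sign_def)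
  next
    case False
    then have "{j \<in> J'. j < i} = {j \<in> J' - {k}. j < i}" by auto
    then show ?thesis using False by (simp add: below_sign_def)
  qed
  have "(\<Prod>i\<in>J. if k < i then -1 else 1 :: complex) = (-1) ^ card {i \<in> J. k < i}"
    using assms(1) by (simp add: prod.If_cases Int_def)
  then have 1: "shuffle_sign J J' = (\<Prod>i\<in>J. below_sign i (J' - {k})) * (-1) ^ card {i \<in> J. k < i}"
    using assms by (simp add: shuffle_sign_prod step[of _] prod.distrib)
  have "J = {i \<in> J. i < k} \<union> {i \<in> J. k < i}" "{i \<in> J. i < k} \<inter> {i \<in> J. k < i} = {}"
    using assms(4) by (auto simp: not_less_iff_gr_or_eq)
  then have "card J = card {i \<in> J. i < k} + card {i \<in> J. k < i}"
    using assms(1) card_Un_disjoint[of "{i \<in> J. i < k}" "{i \<in> J. k < i}"] by simp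
  then have "(-1) ^ card J = below_sign k J * (-1 :: complex) ^ card {i \<in> J. k < i}"
    by (simp add: below_sign_def power_add)
  moreover have "(-1) ^ card {i \<in> J. k < i} * (-1) ^ card {i \<in> J. k < i} = (1 :: complex)"
    by (simp flip: power_add mult_2)
  moreover have "shuffle_sign (insert k J) (J' - {k}) = below_sign k J' * (\<Prod>i\<in>J. below_sign i (J' - {k}))"
    using assms by (simp add: shuffle_sign_prod below_sign_remove)
  ultimately show ?thesis unfolding 1 by (simp add: mult_ac)
qed

definition grading :: "form => form" where
  "grading s I = (-1) ^ card I * s I"

lemma pairing_creation:
  assumes "k < m"
  shows "model_pairing m (creation k s) t = \<i> * model_pairing m (grading s) (creation k t)"
proof -
  let ?T = "{..<m}" let ?P = "{I \<in> Pow {..<m}. k \<in> I}" let ?Q = "{I \<in> Pow {..<m}. k \<notin> I}"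
  have "model_pairing m (creation k s) t
      = (\<Sum>I\<in>?P. shuffle_sign I (?T - I) * \<i> ^ card I * creation k s I * t (?T - I))"
    unfolding model_pairing_eq by (intro sum.mono_neutral_right) (auto simp: creation_def)
  also have "... = (\<Sum>J\<in>?Q. \<i> * (shuffle_sign J (?T - J) * \<i> ^ card J * grading s J * creation k t (?T - J)))"
  proof (rule sum.reindex_bij_witness[of _ "insert k" "\<lambda>I. I - {k}"])
    fix J assume J: "J \<in> ?P"
    define I where "I = J - {k}"
    have JI: "J = insert k I" "k \<notin> I" "I \<subseteq> ?T" "k \<in> ?T - I" "finite I" "?T - J = ?T - I - {k}"
      using J assms finite_subset[of I ?T] by (auto simp: I_def)
    have "shuffle_sign J (?T - J) * below_sign k I = shuffle_sign I (?T - I) * (-1) ^ card I * below_sign k (?T - I)"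
      using shuffle_sign_move[of I "?T - I" k] JI by simp
    then show "\<i> * (shuffle_sign (J - {k}) (?T - (J - {k})) * \<i> ^ card (J - {k}) * grading s (J - {k}) * creation k t (?T - (J - {k})))
        = shuffle_sign J (?T - J) * \<i> ^ card J * creation k s J * t (?T - J)"
      using JI(2,4,5,6) unfolding I_def[symmetric]
      by (simp add: grading_def creation_def JI(1) below_sign_insert mult_ac)
  qed (use assms in auto)
  also have "... = (\<Sum>J\<in>Pow ?T. \<i> * (shuffle_sign J (?T - J) * \<i> ^ card J * grading s J * creation k t (?T - J)))"
    using assms by (intro sum.mono_neutral_left) (auto simp: creation_def)
  finally show ?thesis unfolding model_pairing_eq by (simp add: sum_distrib_left)
qed

lemma pairing_annihilation:
  assumes "k < m"
  shows "model_pairing m (annihilation k s) t = \<i> * model_pairing m (grading s) (annihilation k t)"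
proof -
  let ?T = "{..<m}" let ?P = "{I \<in> Pow {..<m}. k \<in> I}" let ?Q = "{I \<in> Pow {..<m}. k \<notin> I}"
  have "model_pairing m (annihilation k s) t
      = (\<Sum>I\<in>?Q. shuffle_sign I (?T - I) * \<i> ^ card I * annihilation k s I * t (?T - I))"
    unfolding model_pairing_eq by (intro sum.mono_neutral_right) (auto simp: annihilation_def)
  also have "... = (\<Sum>J\<in>?P. \<i> * (shuffle_sign J (?T - J) * \<i> ^ card J * grading s J * annihilation k t (?T - J)))"
  proof (rule sum.reindex_bij_witness[of _ "\<lambda>I. I - {k}" "insert k"])
    fix I assume I: "I \<in> ?Q"
    define J where "J = insert k I"
    have JI: "k \<notin> I" "I \<subseteq> ?T" "k \<in> ?T - I" "finite I" "?T - J = ?T - I - {k}" "insert k (?T - I - {k}) = ?T - I"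
      using I assms finite_subset[of I ?T] by (auto simp: J_def)
    have mv: "shuffle_sign J (?T - J) * below_sign k I = shuffle_sign I (?T - I) * (-1) ^ card I * below_sign k (?T - I)"
      using shuffle_sign_move[of I "?T - I" k] JI by (simp add: J_def)
    have sq: "(-1) ^ card I * (-1) ^ card I = (1 :: complex)" by (simp flip: power_add mult_2)
    have "shuffle_sign I (?T - I) * below_sign k I
        = (shuffle_sign I (?T - I) * (-1) ^ card I * below_sign k (?T - I)) * ((-1) ^ card I * below_sign k (?T - I) * below_sign k I)"
      using sq below_sign_square[of k "?T - I"] by (simp add: mult_ac)
    also have "... = shuffle_sign J (?T - J) * (-1) ^ card I * below_sign k (?T - I)"
      unfolding mv[symmetric] using below_sign_square[of k I] by (simp add: mult_ac)
    finally have "shuffle_sign I (?T - I) * below_sign k I = shuffle_sign J (?T - J) * (-1) ^ card I * below_sign k (?T - I)" .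
    then show "\<i> * (shuffle_sign (insert k I) (?T - insert k I) * \<i> ^ card (insert k I) * grading s (insert k I) * annihilation k t (?T - insert k I))
        = shuffle_sign I (?T - I) * \<i> ^ card I * annihilation k s I * t (?T - I)"
      unfolding J_def[symmetric] using JI
      by (simp add: grading_def annihilation_def below_sign_remove J_def mult_ac)
  qed (use assms in auto)
  also have "... = (\<Sum>J\<in>Pow ?T. \<i> * (shuffle_sign J (?T - J) * \<i> ^ card J * grading s J * annihilation k t (?T - J)))"
    using assms by (intro sum.mono_neutral_left) (auto simp: annihilation_def)
  finally show ?thesis unfolding model_pairing_eq by (simp add: sum_distrib_left)
qed

lemma model_pairing_cong:
  assumes "\<And>K. K \<subseteq> {..<m} ==> s K = s' K" "\<And>K. K \<subseteq> {..<m} ==> t K = t' K"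
  shows "model_pairing m s t = model_pairing m s' t'"
  unfolding model_pairing_eq by (intro sum.cong refl) (simp add: assms)

lemma model_pairing_linear:
  "model_pairing m (\<lambda>K. \<Sum>i\<in>I. c i * u i K) t = (\<Sum>i\<in>I. c i * model_pairing m (u i) t)"
  "model_pairing m s (\<lambda>K. \<Sum>i\<in>I. c i * u i K) = (\<Sum>i\<in>I. c i * model_pairing m s (u i))"
  "model_pairing m (\<lambda>K. s1 K + s2 K) t = model_pairing m s1 t + model_pairing m s2 t"
  "model_pairing m s (\<lambda>K. t1 K + t2 K) = model_pairing m s t1 + model_pairing m s t2"
  "model_pairing m (\<lambda>K. z * s K) t = z * model_pairing m s t"
  "model_pairing m s (\<lambda>K. z * t K) = z * model_pairing m s t"
  unfolding model_pairing_eq sum_distrib_left sum_distrib_right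
  by (subst sum.swap, simp add: mult_ac)+ (simp_all add: algebra_simps sum.distrib)

text \<open>The sign comes from moving a vector past \<open>s\<close>, the factor \<open>\<i>\<close> from the change of degree under \<open>\<vartheta>\<close>; it
  is the same for exterior multiplication and contraction.\<close>

lemma pairing_gam: "model_pairing m (gam m a b s) t = \<i> * model_pairing m (grading s) (gam m a b t)"
proof -
  have "model_pairing m (gam m a b s) t
      = model_pairing m (\<lambda>K. (\<Sum>i<m. a i * creation i s K) + (\<Sum>i<m. b i * annihilation i s K)) t"
    by (rule model_pairing_cong) (simp_all add: gam_eq sum.distrib)
  also have "... = (\<Sum>i<m. a i * model_pairing m (creation i s) t) + (\<Sum>i<m. b i * model_pairing m (annihilation i s) t)"
    by (simp only: model_pairing_linear)
  also have "... = \<i> * ((\<Sum>i<m. a i * model_pairing m (grading s) (creation i t))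
      + (\<Sum>i<m. b i * model_pairing m (grading s) (annihilation i t)))"
    by (simp add: pairing_creation pairing_annihilation distrib_left sum_distrib_left mult_ac)
  also have "... = \<i> * model_pairing m (grading s) (\<lambda>K. (\<Sum>i<m. a i * creation i t K) + (\<Sum>i<m. b i * annihilation i t K))"
    by (simp only: model_pairing_linear)
  also have "... = \<i> * model_pairing m (grading s) (gam m a b t)"
    by (intro arg_cong2[where f = "(*)"] refl model_pairing_cong) (simp_all add: gam_eq sum.distrib)
  finally show ?thesis .
qed

lemma grading_gam:
  assumes "K \<subseteq> {..<m}"
  shows "grading (gam m a b s) K = - gam m a b (grading s) K"
proof -
  have fin: "finite K" using assms finite_subset by blast
  have c: "(-1) ^ card K * creation i s K = - creation i (grading s) K" for i
  proof (cases "i \<in> K")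
    case True
    have "(-1) ^ card K = - ((-1) ^ card (K - {i}) :: complex)"
      unfolding card_Suc_Diff1[OF fin True, symmetric] by simp
    then show ?thesis using True by (simp add: creation_def grading_def del: card_Diff_insert card_Diff_singleton)
  qed (simp add: creation_def)
  have a: "(-1) ^ card K * annihilation i s K = - annihilation i (grading s) K" for i
    using fin by (simp add: annihilation_def grading_def)
  have "(-1) ^ card K * (a i * creation i s K + b i * annihilation i s K)
      = - (a i * creation i (grading s) K + b i * annihilation i (grading s) K)" for i
    using c[of i] a[of i] by (simp add: distrib_left mult.left_commute)
  then show ?thesis
    unfolding grading_def[of "gam m a b s"] gam_eq[OF assms] sum_distrib_left sum_negf[symmetric] by simp
qed

text \<open>A product of two Clifford vectors has as adjoint the product in reverse order; so commutators of
  vectors are skew.\<close>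

lemma pairing_gam_gam:
  "model_pairing m (gam m a b (gam m a' b' s)) t = model_pairing m s (gam m a' b' (gam m a b t))"
proof -
  have "model_pairing m (gam m a b (gam m a' b' s)) t = \<i> * model_pairing m (grading (gam m a' b' s)) (gam m a b t)"
    by (rule pairing_gam)
  also have "... = \<i> * model_pairing m (\<lambda>K. -1 * gam m a' b' (grading s) K) (gam m a b t)"
    by (intro arg_cong2[where f = "(*)"] refl model_pairing_cong) (simp_all add: grading_gam)
  also have "... = - \<i> * model_pairing m (gam m a' b' (grading s)) (gam m a b t)"
    by (simp only: model_pairing_linear) simp
  also have "... = - \<i> * (\<i> * model_pairing m (grading (grading s)) (gam m a' b' (gam m a b t)))"
    by (simp only: pairing_gam)
  also have "... = model_pairing m (grading (grading s)) (gam m a' b' (gam m a b t))"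
    by (simp flip: mult.assoc)
  also have "grading (grading s) = s"
    by (rule ext) (simp add: grading_def flip: mult.assoc power_add mult_2)
  finally show ?thesis .
qed

subsection \<open>Irreducibility\<close>

definition matrix_op :: "nat => (nat set => nat set => complex) => form => form" where
  "matrix_op m M s K = (\<Sum>J\<in>Pow {..<m}. M K J * s J)"

text \<open>An operator that commutes with creation and annihilation is determined by its value on the vacuum,
  which is annihilated by all annihilation operators and hence a multiple of the vacuum.  If the
  operator is also skew for the pairing, the multiple is zero.\<close>

lemma commutant_skew_zero:
  fixes M :: "nat set => nat set => complex" and m :: nat
  assumes cre': "\<And>i s K. i < m ==> K \<subseteq> {..<m} ==>
      matrix_op m M (creation i s) K = creation i (matrix_op m M s) K"
    and ann': "\<And>i s K. i < m ==> K \<subseteq> {..<m} ==>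
      matrix_op m M (annihilation i s) K = annihilation i (matrix_op m M s) K"
    and skew': "\<And>s t. model_pairing m (matrix_op m M s) t + model_pairing m s (matrix_op m M t) = 0"
    and KJ: "K \<subseteq> {..<m}" "J \<subseteq> {..<m}"
  shows "M K J = 0"
proof -
  define L where "L = matrix_op m M"
  note cre = cre'[folded L_def] and ann = ann'[folded L_def] and skew = skew'[folded L_def]
  have L_def: "L s K = (\<Sum>J\<in>Pow {..<m}. M K J * s J)" for s K by (simp add: L_def matrix_op_def)
  have Lmon: "L (monomial J) K = M K J" if "J \<subseteq> {..<m}" for J K
  proof -
    have "L (monomial J) K = (\<Sum>I\<in>Pow {..<m}. if I = J then M K J else 0)"
      unfolding L_def by (intro sum.cong) (auto simp: monomial_def)
    then show ?thesis using that by simp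
  qed
  define c where "c = L vacuum {}"
  have vac: "L vacuum K = c * vacuum K" if "K \<subseteq> {..<m}" for K
  proof (cases "K = {}")
    case False
    then obtain i where i: "i \<in> K" by blast
    have "annihilation i vacuum = (\<lambda>_. 0)" by (auto simp: annihilation_def vacuum_def)
    then have "annihilation i (L vacuum) (K - {i}) = 0"
      using ann[of i "K - {i}" vacuum] i that by (auto simp: L_def)
    moreover have "insert i (K - {i}) = K" using i by blast
    ultimately have "L vacuum K = 0"
      using below_sign_square[of i "K - {i}"] by (auto simp: annihilation_def)
    then show ?thesis using False by (simp add: vacuum_def)
  qed (simp add: c_def vacuum_def)
  have mon: "\<forall>K. K \<subseteq> {..<m} \<longrightarrow> L (monomial J) K = c * monomial J K" if "J \<subseteq> {..<m}" for J
  proof -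
    have "finite J" using that finite_subset by blast
    then show ?thesis using that
    proof (induction J rule: finite_induct)
      case empty
      have "monomial {} = vacuum" by (auto simp: monomial_def vacuum_def)
      then show ?case using vac by simp
    next
      case (insert i J)
      then have i: "i < m" and J: "J \<subseteq> {..<m}" by auto
      have cm: "creation i (monomial J) K = below_sign i J * monomial (insert i J) K" for K
      proof (cases "K = insert i J")
        case True
        then show ?thesis using insert.hyps by (simp add: creation_def monomial_def below_sign_insert)
      next
        case False
        then have "i \<in> K \<longrightarrow> K - {i} \<noteq> J" by auto
        then show ?thesis using False by (simp add: creation_def monomial_def)
      qed
      show ?case
      proof (intro allI impI)
        fix K assume K: "K \<subseteq> {..<m}"
        have "L (creation i (monomial J)) K = creation i (L (monomial J)) K" by (rule cre[OF i K])
        also have "... = creation i (\<lambda>K. c * monomial J K) K"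
          by (rule creation_cong[OF _ K]) (use insert.IH J in blast)
        also have "... = c * creation i (monomial J) K" by (simp add: creation_def)
        finally have "L (creation i (monomial J)) K = c * creation i (monomial J) K" .
        moreover have "L (creation i (monomial J)) K = below_sign i J * L (monomial (insert i J)) K"
          unfolding L_def cm by (simp add: sum_distrib_left mult_ac)
        ultimately have "below_sign i J * L (monomial (insert i J)) K = below_sign i J * (c * monomial (insert i J) K)"
          by (simp add: cm mult_ac)
        then have "(below_sign i J * below_sign i J) * L (monomial (insert i J)) K
            = (below_sign i J * below_sign i J) * (c * monomial (insert i J) K)"
          by (simp only: mult.assoc)
        then show "L (monomial (insert i J)) K = c * monomial (insert i J) K" by (simp add: below_sign_square)
      qed
    qed
  qed
  have "c = 0"
  proof -
    let ?top = "monomial {..<m}"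
    have "model_pairing m (L vacuum) ?top = model_pairing m (\<lambda>K. c * vacuum K) ?top"
      using vac by (intro model_pairing_cong) auto
    then have 1: "model_pairing m (L vacuum) ?top = c * model_pairing m vacuum ?top"
      by (simp only: model_pairing_linear)
    have "model_pairing m vacuum (L ?top) = model_pairing m vacuum (\<lambda>K. c * ?top K)"
      using mon[OF order_refl] by (intro model_pairing_cong) auto
    then have 2: "model_pairing m vacuum (L ?top) = c * model_pairing m vacuum ?top"
      by (simp only: model_pairing_linear)
    have "model_pairing m vacuum ?top = (\<Sum>I\<in>Pow {..<m}. if I = {} then 1 else 0)"
      unfolding model_pairing_eq
      by (intro sum.cong) (auto simp: vacuum_def monomial_def shuffle_sign_def)
    then have "model_pairing m vacuum ?top = 1" by simp
    then show ?thesis using skew[of vacuum ?top] 1 2 by simp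
  qed
  then show ?thesis using mon[OF KJ(2)] KJ(1) Lmon[OF KJ(2)] by simp
qed

text \<open>Vectors \<open>(p \<alpha>, q \<alpha>)\<close> that satisfy the Clifford relations of an orthonormal basis span
  \<open>L\<^sub>1 \<oplus> L\<^sub>2\<close>, so an operator commuting with their action commutes with creation and annihilation.\<close>

lemma clifford_span:
  fixes p q :: "nat => nat => complex" and \<mu> :: "nat => real"
  assumes \<mu>: "\<And>i. i < 2 * m ==> \<mu> i \<noteq> 0"
    and rel: "\<And>i j s K. i < 2 * m ==> j < 2 * m ==> K \<subseteq> {..<m} ==>
      gam m (p i) (q i) (gam m (p j) (q j) s) K + gam m (p j) (q j) (gam m (p i) (q i) s) K
        = of_real (if i = j then \<mu> i else 0) * s K"
  shows "\<exists>u v. \<forall>k s K. k < m \<longrightarrow> K \<subseteq> {..<m} \<longrightarrow>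
    creation k s K = (\<Sum>i<2*m. u k i * gam m (p i) (q i) s K) \<and>
    annihilation k s K = (\<Sum>i<2*m. v k i * gam m (p i) (q i) s K)"
proof -
  have gram: "(\<Sum>k<m. q i k * p j k + q j k * p i k) = of_real (if i = j then \<mu> i else 0)"
    if ij: "i < 2 * m" "j < 2 * m" for i j
  proof -
    have one: "gam m (p j) (q j) vacuum {k} = p j k" if "k < m" for j k
    proof -
      have "{j \<in> {k}. j < k} = {}" by auto
      then have "below_sign k {k} = 1" by (simp only: below_sign_def card.empty power_0)
      then have "p j i * creation i vacuum {k} + q j i * annihilation i vacuum {k} = (if i = k then p j k else 0)" for i
        by (cases "i = k") (simp_all add: creation_def annihilation_def vacuum_def)
      then have "gam m (p j) (q j) vacuum {k} = (\<Sum>i<m. if i = k then p j k else 0)"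
        using that by (subst gam_eq) simp_all
      then show ?thesis using that by simp
    qed
    have "gam m (p i) (q i) (gam m (p j) (q j) vacuum) {} = (\<Sum>k<m. q i k * p j k)" for i j
      by (subst gam_eq) (auto intro!: sum.cong simp: creation_def annihilation_def below_sign_def one)
    then show ?thesis using rel[OF ij, of "{}" vacuum] by (simp add: sum.distrib vacuum_def)
  qed
  define a where "a i kb = (\<lambda>_::unit. if snd kb then p i (fst kb) else q i (fst kb))" for i and kb :: "nat \<times> bool"
  let ?C = "{..<m} \<times> (UNIV :: bool set)"
  have ind: "\<forall>i\<in>{..<2*m}. c i = 0" if c: "\<And>kb. kb \<in> ?C ==> (\<Sum>i<2*m. c i * a i kb ()) = 0" for c
  proof
    fix j assume j: "j \<in> {..<2*m}"
    have cp: "(\<Sum>i<2*m. c i * p i k) = 0" and cq: "(\<Sum>i<2*m. c i * q i k) = 0" if "k < m" for k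
      using c[of "(k, True)"] c[of "(k, False)"] that by (simp_all add: a_def)
    have "(\<Sum>i<2*m. c i * of_real (if i = j then \<mu> i else 0)) = (\<Sum>i<2*m. \<Sum>k<m. (c i * q i k) * p j k + q j k * (c i * p i k))"
      using j by (intro sum.cong refl) (simp add: gram[symmetric] sum_distrib_left distrib_left mult_ac del: of_real_0)
    also have "... = (\<Sum>k<m. (\<Sum>i<2*m. c i * q i k) * p j k + q j k * (\<Sum>i<2*m. c i * p i k))"
      by (subst sum.swap) (simp add: sum.distrib sum_distrib_left sum_distrib_right)
    also have "... = 0" using cp cq by simp
    finally have "(\<Sum>i<2*m. if i = j then c j * of_real (\<mu> j) else 0) = 0"
      by (simp add: if_distrib[of "\<lambda>z. _ * z"] if_distrib[of of_real] cong: if_cong)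
    then show "c j = 0" using j \<mu>[of j] by simp
  qed
  \<comment> \<open>The principal filter on a one-point space turns germs into constants.\<close>
  have "\<exists>b. (\<forall>k\<in>?C. \<forall>i\<in>{..<2*m}. b k i \<in> (UNIV :: (unit => complex) set)) \<and>
      (\<forall>k\<in>?C. \<forall>k'\<in>?C. \<forall>\<^sub>F y in principal {()}. (\<Sum>i<2*m. b k i y * a i k' y) = (if k = k' then 1 else 0))"
  proof (rule germ_matrix_left_inverse[of UNIV "()" "principal {()}"])
    show "\<exists>g\<in>UNIV. \<forall>\<^sub>F y in principal {()}. g y * f y = 1" if "f () \<noteq> 0" for f :: "unit => complex"
      using that by (intro bexI[of _ "\<lambda>_. 1 / f ()"]) (auto simp: eventually_principal)
  qed (use ind in \<open>auto simp: eventually_principal card_cartesian_product\<close>)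
  then obtain b where "\<forall>k\<in>?C. \<forall>k'\<in>?C. \<forall>\<^sub>F y in principal {()}. (\<Sum>i<2*m. b k i y * a i k' y) = (if k = k' then 1 else 0)"
    by blast
  then have b: "(\<Sum>i<2*m. b k i () * a i k' ()) = (if k = k' then 1 else 0)" if "k \<in> ?C" "k' \<in> ?C" for k k'
    using that unfolding eventually_principal by blast
  have exp: "(\<Sum>i<2*m. b kb i () * gam m (p i) (q i) s K)
      = (\<Sum>k<m. (\<Sum>i<2*m. b kb i () * p i k) * creation k s K + (\<Sum>i<2*m. b kb i () * q i k) * annihilation k s K)"
    if "K \<subseteq> {..<m}" for kb s K
  proof -
    have "(\<Sum>i<2*m. b kb i () * gam m (p i) (q i) s K)
        = (\<Sum>i<2*m. \<Sum>k<m. b kb i () * p i k * creation k s K + b kb i () * q i k * annihilation k s K)"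
      unfolding gam_eq[OF that] sum_distrib_left by (simp add: distrib_left mult.assoc)
    then show ?thesis by (subst (asm) sum.swap) (simp add: sum.distrib sum_distrib_right)
  qed
  show ?thesis
  proof (rule exI[of _ "\<lambda>k i. b (k, True) i ()"], rule exI[of _ "\<lambda>k i. b (k, False) i ()"], intro allI impI)
    fix k s K assume k: "k < m" and K: "K \<subseteq> {..<m}"
    have "(\<Sum>i<2*m. b (k, t) i () * p i l) = (if t \<and> k = l then 1 else 0)"
      "(\<Sum>i<2*m. b (k, t) i () * q i l) = (if \<not> t \<and> k = l then 1 else 0)" if "l < m" for l t
      using b[of "(k, t)" "(l, True)"] b[of "(k, t)" "(l, False)"] that k by (auto simp: a_def)
    then show "creation k s K = (\<Sum>i<2*m. b (k, True) i () * gam m (p i) (q i) s K) \<and>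
      annihilation k s K = (\<Sum>i<2*m. b (k, False) i () * gam m (p i) (q i) s K)"
      unfolding exp[OF K] using k
      by (simp_all add: if_distrib[of "\<lambda>z. z * _"] cong: if_cong)
  qed
qed

theorem clifford_commutant_skew_zero:
  fixes p q :: "nat => nat => complex" and \<mu> :: "nat => real" and M :: "nat set => nat set => complex" and m :: nat
  assumes \<mu>: "\<And>i. i < 2 * m ==> \<mu> i \<noteq> 0"
    and rel: "\<And>i j s K. i < 2 * m ==> j < 2 * m ==> K \<subseteq> {..<m} ==>
      gam m (p i) (q i) (gam m (p j) (q j) s) K + gam m (p j) (q j) (gam m (p i) (q i) s) K
        = of_real (if i = j then \<mu> i else 0) * s K"
    and comm: "\<And>i s K. i < 2 * m ==> K \<subseteq> {..<m} ==>
      matrix_op m M (gam m (p i) (q i) s) K = gam m (p i) (q i) (matrix_op m M s) K"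
    and skew: "\<And>s t. model_pairing m (matrix_op m M s) t + model_pairing m s (matrix_op m M t) = 0"
    and KJ: "K \<subseteq> {..<m}" "J \<subseteq> {..<m}"
  shows "M K J = 0"
proof -
  let ?L = "matrix_op m M"
  obtain u v where uv: "\<And>k s K. k < m ==> K \<subseteq> {..<m} ==>
      creation k s K = (\<Sum>i<2*m. u k i * gam m (p i) (q i) s K) \<and>
      annihilation k s K = (\<Sum>i<2*m. v k i * gam m (p i) (q i) s K)"
    using clifford_span[OF \<mu> rel] by blast
  have cre: "\<And>k s K. k < m ==> K \<subseteq> {..<m} ==> creation k s K = (\<Sum>i<2*m. u k i * gam m (p i) (q i) s K)"
    and ann: "\<And>k s K. k < m ==> K \<subseteq> {..<m} ==> annihilation k s K = (\<Sum>i<2*m. v k i * gam m (p i) (q i) s K)"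
    using uv by blast+
  have L_cong: "?L s K = ?L t K" if "\<And>J. J \<subseteq> {..<m} ==> s J = t J" for s t K
    unfolding matrix_op_def using that by (intro sum.cong) auto
  have L_comb: "?L (\<lambda>J. \<Sum>i<2*m. w i * gam m (p i) (q i) s J) K = (\<Sum>i<2*m. w i * gam m (p i) (q i) (?L s) K)"
    if "K \<subseteq> {..<m}" for w s K
  proof -
    have "?L (\<lambda>J. \<Sum>i<2*m. w i * gam m (p i) (q i) s J) K = (\<Sum>i<2*m. w i * ?L (gam m (p i) (q i) s) K)"
      unfolding matrix_op_def sum_distrib_left by (subst sum.swap) (simp add: mult_ac)
    then show ?thesis using comm that by simp
  qed
  show ?thesis
  proof (rule commutant_skew_zero)
    show "?L (creation i s) K = creation i (?L s) K" if "i < m" "K \<subseteq> {..<m}" for i s K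
      using L_cong[of "creation i s" "\<lambda>J. \<Sum>j<2*m. u i j * gam m (p j) (q j) s J" K] cre[OF that(1)]
        L_comb[OF that(2)] that(2) by simp
    show "?L (annihilation i s) K = annihilation i (?L s) K" if "i < m" "K \<subseteq> {..<m}" for i s K
      using L_cong[of "annihilation i s" "\<lambda>J. \<Sum>j<2*m. v i j * gam m (p j) (q j) s J" K] ann[OF that(1)]
        L_comb[OF that(2)] that(2) by simp
  qed (use skew KJ in auto)
qed

section \<open>Spinor bundles and their flat local derivatives\<close>

subsection \<open>Derivatives of complex functions\<close>

context courant_alg
begin

abbreviation "cder x u \<equiv> complex_deriv (anchor E x u)"

lemma Re_C_inf: "smooth_fun_on A UNIV f ==> (\<lambda>y. Re (f y)) \<in> C_inf A"
  and Im_C_inf: "smooth_fun_on A UNIV f ==> (\<lambda>y. Im (f y)) \<in> C_inf A"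
  by (simp_all add: C_inf_iff smooth_fun_on_linear[OF bounded_linear_Re] smooth_fun_on_linear[OF bounded_linear_Im])

lemma smooth_complex:
  fixes f g :: "'m => complex"
  shows "smooth_fun_on A UNIV (\<lambda>_. c)"
    and "smooth_fun_on A UNIV f ==> smooth_fun_on A UNIV g ==> smooth_fun_on A UNIV (\<lambda>y. f y + g y)"
    and "smooth_fun_on A UNIV f ==> smooth_fun_on A UNIV g ==> smooth_fun_on A UNIV (\<lambda>y. f y * g y)"
    and "(\<And>i. i \<in> I ==> smooth_fun_on A UNIV (h i)) ==> smooth_fun_on A UNIV (\<lambda>y. \<Sum>i\<in>I. h i y :: complex)"
    and "k \<in> C_inf A ==> smooth_fun_on A UNIV (\<lambda>y. of_real (k y) :: complex)"
  by (auto intro: smooth_fun_on_const smooth_fun_on_add smooth_fun_on_mult smooth_fun_on_sum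
      smooth_fun_on_linear[OF bounded_linear_of_real] simp: C_inf_iff)

lemma cder_const: "u \<in> fib E x ==> cder x u (\<lambda>_. c) = 0"
  by (simp add: complex_deriv_def anchor_const Complex_eq)

lemma cder_add: "u \<in> fib E x ==> smooth_fun_on A UNIV f ==> smooth_fun_on A UNIV g ==>
    cder x u (\<lambda>y. f y + g y) = cder x u f + cder x u g"
  by (simp add: complex_deriv_def anchor_add_fun Re_C_inf Im_C_inf complex_eq_iff)

lemma cder_mult: "u \<in> fib E x ==> smooth_fun_on A UNIV f ==> smooth_fun_on A UNIV g ==>
    cder x u (\<lambda>y. f y * g y) = f x * cder x u g + g x * cder x u f"
  by (simp add: complex_deriv_def anchor_add_fun anchor_diff_fun anchor_mult_fun C_inf_mult Re_C_inf Im_C_inf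
      complex_eq_iff algebra_simps)

lemma cder_scale: "u \<in> fib E x ==> smooth_fun_on A UNIV f ==> cder x u (\<lambda>y. c * f y) = c * cder x u f"
  using cder_mult[of u x "\<lambda>_. c" f] by (simp add: smooth_complex cder_const)

lemma cder_sum: "u \<in> fib E x ==> (\<And>i. i \<in> I ==> smooth_fun_on A UNIV (h i)) ==>
    cder x u (\<lambda>y. \<Sum>i\<in>I. h i y) = (\<Sum>i\<in>I. cder x u (h i))"
  by (induction I rule: infinite_finite_induct) (auto simp: cder_const cder_add smooth_complex)

lemma cder_of_real: "u \<in> fib E x ==> k \<in> C_inf A ==> cder x u (\<lambda>y. of_real (k y)) = of_real (anchor E x u k)"
  by (simp add: complex_deriv_def anchor_const complex_eq_iff)

lemma cder_local:
  assumes "u \<in> fib E x" "smooth_fun_on A UNIV f" "\<forall>\<^sub>F y in nhds x. f y = g y"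
  shows "cder x u f = cder x u g"
proof -
  have "anchor E x u (\<lambda>y. Re (f y)) = anchor E x u (\<lambda>y. Re (g y))"
    by (rule anchor_near_cong[OF assms(1) Re_C_inf[OF assms(2)]]) (use assms(3) in \<open>auto elim: eventually_mono\<close>)
  moreover have "anchor E x u (\<lambda>y. Im (f y)) = anchor E x u (\<lambda>y. Im (g y))"
    by (rule anchor_near_cong[OF assms(1) Im_C_inf[OF assms(2)]]) (use assms(3) in \<open>auto elim: eventually_mono\<close>)
  ultimately show ?thesis by (simp add: complex_deriv_def)
qed

lemma cder_comb_vec:
  assumes "\<And>i. i \<in> I ==> u i \<in> fib E x" "smooth_fun_on A UNIV f"
  shows "cder x (\<Sum>i\<in>I. c i *\<^sub>R u i) f = (\<Sum>i\<in>I. of_real (c i) * cder x (u i) f)"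
proof -
  have "anchor E x (\<Sum>i\<in>I. c i *\<^sub>R u i) (\<lambda>y. Re (f y)) = (\<Sum>i\<in>I. c i * anchor E x (u i) (\<lambda>y. Re (f y)))"
    and "anchor E x (\<Sum>i\<in>I. c i *\<^sub>R u i) (\<lambda>y. Im (f y)) = (\<Sum>i\<in>I. c i * anchor E x (u i) (\<lambda>y. Im (f y)))"
    by (intro anchor_comb assms Re_C_inf Im_C_inf; assumption)+
  then show ?thesis by (simp add: complex_deriv_def complex_eq_iff Re_sum Im_sum)
qed

end

subsection \<open>Spinor bundles\<close>

lemma gam_matrix:
  assumes "K \<subseteq> {..<m}"
  shows "gam m a b s K = (\<Sum>J\<in>Pow {..<m}. gam m a b (monomial J) K * s J)"
proof -
  have exp: "s I = (\<Sum>J\<in>Pow {..<m}. monomial J I * s J)" if "I \<subseteq> {..<m}" for I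
  proof -
    have "(\<Sum>J\<in>Pow {..<m}. monomial J I * s J) = (\<Sum>J\<in>Pow {..<m}. if J = I then s I else 0)"
      by (intro sum.cong) (auto simp: monomial_def)
    then show ?thesis using that by simp
  qed
  have c: "creation i s K = (\<Sum>J\<in>Pow {..<m}. creation i (monomial J) K * s J)" if "i < m" for i
    using exp[OF subset_trans[OF Diff_subset assms], of "{i}"] by (simp add: creation_def sum_distrib_left mult.assoc)
  have a: "annihilation i s K = (\<Sum>J\<in>Pow {..<m}. annihilation i (monomial J) K * s J)" if "i < m" for i
    using exp[of "insert i K"] assms that by (auto simp: annihilation_def sum_distrib_left mult.assoc)
  have "gam m a b s K = (\<Sum>i<m. \<Sum>J\<in>Pow {..<m}. (a i * creation i (monomial J) K + b i * annihilation i (monomial J) K) * s J)"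
    unfolding gam_eq[OF assms]
    by (intro sum.cong refl) (simp add: c a sum_distrib_left sum.distrib distrib_right mult.assoc)
  also have "... = (\<Sum>J\<in>Pow {..<m}. gam m a b (monomial J) K * s J)"
    unfolding gam_eq[OF assms] sum_distrib_right by (rule sum.swap)
  finally show ?thesis .
qed

lemma gam_linear:
  assumes "K \<subseteq> {..<m}"
  shows "gam m a b (\<lambda>I. \<Sum>i\<in>X. c i * s i I) K = (\<Sum>i\<in>X. c i * gam m a b (s i) K)"
  unfolding gam_matrix[OF assms, of a b "\<lambda>I. \<Sum>i\<in>X. c i * s i I"] gam_matrix[OF assms, of a b "s _"] sum_distrib_left
  by (subst sum.swap) (simp add: mult_ac)

lemma gam_vector:
  assumes "K \<subseteq> {..<m}"
  shows "gam m (\<lambda>j. \<Sum>i\<in>X. c i * a i j) (\<lambda>j. \<Sum>i\<in>X. c i * b i j) s K = (\<Sum>i\<in>X. c i * gam m (a i) (b i) s K)"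
  unfolding gam_eq[OF assms] sum_distrib_left sum_distrib_right sum.distrib[symmetric]
  by (subst sum.swap) (simp add: distrib_left sum.distrib mult_ac)

locale spin_bundle = courant_div A E dv
  for A :: "('m::{t2_space, second_countable_topology}, 'b::{real_inner, heine_borel}) atlas"
    and E :: "('m, 'v::real_vector) courant" and dv :: "('m => 'v) => 'm => real" +
  fixes S :: "('m, 'v, 'w::ab_group_add) spinors"
  assumes spinors: "spinor_bundle A E S"
begin

abbreviation "m \<equiv> r div 2"
abbreviation "sfib \<equiv> fibre (sbundle S)"

lemma r_eq: "r = 2 * m"
  using spinors by (simp add: spinor_bundle_def)

lemma s_index: "vb_index (sbundle S) = Pow {..<m}"
  using spinors by (simp add: spinor_bundle_def)

sublocale sb: smooth_bundle A "smult S" "sbundle S"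
  by unfold_locales (use spinors in \<open>simp add: spinor_bundle_def\<close>)

lemma cl_axioms:
  assumes "u \<in> fib E x" "v \<in> fib E x" "\<phi> \<in> sfib x" "\<xi> \<in> sfib x"
  shows "cl S x u \<phi> \<in> sfib x"
    and "cl S x (u + v) \<phi> = cl S x u \<phi> + cl S x v \<phi>"
    and "cl S x (c *\<^sub>R u) \<phi> = smult S (of_real c) (cl S x u \<phi>)"
    and "cl S x u (\<phi> + \<xi>) = cl S x u \<phi> + cl S x u \<xi>"
    and "cl S x u (smult S z \<phi>) = smult S z (cl S x u \<phi>)"
    and "cl S x u (cl S x v \<phi>) + cl S x v (cl S x u \<phi>) = smult S (of_real (ip E x u v)) \<phi>"
proof -
  have "\<forall>x. \<forall>u\<in>fib E x. \<forall>v\<in>fib E x. \<forall>\<phi>\<in>sfib x. \<forall>\<xi>\<in>sfib x. \<forall>(c::real) z.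
        cl S x u \<phi> \<in> sfib x \<and>
        cl S x (u + v) \<phi> = cl S x u \<phi> + cl S x v \<phi> \<and>
        cl S x (c *\<^sub>R u) \<phi> = smult S (of_real c) (cl S x u \<phi>) \<and>
        cl S x u (\<phi> + \<xi>) = cl S x u \<phi> + cl S x u \<xi> \<and>
        cl S x u (smult S z \<phi>) = smult S z (cl S x u \<phi>) \<and>
        cl S x u (cl S x v \<phi>) + cl S x v (cl S x u \<phi>) = smult S (of_real (ip E x u v)) \<phi>"
    using spinors by (simp add: spinor_bundle_def)
  note * = bspec[OF bspec[OF bspec[OF bspec[OF spec[OF this] assms(1)] assms(2)] assms(3)] assms(4), THEN spec, THEN spec]
  show "cl S x u \<phi> \<in> sfib x"
    and "cl S x (u + v) \<phi> = cl S x u \<phi> + cl S x v \<phi>"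
    and "cl S x (c *\<^sub>R u) \<phi> = smult S (of_real c) (cl S x u \<phi>)"
    and "cl S x u (\<phi> + \<xi>) = cl S x u \<phi> + cl S x u \<xi>"
    and "cl S x u (smult S z \<phi>) = smult S z (cl S x u \<phi>)"
    and "cl S x u (cl S x v \<phi>) + cl S x v (cl S x u \<phi>) = smult S (of_real (ip E x u v)) \<phi>"
    using *[of c z] by auto
qed

lemmas cl_in = cl_axioms(1)[OF _ fib_zero _ sb.fibre_zero]
  and cl_add_vec = cl_axioms(2)[OF _ _ _ sb.fibre_zero]
  and cl_scale_vec = cl_axioms(3)[OF _ fib_zero _ sb.fibre_zero]
  and cl_add = cl_axioms(4)[OF _ fib_zero]
  and cl_smult = cl_axioms(5)[OF _ fib_zero _ sb.fibre_zero]
  and clifford = cl_axioms(6)[OF _ _ _ sb.fibre_zero]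

lemma cl_zero: "u \<in> fib E x ==> cl S x u 0 = 0"
  using cl_smult[of u x 0 0] sb.fibre_zero by simp

lemma cl_zero_vec: "\<phi> \<in> sfib x ==> cl S x 0 \<phi> = 0"
  using cl_scale_vec[of 0 x \<phi> 0] fib_zero by simp

lemma cl_sum: "u \<in> fib E x ==> (\<And>i. i \<in> I ==> \<phi> i \<in> sfib x) ==>
    cl S x u (\<Sum>i\<in>I. \<phi> i) = (\<Sum>i\<in>I. cl S x u (\<phi> i))"
  by (induction I rule: infinite_finite_induct) (auto simp: cl_zero cl_add sb.fibre_sum)

lemma cl_comb_vec:
  assumes "\<And>i. i \<in> I ==> u i \<in> fib E x" "\<phi> \<in> sfib x"
  shows "cl S x (\<Sum>i\<in>I. c i *\<^sub>R u i) \<phi> = (\<Sum>i\<in>I. smult S (of_real (c i)) (cl S x (u i) \<phi>))"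
  using assms(1)
proof (induction I rule: infinite_finite_induct)
  case (insert i I)
  then have "(\<Sum>i\<in>I. c i *\<^sub>R u i) \<in> fib E x" by (intro fib_sum fib_scale) auto
  then show ?case using insert assms(2) by (simp add: cl_add_vec cl_scale_vec fib_scale)
qed (use assms(2) in \<open>auto simp: cl_zero_vec\<close>)

subsection \<open>Flat local derivatives\<close>

abbreviation "sbasis \<psi> y \<equiv> basis_of (smult S) (Pow {..<m}) (\<lambda>I. \<psi> I y) (sfib y)"

abbreviation "tr \<equiv> triv S m"

text \<open>Frames of \<open>E\<close> and \<open>S\<close> near \<open>x\<close> as in a spin frame, with an orthonormal frame of \<open>E\<close>.\<close>

definition spin_on :: "'m => (nat => real) => (nat => 'm => 'v) => (nat set => 'm => 'w) =>
    (nat => nat => complex) => (nat => nat => complex) => bool" where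
  "spin_on x \<mu> f \<psi> p q \<longleftrightarrow> (\<forall>i<r. f i \<in> Gam A E) \<and> (\<forall>I\<in>Pow {..<m}. \<psi> I \<in> sGam A S) \<and>
    (\<forall>\<^sub>F y in nhds x. orthonormal r y \<mu> (\<lambda>i. f i y) \<and>
      sbasis \<psi> y \<and>
      (\<forall>i<r. \<forall>s. cl S y (f i y) (tr \<psi> y s) = tr \<psi> y (gam m (p i) (q i) s)) \<and>
      (\<forall>s t. spair S y (tr \<psi> y s) (tr \<psi> y t) = model_pairing m s t))"

lemma spin_on_near:
  assumes "spin_on x \<mu> f \<psi> p q"
  shows "\<forall>\<^sub>F y in nhds x. sbasis \<psi> y \<and>
      (\<forall>i<r. \<forall>s. cl S y (f i y) (tr \<psi> y s) = tr \<psi> y (gam m (p i) (q i) s)) \<and>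
      (\<forall>s t. spair S y (tr \<psi> y s) (tr \<psi> y t) = model_pairing m s t)"
  using assms unfolding spin_on_def by (auto elim: eventually_mono)

lemma triv_cong: "(\<And>I. I \<subseteq> {..<m} ==> s I = t I) ==> tr \<psi> y s = tr \<psi> y t"
  unfolding triv_def by (intro sum.cong) auto

lemma triv_sum: "tr \<psi> y (\<lambda>I. \<Sum>i\<in>X. c i * s i I) = (\<Sum>i\<in>X. smult S (c i) (tr \<psi> y (s i)))"
  unfolding triv_def sb.vs.scale_sum_left sb.vs.scale_sum_right by (subst sum.swap) simp

lemma triv_add: "tr \<psi> y (\<lambda>I. s I + t I) = tr \<psi> y s + tr \<psi> y t"
  unfolding triv_def by (simp add: sb.vs.scale_left_distrib sum.distrib)

lemma triv_scale: "tr \<psi> y (\<lambda>I. c * s I) = smult S c (tr \<psi> y s)"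
  unfolding triv_def by (simp add: sb.vs.scale_sum_right)

lemma triv_monomial: "I \<subseteq> {..<m} ==> tr \<psi> y (monomial I) = \<psi> I y"
proof -
  assume I: "I \<subseteq> {..<m}"
  have "tr \<psi> y (monomial I) = (\<Sum>J\<in>Pow {..<m}. if J = I then \<psi> I y else 0)"
    unfolding triv_def by (intro sum.cong) (auto simp: monomial_def)
  then show ?thesis using I by simp
qed

abbreviation co :: "(nat set => 'm => 'w) => 'm => 'w => form" where
  "co \<psi> y \<phi> \<equiv> coords (smult S) (Pow {..<m}) (\<lambda>J. \<psi> J y) \<phi>"

text \<open>The derivative along \<open>u\<close> for which the frame \<open>\<psi>\<close> is constant.\<close>

definition nab :: "(nat set => 'm => 'w) => 'm => 'v => ('m => 'w) => 'w" where
  "nab \<psi> x u H = tr \<psi> x (\<lambda>I. cder x u (\<lambda>y. co \<psi> y (H y) I))"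

text \<open>\<open>h\<close> is the coordinate form of \<open>H\<close> near \<open>x\<close>.\<close>

definition rep :: "(nat set => 'm => 'w) => 'm => ('m => 'w) => (nat set => 'm => complex) => bool" where
  "rep \<psi> x H h \<longleftrightarrow> (\<forall>I\<in>Pow {..<m}. smooth_fun_on A UNIV (h I)) \<and>
     (\<forall>\<^sub>F y in nhds x. H y = tr \<psi> y (\<lambda>I. h I y))"

lemma co_triv:
  assumes "sbasis \<psi> y" "I \<subseteq> {..<m}"
  shows "co \<psi> y (tr \<psi> y s) I = s I"
  by (rule sb.vs.coords_eq[OF assms(1)]) (use assms(2) in \<open>auto simp: triv_def\<close>)

lemma triv_co:
  assumes "sbasis \<psi> y" "\<phi> \<in> sfib y"
  shows "tr \<psi> y (co \<psi> y \<phi>) = \<phi>"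
  unfolding triv_def by (rule sb.vs.coords_sum[OF assms])

lemma triv_in:
  assumes "sbasis \<psi> y"
  shows "tr \<psi> y s \<in> sfib y"
  unfolding triv_def by (rule sb.vs.basis_of_sum[OF assms])

lemma nab_rep:
  assumes "\<forall>\<^sub>F y in nhds x. sbasis \<psi> y" "rep \<psi> x H h" "u \<in> fib E x"
  shows "nab \<psi> x u H = tr \<psi> x (\<lambda>I. cder x u (h I))"
  unfolding nab_def
proof (rule triv_cong)
  fix I assume I: "I \<subseteq> {..<m}"
  have "\<forall>\<^sub>F y in nhds x. H y = tr \<psi> y (\<lambda>I. h I y)" using assms(2) by (simp add: rep_def)
  with assms(1) have "\<forall>\<^sub>F y in nhds x. h I y = co \<psi> y (H y) I"
    by eventually_elim (simp add: co_triv[OF _ I])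
  then show "cder x u (\<lambda>y. co \<psi> y (H y) I) = cder x u (h I)"
    using cder_local[OF assms(3)] assms(2) I unfolding rep_def by fastforce
qed

lemma rep_exists:
  assumes "\<forall>\<^sub>F y in nhds x. sbasis \<psi> y"
    and "\<And>I. I \<subseteq> {..<m} ==> \<psi> I \<in> sGam A S" "H \<in> sGam A S"
  obtains h where "rep \<psi> x H h"
proof -
  have "\<exists>c. smooth_fun_on A UNIV c \<and> (\<forall>\<^sub>F y in nhds x. co \<psi> y (H y) I = c y)" if "I \<in> Pow {..<m}" for I
  proof (rule sb.frame_coords_smooth[of "Pow {..<m}" \<psi> x H I])
    show "\<psi> I \<in> sGam A S" if "I \<in> Pow {..<m}" for I using assms(2) that by blast
    fix c assume "smooth_fun_on A UNIV c" "\<forall>\<^sub>F y in nhds x. co \<psi> y (H y) I = c y"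
    then show ?thesis by (intro exI[of _ c] conjI)
  qed (use assms(1,3) that in \<open>simp_all add: s_index\<close>)
  note ex = this
  define h where "h I = (SOME c. smooth_fun_on A UNIV c \<and> (\<forall>\<^sub>F y in nhds x. co \<psi> y (H y) I = c y))" for I
  have h: "smooth_fun_on A UNIV (h I) \<and> (\<forall>\<^sub>F y in nhds x. co \<psi> y (H y) I = h I y)" if "I \<in> Pow {..<m}" for I
    unfolding h_def by (rule someI_ex[OF ex[OF that]])
  have "\<forall>\<^sub>F y in nhds x. \<forall>I\<in>Pow {..<m}. co \<psi> y (H y) I = h I y"
    using h by (intro eventually_ball_finite) auto
  with assms(1) have "\<forall>\<^sub>F y in nhds x. H y = tr \<psi> y (\<lambda>I. h I y)"
  proof eventually_elim
    case (elim y)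
    have "tr \<psi> y (\<lambda>I. h I y) = tr \<psi> y (co \<psi> y (H y))"
      using elim(2) by (intro triv_cong) auto
    then show ?case using triv_co[where \<psi> = \<psi> and y = y and \<phi> = "H y", OF elim(1) sb.sections_fibre[OF assms(3)]] by simp
  qed
  then have "rep \<psi> x H h" using h by (simp add: rep_def)
  then show ?thesis by (rule that)
qed

end

section \<open>Frame independence of the generating Dirac operator\<close>

subsection \<open>Comparison of two flat derivatives\<close>

text \<open>Two spin frames whose frames of \<open>E\<close> are orthonormal and agree at \<open>x\<close>.  The frames \<open>\<psi>\<close> and \<open>\<psi>'\<close> of \<open>S\<close>
  need not agree at \<open>x\<close>, and neither need the constant matrices \<open>gm i\<close> and \<open>gm' i\<close>.\<close>

locale spin_pair = spin_bundle A E dv S + frame_pair A E dv x \<mu> e e'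
  for A :: "('m::{t2_space, second_countable_topology}, 'b::{real_inner, heine_borel}) atlas"
    and E :: "('m, 'v::real_vector) courant" and dv :: "('m => 'v) => 'm => real"
    and S :: "('m, 'v, 'w::ab_group_add) spinors"
    and x :: 'm and \<mu> :: "nat => real" and e e' :: "nat => 'm => 'v" +
  fixes \<psi> \<psi>' :: "nat set => 'm => 'w" and p q p' q' :: "nat => nat => complex"
  assumes spin: "spin_on x \<mu> e \<psi> p q" and spin': "spin_on x \<mu> e' \<psi>' p' q'"
begin

abbreviation "gm i \<equiv> gam m (p i) (q i)"
abbreviation "gm' i \<equiv> gam m (p' i) (q' i)"

lemmas spin_ev = spin_on_near[OF spin] and spin_ev' = spin_on_near[OF spin']

lemma \<psi>_ev: "\<forall>\<^sub>F y in nhds x. sbasis \<psi> y"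
  and \<psi>'_ev: "\<forall>\<^sub>F y in nhds x. sbasis \<psi>' y"
  using spin_ev spin_ev' by (auto elim: eventually_mono)

lemma \<psi>_sec: "I \<subseteq> {..<m} ==> \<psi> I \<in> sGam A S" and \<psi>'_sec: "I \<subseteq> {..<m} ==> \<psi>' I \<in> sGam A S"
  using spin spin' by (auto simp: spin_on_def)

lemmas \<psi>_basis = at_point[OF \<psi>_ev] and \<psi>'_basis = at_point[OF \<psi>'_ev]

lemma act_\<psi>: "i < r ==> cl S x (e i x) (tr \<psi> x s) = tr \<psi> x (gm i s)"
  using at_point[OF spin_ev] by blast

lemma act_\<psi>': "i < r ==> cl S x (e i x) (tr \<psi>' x s) = tr \<psi>' x (gm' i s)"
  using at_point[OF spin_ev'] agree by metis

lemma triv_eqD: "tr \<psi> y s = tr \<psi> y t ==>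
    sbasis \<psi> y ==> I \<subseteq> {..<m} ==> s I = t I"
  using co_triv[of \<psi> y I s] co_triv[of \<psi> y I t] by simp

text \<open>\<open>h J\<close> are the coordinates of \<open>\<psi>' J\<close> with respect to \<open>\<psi>\<close>.\<close>

definition h :: "nat set => nat set => 'm => complex" where
  "h J = (SOME h. rep \<psi> x (\<psi>' J) h)"

definition hx :: "nat set => form" where
  "hx J = (\<lambda>I. h J I x)"

definition dh :: "nat => nat set => form" where
  "dh i J = (\<lambda>I. cder x (e i x) (h J I))"

lemma h_rep: "J \<subseteq> {..<m} ==> rep \<psi> x (\<psi>' J) (h J)"
proof -
  assume "J \<subseteq> {..<m}"
  from rep_exists[OF \<psi>_ev \<psi>_sec \<psi>'_sec[OF this]] obtain h where "rep \<psi> x (\<psi>' J) h" .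
  then have "\<exists>h. rep \<psi> x (\<psi>' J) h" by (rule exI[of "rep \<psi> x (\<psi>' J)"])
  then show ?thesis unfolding h_def by (rule someI_ex)
qed

lemma h_smooth: "J \<subseteq> {..<m} ==> I \<subseteq> {..<m} ==> smooth_fun_on A UNIV (h J I)"
  using h_rep by (simp add: rep_def)

lemma h_near: "\<forall>\<^sub>F y in nhds x. \<forall>J\<in>Pow {..<m}. \<psi>' J y = tr \<psi> y (\<lambda>I. h J I y)"
  using h_rep by (intro eventually_ball_finite) (auto simp: rep_def)

lemma triv_hx: "J \<subseteq> {..<m} ==> tr \<psi> x (hx J) = \<psi>' J x"
  using at_point[OF h_near] by (simp add: hx_def)

text \<open>\<open>a s\<close> are the coordinates with respect to \<open>\<psi>'\<close> at \<open>x\<close> of the spinor whose coordinates with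
  respect to \<open>\<psi>\<close> are \<open>s\<close>.\<close>

definition a :: "form => form" where
  "a s = co \<psi>' x (tr \<psi> x s)"

lemma triv_a: "tr \<psi>' x (a s) = tr \<psi> x s"
  unfolding a_def by (rule triv_co[where \<psi> = \<psi>' and y = x, OF \<psi>'_basis triv_in[where \<psi> = \<psi> and y = x, OF \<psi>_basis]])

lemma a_eqI: "tr \<psi> x s = tr \<psi>' x c ==> J \<subseteq> {..<m} ==> a s J = c J"
  unfolding a_def using co_triv[where \<psi> = \<psi>' and y = x, OF \<psi>'_basis] by simp

lemma a_hx: "J \<subseteq> {..<m} ==> K \<subseteq> {..<m} ==> a (hx J) K = monomial J K"
  by (rule a_eqI) (simp_all add: triv_hx triv_monomial)

lemma a_sum: "K \<subseteq> {..<m} ==> a (\<lambda>I. \<Sum>i\<in>X. c i * s i I) K = (\<Sum>i\<in>X. c i * a (s i) K)"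
  by (rule a_eqI[of _ "\<lambda>K. \<Sum>i\<in>X. c i * a (s i) K"]) (simp_all only: triv_sum triv_a)

lemma s_expand: "I \<subseteq> {..<m} ==> s I = (\<Sum>J\<in>Pow {..<m}. a s J * hx J I)"
proof -
  assume I: "I \<subseteq> {..<m}"
  have "tr \<psi> x (\<lambda>I. \<Sum>J\<in>Pow {..<m}. a s J * hx J I) = (\<Sum>J\<in>Pow {..<m}. smult S (a s J) (\<psi>' J x))"
    unfolding triv_sum by (intro sum.cong refl) (simp add: triv_hx)
  also have "... = tr \<psi> x s" using triv_a[of s] by (simp add: triv_def)
  finally have "tr \<psi> x s = tr \<psi> x (\<lambda>I. \<Sum>J\<in>Pow {..<m}. a s J * hx J I)" by (rule sym)
  then show "s I = (\<Sum>J\<in>Pow {..<m}. a s J * hx J I)" by (rule triv_eqD[OF _ \<psi>_basis I])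
qed

text \<open>The difference of the flat derivatives of \<open>\<psi>'\<close> and \<open>\<psi>\<close> along \<open>e\<^sub>i\<close>, which is of order zero, in coordinates
  with respect to \<open>\<psi>\<close>.\<close>

definition N :: "nat => form => form" where
  "N i s I = - (\<Sum>J\<in>Pow {..<m}. a s J * dh i J I)"

lemma N_hx: "J \<subseteq> {..<m} ==> N i (hx J) I = - dh i J I"
proof -
  assume J: "J \<subseteq> {..<m}"
  have "(\<Sum>K\<in>Pow {..<m}. a (hx J) K * dh i K I) = (\<Sum>K\<in>Pow {..<m}. if K = J then dh i J I else 0)"
    using J by (intro sum.cong) (auto simp: a_hx monomial_def)
  then show ?thesis using J by (simp add: N_def)
qed

lemma N_sum: "N i (\<lambda>I. \<Sum>j\<in>X. c j * s j I) K = (\<Sum>j\<in>X. c j * N i (s j) K)"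
proof -
  have "N i (\<lambda>I. \<Sum>j\<in>X. c j * s j I) K = - (\<Sum>J\<in>Pow {..<m}. (\<Sum>j\<in>X. c j * a (s j) J) * dh i J K)"
    unfolding N_def by (intro arg_cong[where f = uminus] sum.cong refl) (simp add: a_sum)
  also have "... = (\<Sum>j\<in>X. c j * N i (s j) K)"
    unfolding N_def sum_distrib_right sum_distrib_left sum_negf[symmetric]
    by (subst sum.swap) (simp add: sum_distrib_left sum_negf[symmetric] mult_ac)
  finally show ?thesis .
qed

lemma N_cong: "(\<And>I. I \<subseteq> {..<m} ==> s I = t I) ==> N i s K = N i t K"
  using triv_cong[of s t \<psi> x] by (simp add: N_def a_def)

text \<open>Both sides are the derivative along \<open>e\<^sub>i\<close> of the spinor \<open>e'\<^sub>j \<psi>'\<^sub>J\<close> in coordinates with respect to \<open>\<psi>\<close>: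
  the matrix of \<open>e'\<^sub>j\<close> with respect to \<open>\<psi>'\<close> is constant, and so are those of the \<open>e\<^sub>l\<close> with respect to \<open>\<psi>\<close>, in
  which \<open>e'\<^sub>j\<close> is expanded.\<close>

lemma derivative_clifford:
  assumes i: "i < r" and j: "j < r" and J: "J \<subseteq> {..<m}" and I: "I \<subseteq> {..<m}"
  shows "(\<Sum>K\<in>Pow {..<m}. gm' j (monomial J) K * dh i K I)
    = (\<Sum>l<r. of_real (\<mu> l * \<theta> i j l) * gm l (hx J) I) + gm j (dh i J) I"
proof -
  let ?c = "\<lambda>K. gm' j (monomial J) K"
  let ?g = "\<lambda>l K. gam m (p l) (q l) (monomial K) I"
  have ex: "e i x \<in> fib E x" by (rule ef[OF i])
  have ev: "\<forall>\<^sub>F y in nhds x. (\<Sum>K\<in>Pow {..<m}. ?c K * h K I y)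
      = (\<Sum>l<r. of_real (\<mu> l * G j l y) * (\<Sum>K\<in>Pow {..<m}. ?g l K * h J K y))"
    using spin_ev spin_ev' h_near frame_expand[OF j] on
  proof eventually_elim
    case (elim y)
    have b: "sbasis \<psi> y" using elim(1) by blast
    have f: "e l y \<in> fib E y" if "l \<in> {..<r}" for l using orthonormal_fib[OF elim(5)] that by simp
    have "tr \<psi> y (\<lambda>I. \<Sum>K\<in>Pow {..<m}. ?c K * h K I y) = (\<Sum>K\<in>Pow {..<m}. smult S (?c K) (\<psi>' K y))"
      unfolding triv_sum using elim(3) by (intro sum.cong refl) simp
    also have "... = tr \<psi>' y ?c" by (simp add: triv_def)
    also have "... = cl S y (e' j y) (tr \<psi>' y (monomial J))" using elim(2) j by simp
    also have "tr \<psi>' y (monomial J) = tr \<psi> y (\<lambda>I. h J I y)"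
      using triv_monomial[OF J] elim(3) J by simp
    also have "cl S y (e' j y) (tr \<psi> y (\<lambda>I. h J I y))
        = (\<Sum>l<r. smult S (of_real (\<mu> l * G j l y)) (cl S y (e l y) (tr \<psi> y (\<lambda>I. h J I y))))"
      unfolding elim(4) by (rule cl_comb_vec[OF f triv_in[where \<psi> = \<psi> and y = y, OF b]])
    also have "... = (\<Sum>l<r. smult S (of_real (\<mu> l * G j l y)) (tr \<psi> y (gm l (\<lambda>I. h J I y))))"
      using elim(1) by (intro sum.cong refl) simp
    also have "... = tr \<psi> y (\<lambda>I. \<Sum>l<r. of_real (\<mu> l * G j l y) * gm l (\<lambda>I. h J I y) I)"
      by (simp only: triv_sum)
    finally have "(\<Sum>K\<in>Pow {..<m}. ?c K * h K I y) = (\<Sum>l<r. of_real (\<mu> l * G j l y) * gm l (\<lambda>I. h J I y) I)"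
      by (rule triv_eqD[OF _ b I])
    also have "... = (\<Sum>l<r. of_real (\<mu> l * G j l y) * (\<Sum>K\<in>Pow {..<m}. ?g l K * h J K y))"
      by (intro sum.cong refl arg_cong2[where f = "(*)"]) (rule gam_matrix[OF I])
    finally show ?case .
  qed
  have sm: "smooth_fun_on A UNIV (\<lambda>y. ?c K * h K I y)" if "K \<in> Pow {..<m}" for K
    using that I by (intro smooth_complex h_smooth) auto
  have sm1: "smooth_fun_on A UNIV (\<lambda>y. of_real (\<mu> l * G j l y) :: complex)" if "l < r" for l
    using that j by (intro smooth_complex C_inf_mult C_inf_const G_C_inf)
  have sm3: "smooth_fun_on A UNIV (\<lambda>y. ?g l K * h J K y)" if "K \<in> Pow {..<m}" for l K
    using that J by (intro smooth_complex h_smooth) auto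
  have sm2: "smooth_fun_on A UNIV (\<lambda>y. \<Sum>K\<in>Pow {..<m}. ?g l K * h J K y)" for l
    by (intro smooth_complex(4) sm3)
  have "(\<Sum>K\<in>Pow {..<m}. ?c K * dh i K I) = (\<Sum>K\<in>Pow {..<m}. cder x (e i x) (\<lambda>y. ?c K * h K I y))"
    unfolding dh_def using I by (intro sum.cong refl cder_scale[OF ex, symmetric] h_smooth) auto
  also have "... = cder x (e i x) (\<lambda>y. \<Sum>K\<in>Pow {..<m}. ?c K * h K I y)"
    by (rule cder_sum[OF ex sm, symmetric])
  also have "... = cder x (e i x) (\<lambda>y. \<Sum>l<r. of_real (\<mu> l * G j l y) * (\<Sum>K\<in>Pow {..<m}. ?g l K * h J K y))"
    by (rule cder_local[OF ex smooth_complex(4)[OF sm] ev])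
  also have "... = (\<Sum>l<r. cder x (e i x) (\<lambda>y. of_real (\<mu> l * G j l y) * (\<Sum>K\<in>Pow {..<m}. ?g l K * h J K y)))"
    by (rule cder_sum[OF ex]) (use sm1 sm2 smooth_complex(3) in auto)
  also have "... = (\<Sum>l<r. of_real (\<mu> l * \<theta> i j l) * gm l (hx J) I + (if l = j then gm j (dh i J) I else 0))"
  proof (rule sum.cong, rule refl)
    fix l assume "l \<in> {..<r}"
    then have l: "l < r" by simp
    have "cder x (e i x) (\<lambda>y. \<Sum>K\<in>Pow {..<m}. ?g l K * h J K y) = (\<Sum>K\<in>Pow {..<m}. cder x (e i x) (\<lambda>y. ?g l K * h J K y))"
      by (rule cder_sum[OF ex sm3])
    also have "... = (\<Sum>K\<in>Pow {..<m}. ?g l K * dh i J K)"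
      unfolding dh_def using J by (intro sum.cong refl cder_scale[OF ex] h_smooth) auto
    also have "... = gm l (dh i J) I" by (rule gam_matrix[OF I, symmetric])
    finally have d: "cder x (e i x) (\<lambda>y. \<Sum>K\<in>Pow {..<m}. ?g l K * h J K y) = gm l (dh i J) I" .
    have g: "(\<Sum>K\<in>Pow {..<m}. ?g l K * h J K x) = gm l (hx J) I"
      unfolding gam_matrix[OF I, of "p l" "q l" "hx J"] by (simp add: hx_def)
    have c: "cder x (e i x) (\<lambda>y. of_real (\<mu> l * G j l y)) = of_real (\<mu> l * \<theta> i j l)"
      using cder_of_real[OF ex C_inf_mult[OF C_inf_const[of "\<mu> l"] G_C_inf[OF j l]]] anchor_scale_fun[OF ex G_C_inf[OF j l]]
      by (simp add: \<theta>_def)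
    have "\<mu> l * G j l x = (if l = j then 1 else 0)" using sign[OF l] G_at[OF j l] by (cases "l = j") auto
    then show "cder x (e i x) (\<lambda>y. of_real (\<mu> l * G j l y) * (\<Sum>K\<in>Pow {..<m}. ?g l K * h J K y))
        = of_real (\<mu> l * \<theta> i j l) * gm l (hx J) I + (if l = j then gm j (dh i J) I else 0)"
      unfolding cder_mult[OF ex sm1[OF l] sm2] d g c by (cases "l = j") (simp_all del: of_real_mult)
  qed
  also have "... = (\<Sum>l<r. of_real (\<mu> l * \<theta> i j l) * gm l (hx J) I) + gm j (dh i J) I"
    using j by (simp add: sum.distrib)
  finally show ?thesis .
qed

text \<open>It suffices to check this on the spinors \<open>\<psi>' J x\<close>, where it is \<open>derivative_clifford\<close>.\<close>

lemma N_commutator: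
  assumes i: "i < r" and j: "j < r" and I: "I \<subseteq> {..<m}"
  shows "N i (gm j s) I - gm j (N i s) I = (\<Sum>l<r. of_real (\<mu> l * \<theta> i l j) * gm l s I)"
proof -
  have hx: "N i (gm j (hx J)) I - gm j (N i (hx J)) I = (\<Sum>l<r. of_real (\<mu> l * \<theta> i l j) * gm l (hx J) I)"
    if J: "J \<subseteq> {..<m}" for J
  proof -
    have "tr \<psi> x (gm j (hx J)) = tr \<psi>' x (gm' j (monomial J))"
      using act_\<psi>[OF j, of "hx J"] act_\<psi>'[OF j, of "monomial J"] triv_hx[OF J] triv_monomial[OF J] by simp
    then have "a (gm j (hx J)) K = gm' j (monomial J) K" if "K \<subseteq> {..<m}" for K
      using a_eqI that by blast
    then have 1: "N i (gm j (hx J)) I = - (\<Sum>K\<in>Pow {..<m}. gm' j (monomial J) K * dh i K I)"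
      unfolding N_def by simp
    have "gm j (N i (hx J)) I = gm j (\<lambda>I. \<Sum>z\<in>{()}. (-1) * dh i J I) I"
      by (rule gam_cong[OF _ I]) (simp add: N_hx[OF J])
    then have 2: "gm j (N i (hx J)) I = - gm j (dh i J) I"
      unfolding gam_linear[OF I] by simp
    have "(\<Sum>l<r. of_real (\<mu> l * \<theta> i l j) * gm l (hx J) I) = - (\<Sum>l<r. of_real (\<mu> l * \<theta> i j l) * gm l (hx J) I)"
      unfolding sum_negf[symmetric] using i j by (intro sum.cong refl) (simp add: \<theta>_antisym[of i _ j])
    then show ?thesis unfolding 1 2 derivative_clifford[OF i j J I] by simp
  qed
  let ?s = "\<lambda>I. \<Sum>J\<in>Pow {..<m}. a s J * hx J I"
  have s: "K \<subseteq> {..<m} ==> s K = ?s K" for K by (rule s_expand)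
  have gs: "gm l s K = (\<Sum>J\<in>Pow {..<m}. a s J * gm l (hx J) K)" if "K \<subseteq> {..<m}" for l K
    using gam_cong[of m s ?s, OF s that] gam_linear[OF that] by simp
  have "N i (gm j s) I = (\<Sum>J\<in>Pow {..<m}. a s J * N i (gm j (hx J)) I)"
    using N_cong[of "gm j s" "\<lambda>K. \<Sum>J\<in>Pow {..<m}. a s J * gm j (hx J) K"] gs N_sum by simp
  moreover have "N i s K = (\<Sum>J\<in>Pow {..<m}. a s J * N i (hx J) K)" for K
    using N_cong[of s ?s] s N_sum by simp
  then have "gm j (N i s) I = (\<Sum>J\<in>Pow {..<m}. a s J * gm j (N i (hx J)) I)"
    using gam_cong[of m "N i s" "\<lambda>K. \<Sum>J\<in>Pow {..<m}. a s J * N i (hx J) K", OF _ I] gam_linear[OF I] by simp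
  ultimately have "N i (gm j s) I - gm j (N i s) I
      = (\<Sum>J\<in>Pow {..<m}. a s J * (N i (gm j (hx J)) I - gm j (N i (hx J)) I))"
    by (simp add: right_diff_distrib sum_subtractf)
  also have "... = (\<Sum>J\<in>Pow {..<m}. a s J * (\<Sum>l<r. of_real (\<mu> l * \<theta> i l j) * gm l (hx J) I))"
    using hx by (intro sum.cong refl) simp
  also have "... = (\<Sum>l<r. of_real (\<mu> l * \<theta> i l j) * gm l s I)"
    unfolding gs[OF I] sum_distrib_left by (subst sum.swap) (simp add: mult_ac)
  finally show ?thesis .
qed

text \<open>The pairing has constant coefficients with respect to both \<open>\<psi>\<close> and \<open>\<psi>'\<close>.\<close>

lemma N_skew:
  assumes i: "i < r"
  shows "model_pairing m (N i s) t + model_pairing m s (N i t) = 0"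
proof -
  let ?T = "{..<m}"
  have ex: "e i x \<in> fib E x" by (rule ef[OF i])
  have hx: "model_pairing m (dh i J) (hx K) + model_pairing m (hx J) (dh i K) = 0"
    if J: "J \<subseteq> ?T" and K: "K \<subseteq> ?T" for J K
  proof -
    let ?k = "\<lambda>I. shuffle_sign I (?T - I) * \<i> ^ card I"
    have ev: "\<forall>\<^sub>F y in nhds x. (\<Sum>I\<in>Pow ?T. ?k I * (h J I y * h K (?T - I) y)) = model_pairing m (monomial J) (monomial K)"
      using spin_ev spin_ev' h_near
    proof eventually_elim
      case (elim y)
      have "model_pairing m (monomial J) (monomial K) = spair S y (\<psi>' J y) (\<psi>' K y)"
        using elim(2) triv_monomial[OF J] triv_monomial[OF K] by metis
      also have "... = model_pairing m (\<lambda>I. h J I y) (\<lambda>I. h K I y)"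
        using elim(1,3) J K by simp
      finally show ?case unfolding model_pairing_eq by (simp add: mult.assoc)
    qed
    have sm: "smooth_fun_on A UNIV (\<lambda>y. h J I y * h K (?T - I) y)" if "I \<in> Pow ?T" for I
      using that J K by (intro smooth_complex h_smooth) auto
    have smk: "smooth_fun_on A UNIV (\<lambda>y. ?k I * (h J I y * h K (?T - I) y))" if "I \<in> Pow ?T" for I
      by (rule smooth_complex(3)[OF smooth_complex(1) sm[OF that]])
    have "0 = cder x (e i x) (\<lambda>y. \<Sum>I\<in>Pow ?T. ?k I * (h J I y * h K (?T - I) y))"
      using cder_local[OF ex smooth_complex(4)[OF smk] ev] cder_const[OF ex] by simp
    also have "... = (\<Sum>I\<in>Pow ?T. cder x (e i x) (\<lambda>y. ?k I * (h J I y * h K (?T - I) y)))"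
      by (rule cder_sum[OF ex smk])
    also have "... = (\<Sum>I\<in>Pow ?T. ?k I * (h J I x * dh i K (?T - I) + h K (?T - I) x * dh i J I))"
    proof (rule sum.cong, rule refl)
      fix I assume I: "I \<in> Pow ?T"
      have "cder x (e i x) (\<lambda>y. h J I y * h K (?T - I) y) = h J I x * dh i K (?T - I) + h K (?T - I) x * dh i J I"
        unfolding dh_def using I J K by (intro cder_mult[OF ex] h_smooth) auto
      then show "cder x (e i x) (\<lambda>y. ?k I * (h J I y * h K (?T - I) y))
          = ?k I * (h J I x * dh i K (?T - I) + h K (?T - I) x * dh i J I)"
        using cder_scale[OF ex sm[OF I]] by simp
    qed
    finally show ?thesis
      unfolding model_pairing_eq hx_def by (simp add: sum.distrib[symmetric] algebra_simps)
  qed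
  let ?P = "Pow {..<m}"
  have s: "model_pairing m (N i s) t = (\<Sum>J\<in>?P. a s J * (\<Sum>K\<in>?P. a t K * - model_pairing m (dh i J) (hx K)))" for s t
  proof -
    have "model_pairing m (N i s) t = model_pairing m (\<lambda>I. \<Sum>J\<in>?P. a s J * (-1 * dh i J I)) (\<lambda>I. \<Sum>K\<in>?P. a t K * hx K I)"
      by (rule model_pairing_cong) (simp add: N_def sum_negf, rule s_expand)
    then show ?thesis by (simp only: model_pairing_linear) simp
  qed
  have t: "model_pairing m s (N i t) = (\<Sum>J\<in>?P. a s J * (\<Sum>K\<in>?P. a t K * - model_pairing m (hx J) (dh i K)))"
  proof -
    have "model_pairing m s (N i t) = model_pairing m (\<lambda>I. \<Sum>J\<in>?P. a s J * hx J I) (\<lambda>I. \<Sum>K\<in>?P. a t K * (-1 * dh i K I))"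
      by (rule model_pairing_cong) (rule s_expand, simp_all add: N_def sum_negf)
    then show ?thesis by (simp only: model_pairing_linear) simp
  qed
  have "model_pairing m (N i s) t + model_pairing m s (N i t)
      = (\<Sum>J\<in>?P. a s J * (\<Sum>K\<in>?P. a t K * - (model_pairing m (dh i J) (hx K) + model_pairing m (hx J) (dh i K))))"
    unfolding s t by (simp add: sum.distrib[symmetric] distrib_left[symmetric] algebra_simps sum_subtractf sum_negf)
  also have "... = 0" using hx by (intro sum.neutral ballI) simp
  finally show ?thesis .
qed

text \<open>The element \<open>\<Sum> \<theta>\<^sub>i\<^sub>j\<^sub>l e\<^sup>j e\<^sup>l / 2\<close> of the spin Lie algebra that lifts the infinitesimal rotation of the
  frames.\<close>

definition N0 :: "nat => form => form" where
  "N0 i s I = (\<Sum>j<r. \<Sum>l<r. of_real (\<mu> j * \<mu> l * \<theta> i j l / 2) * gm j (gm l s) I)"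

lemma clifford_form:
  assumes j: "j < r" and l: "l < r" and K: "K \<subseteq> {..<m}"
  shows "gm j (gm l s) K + gm l (gm j s) K = of_real (if j = l then \<mu> j else 0) * s K"
proof -
  have "tr \<psi> x (\<lambda>K. gm j (gm l s) K + gm l (gm j s) K)
      = cl S x (e j x) (cl S x (e l x) (tr \<psi> x s)) + cl S x (e l x) (cl S x (e j x) (tr \<psi> x s))"
    unfolding triv_add using act_\<psi> j l by simp
  also have "... = smult S (of_real (if j = l then \<mu> j else 0)) (tr \<psi> x s)"
    using clifford[OF ef[OF j] ef[OF l] triv_in[where \<psi> = \<psi> and y = x, OF \<psi>_basis], of s] orthonormal_ip[OF onx j l] by simp
  also have "... = tr \<psi> x (\<lambda>K. of_real (if j = l then \<mu> j else 0) * s K)" by (simp only: triv_scale)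
  finally show ?thesis by (rule triv_eqD[OF _ \<psi>_basis K])
qed

lemma gm_scale: "K \<subseteq> {..<m} ==> gm i (\<lambda>I. c * s I) K = c * gm i s K"
  using gam_linear[of K m "p i" "q i" "\<lambda>_. c" "\<lambda>_. s" "{()}"] by simp

lemma gm_diff: "K \<subseteq> {..<m} ==> gm i (\<lambda>I. s I - t I) K = gm i s K - gm i t K"
  using gam_linear[of K m "p i" "q i" "\<lambda>b. if b then 1 else -1" "\<lambda>b. if b then s else t" UNIV]
  by (simp add: UNIV_bool)

lemma gm_move:
  assumes "j < r" "l < r" "K \<subseteq> {..<m}"
  shows "gm l (gm j s) K = of_real (if j = l then \<mu> j else 0) * s K - gm j (gm l s) K"
  using clifford_form[OF assms, of s] by (simp add: algebra_simps)

lemma N0_commutator: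
  assumes i: "i < r" and j: "j < r" and I: "I \<subseteq> {..<m}"
  shows "N0 i (gm j s) I - gm j (N0 i s) I = (\<Sum>l<r. of_real (\<mu> l * \<theta> i l j) * gm l s I)"
proof -
  let ?c = "\<lambda>k l. of_real (\<mu> k * \<mu> l * \<theta> i k l / 2) :: complex"
  let ?d = "\<lambda>k. of_real (if k = j then \<mu> j else 0) :: complex"
  have comm: "gm k (gm l (gm j s)) I = ?d l * gm k s I - ?d k * gm l s I + gm j (gm k (gm l s)) I"
    if k: "k < r" and l: "l < r" for k l
  proof -
    have "gm k (gm l (gm j s)) I = gm k (\<lambda>K. ?d l * s K - gm j (gm l s) K) I"
      using gm_move[OF j l] by (intro gam_cong[OF _ I]) (auto simp: eq_commute)
    also have "... = ?d l * gm k s I - gm k (gm j (gm l s)) I"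
      using gm_diff[OF I] gm_scale[OF I] by simp
    also have "gm k (gm j (gm l s)) I = ?d k * gm l s I - gm j (gm k (gm l s)) I"
      using gm_move[OF j k I, of "gm l s"] by (auto simp: eq_commute)
    finally show ?thesis by simp
  qed
  have jN: "gm j (N0 i s) I = (\<Sum>k<r. \<Sum>l<r. ?c k l * gm j (gm k (gm l s)) I)"
  proof -
    have "gm j (N0 i s) I = gm j (\<lambda>I. \<Sum>kl\<in>{..<r} \<times> {..<r}. ?c (fst kl) (snd kl) * gm (fst kl) (gm (snd kl) s) I) I"
      by (rule gam_cong[OF _ I]) (simp add: N0_def sum.cartesian_product case_prod_beta')
    also have "... = (\<Sum>kl\<in>{..<r} \<times> {..<r}. ?c (fst kl) (snd kl) * gm j (gm (fst kl) (gm (snd kl) s)) I)"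
      by (rule gam_linear[OF I])
    finally show ?thesis by (simp add: sum.cartesian_product case_prod_beta')
  qed
  have "N0 i (gm j s) I = (\<Sum>k<r. \<Sum>l<r. ?c k l * (?d l * gm k s I) - ?c k l * (?d k * gm l s I)
      + ?c k l * gm j (gm k (gm l s)) I)"
    unfolding N0_def
  proof (intro sum.cong refl)
    fix k l assume "k \<in> {..<r}" "l \<in> {..<r}"
    then show "?c k l * gm k (gm l (gm j s)) I
        = ?c k l * (?d l * gm k s I) - ?c k l * (?d k * gm l s I) + ?c k l * gm j (gm k (gm l s)) I"
      using comm[of k l] by (simp add: distrib_left right_diff_distrib)
  qed
  then have "N0 i (gm j s) I - gm j (N0 i s) I
      = (\<Sum>k<r. \<Sum>l<r. ?c k l * (?d l * gm k s I)) - (\<Sum>k<r. \<Sum>l<r. ?c k l * (?d k * gm l s I))"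
    unfolding jN by (simp add: sum.distrib sum_subtractf)
  also have "(\<Sum>k<r. \<Sum>l<r. ?c k l * (?d l * gm k s I)) = (\<Sum>k<r. of_real (\<mu> k * \<theta> i k j / 2) * gm k s I)"
  proof (intro sum.cong refl)
    fix k
    have "(\<Sum>l<r. ?c k l * (?d l * gm k s I)) = (\<Sum>l<r. if l = j then ?c k j * of_real (\<mu> j) * gm k s I else 0)"
      by (intro sum.cong) auto
    also have "... = of_real (\<mu> k * (\<mu> j * \<mu> j) * \<theta> i k j / 2) * gm k s I" using j by simp
    finally show "(\<Sum>l<r. ?c k l * (?d l * gm k s I)) = of_real (\<mu> k * \<theta> i k j / 2) * gm k s I"
      using sign[OF j] by simp
  qed
  also have "(\<Sum>k<r. \<Sum>l<r. ?c k l * (?d k * gm l s I)) = (\<Sum>l<r. of_real (- \<mu> l * \<theta> i l j / 2) * gm l s I)"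
  proof (subst sum.swap, intro sum.cong refl)
    fix l assume "l \<in> {..<r}"
    then have l: "l < r" by simp
    have "(\<Sum>k<r. ?c k l * (?d k * gm l s I)) = (\<Sum>k<r. if k = j then ?c j l * of_real (\<mu> j) * gm l s I else 0)"
      by (intro sum.cong) auto
    also have "... = of_real ((\<mu> j * \<mu> j) * \<mu> l * \<theta> i j l / 2) * gm l s I" using j by simp
    finally show "(\<Sum>k<r. ?c k l * (?d k * gm l s I)) = of_real (- \<mu> l * \<theta> i l j / 2) * gm l s I"
      using sign[OF j] \<theta>_antisym[OF i j l] by simp
  qed
  also have "(\<Sum>k<r. of_real (\<mu> k * \<theta> i k j / 2) * gm k s I) - (\<Sum>l<r. of_real (- \<mu> l * \<theta> i l j / 2) * gm l s I)
      = (\<Sum>l<r. of_real (\<mu> l * \<theta> i l j) * gm l s I)"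
    unfolding sum_subtractf[symmetric] by (intro sum.cong refl) (simp add: field_simps)
  finally show ?thesis .
qed

lemma N0_skew:
  assumes i: "i < r"
  shows "model_pairing m (N0 i s) t + model_pairing m s (N0 i t) = 0"
proof -
  let ?c = "\<lambda>k l. of_real (\<mu> k * \<mu> l * \<theta> i k l / 2) :: complex"
  have "model_pairing m (N0 i s) t = (\<Sum>k<r. \<Sum>l<r. ?c k l * model_pairing m (gm k (gm l s)) t)"
  proof -
    have "N0 i s = (\<lambda>I. \<Sum>k<r. 1 * (\<Sum>l<r. ?c k l * gm k (gm l s) I))" by (simp add: N0_def fun_eq_iff)
    then show ?thesis by (simp only: model_pairing_linear) simp
  qed
  also have "... = (\<Sum>k<r. \<Sum>l<r. ?c k l * model_pairing m s (gm l (gm k t)))"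
    by (simp only: pairing_gam_gam)
  also have "... = (\<Sum>l<r. \<Sum>k<r. ?c k l * model_pairing m s (gm l (gm k t)))"
    by (rule sum.swap)
  also have "... = - (\<Sum>l<r. \<Sum>k<r. ?c l k * model_pairing m s (gm l (gm k t)))"
    unfolding sum_negf[symmetric]
  proof (intro sum.cong refl)
    fix k l assume "k \<in> {..<r}" "l \<in> {..<r}"
    then have "?c k l = - ?c l k" using \<theta>_antisym[OF i, of k l] by (simp add: mult_ac)
    then show "?c k l * model_pairing m s (gm l (gm k t)) = - (?c l k * model_pairing m s (gm l (gm k t)))" by simp
  qed
  also have "(\<Sum>l<r. \<Sum>k<r. ?c l k * model_pairing m s (gm l (gm k t))) = model_pairing m s (N0 i t)"
  proof -
    have "N0 i t = (\<lambda>I. \<Sum>l<r. 1 * (\<Sum>k<r. ?c l k * gm l (gm k t) I))" by (simp add: N0_def fun_eq_iff)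
    then show ?thesis by (simp only: model_pairing_linear) simp
  qed
  finally show ?thesis by simp
qed

lemma N0_sum: "K \<subseteq> {..<m} ==> N0 i (\<lambda>I. \<Sum>j\<in>X. c j * s j I) K = (\<Sum>j\<in>X. c j * N0 i (s j) K)"
proof -
  assume K: "K \<subseteq> {..<m}"
  have "gm k (gm l (\<lambda>I. \<Sum>j\<in>X. c j * s j I)) K = (\<Sum>j\<in>X. c j * gm k (gm l (s j)) K)" for k l
    using gam_cong[of m "gm l (\<lambda>I. \<Sum>j\<in>X. c j * s j I)" "\<lambda>I. \<Sum>j\<in>X. c j * gm l (s j) I", OF gam_linear K] gam_linear[OF K]
    by simp
  then have "N0 i (\<lambda>I. \<Sum>j\<in>X. c j * s j I) K = (\<Sum>k<r. \<Sum>l<r. \<Sum>j\<in>X. c j * (of_real (\<mu> k * \<mu> l * \<theta> i k l / 2) * gm k (gm l (s j)) K))"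
    unfolding N0_def by (simp add: sum_distrib_left mult_ac)
  also have "... = (\<Sum>k<r. \<Sum>j\<in>X. \<Sum>l<r. c j * (of_real (\<mu> k * \<mu> l * \<theta> i k l / 2) * gm k (gm l (s j)) K))"
    by (intro sum.cong refl sum.swap)
  also have "... = (\<Sum>j\<in>X. \<Sum>k<r. \<Sum>l<r. c j * (of_real (\<mu> k * \<mu> l * \<theta> i k l / 2) * gm k (gm l (s j)) K))"
    by (rule sum.swap)
  finally show ?thesis unfolding N0_def by (simp add: sum_distrib_left)
qed

lemma diff_eq_diff_swap: "a - b = c - d ==> a - c = b - d" for a b c d :: complex
  by (metis diff_diff_eq2 diff_add_cancel add_diff_cancel_left' add.commute diff_add_eq)

text \<open>The difference of \<open>N i\<close> and \<open>N0 i\<close> commutes with Clifford multiplication and is skew for the pairing,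
  hence zero.  Commutators alone would leave a scalar undetermined; skewness excludes it.\<close>

theorem N_eq_N0:
  assumes i: "i < r" and K: "K \<subseteq> {..<m}"
  shows "N i s K = N0 i s K"
proof -
  define M where "M K J = N i (monomial J) K - N0 i (monomial J) K" for K J
  have exp: "s I = (\<Sum>J\<in>Pow {..<m}. s J * monomial J I)" if "I \<subseteq> {..<m}" for s :: form and I
  proof -
    have "(\<Sum>J\<in>Pow {..<m}. s J * monomial J I) = (\<Sum>J\<in>Pow {..<m}. if J = I then s I else 0)"
      by (intro sum.cong) (auto simp: monomial_def)
    then show ?thesis using that by simp
  qed
  have N0_cong: "N0 i s K = N0 i t K" if "\<And>I. I \<subseteq> {..<m} ==> s I = t I" "K \<subseteq> {..<m}" for s t K
    unfolding N0_def using that by (intro sum.cong refl arg_cong2[where f = "(*)"] gam_cong)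
  have op: "matrix_op m M s K = N i s K - N0 i s K" if "K \<subseteq> {..<m}" for s K
  proof -
    let ?s = "\<lambda>I. \<Sum>J\<in>Pow {..<m}. s J * monomial J I"
    have "N i s K - N0 i s K = N i ?s K - N0 i ?s K"
      using N_cong[of s ?s, OF exp] N0_cong[of s ?s, OF exp that] by simp
    also have "... = (\<Sum>J\<in>Pow {..<m}. s J * N i (monomial J) K) - (\<Sum>J\<in>Pow {..<m}. s J * N0 i (monomial J) K)"
      by (rule arg_cong2[where f = "(-)", OF N_sum N0_sum[OF that]])
    finally show ?thesis
      unfolding matrix_op_def M_def by (simp add: left_diff_distrib sum_subtractf mult.commute right_diff_distrib)
  qed
  have M0: "M K J = 0" if "K \<subseteq> {..<m}" "J \<subseteq> {..<m}" for K J
  proof (rule clifford_commutant_skew_zero[of m \<mu> p q M])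
    show "\<mu> j \<noteq> 0" if "j < 2 * m" for j using sign[of j] that r_eq by auto
    show "gm j (gm l s) K + gm l (gm j s) K = of_real (if j = l then \<mu> j else 0) * s K"
      if "j < 2 * m" "l < 2 * m" "K \<subseteq> {..<m}" for j l s K
      by (rule clifford_form) (use that r_eq in simp_all)
    show "matrix_op m M (gm j s) K = gm j (matrix_op m M s) K" if "j < 2 * m" "K \<subseteq> {..<m}" for j s K
    proof -
      have j: "j < r" using that(1) r_eq by simp
      have "gm j (matrix_op m M s) K = gm j (\<lambda>K. N i s K - N0 i s K) K"
        by (rule gam_cong[OF _ that(2)]) (rule op)
      then have "gm j (matrix_op m M s) K = gm j (N i s) K - gm j (N0 i s) K" by (simp only: gm_diff[OF that(2)])
      then show ?thesis
        unfolding op[OF that(2)] 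
        by (simp only: diff_eq_diff_swap[OF trans[OF N_commutator[OF i j that(2), of s] N0_commutator[OF i j that(2), of s, symmetric]]])
    qed
    show "model_pairing m (matrix_op m M s) t + model_pairing m s (matrix_op m M t) = 0" for s t
    proof -
      have "model_pairing m (matrix_op m M s) t = model_pairing m (\<lambda>K. N i s K + (-1) * N0 i s K) t" for s t
        by (rule model_pairing_cong) (simp_all add: op)
      then have 1: "model_pairing m (matrix_op m M s) t = model_pairing m (N i s) t - model_pairing m (N0 i s) t"
        by (simp only: model_pairing_linear) simp
      have "model_pairing m s (matrix_op m M t) = model_pairing m s (\<lambda>K. N i t K + (-1) * N0 i t K)"
        by (rule model_pairing_cong) (simp_all add: op)
      then have 2: "model_pairing m s (matrix_op m M t) = model_pairing m s (N i t) - model_pairing m s (N0 i t)"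
        by (simp only: model_pairing_linear) simp
      have 3: "model_pairing m (N i s) t = - model_pairing m s (N i t)"
        "model_pairing m (N0 i s) t = - model_pairing m s (N0 i t)"
        using N_skew[OF i, of s t] N0_skew[OF i, of s t] by (simp_all add: add_eq_0_iff)
      show ?thesis unfolding 1 2 3 by simp
    qed
  qed (use that in auto)
  have "matrix_op m M s K = 0" unfolding matrix_op_def using M0[OF K] by (intro sum.neutral) auto
  then show ?thesis using op[OF K, of s] by simp
qed

lemma nab_change:
  assumes i: "i < r" and F: "F \<in> sGam A S"
  shows "nab \<psi>' x (e i x) F = nab \<psi> x (e i x) F
    + (\<Sum>j<r. \<Sum>l<r. smult S (of_real (\<mu> j * \<mu> l * \<theta> i j l / 2)) (cl S x (e j x) (cl S x (e l x) (F x))))"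
proof -
  let ?P = "Pow {..<m}"
  have ex: "e i x \<in> fib E x" by (rule ef[OF i])
  obtain g where g: "rep \<psi>' x F g" using rep_exists[OF \<psi>'_ev \<psi>'_sec F] by blast
  then have gs: "\<And>J. J \<in> ?P ==> smooth_fun_on A UNIV (g J)"
    and gev: "\<forall>\<^sub>F y in nhds x. F y = tr \<psi>' y (\<lambda>J. g J y)" by (auto simp: rep_def)
  define f where "f I y = (\<Sum>J\<in>?P. g J y * h J I y)" for I y
  have sm: "smooth_fun_on A UNIV (\<lambda>y. g J y * h J I y)" if "J \<in> ?P" "I \<in> ?P" for I J
    using that by (intro smooth_complex gs h_smooth) auto
  have fx: "tr \<psi> x (\<lambda>I. f I x) = F x" and f: "rep \<psi> x F f"
  proof -
    have ev: "\<forall>\<^sub>F y in nhds x. F y = tr \<psi> y (\<lambda>I. f I y)"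
      using gev h_near
    proof eventually_elim
      case (elim y)
      have "tr \<psi> y (\<lambda>I. f I y) = (\<Sum>J\<in>?P. smult S (g J y) (\<psi>' J y))"
        unfolding f_def triv_sum using elim(2) by (intro sum.cong refl) simp
      then show ?case using elim(1) by (simp add: triv_def)
    qed
    from at_point[OF this] show "tr \<psi> x (\<lambda>I. f I x) = F x" by simp
    show "rep \<psi> x F f"
      unfolding rep_def using ev sm by (auto simp: f_def[abs_def] intro!: smooth_complex(4))
  qed
  have gx: "a (\<lambda>I. f I x) J = g J x" if "J \<subseteq> {..<m}" for J
    by (rule a_eqI[OF _ that]) (use fx at_point[OF gev] in simp)
  have dF: "cder x (e i x) (f I) = (\<Sum>J\<in>?P. cder x (e i x) (g J) * hx J I) - N i (\<lambda>I. f I x) I"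
    if I: "I \<subseteq> {..<m}" for I
  proof -
    have "cder x (e i x) (f I) = (\<Sum>J\<in>?P. cder x (e i x) (\<lambda>y. g J y * h J I y))"
      unfolding f_def by (rule cder_sum[OF ex]) (use sm I in auto)
    also have "... = (\<Sum>J\<in>?P. g J x * dh i J I + hx J I * cder x (e i x) (g J))"
      unfolding dh_def hx_def using I by (intro sum.cong refl cder_mult[OF ex] gs h_smooth) auto
    also have "... = (\<Sum>J\<in>?P. cder x (e i x) (g J) * hx J I) + (\<Sum>J\<in>?P. a (\<lambda>I. f I x) J * dh i J I)"
      using gx by (simp add: sum.distrib mult.commute)
    finally show ?thesis by (simp add: N_def)
  qed
  have "nab \<psi>' x (e i x) F = tr \<psi>' x (\<lambda>J. cder x (e i x) (g J))" by (rule nab_rep[OF \<psi>'_ev g ex])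
  also have "... = tr \<psi> x (\<lambda>I. \<Sum>J\<in>?P. cder x (e i x) (g J) * hx J I)"
    unfolding triv_sum using triv_hx by (simp add: triv_def)
  also have "... = tr \<psi> x (\<lambda>I. cder x (e i x) (f I) + N0 i (\<lambda>I. f I x) I)"
    by (rule triv_cong) (simp add: dF N_eq_N0[OF i])
  also have "... = nab \<psi> x (e i x) F + tr \<psi> x (N0 i (\<lambda>I. f I x))"
    unfolding triv_add nab_rep[OF \<psi>_ev f ex] ..
  also have "tr \<psi> x (N0 i (\<lambda>I. f I x))
      = tr \<psi> x (\<lambda>I. \<Sum>j<r. 1 * (\<Sum>l<r. of_real (\<mu> j * \<mu> l * \<theta> i j l / 2) * gm j (gm l (\<lambda>I. f I x)) I))"
    by (simp add: N0_def[abs_def])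
  also have "... = (\<Sum>j<r. \<Sum>l<r. smult S (of_real (\<mu> j * \<mu> l * \<theta> i j l / 2)) (cl S x (e j x) (cl S x (e l x) (F x))))"
    unfolding triv_sum sb.vs.scale_one fx[symmetric] using act_\<psi> by simp
  finally show ?thesis .
qed

end

subsection \<open>The cubic term compensates the change of the derivatives\<close>

text \<open>Here \<open>w a b c\<close> and \<open>v a\<close> stand for the spinors \<open>e\<^sub>a e\<^sub>b e\<^sub>c \<phi>\<close> and \<open>e\<^sub>a \<phi>\<close>, and \<open>t\<close> for \<open>\<theta>\<close>.  Moving
  a factor past two others by the Clifford relation produces a trace of \<open>t\<close>; the left-hand side, where
  \<open>t\<close> is symmetrized cyclically, contains it three times, and the factors \<open>1 / 6\<close> and \<open>1 / 2\<close> are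
  exactly those for which the traces match.\<close>

lemma cubic_clifford_identity:
  fixes sc :: "real => 'w => 'w::ab_group_add" and r :: nat
  assumes sc: "vector_space sc"
    and sign: "\<And>i. i < r ==> \<mu> i * \<mu> i = 1"
    and anti: "\<And>i j l. i < r ==> j < r ==> l < r ==> t i j l = - t i l j"
    and cyclic: "\<And>a b c. a < r ==> b < r ==> c < r ==>
      w c a b = w a b c + sc (if c = a then \<mu> c else 0) (v b) - sc (if c = b then \<mu> c else 0) (v a)"
  shows "(\<Sum>a<r. \<Sum>b<r. \<Sum>c<r. sc (\<mu> a * \<mu> b * \<mu> c * (t a b c + t b c a + t c a b) / 6) (w a b c))
    = (\<Sum>a<r. sc (\<mu> a) ((\<Sum>b<r. \<Sum>c<r. sc (\<mu> b * \<mu> c * t a b c / 2) (w a b c)) + sc ((\<Sum>b<r. \<mu> b * t b a b) / 2) (v a)))"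
proof -
  interpret vector_space sc by (rule sc)
  define C where "C a b c = \<mu> a * \<mu> b * \<mu> c" for a b c
  define X where "X = (\<Sum>a<r. \<Sum>b<r. \<Sum>c<r. sc (C a b c * t a b c) (w a b c))"
  define R where "R = (\<Sum>a<r. \<Sum>b<r. sc (\<mu> a * \<mu> b * t a b a) (v b))"
  have rotate: "(\<Sum>a<r. \<Sum>b<r. \<Sum>c<r. f b c a) = (\<Sum>a<r. \<Sum>b<r. \<Sum>c<r. f a b c)"
    for f :: "nat => nat => nat => 'w"
    by (rule trans[OF sum.swap]) (intro sum.cong refl sum.swap)
  have rotate': "(\<Sum>a<r. \<Sum>b<r. \<Sum>c<r. f c a b) = (\<Sum>a<r. \<Sum>b<r. \<Sum>c<r. f a b c)"
    for f :: "nat => nat => nat => 'w"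
    using rotate[of "\<lambda>a b c. f c a b"] by simp
  have Ccyc: "C b c a = C a b c" "C c a b = C a b c" for a b c by (simp_all add: C_def mult_ac)
  have zero: "t a b b = 0" if "a < r" "b < r" for a b using anti[OF that that(2)] by simp
  have d1: "(\<Sum>a<r. \<Sum>b<r. \<Sum>c<r. sc (C a b c * t a b c) (sc (if c = a then \<mu> c else 0) (v b))) = R"
    unfolding R_def
  proof (intro sum.cong refl)
    fix a b assume "a \<in> {..<r}" "b \<in> {..<r}"
    then have a: "a < r" by simp
    have "(\<Sum>c<r. sc (C a b c * t a b c) (sc (if c = a then \<mu> c else 0) (v b)))
        = (\<Sum>c<r. if c = a then sc (C a b a * t a b a * \<mu> a) (v b) else 0)"
      by (intro sum.cong) auto
    also have "... = sc (\<mu> a * \<mu> b * t a b a * (\<mu> a * \<mu> a)) (v b)" using a by (simp add: C_def mult_ac)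
    finally show "(\<Sum>c<r. sc (C a b c * t a b c) (sc (if c = a then \<mu> c else 0) (v b))) = sc (\<mu> a * \<mu> b * t a b a) (v b)"
      using sign[OF a] by simp
  qed
  have d2: "(\<Sum>a<r. \<Sum>b<r. \<Sum>c<r. sc (C a b c * t a b c) (sc (if c = b then \<mu> c else 0) (v a))) = 0"
    using zero by (intro sum.neutral ballI) auto
  have d3: "(\<Sum>a<r. \<Sum>b<r. \<Sum>c<r. sc (C a b c * t a b c) (sc (if a = b then \<mu> a else 0) (v c))) = - R"
  proof -
    have "(\<Sum>a<r. \<Sum>b<r. \<Sum>c<r. sc (C a b c * t a b c) (sc (if a = b then \<mu> a else 0) (v c)))
        = (\<Sum>a<r. \<Sum>c<r. \<Sum>b<r. sc (C a b c * t a b c) (sc (if a = b then \<mu> a else 0) (v c)))"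
      by (intro sum.cong refl sum.swap)
    also have "... = (\<Sum>a<r. \<Sum>b<r. \<Sum>c<r. - sc (C a b c * t a b c) (sc (if c = a then \<mu> c else 0) (v b)))"
    proof (intro sum.cong refl)
      fix a c b assume "a \<in> {..<r}" "c \<in> {..<r}" "b \<in> {..<r}"
      then show "sc (C a b c * t a b c) (sc (if a = b then \<mu> a else 0) (v c))
          = - sc (C a c b * t a c b) (sc (if b = a then \<mu> b else 0) (v c))"
        using anti[of a b c] by (auto simp: C_def mult_ac)
    qed
    finally show ?thesis unfolding d1[symmetric] by (simp add: sum_negf)
  qed
  have Y: "(\<Sum>a<r. \<Sum>b<r. \<Sum>c<r. sc (C a b c * t b c a) (w a b c)) = X + R"
  proof -
    have "(\<Sum>a<r. \<Sum>b<r. \<Sum>c<r. sc (C a b c * t b c a) (w a b c)) = (\<Sum>a<r. \<Sum>b<r. \<Sum>c<r. sc (C a b c * t a b c) (w c a b))"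
      using rotate[of "\<lambda>a b c. sc (C a b c * t a b c) (w c a b)"] by (simp add: Ccyc)
    also have "... = (\<Sum>a<r. \<Sum>b<r. \<Sum>c<r. sc (C a b c * t a b c) (w a b c)
        + sc (C a b c * t a b c) (sc (if c = a then \<mu> c else 0) (v b))
        - sc (C a b c * t a b c) (sc (if c = b then \<mu> c else 0) (v a)))"
    proof (intro sum.cong refl)
      fix a b c assume "a \<in> {..<r}" "b \<in> {..<r}" "c \<in> {..<r}"
      then have "a < r" "b < r" "c < r" by auto
      then show "sc (C a b c * t a b c) (w c a b) = sc (C a b c * t a b c) (w a b c)
        + sc (C a b c * t a b c) (sc (if c = a then \<mu> c else 0) (v b))
        - sc (C a b c * t a b c) (sc (if c = b then \<mu> c else 0) (v a))"
        by (simp only: cyclic[of a b c] scale_right_distrib scale_right_diff_distrib)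
    qed
    finally show ?thesis unfolding sum.distrib sum_subtractf d1 d2 by (simp add: X_def)
  qed
  have Z: "(\<Sum>a<r. \<Sum>b<r. \<Sum>c<r. sc (C a b c * t c a b) (w a b c)) = X + R + R"
  proof -
    have w: "w b c a = w a b c - sc (if a = b then \<mu> a else 0) (v c) + sc (if c = a then \<mu> c else 0) (v b)"
      if "a < r" "b < r" "c < r" for a b c
    proof -
      have eq: "(if a = c then \<mu> a else 0) = (if c = a then \<mu> c else 0)" by simp
      show ?thesis unfolding cyclic[OF that(2,3,1)] eq by simp
    qed
    have "(\<Sum>a<r. \<Sum>b<r. \<Sum>c<r. sc (C a b c * t c a b) (w a b c)) = (\<Sum>a<r. \<Sum>b<r. \<Sum>c<r. sc (C a b c * t a b c) (w b c a))"
      using rotate'[of "\<lambda>a b c. sc (C a b c * t a b c) (w b c a)"] by (simp add: Ccyc)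
    also have "... = (\<Sum>a<r. \<Sum>b<r. \<Sum>c<r. sc (C a b c * t a b c) (w a b c)
        - sc (C a b c * t a b c) (sc (if a = b then \<mu> a else 0) (v c))
        + sc (C a b c * t a b c) (sc (if c = a then \<mu> c else 0) (v b)))"
    proof (intro sum.cong refl)
      fix a b c assume "a \<in> {..<r}" "b \<in> {..<r}" "c \<in> {..<r}"
      then have "a < r" "b < r" "c < r" by auto
      then show "sc (C a b c * t a b c) (w b c a) = sc (C a b c * t a b c) (w a b c)
        - sc (C a b c * t a b c) (sc (if a = b then \<mu> a else 0) (v c))
        + sc (C a b c * t a b c) (sc (if c = a then \<mu> c else 0) (v b))"
        by (simp only: w[of a b c] scale_right_distrib scale_right_diff_distrib)
    qed
    finally show ?thesis unfolding sum.distrib sum_subtractf d1 d3 by (simp add: X_def)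
  qed
  have "(\<Sum>a<r. \<Sum>b<r. \<Sum>c<r. sc (\<mu> a * \<mu> b * \<mu> c * (t a b c + t b c a + t c a b) / 6) (w a b c))
      = (\<Sum>a<r. \<Sum>b<r. \<Sum>c<r. sc (1 / 6) (sc (C a b c * t a b c) (w a b c) + sc (C a b c * t b c a) (w a b c)
          + sc (C a b c * t c a b) (w a b c)))"
    unfolding scale_right_distrib scale_scale scale_left_distrib[symmetric] C_def
    by (intro sum.cong refl arg_cong2[where f = sc]) (simp add: field_simps)
  also have "... = sc (1 / 6) (X + (X + R) + (X + R + R))"
    unfolding scale_sum_right[symmetric] sum.distrib Y Z by (simp add: X_def)
  also have "X + (X + R) + (X + R + R) = sc 3 (X + R)"
  proof -
    have "sc 3 u = u + u + u" for u
      using scale_left_distrib[of "1 + 1" 1 u] scale_left_distrib[of 1 1 u] by simp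
    then show ?thesis by (simp add: algebra_simps)
  qed
  also have "sc (1 / 6) (sc 3 (X + R)) = sc (1 / 2) X + sc (1 / 2) R" by (simp add: scale_right_distrib)
  also have "sc (1 / 2) X = (\<Sum>a<r. sc (\<mu> a) (\<Sum>b<r. \<Sum>c<r. sc (\<mu> b * \<mu> c * t a b c / 2) (w a b c)))"
    unfolding X_def scale_sum_right by (intro sum.cong refl) (simp add: C_def mult_ac)
  also have "sc (1 / 2) R = (\<Sum>a<r. sc (\<mu> a) (sc ((\<Sum>b<r. \<mu> b * t b a b) / 2) (v a)))"
  proof -
    have "sc (1 / 2) R = (\<Sum>b<r. \<Sum>a<r. sc (1 / 2) (sc (\<mu> a * \<mu> b * t a b a) (v b)))"
      unfolding R_def scale_sum_right by (rule sum.swap)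
    then show ?thesis by (simp add: scale_sum_left scale_sum_right sum_divide_distrib sum_distrib_left mult_ac)
  qed
  finally show ?thesis by (simp add: scale_right_distrib sum.distrib)
qed

context spin_bundle
begin

text \<open>Real scalars are kept apart from complex ones because contractions take place in real vector spaces.\<close>

definition rs :: "real => 'w => 'w" where
  "rs c \<phi> = smult S (of_real c) \<phi>"

sublocale rs: vector_space rs
  by unfold_locales (simp_all add: rs_def sb.vs.scale_right_distrib sb.vs.scale_left_distrib)

lemma rs_in: "\<phi> \<in> sfib x ==> rs c \<phi> \<in> sfib x"
  unfolding rs_def by (rule sb.fibre_scale)

lemma cl_rs: "u \<in> fib E x ==> \<phi> \<in> sfib x ==> cl S x u (rs c \<phi>) = rs c (cl S x u \<phi>)"
  unfolding rs_def by (rule cl_smult)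

lemma cl_comb_rs:
  assumes "\<And>i. i \<in> I ==> u i \<in> fib E x" "\<phi> \<in> sfib x"
  shows "cl S x (\<Sum>i\<in>I. c i *\<^sub>R u i) \<phi> = (\<Sum>i\<in>I. rs (c i) (cl S x (u i) \<phi>))"
  unfolding rs_def by (rule cl_comb_vec[OF assms])

text \<open>The Dirac operator in a trivialization whose frame of \<open>E\<close> is orthonormal.\<close>

definition on_dirac :: "(nat => real) => (nat => 'm => 'v) => (nat set => 'm => 'w) => ('m => 'w) => 'm => 'w" where
  "on_dirac \<mu> f \<psi> F x =
     (\<Sum>i<r. rs (\<mu> i) (cl S x (f i x) (nab \<psi> x (f i x) F + rs (dv (f i) x / 2) (F x))))
     - (\<Sum>i<r. \<Sum>j<r. \<Sum>l<r. rs (\<mu> i * \<mu> j * \<mu> l * struct_coeff E x f i j l / 6)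
          (cl S x (f i x) (cl S x (f j x) (cl S x (f l x) (F x)))))"

end

context spin_pair
begin

text \<open>The change of the flat derivatives contributes \<open>\<Sum> \<theta>\<^sub>i\<^sub>j\<^sub>l e\<^sup>i e\<^sup>j e\<^sup>l / 2\<close>, that of the divergences the trace
  of \<open>\<theta>\<close>, and that of the cubic term the cyclic sum of \<open>\<theta>\<close>.\<close>

theorem on_dirac_independent:
  assumes F: "F \<in> sGam A S"
  shows "on_dirac \<mu> e' \<psi>' F x = on_dirac \<mu> e \<psi> F x"
proof -
  let ?c = "\<lambda>i \<phi>. cl S x (e i x) \<phi>"
  have Fx: "F x \<in> sfib x" by (rule sb.sections_fibre[OF F])
  have cin: "?c i \<phi> \<in> sfib x" if "i < r" "\<phi> \<in> sfib x" for i \<phi> by (rule cl_in[OF ef[OF that(1)] that(2)])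
  have nin: "nab \<psi> x u F \<in> sfib x" for u unfolding nab_def by (rule triv_in[where \<psi> = \<psi> and y = x, OF \<psi>_basis])
  define w where "w a b c = ?c a (?c b (?c c (F x)))" for a b c
  define v where "v a = ?c a (F x)" for a
  have swap: "?c j (?c i \<phi>) = rs (if j = i then \<mu> j else 0) \<phi> - ?c i (?c j \<phi>)"
    if "i < r" "j < r" "\<phi> \<in> sfib x" for i j \<phi>
  proof -
    have "?c j (?c i \<phi>) + ?c i (?c j \<phi>) = rs (if j = i then \<mu> j else 0) \<phi>"
      using clifford[OF ef[OF that(2)] ef[OF that(1)] that(3)] orthonormal_ip[OF onx that(2,1)] by (simp add: rs_def)
    then show ?thesis by (simp add: eq_diff_eq)
  qed
  have cyclic: "w c a b = w a b c + rs (if c = a then \<mu> c else 0) (v b) - rs (if c = b then \<mu> c else 0) (v a)"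
    if "a < r" "b < r" "c < r" for a b c
  proof -
    have "w c a b = rs (if c = a then \<mu> c else 0) (v b) - ?c a (?c c (?c b (F x)))"
      unfolding w_def v_def by (rule swap) (use that cin Fx in auto)
    also have "?c c (?c b (F x)) = rs (if c = b then \<mu> c else 0) (F x) - ?c b (?c c (F x))"
      by (rule swap) (use that Fx in auto)
    also have "?c a (rs (if c = b then \<mu> c else 0) (F x) - ?c b (?c c (F x)))
        = rs (if c = b then \<mu> c else 0) (v a) - w a b c"
    proof -
      have "?c a (rs (if c = b then \<mu> c else 0) (F x) + rs (-1) (?c b (?c c (F x))))
          = rs (if c = b then \<mu> c else 0) (v a) + rs (-1) (w a b c)"
        unfolding w_def v_def using that ef cin Fx rs_in by (simp only: cl_add cl_rs)
      then show ?thesis by simp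
    qed
    finally show ?thesis by simp
  qed
  have first: "rs (\<mu> i) (cl S x (e' i x) (nab \<psi>' x (e' i x) F + rs (dv (e' i) x / 2) (F x)))
      = rs (\<mu> i) (?c i (nab \<psi> x (e i x) F + rs (dv (e i) x / 2) (F x)))
      + rs (\<mu> i) ((\<Sum>j<r. \<Sum>l<r. rs (\<mu> j * \<mu> l * \<theta> i j l / 2) (w i j l)) + rs ((\<Sum>j<r. \<mu> j * \<theta> j i j) / 2) (v i))"
    if i: "i < r" for i
  proof -
    let ?s = "\<Sum>j<r. \<Sum>l<r. rs (\<mu> j * \<mu> l * \<theta> i j l / 2) (?c j (?c l (F x)))"
    have terms: "rs (\<mu> j * \<mu> l * \<theta> i j l / 2) (?c j (?c l (F x))) \<in> sfib x" if "j \<in> {..<r}" "l \<in> {..<r}" for j l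
      using that cin Fx rs_in by simp
    then have sin: "?s \<in> sfib x" and sin': "\<And>j. j \<in> {..<r} ==> (\<Sum>l<r. rs (\<mu> j * \<mu> l * \<theta> i j l / 2) (?c j (?c l (F x)))) \<in> sfib x"
      by (intro sb.fibre_sum; simp)+
    have n: "nab \<psi>' x (e i x) F = nab \<psi> x (e i x) F + ?s"
      unfolding rs_def by (rule nab_change[OF i F])
    have d: "rs (dv (e' i) x / 2) (F x) = rs (dv (e i) x / 2) (F x) + rs ((\<Sum>j<r. \<mu> j * \<theta> j i j) / 2) (F x)"
      unfolding dv_change[OF i] by (simp add: add_divide_distrib rs.scale_left_distrib)
    have cs: "?c i ?s = (\<Sum>j<r. \<Sum>l<r. rs (\<mu> j * \<mu> l * \<theta> i j l / 2) (w i j l))"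
    proof -
      have "?c i ?s = (\<Sum>j<r. ?c i (\<Sum>l<r. rs (\<mu> j * \<mu> l * \<theta> i j l / 2) (?c j (?c l (F x)))))"
        by (rule cl_sum[OF ef[OF i] sin'])
      also have "... = (\<Sum>j<r. \<Sum>l<r. ?c i (rs (\<mu> j * \<mu> l * \<theta> i j l / 2) (?c j (?c l (F x)))))"
        by (intro sum.cong refl cl_sum[OF ef[OF i]] terms)
      also have "... = (\<Sum>j<r. \<Sum>l<r. rs (\<mu> j * \<mu> l * \<theta> i j l / 2) (w i j l))"
        unfolding w_def using cin Fx by (intro sum.cong refl cl_rs[OF ef[OF i]]) auto
      finally show ?thesis .
    qed
    have "nab \<psi>' x (e' i x) F + rs (dv (e' i) x / 2) (F x)
        = (nab \<psi> x (e i x) F + rs (dv (e i) x / 2) (F x)) + (?s + rs ((\<Sum>j<r. \<mu> j * \<theta> j i j) / 2) (F x))"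
      unfolding agree[OF i] n d by (simp add: algebra_simps)
    then have "cl S x (e' i x) (nab \<psi>' x (e' i x) F + rs (dv (e' i) x / 2) (F x))
        = ?c i (nab \<psi> x (e i x) F + rs (dv (e i) x / 2) (F x)) + (?c i ?s + rs ((\<Sum>j<r. \<mu> j * \<theta> j i j) / 2) (v i))"
      unfolding agree[OF i] v_def using nin sin Fx rs_in ef[OF i] sb.fibre_add by (simp add: cl_add cl_rs)
    then show ?thesis unfolding cs by (simp only: rs.scale_right_distrib)
  qed
  have second: "(\<Sum>i<r. \<Sum>j<r. \<Sum>l<r. rs (\<mu> i * \<mu> j * \<mu> l * struct_coeff E x e' i j l / 6)
          (cl S x (e' i x) (cl S x (e' j x) (cl S x (e' l x) (F x)))))
      = (\<Sum>i<r. \<Sum>j<r. \<Sum>l<r. rs (\<mu> i * \<mu> j * \<mu> l * struct_coeff E x e i j l / 6) (w i j l))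
      + (\<Sum>i<r. \<Sum>j<r. \<Sum>l<r. rs (\<mu> i * \<mu> j * \<mu> l * (\<theta> i j l + \<theta> j l i + \<theta> l i j) / 6) (w i j l))"
    unfolding sum.distrib[symmetric]
    by (intro sum.cong refl)
      (simp add: w_def agree struct_change rs.scale_left_distrib[symmetric] add_divide_distrib[symmetric] algebra_simps)
  have "(\<Sum>i<r. rs (\<mu> i) (cl S x (e' i x) (nab \<psi>' x (e' i x) F + rs (dv (e' i) x / 2) (F x))))
      = (\<Sum>i<r. rs (\<mu> i) (?c i (nab \<psi> x (e i x) F + rs (dv (e i) x / 2) (F x))))
      + (\<Sum>i<r. rs (\<mu> i) ((\<Sum>j<r. \<Sum>l<r. rs (\<mu> j * \<mu> l * \<theta> i j l / 2) (w i j l)) + rs ((\<Sum>j<r. \<mu> j * \<theta> j i j) / 2) (v i)))"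
    unfolding sum.distrib[symmetric] by (intro sum.cong refl first) simp
  also note cubic_clifford_identity[where sc = rs and \<mu> = \<mu> and t = \<theta> and w = w and v = v and r = r,
      OF rs.vector_space_axioms sign \<theta>_antisym cyclic, symmetric]
  finally show ?thesis
    unfolding on_dirac_def second by (simp add: w_def)
qed

end

subsection \<open>Reduction to orthonormal frames\<close>

context spin_bundle
begin

lemma nab_comb_vec:
  assumes \<psi>: "\<forall>\<^sub>F y in nhds x. sbasis \<psi> y"
    and "\<And>I. I \<subseteq> {..<m} ==> \<psi> I \<in> sGam A S" "F \<in> sGam A S"
    and u: "\<And>i. i \<in> X ==> u i \<in> fib E x"
  shows "nab \<psi> x (\<Sum>i\<in>X. c i *\<^sub>R u i) F = (\<Sum>i\<in>X. rs (c i) (nab \<psi> x (u i) F))"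
proof -
  from rep_exists[OF assms(1-3)] obtain h where h: "rep \<psi> x F h" .
  have s: "(\<Sum>i\<in>X. c i *\<^sub>R u i) \<in> fib E x" by (intro fib_sum fib_scale u)
  have "nab \<psi> x (\<Sum>i\<in>X. c i *\<^sub>R u i) F = tr \<psi> x (\<lambda>I. \<Sum>i\<in>X. of_real (c i) * cder x (u i) (h I))"
    unfolding nab_rep[OF \<psi> h s]
  proof (rule triv_cong)
    fix I assume "I \<subseteq> {..<m}"
    then have "smooth_fun_on A UNIV (h I)" using h by (simp add: rep_def)
    with u show "cder x (\<Sum>i\<in>X. c i *\<^sub>R u i) (h I) = (\<Sum>i\<in>X. of_real (c i) * cder x (u i) (h I))"
      by (intro cder_comb_vec)
  qed
  also have "... = (\<Sum>i\<in>X. rs (c i) (nab \<psi> x (u i) F))"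
    unfolding triv_sum rs_def by (intro sum.cong refl) (simp add: nab_rep[OF \<psi> h u])
  finally show ?thesis .
qed

text \<open>Both terms of the Dirac operator are contractions.  The constant combinations of the \<open>e\<^sub>i\<close> act on \<open>\<psi>\<close> by
  the same combinations of constant matrices, so \<open>\<psi>\<close> can be kept.\<close>

lemma dirac_in_frame_orthonormal:
  assumes sf: "spin_frame A E S x e \<psi>" and b: "orthonormal r x \<mu> b" and F: "F \<in> sGam A S"
  obtains f p q where "spin_on x \<mu> f \<psi> p q" "\<forall>i<r. f i x = b i"
    "dirac_in_frame E S dv e \<psi> F x = on_dirac \<mu> f \<psi> F x"
proof -
  have cf: "const_frame A E x e" and \<psi>_sec: "\<And>I. I \<subseteq> {..<m} ==> \<psi> I \<in> sGam A S"
    using sf by (auto simp: spin_frame_def Let_def)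
  obtain p q where "\<forall>\<^sub>F y in nhds x. sbasis \<psi> y \<and>
        (\<forall>\<alpha><r. \<forall>s. cl S y (e \<alpha> y) (tr \<psi> y s) =
           tr \<psi> y (\<lambda>K. wedge (one_form m (p \<alpha>)) s K + contract m (q \<alpha>) s K)) \<and>
        (\<forall>s t. spair S y (tr \<psi> y s) (tr \<psi> y t) = model_pairing m s t) \<and>
        spin_even S y = tr \<psi> y ` {s. \<forall>I. odd (card I) \<longrightarrow> s I = 0} \<and>
        spin_odd S y = tr \<psi> y ` {s. \<forall>I. even (card I) \<longrightarrow> s I = 0}"
    using sf unfolding spin_frame_def Let_def by blast
  then have ev: "\<forall>\<^sub>F y in nhds x. sbasis \<psi> y \<and>
        (\<forall>\<alpha><r. \<forall>s. cl S y (e \<alpha> y) (tr \<psi> y s) = tr \<psi> y (gam m (p \<alpha>) (q \<alpha>) s)) \<and>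
        (\<forall>s t. spair S y (tr \<psi> y s) (tr \<psi> y t) = model_pairing m s t)"
    by eventually_elim (simp add: gam_def[abs_def])
  then have \<psi>_ev: "\<forall>\<^sub>F y in nhds x. sbasis \<psi> y"
    by (auto elim: eventually_mono)
  note \<psi>_basis = at_point[OF \<psi>_ev]
  have ce: "\<forall>\<^sub>F y in nhds x. basis_of scaleR {..<r} (\<lambda>\<alpha>. e \<alpha> y) (fib E y) \<and>
        (\<forall>\<alpha><r. \<forall>\<beta><r. ip E y (e \<alpha> y) (e \<beta> y) = ip E x (e \<alpha> x) (e \<beta> x))"
    and sec: "\<And>i. i < r ==> e i \<in> Gam A E" using cf by (auto simp: const_frame_def)
  have con: "\<forall>\<^sub>F y in nhds x. \<forall>i<r. \<forall>j<r. ip E y (e i y) (e j y) = ip E x (e i x) (e j x)"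
    using ce by eventually_elim blast
  have basis: "basis_of scaleR {..<r} (\<lambda>i. e i x) (fib E x)" using at_point[OF ce] by blast
  have "\<exists>c. b i = (\<Sum>j<r. c j *\<^sub>R e j x)" if "i < r" for i
    using basis orthonormal_fib[OF b that] unfolding basis_of_def by blast
  then obtain k where k: "\<And>i. i < r ==> b i = (\<Sum>j<r. k i j *\<^sub>R e j x)" by metis
  interpret C: basis_change A E x e \<mu> b k by unfold_locales (use sec basis b k in auto)
  define p' where "p' i j = (\<Sum>l<r. of_real (k i l) * p l j)" for i j
  define q' where "q' i j = (\<Sum>l<r. of_real (k i l) * q l j)" for i j
  have "\<forall>\<^sub>F y in nhds x. orthonormal r y \<mu> (\<lambda>i. C.on i y) \<and>
      sbasis \<psi> y \<and>
      (\<forall>i<r. \<forall>s. cl S y (C.on i y) (tr \<psi> y s) = tr \<psi> y (gam m (p' i) (q' i) s)) \<and>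
      (\<forall>s t. spair S y (tr \<psi> y s) (tr \<psi> y t) = model_pairing m s t)"
    using C.on_orthonormal[OF con] ev
  proof eventually_elim
    case (elim y)
    have bas: "sbasis \<psi> y" using elim(2) by blast
    have "cl S y (C.on i y) (tr \<psi> y s) = tr \<psi> y (gam m (p' i) (q' i) s)" for i s
    proof -
      have "cl S y (C.on i y) (tr \<psi> y s) = (\<Sum>l<r. smult S (of_real (k i l)) (cl S y (e l y) (tr \<psi> y s)))"
        unfolding C.on_def C.comb_def
        by (rule cl_comb_vec[OF _ triv_in[where \<psi> = \<psi> and y = y, OF bas]]) (simp add: C.e_fib)
      also have "... = tr \<psi> y (\<lambda>K. \<Sum>l<r. of_real (k i l) * gam m (p l) (q l) s K)"
        unfolding triv_sum using elim(2) by (intro sum.cong refl) simp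
      also have "... = tr \<psi> y (gam m (p' i) (q' i) s)"
        by (rule triv_cong) (simp add: p'_def[abs_def] q'_def[abs_def] gam_vector)
      finally show ?thesis .
    qed
    then show ?case using elim by blast
  qed
  then have spin: "spin_on x \<mu> C.on \<psi> p' q'"
    unfolding spin_on_def using C.on_sec \<psi>_sec by auto
  let ?e' = "raised E x e"
  have Fx: "F x \<in> sfib x" by (rule sb.sections_fibre[OF F])
  have nin: "nab \<psi> x u F \<in> sfib x" for u unfolding nab_def by (rule triv_in[where \<psi> = \<psi> and y = x, OF \<psi>_basis])
  have contr: "(\<Sum>i<r. B (?e' i) (e i)) = (\<Sum>i<r. rs (\<mu> i) (B (C.on i) (C.on i)))"
    if "\<And>c. C.frame_linear rs (\<lambda>u. B u (C.comb c))" "\<And>c. C.frame_linear rs (\<lambda>v. B (C.comb c) v)" for B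
    by (rule C.contraction[OF rs.vector_space_axioms _ _ that]) auto
  have lin_cl: "C.frame_linear rs (\<lambda>u. cl S x (u x) \<phi>)" if "\<phi> \<in> sfib x" for \<phi>
    unfolding C.frame_linear_def C.comb_def by (intro allI cl_comb_rs[OF _ that]) (simp add: C.e_fib)
  have lin_map: "C.frame_linear rs (\<lambda>u. cl S x w (L u))"
    if "C.frame_linear rs L" "w \<in> fib E x" "\<And>i. i < r ==> L (e i) \<in> sfib x" for w L
    unfolding C.frame_linear_def
  proof
    fix c
    have "cl S x w (\<Sum>i<r. rs (c i) (L (e i))) = (\<Sum>i<r. cl S x w (rs (c i) (L (e i))))"
      by (rule cl_sum) (use that rs_in in auto)
    also have "... = (\<Sum>i<r. rs (c i) (cl S x w (L (e i))))"
      by (intro sum.cong refl cl_rs) (use that in auto)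
    finally show "cl S x w (L (C.comb c)) = (\<Sum>i<r. rs (c i) (cl S x w (L (e i))))"
      using that(1) by (simp add: C.frame_linear_def)
  qed
  have lin_rs: "C.frame_linear rs (\<lambda>u. rs z (L u))" if "C.frame_linear rs L" for L z
    using that unfolding C.frame_linear_def by (simp add: rs.scale_sum_right mult.commute)
  have lin_real: "C.frame_linear rs (\<lambda>u. rs (L u / z) \<phi>)" if "C.frame_linear (*) L" for L z \<phi>
    using that unfolding C.frame_linear_def by (simp add: rs.scale_sum_left sum_divide_distrib)
  have lin_dv: "C.frame_linear (*) (\<lambda>u. dv u x)"
    unfolding C.frame_linear_def C.comb_def by (subst dv_sum) (auto intro: sec_const_scale sec simp: dv_scale sec)
  have lin_nab: "C.frame_linear rs (\<lambda>u. nab \<psi> x (u x) F)"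
    unfolding C.frame_linear_def C.comb_def by (intro allI nab_comb_vec[OF \<psi>_ev \<psi>_sec F]) (simp_all add: C.e_fib)
  have lin_add: "C.frame_linear rs (\<lambda>u. L u + L' u)" if "C.frame_linear rs L" "C.frame_linear rs L'" for L L'
    using that unfolding C.frame_linear_def by (simp add: rs.scale_right_distrib sum.distrib)
  define D where "D v = nab \<psi> x (v x) F + rs (dv v x / 2) (F x)" for v
  have Din: "D v \<in> sfib x" for v unfolding D_def by (intro sb.fibre_add nin rs_in Fx)
  have D: "C.frame_linear rs D" unfolding D_def by (intro lin_add lin_nab lin_real lin_dv)
  have 1: "(\<Sum>i<r. cl S x (?e' i x) (D (e i))) = (\<Sum>i<r. rs (\<mu> i) (cl S x (C.on i x) (D (C.on i))))"
    by (rule contr[of "\<lambda>u v. cl S x (u x) (D v)"])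
      (auto intro!: lin_cl lin_map Din D sec_fib[OF C.comb_sec])
  define T where "T u v w = ip E x (u x) (bracket E v w x)" for u v w
  define K where "K u v w = cl S x (u x) (cl S x (v x) (cl S x (w x) (F x)))" for u v w :: "'m => 'v"
  have T: "C.frame_linear (*) (\<lambda>u. T u v w)" "C.frame_linear (*) (\<lambda>u. T v u w)" "C.frame_linear (*) (\<lambda>u. T v w u)"
    if "v \<in> Gam A E" "w \<in> Gam A E" for v w
    unfolding T_def using C.frame_linear_struct that by blast+
  have cin: "cl S x (u x) \<phi> \<in> sfib x" if "u \<in> Gam A E" "\<phi> \<in> sfib x" for u \<phi> by (rule cl_in[OF sec_fib[OF that(1)] that(2)])
  have K: "C.frame_linear rs (\<lambda>u. K u v w)" "C.frame_linear rs (\<lambda>u. K v u w)" "C.frame_linear rs (\<lambda>u. K v w u)"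
    if "v \<in> Gam A E" "w \<in> Gam A E" for v w
    unfolding K_def using that Fx sec by (auto intro!: lin_cl lin_map cin sec_fib)
  let ?Q = "\<lambda>u v w u' v' w'. rs (T u v w / 6) (K u' v' w')"
  have "(\<Sum>a<r. \<Sum>b<r. \<Sum>c<r. ?Q (e a) (e b) (e c) (?e' a) (?e' b) (?e' c))
      = (\<Sum>a<r. \<Sum>b<r. \<Sum>c<r. rs (\<mu> a * \<mu> b * \<mu> c) (?Q (C.on a) (C.on b) (C.on c) (C.on a) (C.on b) (C.on c)))"
    by (rule C.triple_contraction[OF rs.vector_space_axioms]) (auto intro!: lin_rs lin_real T K)
  then have 2: "(\<Sum>a<r. \<Sum>b<r. \<Sum>c<r. ?Q (e a) (e b) (e c) (?e' a) (?e' b) (?e' c))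
      = (\<Sum>a<r. \<Sum>b<r. \<Sum>c<r. rs (\<mu> a * \<mu> b * \<mu> c * T (C.on a) (C.on b) (C.on c) / 6) (K (C.on a) (C.on b) (C.on c)))"
    by simp
  have "dirac_in_frame E S dv e \<psi> F x = (\<Sum>i<r. cl S x (?e' i x) (D (e i)))
      - (\<Sum>a<r. \<Sum>b<r. \<Sum>c<r. ?Q (e a) (e b) (e c) (?e' a) (?e' b) (?e' c))"
    unfolding dirac_in_frame_def Let_def D_def K_def T_def struct_coeff_def nab_def triv_def rs_def ..
  also have "... = on_dirac \<mu> C.on \<psi> F x"
    unfolding 1 2 unfolding on_dirac_def D_def K_def T_def struct_coeff_def ..
  finally show ?thesis using that[of C.on p' q'] spin C.on_at by blast
qed

theorem dirac_in_frame_independent: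
  assumes "spin_frame A E S x e \<psi>" "spin_frame A E S x e' \<psi>'" and F: "F \<in> sGam A S"
  shows "dirac_in_frame E S dv e \<psi> F x = dirac_in_frame E S dv e' \<psi>' F x"
proof -
  obtain \<mu> b where b: "orthonormal r x \<mu> b" by (rule orthonormal_exists)
  from dirac_in_frame_orthonormal[OF assms(1) b F] obtain f p q
    where f: "spin_on x \<mu> f \<psi> p q" "\<forall>i<r. f i x = b i"
      "dirac_in_frame E S dv e \<psi> F x = on_dirac \<mu> f \<psi> F x" .
  from dirac_in_frame_orthonormal[OF assms(2) b F] obtain f' p' q'
    where f': "spin_on x \<mu> f' \<psi>' p' q'" "\<forall>i<r. f' i x = b i"
      "dirac_in_frame E S dv e' \<psi>' F x = on_dirac \<mu> f' \<psi>' F x" .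
  interpret spin_pair A E dv S x \<mu> f f' \<psi> \<psi>' p q p' q'
    by unfold_locales (use f f' in \<open>auto simp: spin_on_def elim: eventually_mono\<close>)
  show ?thesis using f(3) f'(3) on_dirac_independent[OF F] by simp
qed

lemma dirac_eq:
  assumes "spin_frame A E S x e \<psi>" "F \<in> sGam A S"
  shows "dirac A E S dv F x = dirac_in_frame E S dv e \<psi> F x"
proof -
  define g where "g = (SOME f. spin_frame A E S x (fst f) (snd f))"
  have "spin_frame A E S x (fst g) (snd g)"
    unfolding g_def by (rule someI[where P = "\<lambda>f. spin_frame A E S x (fst f) (snd f)" and x = "(e, \<psi>)"]) (simp add: assms(1))
  then show ?thesis
    using dirac_in_frame_independent[OF _ assms] by (simp add: dirac_def g_def[symmetric] case_prod_beta)
qed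

end

section \<open>Pullback of Courant algebroids and their curvatures\<close>

text \<open>Sections of the pullback that come from the base have bracket, anchor and divergence pulled back
  from the base, and at each point their values exhaust the fibre.\<close>

locale ca_pullback = smooth_mapping A A' \<tau> + B: courant_div A E dv
  for A :: "('m::{t2_space, second_countable_topology}, 'b::{real_inner, heine_borel}) atlas"
    and A' :: "('m'::{t2_space, second_countable_topology}, 'b'::{real_inner, heine_borel}) atlas"
    and \<tau> :: "'m' => 'm" and E :: "('m, 'v::real_vector) courant" and dv :: "('m => 'v) => 'm => real" +
  fixes E' :: "('m', 'v) courant" and dv' :: "('m' => 'v) => 'm' => real"
  assumes pullback: "CA_pullback A' A \<tau> E E'" and pullback_dv: "pullback_divergence A' A \<tau> E E' dv dv'"
begin

sublocale P: courant_div A' E' dv'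
  by unfold_locales (use pullback pullback_dv in \<open>auto simp: CA_pullback_def pullback_divergence_def\<close>)

lemma bundle': "cbundle E' = pullback_bundle \<tau> (cbundle E)"
  using pullback by (simp add: CA_pullback_def)

lemma rank': "crank E' = crank E"
  by (simp add: crank_def bundle' pullback_bundle_def)

lemma fib': "fib E' x = fib E (\<tau> x)"
  by (simp add: bundle' pullback_bundle_def)

lemma sec': "u \<in> Gam A E ==> u \<circ> \<tau> \<in> Gam A' E'"
  unfolding bundle' by (rule sections_pullback[OF B.vb.vector_bundle])

lemma ip':
  assumes "u \<in> fib E (\<tau> x)" "v \<in> fib E (\<tau> x)"
  shows "ip E' x u v = ip E (\<tau> x) u v"
proof -
  obtain s where s: "s \<in> Gam A E" "s (\<tau> x) = u" using B.vb.section_through[OF assms(1)] .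
  obtain t where t: "t \<in> Gam A E" "t (\<tau> x) = v" using B.vb.section_through[OF assms(2)] .
  have "ip E' x ((s \<circ> \<tau>) x) ((t \<circ> \<tau>) x) = ip E (\<tau> x) (s (\<tau> x)) (t (\<tau> x))"
    using pullback s(1) t(1) unfolding CA_pullback_def by blast
  then show ?thesis using s t by simp
qed

lemma bracket': "u \<in> Gam A E ==> v \<in> Gam A E ==> bracket E' (u \<circ> \<tau>) (v \<circ> \<tau>) = bracket E u v \<circ> \<tau>"
  using pullback unfolding CA_pullback_def by blast

lemma anchor':
  assumes "u \<in> fib E (\<tau> x)" "smooth_near A (\<tau> x) f"
  shows "anchor E' x u (f \<circ> \<tau>) = anchor E (\<tau> x) u f"
proof -
  obtain s where s: "s \<in> Gam A E" "s (\<tau> x) = u" using B.vb.section_through[OF assms(1)] .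
  have "push_tangent \<tau> (anchor E' x ((s \<circ> \<tau>) x)) f = anchor E (\<tau> x) (s (\<tau> x)) f"
    using pullback s(1) assms(2) unfolding CA_pullback_def by blast
  then show ?thesis using s by (simp add: push_tangent_def)
qed

lemma act': "u \<in> Gam A E ==> f \<in> C_inf A ==> act E' (u \<circ> \<tau>) (f \<circ> \<tau>) x = act E u f (\<tau> x)"
  using anchor'[of "u (\<tau> x)" x f] B.sec_fib M.smooth_nearI[of f] by (simp add: act_def C_inf_def)

lemma dv': "u \<in> Gam A E ==> dv' (u \<circ> \<tau>) = dv u \<circ> \<tau>"
  using pullback_dv unfolding pullback_divergence_def by blast

lemma perp': "(\<And>y. U y \<subseteq> fib E y) ==> perp E' (U \<circ> \<tau>) = perp E U \<circ> \<tau>"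
  unfolding perp_def by (intro ext) (auto simp: fib' ip' subset_eq)

lemma proj': "(\<And>y. U y \<subseteq> fib E y) ==> proj E' (U \<circ> \<tau>) (s \<circ> \<tau>) = proj E U s \<circ> \<tau>"
  unfolding proj_def by (intro ext) (simp add: perp')

lemma local_section': "open W ==> local_section A (scaleR :: real => 'v => 'v) (cbundle E) W s ==>
    local_section A' (scaleR :: real => 'v => 'v) (cbundle E') (\<tau> -` W) (s \<circ> \<tau>)"
  unfolding bundle' by (rule local_section_pullback[OF B.vb.vector_bundle])

lemma pseudometric':
  assumes "gen_pseudometric A E n V"
  shows "gen_pseudometric A' E' n (V \<circ> \<tau>)"
  unfolding gen_pseudometric_def
proof (intro conjI allI)
  fix x
  show "(V \<circ> \<tau>) x \<subseteq> fib E' x" using B.pseudometric_fib[OF assms] by (auto simp: fib')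
  show "\<forall>u\<in>(V \<circ> \<tau>) x. (\<forall>v\<in>(V \<circ> \<tau>) x. ip E' x u v = 0) \<longrightarrow> u = 0"
    using B.pseudometric_nondeg[OF assms] B.pseudometric_fib[OF assms] by (simp add: ip')
  obtain W e where W: "open W" "\<tau> x \<in> W"
    "\<And>i. i < n ==> local_section A (scaleR :: real => 'v => 'v) (cbundle E) W (e i)"
    "\<And>y. y \<in> W ==> basis_of scaleR {..<n} (\<lambda>i. e i y) (V y)"
    using B.pseudometric_frame[OF assms, of "\<tau> x"] by metis
  show "\<exists>W e. open W \<and> x \<in> W \<and>
        (\<forall>i<n. local_section A' (scaleR :: real => 'v => 'v) (cbundle E') W (e i)) \<and>
        (\<forall>y\<in>W. basis_of scaleR {..<n} (\<lambda>i. e i y) ((V \<circ> \<tau>) y))"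
    by (rule exI[of _ "\<tau> -` W"], rule exI[of _ "\<lambda>i. e i \<circ> \<tau>"])
      (use W local_section'[OF W(1)] open_vimage_map in auto)
qed

lemma orientation':
  assumes "orientation A E n V ori"
  shows "orientation A' E' n (V \<circ> \<tau>) (ori \<circ> \<tau>)"
proof -
  have "\<exists>W e. open W \<and> x \<in> W \<and>
        (\<forall>i<n. local_section A' (scaleR :: real => 'v => 'v) (cbundle E') W (e i)) \<and>
        (\<forall>y\<in>W. (ori \<circ> \<tau>) y (\<lambda>i. e i y))" for x
  proof -
    obtain W e where W: "open W" "\<tau> x \<in> W"
      "\<forall>i<n. local_section A (scaleR :: real => 'v => 'v) (cbundle E) W (e i)"
      "\<forall>y\<in>W. ori y (\<lambda>i. e i y)"
      using conjunct2[OF conjunct2[OF assms[unfolded orientation_def]], rule_format, of "\<tau> x"] by metis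
    show ?thesis
      by (rule exI[of _ "\<tau> -` W"], rule exI[of _ "\<lambda>i. e i \<circ> \<tau>"])
        (use W local_section'[OF W(1)] open_vimage_map in auto)
  qed
  note local_frames = this
  have bases: "basis_of scaleR {..<n} b (V x)" if "ori x b" for x b
    by (rule mp[OF spec[OF spec[OF conjunct1[OF assms[unfolded orientation_def]]]] that])
  have change: "ori x b' \<longleftrightarrow> (\<Sum>p | p permutes {..<n}. of_int (sign p) * (\<Prod>i<n. M i (p i))) > (0::real)"
    if "ori x b" "basis_of scaleR {..<n} b' (V x)" "\<forall>i<n. b' i = (\<Sum>j<n. M i j *\<^sub>R b j)" for x b b' M
    by (rule mp[OF spec[where x = M, OF spec[where x = b', OF spec[where x = b, OF spec[where x = x,
        OF conjunct1[OF conjunct2[OF assms[unfolded orientation_def]]]]]]]])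
      (intro conjI that)
  show ?thesis
    unfolding orientation_def
  proof (intro conjI)
    show "\<forall>x b. (ori \<circ> \<tau>) x b \<longrightarrow> basis_of scaleR {..<n} b ((V \<circ> \<tau>) x)" using bases by simp
    show "\<forall>x b b' M. (ori \<circ> \<tau>) x b \<and> basis_of scaleR {..<n} b' ((V \<circ> \<tau>) x) \<and>
        (\<forall>i<n. b' i = (\<Sum>j<n. M i j *\<^sub>R b j)) \<longrightarrow>
        ((ori \<circ> \<tau>) x b' \<longleftrightarrow>
          (\<Sum>p | p permutes {..<n}. of_int (sign p) * (\<Prod>i<n. M i (p i))) > (0::real))"
      unfolding o_apply by (intro allI impI, elim conjE) (rule change)
  qed (intro allI local_frames)
qed

lemma lorentzian':
  assumes V: "gen_pseudometric A E n V" and "lorentzian E n V"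
  shows "lorentzian E' n (V \<circ> \<tau>)"
proof -
  obtain \<sigma> :: real where \<sigma>: "\<sigma> \<in> {1, -1}"
    "\<And>x. \<exists>b. basis_of scaleR {..<n} b (V x) \<and>
      (\<forall>i<n. \<forall>j<n. ip E x (b i) (b j) = (if i \<noteq> j then 0 else if i = 0 then - \<sigma> else \<sigma>))"
    using assms(2) unfolding lorentzian_def by blast
  have "\<exists>b. basis_of scaleR {..<n} b ((V \<circ> \<tau>) x) \<and>
      (\<forall>i<n. \<forall>j<n. ip E' x (b i) (b j) = (if i \<noteq> j then 0 else if i = 0 then - \<sigma> else \<sigma>))" for x
  proof -
    obtain b where b: "basis_of scaleR {..<n} b (V (\<tau> x))"
      "\<forall>i<n. \<forall>j<n. ip E (\<tau> x) (b i) (b j) = (if i \<noteq> j then 0 else if i = 0 then - \<sigma> else \<sigma>)"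
      using \<sigma>(2) by blast
    have "b i \<in> fib E (\<tau> x)" if "i < n" for i
      using real_vector.basis_of_in[OF b(1)] that B.pseudometric_fib[OF V] by simp
    then show ?thesis using b by (intro exI[of _ b]) (simp add: ip')
  qed
  then show ?thesis using \<sigma>(1) unfolding lorentzian_def by blast
qed

lemma const_frame':
  assumes "const_frame A E (\<tau> x) e"
  shows "const_frame A' E' x (\<lambda>i. e i \<circ> \<tau>)"
proof -
  have sec: "\<And>i. i < crank E ==> e i \<in> Gam A E"
    and ev: "\<forall>\<^sub>F y in nhds (\<tau> x). basis_of scaleR {..<crank E} (\<lambda>i. e i y) (fib E y) \<and>
        (\<forall>i<crank E. \<forall>j<crank E. ip E y (e i y) (e j y) = ip E (\<tau> x) (e i (\<tau> x)) (e j (\<tau> x)))"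
    using assms by (auto simp: const_frame_def)
  show ?thesis
    unfolding const_frame_def rank'
    using sec' sec eventually_pullback[OF ev] by (simp add: fib' ip' B.sec_fib)
qed

lemma adapted_frame':
  assumes V: "gen_pseudometric A E n V" and e: "adapted_frame A E n V (\<tau> x) e"
  shows "adapted_frame A' E' n (V \<circ> \<tau>) x (\<lambda>i. e i \<circ> \<tau>)"
proof -
  have "\<And>y. V y \<subseteq> fib E y" using B.pseudometric_fib[OF V] by blast
  then show ?thesis
    using e const_frame'[of x e] eventually_pullback[where x = x and P = "\<lambda>y. basis_of scaleR {..<n} (\<lambda>a. e a y) (V y) \<and>
        basis_of scaleR {n..<crank E} (\<lambda>a. e a y) (perp E V y)"]
    unfolding adapted_frame_def rank' by (simp add: perp')
qed

lemma inv_gram':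
  assumes "\<And>i. i < crank E ==> e i \<in> Gam A E"
  shows "inv_gram E' x (\<lambda>i. e i \<circ> \<tau>) = inv_gram E (\<tau> x) e"
proof -
  have "(\<Sum>g<crank E. h i g * ip E' x ((e g \<circ> \<tau>) x) ((e j \<circ> \<tau>) x))
      = (\<Sum>g<crank E. h i g * ip E (\<tau> x) (e g (\<tau> x)) (e j (\<tau> x)))"
    if "j < crank E" for h :: "nat => nat => real" and i j
    using that assms by (intro sum.cong refl) (simp add: ip' B.sec_fib)
  then show ?thesis unfolding inv_gram_def rank' by (simp cong: conj_cong)
qed

lemma raised':
  assumes "\<And>i. i < crank E ==> e i \<in> Gam A E"
  shows "raised E' x (\<lambda>i. e i \<circ> \<tau>) i = raised E (\<tau> x) e i \<circ> \<tau>"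
  unfolding raised_def rank' by (rule ext) (simp add: inv_gram'[where e = e, OF assms])

lemma raised_sec:
  assumes "\<And>i. i < crank E ==> e i \<in> Gam A E"
  shows "raised E x e i \<in> Gam A E"
  unfolding raised_def by (intro B.sec_sum B.sec_const_scale assms) simp

lemma struct_coeff':
  assumes "e a \<in> Gam A E" "e b \<in> Gam A E" "e c \<in> Gam A E"
  shows "struct_coeff E' x (\<lambda>i. e i \<circ> \<tau>) a b c = struct_coeff E (\<tau> x) e a b c"
  unfolding struct_coeff_def bracket'[OF assms(2,3)] using assms by (simp add: ip' B.sec_fib B.bracket_sec)

lemma gscal_in_frame':
  assumes sec: "\<And>i. i < crank E ==> e i \<in> Gam A E" and n: "n \<le> crank E"
  shows "gscal_in_frame E' n dv' (\<lambda>i. e i \<circ> \<tau>) x = gscal_in_frame E n dv e (\<tau> x)"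
proof -
  note rs = raised_sec[where e = e, OF sec]
  have s: "e a \<in> Gam A E" if "a \<in> {..<n} \<union> {n..<crank E}" for a using that n sec by auto
  have st: "struct_coeff E' x (\<lambda>i. e i \<circ> \<tau>) a b c * struct_coeff E' x (\<lambda>i. raised E (\<tau> x) e i \<circ> \<tau>) a b c
      = struct_coeff E (\<tau> x) e a b c * struct_coeff E (\<tau> x) (raised E (\<tau> x) e) a b c"
    if "a \<in> {..<n} \<union> {n..<crank E}" "b \<in> {..<n} \<union> {n..<crank E}" "c \<in> {..<n} \<union> {n..<crank E}" for a b c
    using that s rs by (simp only: struct_coeff')
  have r': "raised E' x (\<lambda>i. e i \<circ> \<tau>) = (\<lambda>i. raised E (\<tau> x) e i \<circ> \<tau>)"
    by (intro ext raised'[where e = e, OF sec])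
  have "(\<Sum>a<n. dv' (raised E (\<tau> x) e a \<circ> \<tau>) x * dv' (e a \<circ> \<tau>) x) = (\<Sum>a<n. dv (raised E (\<tau> x) e a) (\<tau> x) * dv (e a) (\<tau> x))"
    using s rs by (intro sum.cong refl) (simp add: dv')
  moreover have "(\<Sum>a<n. act E' (raised E (\<tau> x) e a \<circ> \<tau>) (dv' (e a \<circ> \<tau>)) x) = (\<Sum>a<n. act E (raised E (\<tau> x) e a) (dv (e a)) (\<tau> x))"
    using s rs by (intro sum.cong refl) (simp add: dv' act' B.dv_C_inf)
  moreover have "(\<Sum>a<n. \<Sum>b<n. \<Sum>c\<in>N. struct_coeff E' x (\<lambda>i. e i \<circ> \<tau>) a b c * struct_coeff E' x (\<lambda>i. raised E (\<tau> x) e i \<circ> \<tau>) a b c)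
      = (\<Sum>a<n. \<Sum>b<n. \<Sum>c\<in>N. struct_coeff E (\<tau> x) e a b c * struct_coeff E (\<tau> x) (raised E (\<tau> x) e) a b c)"
    if "N \<subseteq> {..<n} \<union> {n..<crank E}" for N
    using that by (intro sum.cong refl st) auto
  ultimately show ?thesis unfolding gscal_in_frame_def rank' r' by simp
qed

text \<open>Frame independence is used on both sides: on \<open>M'\<close> to compute in a pulled back frame, on \<open>M\<close> to return to
  the frame chosen by \<open>gscal\<close>.\<close>

theorem gscal':
  assumes V: "gen_pseudometric A E n V" and "0 < crank E"
  shows "gscal A' E' n (V \<circ> \<tau>) dv' x = gscal A E n V dv (\<tau> x)"
proof -
  interpret BV: pseudometric A E dv n V by unfold_locales (rule V)
  interpret PV: pseudometric A' E' dv' n "V \<circ> \<tau>" by unfold_locales (rule pseudometric'[OF V])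
  obtain \<mu> e where "B.adapted_on n V (\<tau> x) \<mu> e" using B.adapted_on_exists[OF V] .
  then have e: "adapted_frame A E n V (\<tau> x) e" by (rule B.adapted_on_frame[OF V])
  then have sec: "\<And>i. i < crank E ==> e i \<in> Gam A E" by (simp add: adapted_frame_def const_frame_def)
  have "gscal A' E' n (V \<circ> \<tau>) dv' x = gscal_in_frame E' n dv' (\<lambda>i. e i \<circ> \<tau>) x"
    by (rule PV.gscal_eq[OF _ adapted_frame'[OF V e]]) (simp add: rank' assms(2))
  also have "... = gscal_in_frame E n dv e (\<tau> x)"
    by (rule gscal_in_frame'[where e = e, OF sec B.pseudometric_rank_le[OF V]])
  also have "... = gscal A E n V dv (\<tau> x)" by (rule BV.gscal_eq[OF assms(2) e, symmetric])
  finally show ?thesis .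
qed

text \<open>Both sides of the trace in the Ricci tensor involve choices, a basis of the fibre and sections
  through its elements; the former is the same on both sides, the latter does not matter.\<close>

theorem GRic':
  assumes V: "gen_pseudometric A E n V" and a: "a \<in> sub_sections A E V" and b: "b \<in> sub_sections A E (perp E V)"
  shows "GRic A' E' (V \<circ> \<tau>) dv' (a \<circ> \<tau>) (b \<circ> \<tau>) x = GRic A E V dv a b (\<tau> x)"
proof -
  interpret BV: pseudometric A E dv n V by unfold_locales (rule V)
  interpret PV: pseudometric A' E' dv' n "V \<circ> \<tau>" by unfold_locales (rule pseudometric'[OF V])
  have Vf: "\<And>y. V y \<subseteq> fib E y" using B.pseudometric_fib[OF V] by blast
  have Pf: "\<And>y. perp E V y \<subseteq> fib E y" by (auto simp: perp_def)
  note sec = BV.GamP_sec[OF a] BV.GamM_sec[OF b]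
  have subP: "s \<circ> \<tau> \<in> sub_sections A' E' (V \<circ> \<tau>)" if "s \<in> sub_sections A E V" for s
    using that sec'[of s] by (simp add: sub_sections_def)
  have subM: "b \<circ> \<tau> \<in> sub_sections A' E' (perp E' (V \<circ> \<tau>))"
    using b sec'[of b] by (simp add: sub_sections_def perp'[OF Vf])
  have ric: "PV.ric_endo (a \<circ> \<tau>) (b \<circ> \<tau>) (s \<circ> \<tau>) = BV.ric_endo a b s \<circ> \<tau>" if s: "s \<in> sub_sections A E V" for s
  proof -
    have "PV.mixed (b \<circ> \<tau>) (s \<circ> \<tau>) = BV.mixed b s \<circ> \<tau>"
      unfolding PV.mixed_def BV.mixed_def perp'[OF Vf] bracket'[OF BV.GamP_sec[OF s] sec(2)] by (rule proj'[OF Pf])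
    moreover have "BV.mixed b s \<in> Gam A E" by (rule BV.GamM_sec[OF BV.mixed_sec[OF s b]])
    ultimately show ?thesis
      unfolding PV.ric_endo_def BV.ric_endo_def by (simp only: bracket'[OF _ sec(1)] proj'[OF Vf])
  qed
  have base: "PV.fibre_base x = BV.fibre_base (\<tau> x)" by (simp add: PV.fibre_base_def BV.fibre_base_def)
  have "PV.ric_endo (a \<circ> \<tau>) (b \<circ> \<tau>) (PV.lift x v) x = BV.ric_endo a b (BV.lift (\<tau> x) v) (\<tau> x)"
    if "v \<in> BV.fibre_base (\<tau> x)" for v
  proof -
    have v: "v \<in> V (\<tau> x)" by (rule BV.fibre_base_in[OF that])
    have l: "BV.lift (\<tau> x) v \<in> sub_sections A E V" "BV.lift (\<tau> x) v (\<tau> x) = v" using BV.lift[OF v] by auto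
    have l': "PV.lift x v \<in> sub_sections A' E' (V \<circ> \<tau>)" "PV.lift x v x = v" using PV.lift[of v x] v by auto
    have "PV.ric_endo (a \<circ> \<tau>) (b \<circ> \<tau>) (PV.lift x v) x = PV.ric_endo (a \<circ> \<tau>) (b \<circ> \<tau>) (BV.lift (\<tau> x) v \<circ> \<tau>) x"
      by (rule PV.ric_endo_pointwise[OF subP[OF a] subM l'(1) subP[OF l(1)]]) (simp add: l l')
    then show ?thesis by (simp add: ric[OF l(1)])
  qed
  moreover have "dv' (proj E' (V \<circ> \<tau>) (bracket E' (b \<circ> \<tau>) (a \<circ> \<tau>))) x = dv (proj E V (bracket E b a)) (\<tau> x)"
    unfolding bracket'[OF sec(2,1)] proj'[OF Vf]
    by (simp add: dv' BV.GamP_sec[OF BV.proj_sec[OF B.bracket_sec[OF sec(2,1)]]])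
  moreover have "act E' (b \<circ> \<tau>) (dv' (a \<circ> \<tau>)) x = act E b (dv a) (\<tau> x)"
    using sec by (simp add: dv' act' B.dv_C_inf)
  ultimately show ?thesis unfolding PV.GRic_eq BV.GRic_eq base by simp
qed

end

subsection \<open>Spinors and the Dirac operator\<close>

locale spin_pullback = ca_pullback A A' \<tau> E dv E' dv'
  for A :: "('m::{t2_space, second_countable_topology}, 'b::{real_inner, heine_borel}) atlas"
    and A' :: "('m'::{t2_space, second_countable_topology}, 'b'::{real_inner, heine_borel}) atlas"
    and \<tau> :: "'m' => 'm" and E :: "('m, 'v::real_vector) courant" and dv :: "('m => 'v) => 'm => real"
    and E' :: "('m', 'v) courant" and dv' :: "('m' => 'v) => 'm' => real" +
  fixes S :: "('m, 'v, 'w::ab_group_add) spinors"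
  assumes spinors: "spinor_bundle A E S"
begin

abbreviation "S' \<equiv> pullback_spinors \<tau> S"

sublocale BS: spin_bundle A E dv S
  by unfold_locales (rule spinors)

lemma spinors'_simps: "sbundle S' = pullback_bundle \<tau> (sbundle S)" "smult S' = smult S"
    "fibre (sbundle S') x = fibre (sbundle S) (\<tau> x)" "cl S' x = cl S (\<tau> x)" "spair S' x = spair S (\<tau> x)"
    "spin_even S' x = spin_even S (\<tau> x)" "spin_odd S' x = spin_odd S (\<tau> x)"
  by (simp_all add: pullback_spinors_def pullback_bundle_def)

lemma spin_frame_exists: "\<exists>e \<psi>. spin_frame A E S y e \<psi>"
  using spinors by (simp add: spinor_bundle_def)

lemma triv': "triv S' m (\<lambda>I. \<psi> I \<circ> \<tau>) y s = triv S m \<psi> (\<tau> y) s"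
  by (simp add: triv_def spinors'_simps)

lemma ssec': "F \<in> sGam A S ==> F \<circ> \<tau> \<in> sGam A' S'"
  unfolding spinors'_simps by (rule sections_pullback[OF BS.sb.vector_bundle])

lemma spin_frame':
  assumes "spin_frame A E S (\<tau> x) e \<psi>"
  shows "spin_frame A' E' S' x (\<lambda>i. e i \<circ> \<tau>) (\<lambda>I. \<psi> I \<circ> \<tau>)"
proof -
  let ?m = "crank E div 2"
  have cf: "const_frame A E (\<tau> x) e" and \<psi>: "\<And>I. I \<in> Pow {..<?m} ==> \<psi> I \<in> sGam A S"
    using assms by (auto simp: spin_frame_def Let_def)
  obtain p q where "\<forall>\<^sub>F y in nhds (\<tau> x). basis_of (smult S) (Pow {..<?m}) (\<lambda>I. \<psi> I y) (fibre (sbundle S) y) \<and>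
        (\<forall>\<alpha><crank E. \<forall>s. cl S y (e \<alpha> y) (triv S ?m \<psi> y s) =
           triv S ?m \<psi> y (\<lambda>K. wedge (one_form ?m (p \<alpha>)) s K + contract ?m (q \<alpha>) s K)) \<and>
        (\<forall>s t. spair S y (triv S ?m \<psi> y s) (triv S ?m \<psi> y t) = model_pairing ?m s t) \<and>
        spin_even S y = triv S ?m \<psi> y ` {s. \<forall>I. odd (card I) \<longrightarrow> s I = 0} \<and>
        spin_odd S y = triv S ?m \<psi> y ` {s. \<forall>I. even (card I) \<longrightarrow> s I = 0}"
    using assms unfolding spin_frame_def Let_def by blast
  from eventually_pullback[OF this]
  have "\<forall>\<^sub>F y in nhds x. basis_of (smult S) (Pow {..<?m}) (\<lambda>I. (\<psi> I \<circ> \<tau>) y) (fibre (sbundle S) (\<tau> y)) \<and>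
        (\<forall>\<alpha><crank E. \<forall>s. cl S (\<tau> y) ((e \<alpha> \<circ> \<tau>) y) (triv S ?m \<psi> (\<tau> y) s) =
           triv S ?m \<psi> (\<tau> y) (\<lambda>K. wedge (one_form ?m (p \<alpha>)) s K + contract ?m (q \<alpha>) s K)) \<and>
        (\<forall>s t. spair S (\<tau> y) (triv S ?m \<psi> (\<tau> y) s) (triv S ?m \<psi> (\<tau> y) t) = model_pairing ?m s t) \<and>
        spin_even S (\<tau> y) = triv S ?m \<psi> (\<tau> y) ` {s. \<forall>I. odd (card I) \<longrightarrow> s I = 0} \<and>
        spin_odd S (\<tau> y) = triv S ?m \<psi> (\<tau> y) ` {s. \<forall>I. even (card I) \<longrightarrow> s I = 0}"
    by simp
  note ev = this
  show ?thesis
    unfolding spin_frame_def Let_def rank' triv'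
  proof (intro conjI ballI)
    show "const_frame A' E' x (\<lambda>i. e i \<circ> \<tau>)" by (rule const_frame'[OF cf])
    show "\<psi> I \<circ> \<tau> \<in> sGam A' S'" if "I \<in> Pow {..<?m}" for I by (rule ssec'[OF \<psi>[OF that]])
  qed (rule exI[of _ p], rule exI[of _ q], use ev in \<open>simp only: spinors'_simps(2-)\<close>)
qed

lemma spinor_bundle': "spinor_bundle A' E' S'"
proof -
  have "\<exists>e \<psi>. spin_frame A' E' S' x e \<psi>" for x
  proof -
    obtain e \<psi> where "spin_frame A E S (\<tau> x) e \<psi>" using spin_frame_exists by metis
    from spin_frame'[OF this] show ?thesis by (intro exI)
  qed
  moreover have "vector_bundle A' (smult S) (sbundle S')"
    unfolding spinors'_simps(1) by (rule vector_bundle_pullback[OF BS.sb.vector_bundle])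
  moreover have "vb_index (sbundle S') = Pow {..<crank E div 2}"
    using BS.s_index by (simp add: spinors'_simps(1) pullback_bundle_def)
  moreover have "even (crank E)" using spinors by (simp add: spinor_bundle_def)
  ultimately show ?thesis
    unfolding spinor_bundle_def rank' spinors'_simps(2-) fib'
    by (auto simp: BS.cl_in BS.cl_add_vec BS.cl_scale_vec BS.cl_add BS.cl_smult BS.clifford ip')
qed

sublocale PS: spin_bundle A' E' dv' S'
  by unfold_locales (rule spinor_bundle')

text \<open>The components of \<open>F\<close> in the frame \<open>\<psi>\<close> are smooth only near \<open>\<tau> x\<close>, which suffices for \<open>\<rho>'\<close> to differentiate
  their pullbacks as \<open>\<rho>\<close> does.\<close>

lemma dirac_in_frame':
  assumes sf: "spin_frame A E S (\<tau> x) e \<psi>" and F: "F \<in> sGam A S"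
  shows "dirac_in_frame E' S' dv' (\<lambda>i. e i \<circ> \<tau>) (\<lambda>I. \<psi> I \<circ> \<tau>) (F \<circ> \<tau>) x = dirac_in_frame E S dv e \<psi> F (\<tau> x)"
proof -
  let ?P = "Pow {..<crank E div 2}"
  have sec: "\<And>i. i < crank E ==> e i \<in> Gam A E" and \<psi>: "\<And>I. I \<in> ?P ==> \<psi> I \<in> sGam A S"
    using sf by (auto simp: spin_frame_def const_frame_def Let_def)
  have \<psi>_ev: "\<forall>\<^sub>F y in nhds (\<tau> x). basis_of (smult S) ?P (\<lambda>I. \<psi> I y) (fibre (sbundle S) y)"
    using sf unfolding spin_frame_def Let_def by (auto elim: eventually_mono)
  have der: "complex_deriv (anchor E' x u) (\<lambda>y. coords (smult S) ?P (\<lambda>J. \<psi> J (\<tau> y)) (F (\<tau> y)) I)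
      = complex_deriv (anchor E (\<tau> x) u) (\<lambda>y. coords (smult S) ?P (\<lambda>J. \<psi> J y) (F y) I)"
    if u: "u \<in> fib E (\<tau> x)" and I: "I \<in> ?P" for u I
  proof -
    let ?g = "\<lambda>y. coords (smult S) ?P (\<lambda>J. \<psi> J y) (F y) I"
    obtain c where c: "smooth_fun_on A UNIV c" "\<forall>\<^sub>F y in nhds (\<tau> x). ?g y = c y"
      by (rule BS.sb.frame_coords_smooth[where I = ?P and \<psi> = \<psi> and x = "\<tau> x" and s = F and i = I])
        (use \<psi> \<psi>_ev F I in \<open>simp_all add: BS.s_index\<close>)
    have "smooth_near A (\<tau> x) (\<lambda>y. Re (?g y))"
      by (rule M.smooth_near_cong[OF M.smooth_nearI[of "\<lambda>y. Re (c y)"]])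
        (use B.Re_C_inf[OF c(1)] c(2) in \<open>auto simp: C_inf_def elim: eventually_mono\<close>)
    moreover have "smooth_near A (\<tau> x) (\<lambda>y. Im (?g y))"
      by (rule M.smooth_near_cong[OF M.smooth_nearI[of "\<lambda>y. Im (c y)"]])
        (use B.Im_C_inf[OF c(1)] c(2) in \<open>auto simp: C_inf_def elim: eventually_mono\<close>)
    ultimately show ?thesis
      using anchor'[OF u, of "\<lambda>y. Re (?g y)"] anchor'[OF u, of "\<lambda>y. Im (?g y)"]
      by (simp add: complex_deriv_def o_def)
  qed
  have r': "raised E' x (\<lambda>i. e i \<circ> \<tau>) = (\<lambda>i. raised E (\<tau> x) e i \<circ> \<tau>)"
    by (rule ext, rule raised'[where e = e, OF sec])
  have "(\<Sum>i<crank E. cl S (\<tau> x) (raised E (\<tau> x) e i (\<tau> x))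
        ((\<Sum>I\<in>?P. smult S (complex_deriv (anchor E' x (e i (\<tau> x)))
             (\<lambda>y. coords (smult S) ?P (\<lambda>J. \<psi> J (\<tau> y)) (F (\<tau> y)) I)) (\<psi> I (\<tau> x)))
         + smult S (of_real (dv' (e i \<circ> \<tau>) x / 2)) (F (\<tau> x))))
      = (\<Sum>i<crank E. cl S (\<tau> x) (raised E (\<tau> x) e i (\<tau> x))
        ((\<Sum>I\<in>?P. smult S (complex_deriv (anchor E (\<tau> x) (e i (\<tau> x)))
             (\<lambda>y. coords (smult S) ?P (\<lambda>J. \<psi> J y) (F y) I)) (\<psi> I (\<tau> x)))
         + smult S (of_real (dv (e i) (\<tau> x) / 2)) (F (\<tau> x))))"
    by (intro sum.cong refl arg_cong2[where f = "(+)"] arg_cong[where f = "cl S (\<tau> x) _"] arg_cong2[where f = "smult S"])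
      (simp_all add: der dv' sec B.sec_fib)
  moreover have "(\<Sum>i<crank E. \<Sum>j<crank E. \<Sum>l<crank E.
        smult S (of_real (struct_coeff E' x (\<lambda>i. e i \<circ> \<tau>) i j l / 6)) (H i j l))
      = (\<Sum>i<crank E. \<Sum>j<crank E. \<Sum>l<crank E.
        smult S (of_real (struct_coeff E (\<tau> x) e i j l / 6)) (H i j l))" for H
    by (intro sum.cong refl) (simp add: struct_coeff' sec)
  ultimately show ?thesis
    unfolding dirac_in_frame_def Let_def rank' r' spinors'_simps by simp
qed

theorem dirac':
  assumes F: "F \<in> sGam A S"
  shows "dirac A' E' S' dv' (F \<circ> \<tau>) x = dirac A E S dv F (\<tau> x)"
proof -
  obtain e \<psi> where f: "spin_frame A E S (\<tau> x) e \<psi>" using spin_frame_exists by metis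
  show ?thesis
    unfolding PS.dirac_eq[OF spin_frame'[OF f] ssec'[OF F]] BS.dirac_eq[OF f F] by (rule dirac_in_frame'[OF f F])
qed

text \<open>An oriented basis of \<open>V\<close> consists of vectors of the fibre of \<open>E\<close>, on which the metrics of \<open>E\<close> and \<open>E'\<close> agree; so
  the same basis is chosen on both sides.\<close>

lemma R_op':
  assumes V: "gen_pseudometric A E n V" and ori: "orientation A E n V ori"
  shows "R_op E' S' n (ori \<circ> \<tau>) (F \<circ> \<tau>) x = R_op E S n ori F (\<tau> x)"
proof -
  have "((ori \<circ> \<tau>) x b \<and> (\<forall>i<n. \<forall>j<n. if i = j then \<bar>ip E' x (b i) (b j)\<bar> = 1 else ip E' x (b i) (b j) = 0))
      = (ori (\<tau> x) b \<and> (\<forall>i<n. \<forall>j<n. if i = j then \<bar>ip E (\<tau> x) (b i) (b j)\<bar> = 1 else ip E (\<tau> x) (b i) (b j) = 0))"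
    for b
  proof (cases "ori (\<tau> x) b")
    case True
    then have b: "basis_of scaleR {..<n} b (V (\<tau> x))" using ori unfolding orientation_def by blast
    have "b i \<in> fib E (\<tau> x)" if "i < n" for i
      using real_vector.basis_of_in[OF b] that B.pseudometric_fib[OF V] by simp
    then show ?thesis by (simp add: ip')
  qed simp
  then show ?thesis unfolding R_op_def spinors'_simps by simp
qed

lemma sugra_setting':
  assumes "sugra_setting A E S n V ori dv F"
  shows "sugra_setting A' E' S' n (V \<circ> \<tau>) (ori \<circ> \<tau>) dv' (F \<circ> \<tau>)"
  using assms spinor_bundle' pseudometric' orientation' lorentzian' P.divergence ssec'
  by (auto simp: sugra_setting_def)

text \<open>The rank of \<open>E\<close> is positive because \<open>n mod 4 = 2\<close>.  In the Ricci equation the sections are replaced at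
  each point by pullbacks with the same values; the right-hand side depends only on the values.\<close>

lemma sugra_equations':
  assumes set: "sugra_setting A E S n V ori dv F" and eqs: "sugra_equations A E S n V ori dv F \<nu>"
  shows "sugra_equations A' E' S' n (V \<circ> \<tau>) (ori \<circ> \<tau>) dv' (F \<circ> \<tau>) \<nu>"
proof -
  have V: "gen_pseudometric A E n V" and ori: "orientation A E n V ori" and F: "F \<in> sGam A S" and n: "n mod 4 = 2"
    using set by (auto simp: sugra_setting_def)
  have "n \<noteq> 0" using n by auto
  then have pos: "0 < crank E" using B.pseudometric_rank_le[OF V] by linarith
  have Vf: "\<And>y. V y \<subseteq> fib E y" using B.pseudometric_fib[OF V] by blast
  interpret BV: pseudometric A E dv n V by unfold_locales (rule V)
  interpret PV: pseudometric A' E' dv' n "V \<circ> \<tau>" by unfold_locales (rule pseudometric'[OF V])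
  have ric: "of_real (GRic A' E' (V \<circ> \<tau>) dv' u v x) =
        \<i> / (8 * \<nu>) * spair S' x (cl S' x (u x) ((F \<circ> \<tau>) x)) (cl S' x (v x) ((F \<circ> \<tau>) x))"
    if u: "u \<in> sub_sections A' E' (V \<circ> \<tau>)" and v: "v \<in> sub_sections A' E' (perp E' (V \<circ> \<tau>))" for u v x
  proof -
    have "u x \<in> V (\<tau> x)" using u by (simp add: sub_sections_def)
    from B.sub_section_through[OF V this] obtain a where a: "a \<in> sub_sections A E V" "a (\<tau> x) = u x" .
    have "v x \<in> perp E V (\<tau> x)" using v by (simp add: sub_sections_def perp'[OF Vf])
    from B.sub_section_through[OF BV.perp_pseudometric this]
    obtain b where b: "b \<in> sub_sections A E (perp E V)" "b (\<tau> x) = v x" .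
    have at: "a \<circ> \<tau> \<in> sub_sections A' E' (V \<circ> \<tau>)" and bt: "b \<circ> \<tau> \<in> sub_sections A' E' (perp E' (V \<circ> \<tau>))"
      using a(1) b(1) sec'[of a] sec'[of b] by (simp_all add: sub_sections_def perp'[OF Vf])
    have "GRic A' E' (V \<circ> \<tau>) dv' u v x = GRic A' E' (V \<circ> \<tau>) dv' (a \<circ> \<tau>) (b \<circ> \<tau>) x"
      by (rule PV.GRic_pointwise[OF _ u at _ v bt]) (simp_all add: rank' pos a b)
    also have "... = GRic A E V dv a b (\<tau> x)" by (rule GRic'[OF V a(1) b(1)])
    finally show ?thesis
      using eqs a b by (simp add: sugra_equations_def spinors'_simps)
  qed
  show ?thesis
    unfolding sugra_equations_def R_op'[OF V ori] dirac'[OF F] gscal'[OF V pos]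
    using eqs ric by (auto simp: sugra_equations_def)
qed

end

theorem theorem7p1:
  fixes A :: "('m::{t2_space, second_countable_topology}, 'b::{real_inner, heine_borel}) atlas"
    and A' :: "('m'::{t2_space, second_countable_topology}, 'b'::{real_inner, heine_borel}) atlas"
    and \<tau> :: "'m' \<Rightarrow> 'm"
    and E :: "('m, 'v::real_vector) courant"
    and E' :: "('m', 'v) courant"
    and S :: "('m, 'v, 'w::ab_group_add) spinors"
    and V :: "'m \<Rightarrow> 'v set" and n :: nat
    and ori :: "'m \<Rightarrow> (nat \<Rightarrow> 'v) \<Rightarrow> bool"
    and dv :: "('m \<Rightarrow> 'v) \<Rightarrow> 'm \<Rightarrow> real"
    and dv' :: "('m' \<Rightarrow> 'v) \<Rightarrow> 'm' \<Rightarrow> real"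
    and F :: "'m \<Rightarrow> 'w"
  assumes "manifold A" and "manifold A'" and "smooth_map A' A \<tau>"
    and "courant_algebroid A E"
    and "CA_pullback A' A \<tau> E E'"
    and "pullback_divergence A' A \<tau> E E' dv dv'"
    and "sugra_solution A E S n V ori dv F"
  shows "sugra_solution A' E' (pullback_spinors \<tau> S) n (V \<circ> \<tau>) (ori \<circ> \<tau>) dv' (F \<circ> \<tau>)"
proof -
  have set: "sugra_setting A E S n V ori dv F" using assms(7) by (simp add: sugra_solution_def)
  interpret spin_pullback A A' \<tau> E dv E' dv' S
    by unfold_locales (use assms set in \<open>auto simp: sugra_setting_def\<close>)
  show ?thesis
    using assms(7) sugra_setting'[OF set] sugra_equations'[OF set]
    by (auto simp: sugra_solution_def spinors'_simps)
qed

end
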